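(* Let $P_1,\ldots,P_n$ be the points of the spherical ensemble $\mathcal{X}^{(n)}$ and let $m_n=\min_{i\neq j}|P_i-P_j|$. For any $x>0$, \[\lim_{n\to+\infty}\mathbf{P}\left(n^{3/4}m_n>x\right)=\exp\left(-\frac{x^4}{64}\right).\]
   Context: Spherical ensemble. Let $\mathbb{S}^2=\{p\in\mathbb{R}^3:|p|=1\}$ and let $\nu$ be the surface area measure on $\mathbb{S}^2$ (total mass $4\pi$). Let $A_n,B_n$ be independent $n\times n$ random matrices with i.i.d. standard complex Gaussian entries, let $\lambda_1,\ldots,\lambda_n$ be the eigenvalues of $A_n^{-1}B_n$, let $g$ be the stereographic projection of $\mathbb{S}^2$ from the north pole onto the plane $\{(t_1,t_2,0)\}\cong\mathbb{C}$, and let $P_i=g^{-1}(\lambda_i)$. Equivalently, in uniform random order, $(P_1,\ldots,P_n)$ has joint density proportional to $\prod_{i<j}|p_i-p_j|^2$ with respect to $\nu^{\otimes n}$ on $(\mathbb{S}^2)^n$, where $|\cdot|$ is the Euclidean norm. The point process is $\mathcal{X}^{(n)}=\sum_{i=1}^n\delta_{P_i}$. *)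

theory Defs
  imports
    "HOL-Probability.Probability"
    "Jordan_Normal_Form.Char_Poly"
    "Jordan_Normal_Form.Gauss_Jordan_Elimination"
begin

no_notation Matrix.vec_index (infixl "$" 100)

(* The standard complex Gaussian is normalised by E|Z|^2 = 1; rescaling all entries would
   not change A^{-1} B. *)
definition std_complex_gaussian_density :: "complex \<Rightarrow> real" where
  "std_complex_gaussian_density z = exp (- (cmod z)\<^sup>2) / pi"

definition gaussian_matrix_pair ::
    "nat \<Rightarrow> 'a measure \<Rightarrow> ('a \<Rightarrow> complex mat) \<Rightarrow> ('a \<Rightarrow> complex mat) \<Rightarrow> bool" where
  "gaussian_matrix_pair n M A B \<longleftrightarrow>
     prob_space M \<and>
     (\<forall>\<omega>\<in>space M. A \<omega> \<in> carrier_mat n n \<and> B \<omega> \<in> carrier_mat n n) \<and>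
     (\<forall>i<n. \<forall>j<n.
        distributed M lborel (\<lambda>\<omega>. A \<omega> $$ (i, j)) (\<lambda>z. ennreal (std_complex_gaussian_density z)) \<and>
        distributed M lborel (\<lambda>\<omega>. B \<omega> $$ (i, j)) (\<lambda>z. ennreal (std_complex_gaussian_density z))) \<and>
     \<comment> \<open>all \<open>2 n\<^sup>2\<close> entries of the two matrices together are independent\<close>
     prob_space.indep_vars M (\<lambda>_. borel)
       (\<lambda>(isA, i, j) \<omega>. (if isA then A \<omega> else B \<omega>) $$ (i, j))
       (UNIV \<times> {..<n} \<times> {..<n})"

(* A singular A (an event of probability 0) is given the inverse 0, so that the quantities
   below remain measurable functions of the entries. *)
definition inverse_mat :: "complex mat \<Rightarrow> complex mat" where
  "inverse_mat A =
     (case mat_inverse A of Some C \<Rightarrow> C | None \<Rightarrow> 0\<^sub>m (dim_row A) (dim_row A))"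

(* The eigenvalues, listed with algebraic multiplicity, in an arbitrary order. *)
definition eigenvalue_list :: "complex mat \<Rightarrow> complex list" where
  "eigenvalue_list C = (SOME es. char_poly C = (\<Prod>e\<leftarrow>es. [:- e, 1:]))"

definition north_pole :: "real^3" where
  "north_pole = vector [0, 0, 1]"

(* The line through the north pole and p meets the plane t_3 = 0, identified with the
   complex numbers, in this point. *)
definition stereographic :: "real^3 \<Rightarrow> complex" where
  "stereographic p = Complex (p $ 1 / (1 - p $ 3)) (p $ 2 / (1 - p $ 3))"

definition inv_stereographic :: "complex \<Rightarrow> real^3" where
  "inv_stereographic = inv_into (sphere 0 1 - {north_pole}) stereographic"

definition spherical_points :: "complex mat \<Rightarrow> complex mat \<Rightarrow> (real^3) list" where
  "spherical_points A B = map inv_stereographic (eigenvalue_list (inverse_mat A * B))"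

(* The minimum runs over pairs of indices, so a multiple point gives 0; the value is
   meaningful for lists of length at least 2. *)
definition min_distance :: "(real^3) list \<Rightarrow> real" where
  "min_distance ps =
     Min {norm (ps ! i - ps ! j) | i j. i < length ps \<and> j < length ps \<and> i \<noteq> j}"

lemma bij_betw_stereographic: "bij_betw stereographic (sphere 0 1 - {north_pole}) UNIV"
  and inv_stereographic_eq:
    "inv_stereographic z =
       vector [2 * Re z / ((cmod z)\<^sup>2 + 1), 2 * Im z / ((cmod z)\<^sup>2 + 1),
               ((cmod z)\<^sup>2 - 1) / ((cmod z)\<^sup>2 + 1)]"
proof -
  define S where "S = sphere (0 :: real^3) 1 - {north_pole}"
  define h :: "complex \<Rightarrow> real^3" where
    "h z = vector [2 * Re z / ((cmod z)\<^sup>2 + 1), 2 * Im z / ((cmod z)\<^sup>2 + 1),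
                   ((cmod z)\<^sup>2 - 1) / ((cmod z)\<^sup>2 + 1)]" for z
  have S_iff: "p \<in> S \<longleftrightarrow> (p $ 1)\<^sup>2 + (p $ 2)\<^sup>2 + (p $ 3)\<^sup>2 = 1 \<and> p $ 3 \<noteq> 1" for p
  proof -
    have "p = north_pole \<longleftrightarrow> p $ 1 = 0 \<and> p $ 2 = 0 \<and> p $ 3 = 1"
      by (simp add: north_pole_def Finite_Cartesian_Product.vec_eq_iff[of p] forall_3)
    then show ?thesis
      by (auto simp: S_def norm_vec_def L2_set_def sum_3)
  qed
  have h_mem: "h z \<in> S" and gh: "stereographic (h z) = z" for z
  proof -
    define r where "r = (cmod z)\<^sup>2 + 1"
    have r: "r > 0" "(Re z)\<^sup>2 + (Im z)\<^sup>2 = r - 1"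
      by (auto simp: r_def cmod_power2 add_nonneg_pos)
    have h: "h z = vector [2 * Re z / r, 2 * Im z / r, (r - 2) / r]"
      by (simp add: h_def r_def)
    have "(2 * Re z / r)\<^sup>2 + (2 * Im z / r)\<^sup>2 + ((r - 2) / r)\<^sup>2
          = (4 * ((Re z)\<^sup>2 + (Im z)\<^sup>2) + (r - 2)\<^sup>2) / r\<^sup>2"
      by (simp add: power_divide power_mult_distrib add_divide_distrib)
    also have "\<dots> = 1"
      using r by (simp add: power2_eq_square field_simps)
    finally show "h z \<in> S" using r by (simp add: S_iff h)
    have "1 - (r - 2) / r = 2 / r" using r by (simp add: field_simps)
    then show "stereographic (h z) = z"
      using r by (simp add: stereographic_def h complex_eq_iff)
  qed
  have hg: "h (stereographic p) = p" if "p \<in> S" for p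
  proof -
    define d where "d = 1 - p $ 3"
    have d: "d \<noteq> 0" "p $ 3 = 1 - d" "(p $ 1)\<^sup>2 + (p $ 2)\<^sup>2 = d * (2 - d)"
      using that by (auto simp: S_iff d_def power2_eq_square algebra_simps)
    have "(cmod (stereographic p))\<^sup>2 = ((p $ 1)\<^sup>2 + (p $ 2)\<^sup>2) / d\<^sup>2"
      by (simp add: cmod_power2 stereographic_def d_def power_divide add_divide_distrib)
    also have "\<dots> = (2 - d) / d" using d by (simp add: power2_eq_square)
    finally have c: "(cmod (stereographic p))\<^sup>2 = (2 - d) / d" .
    have c1: "(2 - d) / d + 1 = 2 / d" "(2 - d) / d - 1 = (2 - 2 * d) / d"
      using d(1) by (simp_all add: field_simps)
    have re_im: "Re (stereographic p) = p $ 1 / d" "Im (stereographic p) = p $ 2 / d"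
      by (simp_all add: stereographic_def d_def)
    have "h (stereographic p) = vector [2 * (p $ 1 / d) / (2 / d), 2 * (p $ 2 / d) / (2 / d),
            ((2 - 2 * d) / d) / (2 / d)]"
      unfolding h_def c c1 re_im ..
    also have "\<dots> = vector [p $ 1, p $ 2, 1 - d]"
    proof -
      have "((2 - 2 * d) / d) / (2 / d) = 1 - d" "2 * (t / d) / (2 / d) = t" for t
        using d(1) by (simp_all add: field_simps)
      then show ?thesis by (simp only:)
    qed
    also have "\<dots> = p"
      using d(2) by (simp add: Finite_Cartesian_Product.vec_eq_iff[of _ p] forall_3)
    finally show ?thesis .
  qed
  show bij: "bij_betw stereographic (sphere 0 1 - {north_pole}) UNIV"
    unfolding S_def[symmetric]
    by (rule bij_betwI[where g = h]) (auto simp: h_mem gh hg)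
  have "inv_into S stereographic z = h z"
    using bij by (intro inv_into_f_eq h_mem gh) (simp add: bij_betw_def S_def)
  then show "inv_stereographic z =
       vector [2 * Re z / ((cmod z)\<^sup>2 + 1), 2 * Im z / ((cmod z)\<^sup>2 + 1),
               ((cmod z)\<^sup>2 - 1) / ((cmod z)\<^sup>2 + 1)]"
    by (simp add: inv_stereographic_def h_def S_def)
qed

lemma inverse_mat_inverts:
  assumes "A \<in> carrier_mat n n" "invertible_mat A"
  shows "inverse_mat A \<in> carrier_mat n n" "A * inverse_mat A = 1\<^sub>m n" "inverse_mat A * A = 1\<^sub>m n"
proof -
  obtain C where C: "A * C = 1\<^sub>m n" "C * A = 1\<^sub>m (dim_row C)"
    using assms by (auto simp: invertible_mat_def inverts_mat_def)
  have "dim_row C = n" using C assms(1)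
    by (metis carrier_matD(2) index_mult_mat(3) index_one_mat(3))
  moreover have "dim_col C = n" using C(1)
    by (metis index_mult_mat(3) index_one_mat(3))
  ultimately have "A \<in> Units (ring_mat TYPE(complex) n ())"
    using C assms(1) by (auto simp: Units_def ring_mat_def)
  then obtain D where "mat_inverse A = Some D"
    using mat_inverse(1)[OF assms(1), where b = "()"] by (cases "mat_inverse A") auto
  with mat_inverse(2)[OF assms(1) this]
  show "inverse_mat A \<in> carrier_mat n n" "A * inverse_mat A = 1\<^sub>m n" "inverse_mat A * A = 1\<^sub>m n"
    by (auto simp: inverse_mat_def)
qed

lemma eigenvalue_list:
  assumes "C \<in> carrier_mat n n"
  shows "char_poly C = (\<Prod>e\<leftarrow>eigenvalue_list C. [:- e, 1:])" "length (eigenvalue_list C) = n"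
proof -
  have "\<exists>es. char_poly C = (\<Prod>e\<leftarrow>es. [:- e, 1:])"
    using char_poly_factorized[OF assms] by blast
  then show *: "char_poly C = (\<Prod>e\<leftarrow>eigenvalue_list C. [:- e, 1:])"
    unfolding eigenvalue_list_def by (rule someI_ex)
  have "degree (\<Prod>e\<leftarrow>es. [:- e, 1:]) = length es" for es :: "complex list"
    by (rule degree_linear_factors)
  with * show "length (eigenvalue_list C) = n"
    using degree_monic_char_poly[OF assms] by metis
qed

end

theory Submission
  imports Defs "HOL-Complex_Analysis.Complex_Analysis" "HOL-Real_Asymp.Real_Asymp"
begin

text \<open>
  The characteristic polynomial of \<open>A^-1 B\<close> is \<open>det (z A - B) / det A\<close>. Counting the zeros of this function by a
  change of variables that splits off an eigenvalue, an eigenvector and a pencil of size one less turns the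
  Gaussian integral, by induction on \<open>n\<close>, into an integral against the density
  \<open>\<Prod>i<k. |x\<^sub>i - x\<^sub>k|^2\<close> times \<open>\<Prod>i. (1 + |x\<^sub>i|^2)^-(n+1)\<close> of the roots.

  With respect to the uniform measure of the sphere this is the determinantal process of a projection kernel
  of rank \<open>n\<close>. Schur complements of a reproducing kernel are again reproducing, with trace smaller by one; this
  gives the correlation functions as determinants and, by Fischer's inequality, bounds them by products over
  disjoint pairs.

  A pair of points at distance at most \<open>x n^(-3/4)\<close> is called good if no third point is that close to
  either of them. Good pairs are disjoint, and close pairs that are not good have vanishing probability.
  The \<open>k\<close>-th factorial moment of the number of good pairs tends to \<open>(x^4/64)^k\<close>: the upper bound is Fischer's
  inequality, and the lower bound holds since the kernel is exponentially small between separated pairs. The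
  Bonferroni inequalities then give the limit \<open>exp (- x^4/64)\<close> for the probability that there is no close pair.
\<close>

subsection \<open>Change of variables in the complex plane\<close>

text \<open>Unipotent factors replace a generalised Schur form: all variables stay complex
  coordinates with Lebesgue measure, handled by translations, scalings and Fubini instead of
  integration over a unitary group. The price is that the Gaussian exponent changes shape, so the
  induction runs over all exponents \<open>qf N \<pi> \<rho>\<close>, a class preserved by the
  splitting, with a power of |det A| that grows at each step. No constant of a fibre is computed:
  the induction compares two test functionals by a cross-multiplied identity, and the functional 1
  fixes the normalisation. Functionals depend on the monic polynomial of the eigenvalues, which
  avoids a measurable enumeration of the roots.

  The scale n^(-3/4) comes from repulsion. For u a quarter of the squared chordal distance, which is
  uniform on [0, 1], the two-point density is n^2 (1 - (1 - u)^(n-1)), about n^3 u for small u.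
  Integrated up to t = (x^2/4) n^(-3/2) it gives (x^2/4)^2 / 2 ordered pairs in the limit, hence
  x^4/64 unordered ones.\<close>

definition complex_of_vec :: "real^2 => complex" where
  "complex_of_vec x = Complex (x $ 1) (x $ 2)"

text \<open>The Jacobian theorem \<open>has_measure_differentiable_image\<close> speaks of real
  vectors and matrix determinants, so holomorphic maps are transported to real^2 and back.\<close>

definition vec_of_complex :: "complex => real^2" where
  "vec_of_complex z = (\<chi> i. if i = 1 then Re z else Im z)"

lemma vec_of_complex_inverse [simp]: "complex_of_vec (vec_of_complex z) = z"
  by (simp add: complex_of_vec_def vec_of_complex_def)

lemma complex_of_vec_inverse [simp]: "vec_of_complex (complex_of_vec x) = x"
  by (simp add: complex_of_vec_def vec_of_complex_def Finite_Cartesian_Product.vec_eq_iff forall_2)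

lemma bounded_linear_complex_of_vec: "bounded_linear complex_of_vec"
  unfolding linear_conv_bounded_linear[symmetric]
  by (intro linearI) (simp_all add: complex_of_vec_def complex_eq_iff)

lemma bounded_linear_vec_of_complex: "bounded_linear vec_of_complex"
  unfolding linear_conv_bounded_linear[symmetric]
  by (intro linearI) (simp_all add: vec_of_complex_def Finite_Cartesian_Product.vec_eq_iff)

lemma borel_measurable_vec_of_complex [measurable]: "vec_of_complex \<in> borel_measurable borel"
  by (intro borel_measurable_continuous_onI linear_continuous_on bounded_linear_vec_of_complex)

lemma borel_measurable_complex_of_vec [measurable]: "complex_of_vec \<in> borel_measurable borel"
  by (intro borel_measurable_continuous_onI linear_continuous_on bounded_linear_complex_of_vec)

lemma distr_vec_of_complex: "distr lborel borel vec_of_complex = lborel"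
proof (rule lborel_eqI[symmetric])
  fix l u :: "real^2" assume le: "\<And>b. b \<in> Basis ==> l \<bullet> b \<le> u \<bullet> b"
  have "vec_of_complex -` box l u = box (complex_of_vec l) (complex_of_vec u)"
    by (auto simp: box_def vec_of_complex_def complex_of_vec_def Basis_vec_def inner_axis Basis_complex_def
          forall_2 inner_complex_def)
  moreover have "l $ 1 \<le> u $ 1" "l $ 2 \<le> u $ 2"
    using le[of "axis 1 1"] le[of "axis 2 1"] by (auto simp: Basis_vec_def inner_axis)
  ultimately have "emeasure (distr lborel borel vec_of_complex) (box l u)
      = ennreal ((u $ 1 - l $ 1) * (u $ 2 - l $ 2))"
    by (simp add: emeasure_distr emeasure_lborel_box_eq Basis_complex_def complex_of_vec_def)
  also have "... = ennreal (\<Prod>b\<in>Basis. (u - l) \<bullet> b)"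
  proof -
    have B: "(Basis :: (real^2) set) = {axis 1 1, axis 2 1}"
      by (auto simp: Basis_vec_def) (metis exhaust_2)
    show ?thesis
      unfolding B by (simp add: axis_eq_axis inner_axis)
  qed
  finally show "emeasure (distr lborel borel vec_of_complex) (box l u) = ennreal (\<Prod>b\<in>Basis. (u - l) \<bullet> b)" .
qed simp

text \<open>Holomorphic images of Borel sets enter only as Lebesgue measurable sets, so the two
  planes have to be compared for the completed measures. Each Lebesgue set is a Borel set plus a
  subset of a Borel null set, and both parts transfer.\<close>

lemma lebesgue_complex_of_vec_image:
  assumes "A \<in> sets lebesgue"
  shows "complex_of_vec ` A \<in> sets lebesgue"
    and "emeasure lebesgue (complex_of_vec ` A) = emeasure lebesgue A"
proof -
  have im: "complex_of_vec ` B = vec_of_complex -` B" for B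
    by (auto simp: image_iff) (metis vec_of_complex_inverse)
  have em: "vec_of_complex -` B \<in> sets lborel" "emeasure lborel (vec_of_complex -` B) = emeasure lborel B"
    if "B \<in> sets lborel" for B
  proof -
    from that have [measurable]: "B \<in> sets borel" by simp
    show "vec_of_complex -` B \<in> sets lborel"
      using measurable_sets[OF borel_measurable_vec_of_complex, of B] by simp
    have "emeasure (distr lborel borel vec_of_complex) B = emeasure lborel (vec_of_complex -` B)"
      by (subst emeasure_distr) auto
    then show "emeasure lborel (vec_of_complex -` B) = emeasure lborel B"
      by (simp add: distr_vec_of_complex)
  qed
  obtain S N N' where A: "A = S \<union> N" "N \<subseteq> N'" "N' \<in> null_sets lborel" "S \<in> sets lborel"
    using sets_completionE[OF assms] .
  have N': "vec_of_complex -` N' \<in> null_sets lborel"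
    using A(3) em[of N'] by (auto simp: null_sets_def)
  have vim: "vec_of_complex -` A = vec_of_complex -` S \<union> vec_of_complex -` N"
    using A by auto
  have sub: "vec_of_complex -` N \<subseteq> vec_of_complex -` N'" using A by auto
  show 1: "complex_of_vec ` A \<in> sets lebesgue"
    unfolding im by (rule sets_completionI[OF vim sub N' em(1)[OF A(4)]])
  have nulls: "N \<in> null_sets lebesgue" "vec_of_complex -` N \<in> null_sets lebesgue"
    using A N' sub by (auto simp: null_sets_completion_iff2)
  have "emeasure lebesgue (complex_of_vec ` A) = emeasure lebesgue (vec_of_complex -` S)"
    unfolding im vim by (rule emeasure_Un_null_set[OF _ nulls(2)]) (use em(1)[OF A(4)] in auto)
  also have "... = emeasure lborel (vec_of_complex -` S)"
    using em(1)[OF A(4)] by simp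
  also have "... = emeasure lebesgue S" using em(2)[OF A(4)] A(4) by simp
  also have "... = emeasure lebesgue A"
    unfolding A(1) by (rule emeasure_Un_null_set[OF _ nulls(1), symmetric]) (use A(4) in auto)
  finally show "emeasure lebesgue (complex_of_vec ` A) = emeasure lebesgue A" .
qed

text \<open>By the Cauchy-Riemann equations the real Jacobian matrix of a holomorphic map is
  multiplication by a complex number; this is the origin of the squared moduli in the changes of
  variables below.\<close>

lemma det_matrix_complex_mult:
  "Determinants.det (matrix (\<lambda>x. vec_of_complex (w * complex_of_vec x))) = (cmod w)\<^sup>2"
  unfolding cmod_power2
  by (simp add: det_2 matrix_def vec_of_complex_def complex_of_vec_def axis_def power2_eq_square)

text \<open>A bounded set and a bounded derivative make the Jacobian integrable, as the theorem in
  real^2 demands; \<open>emeasure_holomorphic_image\<close> removes both bounds by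
  exhaustion.\<close>

lemma emeasure_holomorphic_image_bounded:
  fixes f f' :: "complex => complex"
  assumes S: "S \<in> sets borel" "bounded S"
    and der: "\<And>z. z \<in> S ==> (f has_field_derivative f' z) (at z)"
    and inj: "inj_on f S"
    and f' [measurable]: "f' \<in> borel_measurable borel" and bnd: "\<And>z. z \<in> S ==> cmod (f' z) \<le> B"
  shows "f ` S \<in> sets lebesgue"
    and "emeasure lebesgue (f ` S) = (\<integral>\<^sup>+z\<in>S. ennreal ((cmod (f' z))\<^sup>2) \<partial>lborel)"
proof -
  define S' where "S' = vec_of_complex ` S"
  define F where "F = (\<lambda>x. vec_of_complex (f (complex_of_vec x)))"
  define F' where "F' = (\<lambda>x y. vec_of_complex (f' (complex_of_vec x) * complex_of_vec y))"
  have S'_eq: "S' = complex_of_vec -` S"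
    unfolding S'_def by (auto simp: image_iff) (metis complex_of_vec_inverse)
  have S'b: "S' \<in> sets borel"
    unfolding S'_eq using measurable_sets[OF borel_measurable_complex_of_vec S(1)] by simp
  have S'l: "S' \<in> sets lebesgue" using S'b by simp
  have bS': "bounded S'" unfolding S'_def
    by (rule bounded_linear_image[OF S(2) bounded_linear_vec_of_complex])
  have FS': "complex_of_vec ` (F ` S') = f ` S"
    by (auto simp: F_def S'_def image_image)
  have injF: "inj_on F S'"
    using inj unfolding F_def S'_def inj_on_def
    by (auto simp: image_iff) (metis vec_of_complex_inverse)
  have derF: "(F has_derivative F' x) (at x within S')" if "x \<in> S'" for x
  proof -
    have "complex_of_vec x \<in> S" using that by (auto simp: S'_def)
    then have "(f has_derivative (\<lambda>h. h * f' (complex_of_vec x))) (at (complex_of_vec x))"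
      using der[of "complex_of_vec x"] by (simp add: has_field_derivative_def mult_commute_abs)
    from bounded_linear.has_derivative[OF bounded_linear_vec_of_complex
        has_derivative_compose[OF bounded_linear_imp_has_derivative[OF bounded_linear_complex_of_vec] this]]
    have "((\<lambda>x. vec_of_complex (f (complex_of_vec x))) has_derivative
        (\<lambda>y. vec_of_complex (complex_of_vec y * f' (complex_of_vec x)))) (at x)" .
    then show ?thesis
      unfolding F_def F'_def by (simp add: mult.commute has_derivative_at_withinI)
  qed
  have det: "\<bar>Determinants.det (matrix (F' x))\<bar> = (cmod (f' (complex_of_vec x)))\<^sup>2" for x
    unfolding F'_def by (simp add: det_matrix_complex_mult)
  define h where "h = (\<lambda>x. (cmod (f' (complex_of_vec x)))\<^sup>2)"
  have hm: "h \<in> borel_measurable borel" unfolding h_def by measurable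
  have B: "cmod (f' z) \<le> max 0 B" if "z \<in> S" for z using bnd[OF that] by simp
  have fin: "emeasure lborel S' < \<infinity>" using bS' by (rule emeasure_bounded_finite)
  have int: "set_integrable lborel S' h"
  proof -
    have "set_integrable lborel S' (\<lambda>_. (max 0 B)\<^sup>2)"
      using fin S'b by (simp add: set_integrable_def)
    moreover have "(\<lambda>x. indicator S' x *\<^sub>R h x) \<in> borel_measurable lborel"
      using hm S'b by measurable
    ultimately show ?thesis unfolding set_integrable_def
      by (rule Bochner_Integration.integrable_bound)
         (use B in \<open>auto simp: h_def indicator_def S'_eq intro!: AE_I2 power_mono\<close>)
  qed
  then have "((\<lambda>x. indicator S' x *\<^sub>R h x) has_integral (LINT x:S'|lborel. h x)) UNIV"
    unfolding set_integrable_def set_lebesgue_integral_def by (rule has_integral_integral_lborel)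
  moreover have "(\<lambda>x. indicator S' x *\<^sub>R h x) = (\<lambda>x. if x \<in> S' then h x else 0)"
    by (auto simp: indicator_def)
  ultimately have hi: "(h has_integral (LINT x:S'|lborel. h x)) S'"
    using has_integral_restrict_UNIV by metis
  have "(\<lambda>x. \<bar>Determinants.det (matrix (F' x))\<bar>) = h" by (simp add: det h_def)
  then have FS: "F ` S' \<in> lmeasurable" "measure lebesgue (F ` S') = (LINT x:S'|lborel. h x)"
    using has_measure_differentiable_image[OF S'l derF injF, of "LINT x:S'|lborel. h x"] hi by auto
  show "f ` S \<in> sets lebesgue"
    unfolding FS'[symmetric] by (rule lebesgue_complex_of_vec_image) (use FS in \<open>auto simp: fmeasurable_def\<close>)
  have "emeasure lebesgue (f ` S) = emeasure lebesgue (F ` S')"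
    unfolding FS'[symmetric] by (rule lebesgue_complex_of_vec_image) (use FS in \<open>auto simp: fmeasurable_def\<close>)
  also have "... = ennreal (LINT x:S'|lborel. h x)"
    using FS by (simp add: emeasure_eq_measure2 del: emeasure_completion)
  also have "... = (\<integral>\<^sup>+x\<in>S'. ennreal (h x) \<partial>lborel)"
    unfolding set_lebesgue_integral_def
    by (subst nn_integral_eq_integral[symmetric])
       (use int in \<open>auto simp: set_integrable_def h_def indicator_def intro!: nn_integral_cong\<close>)
  also have "... = (\<integral>\<^sup>+x\<in>S'. ennreal (h x) \<partial>(distr lborel borel vec_of_complex))"
    by (simp add: distr_vec_of_complex)
  also have "... = (\<integral>\<^sup>+z\<in>S. ennreal ((cmod (f' z))\<^sup>2) \<partial>lborel)"
  proof -
    have "(\<lambda>x. ennreal (h x) * indicator S' x) \<in> borel_measurable (distr lborel borel vec_of_complex)"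
      using hm S'b by measurable
    from nn_integral_distr[OF _ this] show ?thesis
      by (simp add: h_def S'_eq indicator_def)
  qed
  finally show "emeasure lebesgue (f ` S) = (\<integral>\<^sup>+z\<in>S. ennreal ((cmod (f' z))\<^sup>2) \<partial>lborel)" .
qed

lemma emeasure_holomorphic_image:
  fixes f f' :: "complex => complex"
  assumes S [measurable]: "S \<in> sets borel"
    and der: "\<And>z. z \<in> S ==> (f has_field_derivative f' z) (at z)"
    and inj: "inj_on f S"
    and f' [measurable]: "f' \<in> borel_measurable borel"
  shows "f ` S \<in> sets lebesgue"
    and "emeasure lebesgue (f ` S) = (\<integral>\<^sup>+z\<in>S. ennreal ((cmod (f' z))\<^sup>2) \<partial>lborel)"
proof -
  define T where "T k = S \<inter> {z. cmod z \<le> real k \<and> cmod (f' z) \<le> real k}" for k :: nat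
  have Tm: "T k \<in> sets borel" for k unfolding T_def by measurable
  have Tb: "bounded (T k)" for k unfolding T_def bounded_iff by auto
  have incT: "incseq T" unfolding T_def incseq_def by (auto intro: order_trans)
  have S_eq: "S = (\<Union>k. T k)"
  proof -
    have "z \<in> (\<Union>k. T k)" if "z \<in> S" for z
    proof -
      obtain k where "max (cmod z) (cmod (f' z)) \<le> real k" using real_arch_simple by blast
      then show ?thesis using that by (auto simp: T_def)
    qed
    then show ?thesis by (auto simp: T_def)
  qed
  have *: "f ` T k \<in> sets lebesgue"
    "emeasure lebesgue (f ` T k) = (\<integral>\<^sup>+z\<in>T k. ennreal ((cmod (f' z))\<^sup>2) \<partial>lborel)" for k
  proof -
    have "inj_on f (T k)" by (rule inj_on_subset[OF inj]) (simp add: T_def)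
    moreover have "(f has_field_derivative f' z) (at z)" "cmod (f' z) \<le> real k" if "z \<in> T k" for z
      using that der by (simp_all add: T_def)
    ultimately show "f ` T k \<in> sets lebesgue"
      "emeasure lebesgue (f ` T k) = (\<integral>\<^sup>+z\<in>T k. ennreal ((cmod (f' z))\<^sup>2) \<partial>lborel)"
      using emeasure_holomorphic_image_bounded[OF Tm Tb _ _ f'] by blast+
  qed
  have fS: "f ` S = (\<Union>k. f ` T k)" unfolding S_eq by auto
  show "f ` S \<in> sets lebesgue" unfolding fS using *(1) by auto
  have "emeasure lebesgue (f ` S) = (SUP k. emeasure lebesgue (f ` T k))"
    unfolding fS
    by (rule SUP_emeasure_incseq[symmetric]) (use *(1) incT in \<open>auto simp: incseq_def image_mono\<close>)
  also have "... = (SUP k. (\<integral>\<^sup>+z. ennreal ((cmod (f' z))\<^sup>2) * indicator (T k) z \<partial>lborel))"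
    by (simp only: *(2))
  also have "... = (\<integral>\<^sup>+z. (SUP k. ennreal ((cmod (f' z))\<^sup>2) * indicator (T k) z) \<partial>lborel)"
  proof (rule nn_integral_monotone_convergence_SUP[symmetric])
    show "incseq (\<lambda>k z. ennreal ((cmod (f' z))\<^sup>2) * indicator (T k) z)"
      using incT by (auto simp: incseq_def le_fun_def indicator_def subset_eq)
    show "(\<lambda>z. ennreal ((cmod (f' z))\<^sup>2) * indicator (T k) z) \<in> borel_measurable lborel" for k
      using Tm[of k] by measurable
  qed
  also have "... = (\<integral>\<^sup>+z\<in>S. ennreal ((cmod (f' z))\<^sup>2) \<partial>lborel)"
  proof (intro nn_integral_cong)
    fix z
    show "(SUP k. ennreal ((cmod (f' z))\<^sup>2) * indicator (T k) z) = ennreal ((cmod (f' z))\<^sup>2) * indicator S z"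
    proof (cases "z \<in> S")
      case True
      then obtain k where "z \<in> T k" using S_eq by auto
      then show ?thesis using True
        by (intro antisym SUP_least SUP_upper2[of k]) (auto simp: indicator_def)
    next
      case False
      then have "z \<notin> T k" for k using S_eq by auto
      then show ?thesis using False by simp
    qed
  qed
  finally show "emeasure lebesgue (f ` S) = (\<integral>\<^sup>+z\<in>S. ennreal ((cmod (f' z))\<^sup>2) \<partial>lborel)" .
qed

lemma nn_integral_holomorphic_image:
  fixes f f' :: "complex => complex"
  assumes S [measurable]: "S \<in> sets borel"
    and der: "\<And>z. z \<in> S ==> (f has_field_derivative f' z) (at z)"
    and inj: "inj_on f S"
    and f [measurable]: "f \<in> borel_measurable borel"
    and f' [measurable]: "f' \<in> borel_measurable borel"
    and g [measurable]: "g \<in> borel_measurable borel"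
  shows "(\<integral>\<^sup>+z\<in>S. g (f z) * ennreal ((cmod (f' z))\<^sup>2) \<partial>lborel) = (\<integral>\<^sup>+w\<in>f ` S. g w \<partial>lebesgue)"
proof -
  \<comment> \<open>The formula for sets says that these two measures on the target plane agree;
    integrating \<open>g\<close> against both is the claim. The second one lives on
    \<open>lebesgue\<close> because the image of \<open>S\<close> is only known to be Lebesgue
    measurable.\<close>
  define M1 where "M1 = distr (density lborel (\<lambda>z. ennreal ((cmod (f' z))\<^sup>2) * indicator S z)) borel f"
  define M2 where "M2 = distr (density lebesgue (indicator (f ` S))) borel (\<lambda>x. x)"
  have fS: "f ` S \<in> sets lebesgue" by (rule emeasure_holomorphic_image[OF S der inj f'])
  note [measurable] = measurable_completion[of "\<lambda>x. x" lborel borel, simplified]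
  have id_m: "(\<lambda>x. x) \<in> density lebesgue (indicator (f ` S)) \<rightarrow>\<^sub>M borel"
    by (simp add: measurable_completion)
  have "M1 = M2"
  proof (rule measure_eqI)
    fix T assume "T \<in> sets M1"
    then have T [measurable]: "T \<in> sets borel" by (simp add: M1_def)
    define S1 where "S1 = S \<inter> f -` T"
    have S1 [measurable]: "S1 \<in> sets borel"
      unfolding S1_def using measurable_sets[OF f T] by auto
    have im: "f ` S1 = T \<inter> f ` S" unfolding S1_def by auto
    have "emeasure M1 T = (\<integral>\<^sup>+z. ennreal ((cmod (f' z))\<^sup>2) * indicator S1 z \<partial>lborel)"
      unfolding M1_def
      by (subst emeasure_distr, simp, simp, subst emeasure_density)
         (auto intro!: nn_integral_cong measurable_sets_borel[OF f T] simp: S1_def indicator_def)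
    also have "... = emeasure lebesgue (f ` S1)"
      by (rule emeasure_holomorphic_image(2)[OF S1 _ _ f', symmetric])
         (use der inj in \<open>auto simp: S1_def intro: inj_on_subset\<close>)
    also have "... = emeasure M2 T"
    proof -
      have "f ` S1 \<in> sets lebesgue" unfolding im using fS T by auto
      have "emeasure M2 T = emeasure (density lebesgue (indicator (f ` S))) T"
        unfolding M2_def by (subst emeasure_distr[OF id_m T]) simp
      also have "... = (\<integral>\<^sup>+x. indicator (f ` S1) x \<partial>lebesgue)"
        using fS T by (subst emeasure_density) (auto intro!: nn_integral_cong simp: im indicator_def simp del: nn_integral_indicator)
      also have "... = emeasure lebesgue (f ` S1)"
        using \<open>f ` S1 \<in> sets lebesgue\<close> by (rule nn_integral_indicator)
      finally show ?thesis ..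
    qed
    finally show "emeasure M1 T = emeasure M2 T" .
  qed (simp add: M1_def M2_def)
  then have "(\<integral>\<^sup>+x. g x \<partial>M1) = (\<integral>\<^sup>+x. g x \<partial>M2)" by simp
  also have "(\<integral>\<^sup>+x. g x \<partial>M1) = (\<integral>\<^sup>+z. ennreal ((cmod (f' z))\<^sup>2) * indicator S z * g (f z) \<partial>lborel)"
    unfolding M1_def by (subst nn_integral_distr, simp, simp) (subst nn_integral_density; simp)
  also have "... = (\<integral>\<^sup>+z\<in>S. g (f z) * ennreal ((cmod (f' z))\<^sup>2) \<partial>lborel)"
    by (intro nn_integral_cong) (simp add: mult_ac)
  also have "(\<integral>\<^sup>+x. g x \<partial>M2) = (\<integral>\<^sup>+x. g x \<partial>density lebesgue (indicator (f ` S)))"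
    unfolding M2_def by (rule nn_integral_distr[OF id_m]) simp
  also have "... = (\<integral>\<^sup>+w. indicator (f ` S) w * g w \<partial>lebesgue)"
    using fS by (intro nn_integral_density) (auto simp: measurable_completion)
  finally show ?thesis by (simp add: mult.commute)
qed

text \<open>The area formula. Lindelof gives countably many balls on which \<open>f\<close> is
  injective; made disjoint, they cut \<open>U\<close> into pieces to which the injective case
  applies, and almost every \<open>w\<close> lies in exactly \<open>n\<close> of the images.\<close>

lemma nn_integral_count_preimages:
  fixes f f' :: "complex => complex"
  assumes U: "open U"
    and der: "\<And>z. z \<in> U ==> (f has_field_derivative f' z) (at z)"
    and nz: "\<And>z. z \<in> U ==> f' z \<noteq> 0"
    and f [measurable]: "f \<in> borel_measurable borel"
    and f' [measurable]: "f' \<in> borel_measurable borel"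
    and g [measurable]: "g \<in> borel_measurable borel"
    and count: "AE w in lborel. card {z\<in>U. f z = w} = n \<and> finite {z\<in>U. f z = w}"
  shows "(\<integral>\<^sup>+z\<in>U. g (f z) * ennreal ((cmod (f' z))\<^sup>2) \<partial>lborel) = of_nat n * (\<integral>\<^sup>+w. g w \<partial>lborel)"
proof -
  define \<B> where "\<B> = {b :: complex set. \<exists>r. b = ball (fst r) (snd r) \<and> b \<subseteq> U \<and> inj_on f b}"
  have hol: "f holomorphic_on U"
    using der by (auto simp: holomorphic_on_def field_differentiable_def intro: has_field_derivative_at_within)
  have "\<exists>b\<in>\<B>. z \<in> b" if z: "z \<in> U" for z
  proof -
    have "deriv f z \<noteq> 0" using der[OF z] nz[OF z] by (simp add: DERIV_imp_deriv)
    from has_complex_derivative_locally_injective[OF hol z U this]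
    obtain r where "r > 0" "ball z r \<subseteq> U" "inj_on f (ball z r)" by blast
    then show ?thesis
      by (intro bexI[of _ "ball z r"]) (auto simp: \<B>_def)
  qed
  then have "U = \<Union>\<B>" by (auto simp: \<B>_def)
  moreover obtain \<B>' where B': "\<B>' \<subseteq> \<B>" "countable \<B>'" "\<Union>\<B>' = \<Union>\<B>"
    using Lindelof[of \<B>] by (auto simp: \<B>_def)
  ultimately have U_eq: "U = \<Union>(insert {} \<B>')" by simp
  define b where "b = from_nat_into (insert {} \<B>')"
  have rb: "range b = insert {} \<B>'"
    unfolding b_def using B' by (intro range_from_nat_into) auto
  have bi: "inj_on f (b i)" "open (b i)" "b i \<subseteq> U" for i
  proof -
    have "b i \<in> insert {} \<B>'" using rb by (metis rangeI)
    then show "inj_on f (b i)" "open (b i)" "b i \<subseteq> U" using B' by (auto simp: \<B>_def)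
  qed
  define D where "D = disjointed b"
  have Dsub: "D i \<subseteq> b i" for i unfolding D_def by (rule disjointed_subset)
  have Dm [measurable]: "D i \<in> sets borel" for i
  proof -
    have "range b \<subseteq> sets borel" using bi(2) by auto
    from sets.range_disjointed_sets[OF this] show ?thesis by (auto simp: D_def)
  qed
  have UD: "U = (\<Union>i. D i)"
    unfolding D_def UN_disjointed_eq using U_eq rb by metis
  have disj: "disjoint_family D" unfolding D_def by (rule disjoint_family_disjointed)
  have injD: "inj_on f (D i)" for i using bi(1) Dsub by (rule inj_on_subset)
  have derD: "z \<in> D i ==> (f has_field_derivative f' z) (at z)" for z i using der bi(3) Dsub by blast
  have im: "f ` D i \<in> sets lebesgue" for i
    by (rule emeasure_holomorphic_image(1)[OF Dm derD injD f'])
  have gl [measurable]: "g \<in> borel_measurable lebesgue" by (simp add: measurable_completion)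
  have "(\<integral>\<^sup>+z\<in>U. g (f z) * ennreal ((cmod (f' z))\<^sup>2) \<partial>lborel)
      = (\<integral>\<^sup>+z. (\<Sum>i. g (f z) * ennreal ((cmod (f' z))\<^sup>2) * indicator (D i) z) \<partial>lborel)"
    unfolding UD by (intro nn_integral_cong) (simp add: suminf_indicator[OF disj])
  also have "... = (\<Sum>i. \<integral>\<^sup>+z\<in>D i. g (f z) * ennreal ((cmod (f' z))\<^sup>2) \<partial>lborel)"
    by (rule nn_integral_suminf) measurable
  also have "... = (\<Sum>i. \<integral>\<^sup>+w\<in>f ` D i. g w \<partial>lebesgue)"
    by (intro suminf_cong nn_integral_holomorphic_image[OF Dm derD injD f f' g])
  also have "... = (\<integral>\<^sup>+w. (\<Sum>i. g w * indicator (f ` D i) w) \<partial>lebesgue)"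
    using im by (intro nn_integral_suminf[symmetric]) auto
  also have "... = (\<integral>\<^sup>+w. g w * of_nat n \<partial>lebesgue)"
  proof (rule nn_integral_cong_AE)
    show "AE w in lebesgue. (\<Sum>i. g w * indicator (f ` D i) w) = g w * of_nat n"
      using AE_completion[OF count]
    proof eventually_elim
      case (elim w)
      define I where "I = {i. w \<in> f ` D i}"
      define idx where "idx = (\<lambda>z. THE i. z \<in> D i)"
      have idx: "idx z = i" if "z \<in> D i" for z i
        unfolding idx_def using that disj by (intro the_equality) (auto simp: disjoint_family_on_def)
      \<comment> \<open>Each preimage lies in exactly one piece and a piece contains at most one
        preimage, so the pieces whose image contains \<open>w\<close> are counted by the
        fibre.\<close>
      have "bij_betw idx {z\<in>U. f z = w} I"
        unfolding bij_betw_def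
      proof
        show "inj_on idx {z\<in>U. f z = w}"
        proof (rule inj_onI)
          fix y z assume yz: "y \<in> {z\<in>U. f z = w}" "z \<in> {z\<in>U. f z = w}" and eq: "idx y = idx z"
          then obtain i j where ij: "y \<in> D i" "z \<in> D j" using UD by auto
          then have "i = j" using idx eq by auto
          then show "y = z" using ij yz injD[of i] by (auto simp: inj_on_def)
        qed
        show "idx ` {z\<in>U. f z = w} = I"
          unfolding I_def using idx UD by (force simp: image_iff)
      qed
      with elim have I: "card I = n" "finite I" by (auto simp: bij_betw_same_card dest: bij_betw_finite)
      have "(\<Sum>i. g w * indicator (f ` D i) w) = (\<Sum>i\<in>I. g w * indicator (f ` D i) w)"
        by (rule suminf_finite[OF I(2)]) (auto simp: I_def)
      also have "... = (\<Sum>i\<in>I. g w)" by (intro sum.cong) (auto simp: I_def)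
      finally show ?case using I by (simp add: mult.commute)
    qed
  qed
  also have "... = (\<integral>\<^sup>+w. g w * of_nat n \<partial>lborel)" by (simp add: nn_integral_completion)
  also have "... = of_nat n * (\<integral>\<^sup>+w. g w \<partial>lborel)"
    by (subst nn_integral_multc) (auto simp: mult.commute)
  finally show ?thesis .
qed

lemma AE_lborel_finite:
  assumes "finite (A :: 'a :: euclidean_space set)"
  shows "AE x in lborel. x \<notin> A"
  using finite_imp_null_set_lborel[OF assms] by (rule AE_not_in)

lemma card_poly_roots_simple:
  fixes p :: "complex poly"
  assumes "p \<noteq> 0" "\<And>z. poly p z = 0 ==> poly (pderiv p) z \<noteq> 0"
  shows "card {z. poly p z = 0} = degree p"
proof -
  have "rsquarefree p" using assms unfolding rsquarefree_roots by blast
  then show ?thesis using rsquarefree_card_degree[OF assms(1)] by simp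
qed

text \<open>The fibre over \<open>w\<close> consists of the roots of P - w Q, a polynomial of degree
  \<open>n\<close> by the degree condition. A multiple root is a zero of the Wronskian
  \<open>W\<close>, so outside finitely many critical values the fibre has exactly \<open>n\<close>
  points.\<close>

lemma nn_integral_rational_fibres:
  fixes P Q :: "complex poly" and R' :: "complex => complex"
  assumes deg: "degree P = n" "degree Q < n" and Q0: "Q \<noteq> 0"
    and cop: "\<And>z. poly P z = 0 ==> poly Q z \<noteq> 0"
    and R': "\<And>z. poly Q z \<noteq> 0 ==> ((\<lambda>z. poly P z / poly Q z) has_field_derivative R' z) (at z)"
    and R'm [measurable]: "R' \<in> borel_measurable borel"
    and g [measurable]: "g \<in> borel_measurable borel"
  shows "(\<integral>\<^sup>+z. g (poly P z / poly Q z) * ennreal ((cmod (R' z))\<^sup>2) \<partial>lborel) = of_nat n * (\<integral>\<^sup>+w. g w \<partial>lborel)"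
proof -
  define f where "f = (\<lambda>z. poly P z / poly Q z)"
  define W where "W = P * pderiv Q - pderiv P * Q"
  have polym [measurable]: "poly p \<in> borel_measurable borel" for p :: "complex poly"
    by (intro borel_measurable_continuous_onI continuous_intros)
  have fm [measurable]: "f \<in> borel_measurable borel" unfolding f_def by measurable
  have R'_eq: "R' z = - poly W z / (poly Q z)\<^sup>2" if "poly Q z \<noteq> 0" for z
  proof -
    have "((\<lambda>z. poly P z / poly Q z) has_field_derivative
       (poly (pderiv P) z * poly Q z - poly P z * poly (pderiv Q) z) / (poly Q z * poly Q z)) (at z)"
      by (intro DERIV_divide poly_DERIV that)
    from DERIV_unique[OF R'[OF that] this] show ?thesis
      by (simp add: W_def power2_eq_square)
  qed
  have P0: "P \<noteq> 0" using deg by auto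
  \<comment> \<open>If P Q' = P' Q, compare orders at a root of \<open>P\<close>: there
    \<open>Q\<close> does not vanish, while differentiation lowers the order of \<open>P\<close> by
    one.\<close>
  have W0: "W \<noteq> 0"
  proof
    assume "W = 0"
    have eq: "P * pderiv Q = pderiv P * Q" using \<open>W = 0\<close> by (simp add: W_def)
    obtain z where z: "poly P z = 0"
      using Fundamental_Theorem_Algebra.fundamental_theorem_of_algebra[of P] deg
      by (auto simp: constant_degree)
    have P': "pderiv P \<noteq> 0" using deg by (simp add: pderiv_eq_0_iff)
    then have nz: "pderiv P * Q \<noteq> 0" using Q0 by simp
    have "order z P + order z (pderiv Q) = order z (pderiv P) + order z Q"
      using order_mult[OF nz, of z] order_mult[of P "pderiv Q" z] nz eq by metis
    moreover have "order z Q = 0" using cop[OF z] by (simp add: order_root)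
    moreover have "order z P = Suc (order z (pderiv P))"
      using z P0 P' by (intro order_pderiv) (auto simp: order_root)
    ultimately show False by simp
  qed
  define U where "U = {z. poly Q z \<noteq> 0 \<and> poly W z \<noteq> 0}"
  have "U = - ({z. poly Q z = 0} \<union> {z. poly W z = 0})" by (auto simp: U_def)
  moreover have finQW: "finite ({z. poly Q z = 0} \<union> {z. poly W z = 0})"
    using poly_roots_finite[OF Q0] poly_roots_finite[OF W0] by simp
  ultimately have Uo: "open U" by (simp add: finite_imp_closed open_Compl open_Int)
  have der: "(f has_field_derivative R' z) (at z)" if "z \<in> U" for z
    unfolding f_def using R' that by (auto simp: U_def)
  have nz: "R' z \<noteq> 0" if "z \<in> U" for z using R'_eq that by (auto simp: U_def)
  have count: "AE w in lborel. card {z\<in>U. f z = w} = n \<and> finite {z\<in>U. f z = w}"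
    using AE_lborel_finite[OF finite_imageI[OF poly_roots_finite[OF W0]], of f]
  proof eventually_elim
    case (elim w)
    define S where "S = P - Polynomial.smult w Q"
    have dS: "degree S = n"
    proof -
      have "degree (Polynomial.smult w Q) < degree P" using deg by (simp add: degree_smult_eq)
      then show ?thesis unfolding S_def using deg degree_add_eq_left[of "- Polynomial.smult w Q" P] by simp
    qed
    then have S0: "S \<noteq> 0" using deg by auto
    have roots: "poly S z = 0 \<longleftrightarrow> z \<in> U \<and> f z = w" for z
    proof
      assume z: "poly S z = 0"
      have Qz: "poly Q z \<noteq> 0" using z cop[of z] by (auto simp: S_def)
      then have fz: "f z = w" using z by (simp add: f_def S_def field_simps)
      with elim Qz show "z \<in> U \<and> f z = w" by (auto simp: U_def)
    qed (auto simp: U_def f_def S_def)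
    have "poly (pderiv S) z \<noteq> 0" if "poly S z = 0" for z
    proof
      assume "poly (pderiv S) z = 0"
      then have "poly (pderiv P) z = w * poly (pderiv Q) z"
        by (simp add: S_def pderiv_diff pderiv_smult)
      moreover have "poly P z = w * poly Q z" using that by (simp add: S_def)
      ultimately have "poly W z = 0" by (simp add: W_def)
      then show False using roots[of z] that by (auto simp: U_def)
    qed
    from card_poly_roots_simple[OF S0 this] show ?case
      using roots dS poly_roots_finite[OF S0] by simp
  qed
  have "(\<integral>\<^sup>+z. g (f z) * ennreal ((cmod (R' z))\<^sup>2) \<partial>lborel) = (\<integral>\<^sup>+z\<in>U. g (f z) * ennreal ((cmod (R' z))\<^sup>2) \<partial>lborel)"
  proof (rule nn_integral_cong_AE)
    show "AE z in lborel. g (f z) * ennreal ((cmod (R' z))\<^sup>2) = g (f z) * ennreal ((cmod (R' z))\<^sup>2) * indicator U z"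
      using AE_lborel_finite[OF finQW] by eventually_elim (auto simp: U_def)
  qed
  also have "... = of_nat n * (\<integral>\<^sup>+w. g w \<partial>lborel)"
    by (rule nn_integral_count_preimages[OF Uo der nz fm R'm g count])
  finally show ?thesis by (simp add: f_def)
qed

text \<open>The degree one case of the fibre count.\<close>

lemma nn_integral_lborel_complex_scale:
  fixes c :: complex
  assumes [measurable]: "g \<in> borel_measurable borel" and c: "c \<noteq> 0"
  shows "(\<integral>\<^sup>+w. g w \<partial>lborel) = ennreal ((cmod c)\<^sup>2) * (\<integral>\<^sup>+z. g (c * z) \<partial>lborel)"
proof -
  have "(\<integral>\<^sup>+z. g (poly [:0, c:] z / poly [:1:] z) * ennreal ((cmod c)\<^sup>2) \<partial>lborel) = of_nat 1 * (\<integral>\<^sup>+w. g w \<partial>lborel)"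
    using c by (intro nn_integral_rational_fibres) (auto intro!: derivative_eq_intros)
  then show ?thesis by (simp add: nn_integral_multc mult.commute)
qed

lemma nn_integral_lborel_translation:
  fixes c :: "'a :: euclidean_space"
  assumes [measurable]: "g \<in> borel_measurable borel"
  shows "(\<integral>\<^sup>+w. g w \<partial>lborel) = (\<integral>\<^sup>+z. g (c + z) \<partial>lborel)"
  by (subst lborel_distr_plus[of c, symmetric]) (simp add: nn_integral_distr)

lemma nn_integral_lborel_complex_affine:
  fixes c d :: complex
  assumes [measurable]: "g \<in> borel_measurable borel" and c: "c \<noteq> 0"
  shows "(\<integral>\<^sup>+w. g w \<partial>lborel) = ennreal ((cmod c)\<^sup>2) * (\<integral>\<^sup>+z. g (c * z + d) \<partial>lborel)"
  by (subst nn_integral_lborel_translation[of _ d], simp, subst nn_integral_lborel_complex_scale[OF _ c])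
     (simp_all add: add.commute)

subsection \<open>Determinants of finite arrays\<close>

text \<open>Only the values at indices below \<open>n\<close> matter (\<open>dt_cong\<close>), so
  matrices that are modified entry by entry can be handled as plain functions, free of carrier
  conditions.\<close>

definition dt :: "nat => (nat => nat => 'a :: comm_ring_1) => 'a" where
  "dt n f = Determinant.det (Matrix.mat n n (\<lambda>(i, j). f i j))"

lemma dt_leibniz:
  "dt n f = (\<Sum>p | p permutes {0..<n}. signof p * (\<Prod>i = 0..<n. f i (p i)))"
proof -
  have "dt n f = (\<Sum>p | p permutes {0..<n}. signof p * (\<Prod>i = 0..<n. Matrix.mat n n (\<lambda>(i, j). f i j) $$ (i, p i)))"
    unfolding dt_def by (rule det_def') simp
  also have "... = (\<Sum>p | p permutes {0..<n}. signof p * (\<Prod>i = 0..<n. f i (p i)))"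
    by (intro sum.cong prod.cong arg_cong2[where f="(*)"] refl) (auto dest: permutes_in_image)
  finally show ?thesis .
qed

lemma dt_cong: "(\<And>i j. i < n ==> j < n ==> f i j = g i j) ==> dt n f = dt n g"
  unfolding dt_def by (intro arg_cong[where f=Determinant.det]) auto

lemma dt_0 [simp]: "dt 0 f = 1"
  by (simp add: dt_leibniz)

lemma borel_measurable_dt:
  fixes f :: "'b => nat => nat => complex"
  assumes "\<And>i j. i < n ==> j < n ==> (\<lambda>x. f x i j) \<in> borel_measurable M"
  shows "(\<lambda>x. dt n (f x)) \<in> borel_measurable M"
  unfolding dt_leibniz
proof (intro borel_measurable_sum borel_measurable_times borel_measurable_const borel_measurable_prod)
  fix p i assume "p \<in> {p. p permutes {0..<n}}" "i \<in> {0..<n}"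
  then have "p i < n" "i < n" by (auto dest: permutes_in_image)
  then show "(\<lambda>x. f x i (p i)) \<in> borel_measurable M" by (intro assms)
qed

lemma dt_row_zero:
  assumes "i < n" "\<And>j. j < n ==> f i j = 0"
  shows "dt n f = 0"
  unfolding dt_leibniz
proof (intro sum.neutral ballI)
  fix p assume "p \<in> {p. p permutes {0..<n}}"
  then have "p i < n" using assms(1) by (auto dest: permutes_in_image[of p _ i])
  then have "(\<Prod>i = 0..<n. f i (p i)) = 0" using assms by (intro prod_zero bexI[of _ i]) auto
  then show "signof p * (\<Prod>i = 0..<n. f i (p i)) = 0" by simp
qed

definition bmat :: "nat => (nat => nat => 'a) => (nat => 'a) => (nat => 'a) => 'a => nat => nat => 'a" where
  "bmat n A c r s i j = (if i < n then (if j < n then A i j else c i) else (if j < n then r j else s))"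

lemma mat_bmat:
  "Matrix.mat (Suc n) (Suc n) (\<lambda>(i, j). bmat n A c r s i j) =
    four_block_mat (Matrix.mat n n (\<lambda>(i, j). A i j)) (Matrix.mat n 1 (\<lambda>(i, j). c i))
      (Matrix.mat 1 n (\<lambda>(i, j). r j)) (Matrix.mat 1 1 (\<lambda>_. s))"
  by (rule eq_matI) (auto simp: bmat_def)

lemma dt_Suc_bmat: "dt (Suc n) f = dt (Suc n) (bmat n f (\<lambda>i. f i n) (\<lambda>j. f n j) (f n n))"
  by (rule dt_cong) (auto simp: bmat_def less_Suc_eq)

lemma dt_bmat_upper:
  fixes A :: "nat => nat => 'a :: idom"
  shows "dt (Suc n) (bmat n A c (\<lambda>_. 0) s) = dt n A * s"
  unfolding dt_def mat_bmat
  by (subst det_four_block_mat_lower_left_zero[where n=n and m=1]) (auto simp: det_single intro!: eq_matI)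

lemma dt_bmat_lower:
  fixes A :: "nat => nat => 'a :: idom"
  shows "dt (Suc n) (bmat n A (\<lambda>_. 0) r s) = dt n A * s"
  unfolding dt_def mat_bmat
  by (subst det_four_block_mat_upper_right_zero[where n=n and m=1]) (auto simp: det_single intro!: eq_matI)

lemma dt_id: "dt n (\<lambda>i j. if i = j then 1 else 0 :: 'a :: idom) = 1"
proof -
  have "Matrix.mat n n (\<lambda>(i, j). if i = j then 1 else 0) = (1\<^sub>m n :: 'a mat)" by (rule eq_matI) auto
  then show ?thesis by (simp add: dt_def)
qed

lemma dt_mult:
  "dt n A * dt n B = dt n (\<lambda>i j. \<Sum>k<n. A i k * B k j :: 'a :: idom)"
proof -
  have "Matrix.mat n n (\<lambda>(i, j). \<Sum>k<n. A i k * B k j) =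
      Matrix.mat n n (\<lambda>(i, j). A i j) * Matrix.mat n n (\<lambda>(i, j). B i j)"
    by (rule eq_matI) (auto simp: scalar_prod_def lessThan_atLeast0)
  then show ?thesis unfolding dt_def by (simp add: det_mult[of _ n])
qed

lemma sum_mult_delta:
  fixes X :: "nat => 'a :: comm_ring_1"
  shows "(\<Sum>k<n. X k * (if k = j then 1 else 0)) = (if j < n then X j else 0)"
    and "(\<Sum>k<n. (if j = k then 1 else 0) * X k) = (if j < n then X j else 0)"
proof -
  have 1: "X k * (if k = j then 1 else 0) = (if k = j then X k else 0)"
    "(if j = k then 1 else 0) * X k = (if j = k then X k else 0)" for k
    by auto
  show "(\<Sum>k<n. X k * (if k = j then 1 else 0)) = (if j < n then X j else 0)"
    "(\<Sum>k<n. (if j = k then 1 else 0) * X k) = (if j < n then X j else 0)"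
    unfolding 1 by simp_all
qed

text \<open>Right multiplication by the identity matrix whose last column is replaced by (v,
  \<open>\<alpha>\<close>): adding multiples of the other columns to the last one costs nothing,
  scaling it costs \<open>\<alpha>\<close>.\<close>

lemma dt_bmat_column:
  fixes A :: "nat => nat => 'a :: idom"
  shows "dt (Suc n) (bmat n A (\<lambda>i. (\<Sum>j<n. A i j * v j) + c i * \<alpha>) r ((\<Sum>j<n. r j * v j) + s * \<alpha>))
    = dt (Suc n) (bmat n A c r s) * \<alpha>"
proof -
  have "dt (Suc n) (bmat n A c r s) * \<alpha> = dt (Suc n) (bmat n A c r s) *
      dt (Suc n) (bmat n (\<lambda>i j. if i = j then 1 else 0) v (\<lambda>_. 0) \<alpha>)"
    by (simp add: dt_bmat_upper dt_id)
  also have "... = dt (Suc n) (bmat n A (\<lambda>i. (\<Sum>j<n. A i j * v j) + c i * \<alpha>) r ((\<Sum>j<n. r j * v j) + s * \<alpha>))"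
    unfolding dt_mult
    by (rule dt_cong) (auto simp: bmat_def sum_mult_delta)
  finally show ?thesis ..
qed

lemma dt_Schur_last:
  fixes f :: "nat => nat => 'a :: field"
  assumes "f n n \<noteq> 0"
  shows "dt (Suc n) f = f n n * dt n (\<lambda>i j. f i j - f i n * f n j / f n n)"
proof -
  have "dt (Suc n) (bmat n (\<lambda>i j. if i = j then 1 else 0) (\<lambda>i. f i n / f n n) (\<lambda>_. 0) 1) *
      dt (Suc n) (bmat n (\<lambda>i j. f i j - f i n * f n j / f n n) (\<lambda>_. 0) (\<lambda>j. f n j) (f n n)) = dt (Suc n) f"
    unfolding dt_mult
    by (rule dt_cong) (use assms in \<open>auto simp: bmat_def less_Suc_eq sum_mult_delta\<close>)
  then show ?thesis by (simp add: dt_bmat_upper dt_bmat_lower dt_id mult.commute)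
qed

text \<open>Eliminates the first index instead of the last; this is the order in which points are
  removed from a kernel matrix in \<open>dt_DD\<close>.\<close>

lemma dt_Schur_first:
  fixes f :: "nat => nat => 'a :: field"
  assumes "f 0 0 \<noteq> 0"
  shows "dt (Suc n) f = f 0 0 * dt n (\<lambda>i j. f (Suc i) (Suc j) - f (Suc i) 0 * f 0 (Suc j) / f 0 0)"
proof -
  define U where "U = four_block_mat (1\<^sub>m 1) (0\<^sub>m 1 n) (Matrix.mat n 1 (\<lambda>(i, j). f (Suc i) 0 / f 0 0)) (1\<^sub>m n)"
  define L where "L = four_block_mat (Matrix.mat 1 1 (\<lambda>_. f 0 0)) (Matrix.mat 1 n (\<lambda>(i, j). f 0 (Suc j))) (0\<^sub>m n 1)
     (Matrix.mat n n (\<lambda>(i, j). f (Suc i) (Suc j) - f (Suc i) 0 * f 0 (Suc j) / f 0 0))"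
  have "Matrix.mat (Suc n) (Suc n) (\<lambda>(i, j). f i j) = U * L"
  proof (rule eq_matI)
    fix i j assume "i < dim_row (U * L)" "j < dim_col (U * L)"
    then have ij: "i < Suc n" "j < Suc n" by (auto simp: U_def L_def)
    have "(U * L) $$ (i, j) = (\<Sum>k = 0..<Suc n. U $$ (i, k) * L $$ (k, j))"
      using ij by (simp add: U_def L_def scalar_prod_def)
    also have "... = U $$ (i, 0) * L $$ (0, j) + (\<Sum>k = 0..<n. U $$ (i, Suc k) * L $$ (Suc k, j))"
      by (simp add: sum.atLeast0_lessThan_Suc_shift del: sum.op_ivl_Suc)
    also have "... = f i j"
    proof (cases i)
      case 0
      then show ?thesis using ij by (cases j) (auto simp: U_def L_def)
    next
      case (Suc i')
      have "(\<Sum>k = 0..<n. U $$ (i, Suc k) * L $$ (Suc k, j)) = (\<Sum>k = 0..<n. if k = i' then L $$ (Suc k, j) else 0)"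
        using Suc ij by (intro sum.cong) (auto simp: U_def)
      then show ?thesis
        using ij Suc assms by (cases j) (auto simp: U_def L_def)
    qed
    finally show "Matrix.mat (Suc n) (Suc n) (\<lambda>(i, j). f i j) $$ (i, j) = (U * L) $$ (i, j)"
      using ij by simp
  qed (auto simp: U_def L_def)
  moreover have "U \<in> carrier_mat (1 + n) (1 + n)" "L \<in> carrier_mat (1 + n) (1 + n)"
    unfolding U_def L_def by (rule four_block_carrier_mat; simp)+
  moreover have "Determinant.det U = 1"
    unfolding U_def by (subst det_four_block_mat_upper_right_zero[where n=1 and m=n]) auto
  moreover have "Determinant.det L = f 0 0 * dt n (\<lambda>i j. f (Suc i) (Suc j) - f (Suc i) 0 * f 0 (Suc j) / f 0 0)"
    unfolding L_def dt_def
    by (subst det_four_block_mat_lower_left_zero[where n=1 and m=n]) (auto simp: det_single)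
  ultimately show ?thesis unfolding dt_def by (simp add: det_mult[of U "Suc n"])
qed

text \<open>Laplace expansion along the last column: the cofactors do not see the corner, whose own
  cofactor is \<open>dt n A\<close>.\<close>

lemma dt_bmat_corner:
  fixes A :: "nat => nat => 'a :: idom"
  shows "dt (Suc n) (bmat n A c r (s + t)) = dt (Suc n) (bmat n A c r s) + t * dt n A"
proof -
  define M where "M s = Matrix.mat (Suc n) (Suc n) (\<lambda>(i, j). bmat n A c r s i j)" for s
  have M: "M s \<in> carrier_mat (Suc n) (Suc n)" for s by (simp add: M_def)
  have cof: "cofactor (M (s + t)) i n = cofactor (M s) i n" if "i < Suc n" for i
    using that unfolding cofactor_def mat_delete_def M_def
    by (intro arg_cong2[where f="(*)"] refl arg_cong[where f=Determinant.det] eq_matI) (auto simp: bmat_def)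
  have dA: "cofactor (M s) n n = dt n A"
    unfolding cofactor_def mat_delete_def M_def dt_def
    by (subst power_add[symmetric] | simp)+ (intro arg_cong[where f=Determinant.det] eq_matI, auto simp: bmat_def)
  have "dt (Suc n) (bmat n A c r (s + t)) = (\<Sum>i<Suc n. M (s + t) $$ (i, n) * cofactor (M (s + t)) i n)"
    unfolding dt_def M_def[symmetric] by (rule laplace_expansion_column[OF M]) simp
  also have "... = (\<Sum>i<n. M s $$ (i, n) * cofactor (M s) i n) + (s + t) * cofactor (M s) n n"
    by (simp add: cof) (simp add: M_def bmat_def)
  also have "... = (\<Sum>i<Suc n. M s $$ (i, n) * cofactor (M s) i n) + t * dt n A"
    by (simp add: dA ring_distribs) (simp add: M_def bmat_def)
  also have "(\<Sum>i<Suc n. M s $$ (i, n) * cofactor (M s) i n) = dt (Suc n) (bmat n A c r s)"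
    unfolding dt_def M_def[symmetric] by (rule laplace_expansion_column[OF M, symmetric]) simp
  finally show ?thesis .
qed

subsection \<open>Lebesgue measure on finite products of the complex plane\<close>

abbreviation Lb :: "'i set => ('i => complex) measure" where
  "Lb I \<equiv> PiM I (\<lambda>_. lborel)"

interpretation lborel_product: product_sigma_finite "\<lambda>_. lborel :: complex measure"
  by standard

lemma sigma_finite_Lb: "finite I ==> sigma_finite_measure (Lb I)"
  by (rule lborel_product.sigma_finite)

lemma nn_integral_swap:
  assumes "sigma_finite_measure M1" "sigma_finite_measure M2" "(\<lambda>(x, y). f x y) \<in> borel_measurable (M1 \<Otimes>\<^sub>M M2)"
  shows "(\<integral>\<^sup>+x. \<integral>\<^sup>+y. f x y \<partial>M2 \<partial>M1) = (\<integral>\<^sup>+y. \<integral>\<^sup>+x. f x y \<partial>M1 \<partial>M2)"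
  using assms by (intro pair_sigma_finite.Fubini') (auto simp: pair_sigma_finite_def)

lemma nn_integral_Lb_translation:
  fixes f :: "('i => complex) => ennreal"
  assumes "finite I" "f \<in> borel_measurable (Lb I)"
  shows "(\<integral>\<^sup>+x. f x \<partial>Lb I) = (\<integral>\<^sup>+x. f (\<lambda>i\<in>I. x i + h i) \<partial>Lb I)"
  using assms
proof (induction I arbitrary: f rule: finite_induct)
  case empty
  then show ?case
    by (subst (1 2) lborel_product.nn_integral_empty) (auto simp: restrict_def)
next
  case (insert i I)
  note [measurable] = insert.prems
  note fin [simp] = insert.hyps(1)
  have m2: "(\<lambda>x. f (\<lambda>k\<in>insert i I. x k + h k)) \<in> borel_measurable (Lb (insert i I))"
    by measurable
  have m3 [measurable]: "(\<lambda>(t, x). f (x(i := t))) \<in> borel_measurable (lborel \<Otimes>\<^sub>M Lb I)"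
    by measurable
  have m4: "(\<lambda>x. f (x(i := t))) \<in> borel_measurable (Lb I)" for t
    by measurable
  have upd: "(\<lambda>k\<in>insert i I. (x(i := t)) k + h k) = (\<lambda>k\<in>I. x k + h k)(i := h i + t)" for x t
    using insert.hyps by (auto simp: fun_eq_iff)
  have "(\<integral>\<^sup>+x. f (\<lambda>k\<in>insert i I. x k + h k) \<partial>Lb (insert i I))
      = (\<integral>\<^sup>+t. \<integral>\<^sup>+x. f ((\<lambda>k\<in>I. x k + h k)(i := h i + t)) \<partial>Lb I \<partial>lborel)"
    by (subst lborel_product.product_nn_integral_insert_rev[OF fin insert.hyps(2) m2]) (simp only: upd)
  also have "... = (\<integral>\<^sup>+t. \<integral>\<^sup>+x. f (x(i := h i + t)) \<partial>Lb I \<partial>lborel)"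
    by (intro nn_integral_cong insert.IH[OF m4, symmetric])
  also have "... = (\<integral>\<^sup>+t. \<integral>\<^sup>+x. f (x(i := t)) \<partial>Lb I \<partial>lborel)"
  proof (rule nn_integral_lborel_translation[symmetric])
    interpret sigma_finite_measure "Lb I" by (rule sigma_finite_Lb) simp
    show "(\<lambda>t. \<integral>\<^sup>+x. f (x(i := t)) \<partial>Lb I) \<in> borel_measurable borel"
      by measurable
  qed
  also have "... = (\<integral>\<^sup>+x. f x \<partial>Lb (insert i I))"
    by (rule lborel_product.product_nn_integral_insert_rev[OF fin insert.hyps(2) insert.prems, symmetric])
  finally show ?case ..
qed

text \<open>Repairs a vanishing pivot in \<open>nn_integral_Lb_linear\<close>. With the other
  coordinates fixed, it is a translation of the coordinate \<open>j\<close>.\<close>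

lemma nn_integral_Lb_shear:
  fixes f :: "(nat => complex) => ennreal"
  assumes [measurable]: "f \<in> borel_measurable (Lb {..<Suc n})" and j: "j < n"
  shows "(\<integral>\<^sup>+x. f x \<partial>Lb {..<Suc n}) = (\<integral>\<^sup>+x. f (x(j := x j + x n)) \<partial>Lb {..<Suc n})"
proof -
  define J where "J = {..<Suc n} - {j}"
  have I: "{..<Suc n} = insert j J" "finite J" "j \<notin> J" "n \<in> J" using j by (auto simp: J_def)
  have [measurable]: "f \<in> borel_measurable (Lb (insert j J))" using assms(1) I by simp
  have m: "(\<lambda>x. f (x(j := x j + x n))) \<in> borel_measurable (Lb (insert j J))"
  proof -
    have "(\<lambda>x. x(j := x j + x n)) \<in> Lb (insert j J) \<rightarrow>\<^sub>M Lb (insert j J)"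
    proof (rule measurable_fun_upd[where J="insert j J"])
      show "(\<lambda>x. x j + x n) \<in> Lb (insert j J) \<rightarrow>\<^sub>M lborel"
        using I by simp
    qed auto
    then show ?thesis by measurable
  qed
  have "(\<integral>\<^sup>+x. f (x(j := x j + x n)) \<partial>Lb (insert j J)) = (\<integral>\<^sup>+x. \<integral>\<^sup>+t. f (x(j := x n + t)) \<partial>lborel \<partial>Lb J)"
    using I j by (subst lborel_product.product_nn_integral_insert[OF I(2,3) m]) (simp add: add.commute)
  also have "... = (\<integral>\<^sup>+x. \<integral>\<^sup>+t. f (x(j := t)) \<partial>lborel \<partial>Lb J)"
  proof (rule nn_integral_cong)
    fix x assume "x \<in> space (Lb J)"
    then have "(\<lambda>t. f (x(j := t))) \<in> borel_measurable lborel"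
      using I by measurable
    then show "(\<integral>\<^sup>+t. f (x(j := x n + t)) \<partial>lborel) = (\<integral>\<^sup>+t. f (x(j := t)) \<partial>lborel)"
      by (subst nn_integral_lborel_translation[of "\<lambda>t. f (x(j := t))" "x n"]) auto
  qed
  also have "... = (\<integral>\<^sup>+x. f x \<partial>Lb (insert j J))"
    using I by (subst lborel_product.product_nn_integral_insert) auto
  finally show ?thesis unfolding I(1) ..
qed

lemma measurable_affine_Lb [measurable]:
  fixes M :: "nat => nat => complex"
  shows "(\<lambda>x. \<lambda>i\<in>{..<n}. (\<Sum>j<m. M i j * x j) + h i) \<in> Lb {..<m} \<rightarrow>\<^sub>M Lb {..<n}"
proof (rule measurable_restrict)
  have [measurable]: "(\<lambda>x. x j) \<in> borel_measurable (Lb {..<m})" if "j < m" for j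
    using that by simp
  fix i
  have "(\<lambda>x. (\<Sum>j<m. M i j * x j) + h i) \<in> borel_measurable (Lb {..<m})"
    by (intro borel_measurable_add borel_measurable_sum borel_measurable_times) auto
  then show "(\<lambda>x. (\<Sum>j<m. M i j * x j) + h i) \<in> Lb {..<m} \<rightarrow>\<^sub>M lborel" by simp
qed

text \<open>Induction on the dimension. With a nonzero pivot the last output is an affine function
  of the last input, and once it is fixed the other outputs depend on the other inputs through the
  Schur complement; the determinant is the product of the two Jacobians. A zero pivot is made
  nonzero by a shear.\<close>

lemma nn_integral_Lb_linear:
  fixes M :: "nat => nat => complex"
  assumes "dt n M \<noteq> 0" "g \<in> borel_measurable (Lb {..<n})"
  shows "(\<integral>\<^sup>+x. g x \<partial>Lb {..<n})
    = ennreal ((cmod (dt n M))\<^sup>2) * (\<integral>\<^sup>+x. g (\<lambda>i\<in>{..<n}. (\<Sum>j<n. M i j * x j) + h i) \<partial>Lb {..<n})"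
  using assms
proof (induction n arbitrary: M h g)
  case 0
  show ?case
    by (simp add: PiM_empty nn_integral_count_space_finite restrict_def)
next
  case (Suc n)
  note gm [measurable] = Suc.prems(2)
  have I: "{..<Suc n} = insert n {..<n}" "finite {..<n}" "n \<notin> {..<n}" by auto
  have main: "(\<integral>\<^sup>+x. g x \<partial>Lb {..<Suc n})
    = ennreal ((cmod (dt (Suc n) M))\<^sup>2) * (\<integral>\<^sup>+x. g (\<lambda>i\<in>{..<Suc n}. (\<Sum>j<Suc n. M i j * x j) + h i) \<partial>Lb {..<Suc n})"
    if nz: "M n n \<noteq> 0" and dnz: "dt (Suc n) M \<noteq> 0" for M
  proof -
    \<comment> \<open>With \<open>s\<close> the value of the last output, eliminating the last input
      expresses the other outputs as \<open>M'\<close> applied to the other inputs plus an offset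
      \<open>h' s\<close> that depends on \<open>s\<close> alone.\<close>
    define M' where "M' = (\<lambda>i j. M i j - M i n * M n j / M n n)"
    define h' where "h' = (\<lambda>s i. M i n / M n n * (s - h n) + h i)"
    have d: "dt (Suc n) M = M n n * dt n M'" using dt_Schur_last[of M n, OF nz] by (simp add: M'_def)
    have dM': "dt n M' \<noteq> 0" using d dnz by auto
    define T where "T = (\<lambda>s x. (\<lambda>i\<in>{..<n}. (\<Sum>j<n. M' i j * x j) + h' s i)(n := s))"
    have Tm [measurable]: "(\<lambda>(s, x). T s x) \<in> lborel \<Otimes>\<^sub>M Lb {..<n} \<rightarrow>\<^sub>M Lb {..<Suc n}"
    proof -
      have [measurable]: "(\<lambda>x. snd x j) \<in> borel_measurable (lborel \<Otimes>\<^sub>M Lb {..<n})" if "j < n" for j :: nat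
        by (rule measurable_compose[OF measurable_snd]) (use that in simp)
      have "(\<lambda>(s, x). \<lambda>i\<in>{..<n}. (\<Sum>j<n. M' i j * x j) + h' s i) \<in> lborel \<Otimes>\<^sub>M Lb {..<n} \<rightarrow>\<^sub>M Lb {..<n}"
        unfolding case_prod_beta h'_def
      proof (rule measurable_restrict)
        fix i
        have "(\<lambda>x. (\<Sum>j<n. M' i j * snd x j) + (M i n / M n n * (fst x - h n) + h i)) \<in> borel_measurable (lborel \<Otimes>\<^sub>M Lb {..<n})"
          by (intro borel_measurable_add borel_measurable_sum borel_measurable_times) auto
        then show "(\<lambda>x. (\<Sum>j<n. M' i j * snd x j) + (M i n / M n n * (fst x - h n) + h i)) \<in> lborel \<Otimes>\<^sub>M Lb {..<n} \<rightarrow>\<^sub>M lborel"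
          by simp
      qed
      then show ?thesis
        unfolding T_def case_prod_beta I(1)
        by (intro measurable_fun_upd[where J="{..<n}"]) auto
    qed
    have eq: "(\<lambda>i\<in>{..<Suc n}. (\<Sum>j<Suc n. M i j * (x(n := t)) j) + h i)
      = T (M n n * t + ((\<Sum>j<n. M n j * x j) + h n)) x" for x t
    proof
      fix i
      have "(\<Sum>j<Suc n. M i j * (x(n := t)) j) = (\<Sum>j<n. M i j * x j) + M i n * t" by simp
      moreover have "(\<Sum>j<n. M' i j * x j) = (\<Sum>j<n. M i j * x j) - M i n / M n n * (\<Sum>j<n. M n j * x j)"
        by (simp add: M'_def left_diff_distrib sum_subtractf sum_distrib_left mult.assoc)
      then have "(\<Sum>j<n. M' i j * x j) + M i n / M n n * (M n n * t + (\<Sum>j<n. M n j * x j))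
         = (\<Sum>j<n. M i j * x j) + M i n * t"
        using nz by (simp add: ring_distribs)
      ultimately show "(\<lambda>i\<in>{..<Suc n}. (\<Sum>j<Suc n. M i j * (x(n := t)) j) + h i) i
        = T (M n n * t + ((\<Sum>j<n. M n j * x j) + h n)) x i"
        by (auto simp: T_def h'_def less_Suc_eq simp del: sum.lessThan_Suc)
    qed
    have "(\<integral>\<^sup>+x. g (\<lambda>i\<in>{..<Suc n}. (\<Sum>j<Suc n. M i j * x j) + h i) \<partial>Lb {..<Suc n})
      = (\<integral>\<^sup>+x. \<integral>\<^sup>+t. g (T (M n n * t + ((\<Sum>j<n. M n j * x j) + h n)) x) \<partial>lborel \<partial>Lb {..<n})"
      unfolding eq[symmetric]
      by (rule lborel_product.product_nn_integral_insert[OF I(2,3), folded I(1)])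
         (rule measurable_compose[OF measurable_affine_Lb gm])
    also have "ennreal ((cmod (M n n))\<^sup>2) * ...
        = (\<integral>\<^sup>+x. ennreal ((cmod (M n n))\<^sup>2) * (\<integral>\<^sup>+t. g (T (M n n * t + ((\<Sum>j<n. M n j * x j) + h n)) x) \<partial>lborel) \<partial>Lb {..<n})"
    proof (rule nn_integral_cmult[symmetric])
      have [measurable]: "(\<lambda>x. fst x j) \<in> borel_measurable (Lb {..<n} \<Otimes>\<^sub>M lborel)" if "j < n" for j :: nat
        by (rule measurable_compose[OF measurable_fst]) (use that in simp)
      have "(\<lambda>x. M n n * snd x + ((\<Sum>j<n. M n j * fst x j) + h n)) \<in> borel_measurable (Lb {..<n} \<Otimes>\<^sub>M lborel)"
        by (intro borel_measurable_add borel_measurable_sum borel_measurable_times) auto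
      then have "(\<lambda>x. g ((\<lambda>(s, x). T s x) (M n n * snd x + ((\<Sum>j<n. M n j * fst x j) + h n), fst x))) \<in> borel_measurable (Lb {..<n} \<Otimes>\<^sub>M lborel)"
        by measurable
      from lborel.borel_measurable_nn_integral_fst[OF this]
      show "(\<lambda>x. \<integral>\<^sup>+t. g (T (M n n * t + ((\<Sum>j<n. M n j * x j) + h n)) x) \<partial>lborel) \<in> borel_measurable (Lb {..<n})"
        by simp
    qed
    also have "... = (\<integral>\<^sup>+x. \<integral>\<^sup>+s. g (T s x) \<partial>lborel \<partial>Lb {..<n})"
    proof (rule nn_integral_cong)
      fix x assume x: "x \<in> space (Lb {..<n})"
      have "(\<lambda>s. g ((\<lambda>(s, x). T s x) (s, x))) \<in> borel_measurable lborel"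
        using x by measurable
      then show "ennreal ((cmod (M n n))\<^sup>2) * (\<integral>\<^sup>+t. g (T (M n n * t + ((\<Sum>j<n. M n j * x j) + h n)) x) \<partial>lborel) = (\<integral>\<^sup>+s. g (T s x) \<partial>lborel)"
        by (intro nn_integral_lborel_complex_affine[OF _ nz, symmetric]) simp
    qed
    also have "... = (\<integral>\<^sup>+s. \<integral>\<^sup>+x. g (T s x) \<partial>Lb {..<n} \<partial>lborel)"
    proof (rule nn_integral_swap[OF sigma_finite_Lb sigma_finite_lborel])
      have "(\<lambda>p. g ((\<lambda>(s, x). T s x) (snd p, fst p))) \<in> borel_measurable (Lb {..<n} \<Otimes>\<^sub>M lborel)"
        by measurable
      then show "(\<lambda>(x, s). g (T s x)) \<in> borel_measurable (Lb {..<n} \<Otimes>\<^sub>M lborel)"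
        by (simp add: case_prod_beta)
    qed simp
    finally have 1: "ennreal ((cmod (M n n))\<^sup>2) * (\<integral>\<^sup>+x. g (\<lambda>i\<in>{..<Suc n}. (\<Sum>j<Suc n. M i j * x j) + h i) \<partial>Lb {..<Suc n})
       = (\<integral>\<^sup>+s. \<integral>\<^sup>+x. g (T s x) \<partial>Lb {..<n} \<partial>lborel)" .
    have "(\<integral>\<^sup>+x. g x \<partial>Lb {..<Suc n}) = (\<integral>\<^sup>+s. \<integral>\<^sup>+x. g (x(n := s)) \<partial>Lb {..<n} \<partial>lborel)"
      unfolding I(1) by (rule lborel_product.product_nn_integral_insert_rev[OF I(2,3)]) (use gm I in simp)
    also have "... = (\<integral>\<^sup>+s. ennreal ((cmod (dt n M'))\<^sup>2) * (\<integral>\<^sup>+x. g (T s x) \<partial>Lb {..<n}) \<partial>lborel)"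
    proof (rule nn_integral_cong)
      fix s :: complex
      have "(\<lambda>x. x(n := s)) \<in> Lb {..<n} \<rightarrow>\<^sub>M Lb {..<Suc n}"
        unfolding I(1) by (rule measurable_fun_upd[where J="{..<n}"]) auto
      then have "(\<lambda>x. g (x(n := s))) \<in> borel_measurable (Lb {..<n})" by measurable
      from Suc.IH[OF dM' this, of "h' s"]
      show "(\<integral>\<^sup>+x. g (x(n := s)) \<partial>Lb {..<n}) = ennreal ((cmod (dt n M'))\<^sup>2) * (\<integral>\<^sup>+x. g (T s x) \<partial>Lb {..<n})"
        unfolding T_def .
    qed
    also have "... = ennreal ((cmod (dt n M'))\<^sup>2) * (\<integral>\<^sup>+s. \<integral>\<^sup>+x. g (T s x) \<partial>Lb {..<n} \<partial>lborel)"
    proof (rule nn_integral_cmult)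
      interpret sigma_finite_measure "Lb {..<n}" by (rule sigma_finite_Lb) simp
      have "(\<lambda>p. g ((\<lambda>(s, x). T s x) p)) \<in> borel_measurable (lborel \<Otimes>\<^sub>M Lb {..<n})"
        by measurable
      from borel_measurable_nn_integral_fst[OF this]
      show "(\<lambda>s. \<integral>\<^sup>+x. g (T s x) \<partial>Lb {..<n}) \<in> borel_measurable lborel" by simp
    qed
    finally show ?thesis
      unfolding 1[symmetric] d by (simp add: norm_mult power_mult_distrib ennreal_mult' mult_ac)
  qed
  show ?case
  proof (cases "M n n = 0")
    case False
    then show ?thesis using main Suc.prems by blast
  next
    case True
    obtain j where "j < Suc n" "M n j \<noteq> 0"
      using dt_row_zero[of n "Suc n" M] Suc.prems(1) by auto
    with True have j: "j < n" "M n j \<noteq> 0" by (auto simp: less_Suc_eq)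
    \<comment> \<open>The shear adds column \<open>j\<close> to the last column. A nonzero entry
      \<open>M n j\<close> exists because a zero last row would make the determinant vanish.\<close>
    define M' where "M' = (\<lambda>i k. if k = n then M i n + M i j else M i k)"
    have "dt (Suc n) (bmat n M (\<lambda>i. (\<Sum>k<n. M i k * (if k = j then 1 else 0)) + M i n * 1) (\<lambda>k. M n k)
        ((\<Sum>k<n. M n k * (if k = j then 1 else 0)) + M n n * 1)) = dt (Suc n) (bmat n M (\<lambda>i. M i n) (\<lambda>k. M n k) (M n n)) * 1"
      by (rule dt_bmat_column)
    moreover have "dt (Suc n) M' = dt (Suc n) (bmat n M (\<lambda>i. M i j + M i n) (\<lambda>k. M n k) (M n j + M n n))"
      by (rule dt_cong) (auto simp: M'_def bmat_def less_Suc_eq)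
    ultimately have d: "dt (Suc n) M' = dt (Suc n) M"
      using j dt_Suc_bmat[of n M] by (simp add: sum_mult_delta)
    have M'nz: "M' n n \<noteq> 0" using True j by (simp add: M'_def)
    have eq: "(\<Sum>k<Suc n. M i k * (x(j := x j + x n)) k) = (\<Sum>k<Suc n. M' i k * x k)" for i x
    proof -
      have "(\<Sum>k<Suc n. M i k * (x(j := x j + x n)) k) = (\<Sum>k<n. M i k * x k + (if k = j then M i j * x n else 0)) + M i n * x n"
        using j by (auto intro!: sum.cong simp: ring_distribs)
      also have "... = (\<Sum>k<n. M i k * x k) + M i j * x n + M i n * x n"
        using j by (simp add: sum.distrib)
      also have "... = (\<Sum>k<Suc n. M' i k * x k)" by (simp add: M'_def ring_distribs)
      finally show ?thesis .
    qed
    have "(\<integral>\<^sup>+x. g (\<lambda>i\<in>{..<Suc n}. (\<Sum>j<Suc n. M i j * x j) + h i) \<partial>Lb {..<Suc n})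
      = (\<integral>\<^sup>+x. g (\<lambda>i\<in>{..<Suc n}. (\<Sum>j<Suc n. M' i j * x j) + h i) \<partial>Lb {..<Suc n})"
      unfolding eq[symmetric]
      by (rule nn_integral_Lb_shear[OF _ j(1)]) (rule measurable_compose[OF measurable_affine_Lb gm])
    moreover have "dt (Suc n) M' \<noteq> 0" using d Suc.prems(1) by simp
    ultimately show ?thesis using main[of M', OF M'nz] unfolding d by metis
  qed
qed

subsection \<open>Matrix pencils\<close>

definition IX :: "nat => (bool \<times> nat \<times> nat) set" where
  "IX n = UNIV \<times> {..<n} \<times> {..<n}"

lemma finite_IX [simp]: "finite (IX n)" by (simp add: IX_def)

lemma mem_IX [simp]: "(b, i, j) \<in> IX n \<longleftrightarrow> i < n \<and> j < n" by (simp add: IX_def)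

lemma prod_IX: "(\<Prod>e\<in>IX n. g e) = (\<Prod>i<n. \<Prod>j<n. g (True, i, j)) * (\<Prod>i<n. \<Prod>j<n. g (False, i, j))"
proof -
  have "(\<Prod>e\<in>IX n. g e) = (\<Prod>b\<in>UNIV. \<Prod>e\<in>{..<n} \<times> {..<n}. g (b, e))"
    unfolding IX_def by (subst prod.cartesian_product) (auto intro!: prod.cong)
  also have "... = (\<Prod>b\<in>UNIV. \<Prod>i<n. \<Prod>j<n. g (b, i, j))"
    by (subst prod.cartesian_product) (auto intro!: prod.cong)
  finally show ?thesis by (simp add: UNIV_bool mult.commute)
qed

lemma has_field_derivative_pencil:
  fixes a b :: "nat => nat => complex"
  shows "((\<lambda>z. dt n (\<lambda>i j. z * a i j - b i j)) has_field_derivative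
    (\<Sum>p | p permutes {0..<n}. signof p *
      (\<Sum>i = 0..<n. a i (p i) * (\<Prod>j\<in>{0..<n} - {i}. z * a j (p j) - b j (p j))))) (at z)"
  unfolding dt_leibniz
  by (intro DERIV_sum DERIV_cmult has_field_derivative_prod) (auto intro!: derivative_eq_intros)

lemma isCont_pencil: "isCont (\<lambda>z. dt n (\<lambda>i j. z * a i j - b i j)) (z :: complex)"
  using has_field_derivative_pencil by (rule DERIV_isCont)

lemma coeff_prod_linear:
  fixes a b :: "'i => 'a :: comm_ring_1"
  assumes "finite S"
  shows "degree (\<Prod>i\<in>S. [:b i, a i:]) \<le> card S" "coeff (\<Prod>i\<in>S. [:b i, a i:]) (card S) = (\<Prod>i\<in>S. a i)"
proof -
  have "degree (\<Prod>i\<in>S. [:b i, a i:]) \<le> card S \<and> coeff (\<Prod>i\<in>S. [:b i, a i:]) (card S) = (\<Prod>i\<in>S. a i)"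
    using assms
  proof (induction S rule: finite_induct)
    case (insert i S)
    define p where "p = (\<Prod>i\<in>S. [:b i, a i:])"
    have p: "degree p \<le> card S" "coeff p (card S) = (\<Prod>i\<in>S. a i)" using insert.IH by (auto simp: p_def)
    have "degree ([:b i, a i:] * p) \<le> degree [:b i, a i:] + degree p" by (rule degree_mult_le)
    also have "degree [:b i, a i:] \<le> 1" by simp
    finally have "degree ([:b i, a i:] * p) \<le> Suc (card S)" using p(1) by simp
    moreover have "coeff ([:b i, a i:] * p) (Suc (card S)) = a i * (\<Prod>i\<in>S. a i)"
      using p coeff_eq_0[of p "Suc (card S)"] by (simp add: mult_pCons_left)
    ultimately show ?case using insert.hyps by (simp add: p_def)
  qed simp
  then show "degree (\<Prod>i\<in>S. [:b i, a i:]) \<le> card S" "coeff (\<Prod>i\<in>S. [:b i, a i:]) (card S) = (\<Prod>i\<in>S. a i)"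
    by auto
qed

text \<open>The pencil determinant as a genuine polynomial in the spectral parameter, so that degree
  and number of roots become available; its top coefficient is \<open>dt n a\<close>.\<close>

definition pencil_poly :: "nat => (nat => nat => complex) => (nat => nat => complex) => complex poly" where
  "pencil_poly n a b = (\<Sum>p | p permutes {0..<n}. Polynomial.smult (signof p) (\<Prod>i = 0..<n. [:- b i (p i), a i (p i):]))"

lemma poly_pencil_poly: "poly (pencil_poly n a b) z = dt n (\<lambda>i j. z * a i j - b i j)"
  unfolding pencil_poly_def dt_leibniz
  by (simp add: poly_sum poly_prod algebra_simps)

lemma degree_pencil_poly_le: "degree (pencil_poly n a b) \<le> n"
  unfolding pencil_poly_def
proof (intro degree_sum_le)
  fix p
  have "degree (Polynomial.smult (signof p) (\<Prod>i = 0..<n. [:- b i (p i), a i (p i):]))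
      \<le> degree (\<Prod>i = 0..<n. [:- b i (p i), a i (p i):])"
    by (rule degree_smult_le)
  also have "... \<le> n" using coeff_prod_linear(1)[of "{0..<n}"] by simp
  finally show "degree (Polynomial.smult (signof p) (\<Prod>i = 0..<n. [:- b i (p i), a i (p i):])) \<le> n" .
qed (simp add: finite_permutations)

lemma coeff_pencil_poly: "coeff (pencil_poly n a b) n = dt n a"
proof -
  have "coeff (\<Prod>i = 0..<n. [:- b i (p i), a i (p i):]) n = (\<Prod>i = 0..<n. a i (p i))" for p
    using coeff_prod_linear(2)[of "{0..<n}"] by simp
  then show ?thesis unfolding pencil_poly_def dt_leibniz coeff_sum by simp
qed

lemma degree_pencil_poly: "dt n a \<noteq> 0 ==> degree (pencil_poly n a b) = n"
  using degree_pencil_poly_le[of n a b] coeff_pencil_poly[of n a b] le_degree[of "pencil_poly n a b" n]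
  by (metis antisym)

lemma pencil_poly_nonzero: "dt n a \<noteq> 0 ==> pencil_poly n a b \<noteq> 0"
  using coeff_pencil_poly[of n a b] by auto

section \<open>Regrouping the entries of a pencil around its leading block\<close>

definition IM :: "nat => ((bool \<times> nat \<times> nat => complex) \<times> (nat => complex) \<times> (nat => complex)) measure" where
  "IM n = Lb (IX n) \<Otimes>\<^sub>M (Lb {..<n} \<Otimes>\<^sub>M Lb {..<n})"

definition CM :: "nat => (complex \<times> (nat => complex)) measure" where
  "CM n = lborel \<Otimes>\<^sub>M Lb {..<n}"

lemma sigma_finite_pair: "sigma_finite_measure M ==> sigma_finite_measure N ==> sigma_finite_measure (M \<Otimes>\<^sub>M N)"
  by (rule sigma_finite_pair_measure)

lemma sigma_finite_IM: "sigma_finite_measure (IM n)"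
  unfolding IM_def by (intro sigma_finite_pair sigma_finite_Lb) simp_all

lemma sigma_finite_CM: "sigma_finite_measure (CM n)"
  unfolding CM_def by (intro sigma_finite_pair sigma_finite_Lb sigma_finite_lborel) simp_all

text \<open>A pencil of size \<open>n + 1\<close> is assembled from its leading block of size \<open>n\<close> together with the last rows,
  from the last column of \<open>A\<close> (corner first), and from the last column of \<open>B\<close> (corner first).\<close>

definition bjoin ::
  "nat => (bool \<times> nat \<times> nat => complex) \<times> (nat => complex) \<times> (nat => complex) =>
    complex \<times> (nat => complex) => complex \<times> (nat => complex) => bool \<times> nat \<times> nat => complex" where
  "bjoin n y p q = restrict (\<lambda>(b, i, j).
     bmat n (\<lambda>i j. fst y (b, i, j)) (if b then snd p else snd q)
       (if b then fst (snd y) else snd (snd y)) (if b then fst p else fst q) i j) (IX (Suc n))"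

lemma borel_measurable_component:
  "F \<in> M \<rightarrow>\<^sub>M Lb I ==> i \<in> I ==> (\<lambda>p. F p i) \<in> borel_measurable M"
  by (drule measurable_compose[OF _ measurable_component_singleton[of i I "\<lambda>_. lborel"]]) simp_all

lemma measurable_into_Lb:
  "(\<And>i. i \<in> I ==> (\<lambda>p. F p i) \<in> borel_measurable M) ==> (\<lambda>p. \<lambda>i\<in>I. F p i) \<in> M \<rightarrow>\<^sub>M Lb I"
  by (rule measurable_restrict) simp

lemma measurable_join:
  assumes Y: "Y \<in> M \<rightarrow>\<^sub>M IM n" and P: "P \<in> M \<rightarrow>\<^sub>M CM n" and Q: "Q \<in> M \<rightarrow>\<^sub>M CM n"
  shows "(\<lambda>x. bjoin n (Y x) (P x) (Q x)) \<in> M \<rightarrow>\<^sub>M Lb (IX (Suc n))"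
proof -
  note [measurable] = Y[unfolded IM_def] P[unfolded CM_def] Q[unfolded CM_def]
  have Y1: "(\<lambda>x. fst (Y x)) \<in> M \<rightarrow>\<^sub>M Lb (IX n)" and Y2: "(\<lambda>x. fst (snd (Y x))) \<in> M \<rightarrow>\<^sub>M Lb {..<n}"
    and Y3: "(\<lambda>x. snd (snd (Y x))) \<in> M \<rightarrow>\<^sub>M Lb {..<n}"
    and P2: "(\<lambda>x. snd (P x)) \<in> M \<rightarrow>\<^sub>M Lb {..<n}" and Q2: "(\<lambda>x. snd (Q x)) \<in> M \<rightarrow>\<^sub>M Lb {..<n}"
    by measurable
  have P1: "(\<lambda>x. fst (P x)) \<in> borel_measurable M" and Q1: "(\<lambda>x. fst (Q x)) \<in> borel_measurable M"
    using measurable_compose[OF P[unfolded CM_def] measurable_fst] measurable_compose[OF Q[unfolded CM_def] measurable_fst]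
    by simp_all
  show ?thesis
    unfolding bjoin_def
  proof (rule measurable_into_Lb)
    fix e assume "e \<in> IX (Suc n)"
    then obtain b i j where e: "e = (b, i, j)" "i < Suc n" "j < Suc n" by (cases e) auto
    show "(\<lambda>x. case e of (b, i, j) => bmat n (\<lambda>i j. fst (Y x) (b, i, j)) (if b then snd (P x) else snd (Q x))
       (if b then fst (snd (Y x)) else snd (snd (Y x))) (if b then fst (P x) else fst (Q x)) i j) \<in> borel_measurable M"
      unfolding e prod.case bmat_def
      by (cases b; cases "i < n"; cases "j < n")
         (simp_all add: borel_measurable_component[OF Y1] borel_measurable_component[OF Y2]
            borel_measurable_component[OF Y3] borel_measurable_component[OF P2]
            borel_measurable_component[OF Q2] P1 Q1)
  qed
qed

text \<open>Joining merely relabels coordinates: boxes pull back to products of boxes of the same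
  measure, and boxes determine the product measure.\<close>

lemma distr_join:
  "distr ((IM n \<Otimes>\<^sub>M CM n) \<Otimes>\<^sub>M CM n) (Lb (IX (Suc n))) (\<lambda>x. bjoin n (fst (fst x)) (snd (fst x)) (snd x)) = Lb (IX (Suc n))"
  (is "distr ?M _ ?J = _")
proof (rule lborel_product.PiM_eqI)
  fix A :: "bool \<times> nat \<times> nat => complex set"
  assume A: "\<And>i. i \<in> IX (Suc n) ==> A i \<in> sets lborel"
  have A' [measurable]: "A (b, i, j) \<in> sets borel" if "i < Suc n" "j < Suc n" for b i j using A[of "(b, i, j)"] that by simp
  have J: "?J \<in> ?M \<rightarrow>\<^sub>M Lb (IX (Suc n))" by (intro measurable_join) auto
  define R1 where "R1 = (\<Pi>\<^sub>E e\<in>IX n. A e) \<times> ((\<Pi>\<^sub>E j\<in>{..<n}. A (True, n, j)) \<times> (\<Pi>\<^sub>E j\<in>{..<n}. A (False, n, j)))"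
  define R2 where "R2 = A (True, n, n) \<times> (\<Pi>\<^sub>E i\<in>{..<n}. A (True, i, n))"
  define R3 where "R3 = A (False, n, n) \<times> (\<Pi>\<^sub>E i\<in>{..<n}. A (False, i, n))"
  have S: "(\<Pi>\<^sub>E e\<in>IX n. A e) \<in> sets (Lb (IX n))" "(\<Pi>\<^sub>E j\<in>{..<n}. A (b, n, j)) \<in> sets (Lb {..<n})"
    "(\<Pi>\<^sub>E i\<in>{..<n}. A (b, i, n)) \<in> sets (Lb {..<n})" "A (b, n, n) \<in> sets lborel" for b
    by (auto intro!: sets_PiM_I_finite A)
  have E: "emeasure (Lb (IX n)) (\<Pi>\<^sub>E e\<in>IX n. A e) = (\<Prod>e\<in>IX n. emeasure lborel (A e))"
    "emeasure (Lb {..<n}) (\<Pi>\<^sub>E j\<in>{..<n}. A (b, n, j)) = (\<Prod>j<n. emeasure lborel (A (b, n, j)))"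
    "emeasure (Lb {..<n}) (\<Pi>\<^sub>E i\<in>{..<n}. A (b, i, n)) = (\<Prod>i<n. emeasure lborel (A (b, i, n)))" for b
    by (rule lborel_product.emeasure_PiM; auto intro!: A)+
  have R: "R1 \<in> sets (IM n)" "R2 \<in> sets (CM n)" "R3 \<in> sets (CM n)"
    unfolding R1_def R2_def R3_def IM_def CM_def using S by auto
  have pre: "?J -` (Pi\<^sub>E (IX (Suc n)) A) \<inter> space ?M = (R1 \<times> R2) \<times> R3"
  proof (rule subset_antisym; rule subsetI)
    fix x assume x: "x \<in> ?J -` (Pi\<^sub>E (IX (Suc n)) A) \<inter> space ?M"
    obtain X ra rb sa ca sb cb where xe: "x = (((X, (ra, rb)), (sa, ca)), (sb, cb))" by (metis prod.exhaust)
    have sp: "X \<in> extensional (IX n)" "ra \<in> extensional {..<n}" "rb \<in> extensional {..<n}" "ca \<in> extensional {..<n}" "cb \<in> extensional {..<n}"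
      using x unfolding xe by (auto simp: space_pair_measure IM_def CM_def space_PiM PiE_iff)
    have mem: "bjoin n (X, (ra, rb)) (sa, ca) (sb, cb) (b, i, j) \<in> A (b, i, j)" if "i < Suc n" "j < Suc n" for b i j
      using x that unfolding xe by (auto simp: PiE_iff)
    have "X (b, i, j) \<in> A (b, i, j)" if "i < n" "j < n" for b i j
      using mem[of i j b] that by (simp add: bjoin_def bmat_def)
    then have m1: "\<forall>e\<in>IX n. X e \<in> A e"
      by (auto simp: IX_def)
    have "(if b then ca else cb) i \<in> A (b, i, n)" if "i < n" for b i
      using mem[of i n b] that by (auto simp add: bjoin_def bmat_def split: if_splits)
    from this[of _ True] this[of _ False] have m2: "\<forall>i\<in>{..<n}. ca i \<in> A (True, i, n)" "\<forall>i\<in>{..<n}. cb i \<in> A (False, i, n)"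
      by simp_all
    have "(if b then ra else rb) j \<in> A (b, n, j)" if "j < n" for b j
      using mem[of n j b] that by (auto simp add: bjoin_def bmat_def split: if_splits)
    from this[of _ True] this[of _ False] have m3: "\<forall>i\<in>{..<n}. ra i \<in> A (True, n, i)" "\<forall>i\<in>{..<n}. rb i \<in> A (False, n, i)"
      by simp_all
    have "(if b then sa else sb) \<in> A (b, n, n)" for b
      using mem[of n n b] by (auto simp add: bjoin_def bmat_def split: if_splits)
    from this[of True] this[of False] have m4: "sa \<in> A (True, n, n)" "sb \<in> A (False, n, n)"
      by simp_all
    show "x \<in> (R1 \<times> R2) \<times> R3"
      unfolding xe R1_def R2_def R3_def mem_Times_iff fst_conv snd_conv PiE_iff
      by (intro conjI m1 m2 m3 m4 sp)
  next
    fix x assume x: "x \<in> (R1 \<times> R2) \<times> R3"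
    have "x \<in> space ?M" using R[THEN sets.sets_into_space] x by (auto simp: space_pair_measure)
    moreover have "?J x \<in> Pi\<^sub>E (IX (Suc n)) A"
      unfolding bjoin_def PiE_restrict
      using x by (auto simp: R1_def R2_def R3_def bmat_def PiE_iff less_Suc_eq)
    ultimately show "x \<in> ?J -` (Pi\<^sub>E (IX (Suc n)) A) \<inter> space ?M" by simp
  qed
  have "emeasure (distr ?M (Lb (IX (Suc n))) ?J) (Pi\<^sub>E (IX (Suc n)) A) = emeasure ?M ((R1 \<times> R2) \<times> R3)"
    by (subst emeasure_distr[OF J]) (auto intro!: sets_PiM_I_finite A simp: pre)
  also have "... = emeasure (IM n) R1 * emeasure (CM n) R2 * emeasure (CM n) R3"
    using R by (simp add: sigma_finite_measure.emeasure_pair_measure_Times[OF sigma_finite_CM])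
  also have "emeasure (IM n) R1 = (\<Prod>e\<in>IX n. emeasure lborel (A e)) * ((\<Prod>j<n. emeasure lborel (A (True, n, j))) * (\<Prod>j<n. emeasure lborel (A (False, n, j))))"
    unfolding IM_def R1_def using S
    by (simp add: sigma_finite_measure.emeasure_pair_measure_Times sigma_finite_pair sigma_finite_Lb E)
  also have "emeasure (CM n) R2 = emeasure lborel (A (True, n, n)) * (\<Prod>i<n. emeasure lborel (A (True, i, n)))"
    unfolding CM_def R2_def using S
    by (simp add: sigma_finite_measure.emeasure_pair_measure_Times sigma_finite_Lb E)
  also have "emeasure (CM n) R3 = emeasure lborel (A (False, n, n)) * (\<Prod>i<n. emeasure lborel (A (False, i, n)))"
    unfolding CM_def R3_def using S
    by (simp add: sigma_finite_measure.emeasure_pair_measure_Times sigma_finite_Lb E)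
  finally show "emeasure (distr ?M (Lb (IX (Suc n))) ?J) (Pi\<^sub>E (IX (Suc n)) A) = (\<Prod>e\<in>IX (Suc n). emeasure lborel (A e))"
    unfolding prod_IX by (simp add: prod.distrib mult_ac)
qed simp_all

lemma measurable_join_id: "(\<lambda>x. bjoin n (fst (fst x)) (snd (fst x)) (snd x)) \<in> (IM n \<Otimes>\<^sub>M CM n) \<Otimes>\<^sub>M CM n \<rightarrow>\<^sub>M Lb (IX (Suc n))"
  by (intro measurable_join) auto

lemma nn_integral_join:
  assumes f: "f \<in> borel_measurable (Lb (IX (Suc n)))"
  shows "(\<integral>\<^sup>+X. f X \<partial>Lb (IX (Suc n))) = (\<integral>\<^sup>+w. \<integral>\<^sup>+q. f (bjoin n (fst w) (snd w) q) \<partial>CM n \<partial>(IM n \<Otimes>\<^sub>M CM n))"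
proof -
  have "(\<integral>\<^sup>+X. f X \<partial>Lb (IX (Suc n))) =
      (\<integral>\<^sup>+x. f (bjoin n (fst (fst x)) (snd (fst x)) (snd x)) \<partial>((IM n \<Otimes>\<^sub>M CM n) \<Otimes>\<^sub>M CM n))"
    by (subst distr_join[symmetric], subst nn_integral_distr[OF measurable_join_id]) (use f in auto)
  also have "... = (\<integral>\<^sup>+w. \<integral>\<^sup>+q. f (bjoin n (fst w) (snd w) q) \<partial>CM n \<partial>(IM n \<Otimes>\<^sub>M CM n))"
    using measurable_compose[OF measurable_join_id f]
    by (subst sigma_finite_measure.nn_integral_fst[OF sigma_finite_CM, symmetric]) auto
  finally show ?thesis .
qed

lemma AE_join:
  assumes "AE X in Lb (IX (Suc n)). P X"
  shows "AE w in IM n \<Otimes>\<^sub>M CM n. AE q in CM n. P (bjoin n (fst w) (snd w) q)"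
proof -
  have "AE X in distr ((IM n \<Otimes>\<^sub>M CM n) \<Otimes>\<^sub>M CM n) (Lb (IX (Suc n))) (\<lambda>x. bjoin n (fst (fst x)) (snd (fst x)) (snd x)). P X"
    unfolding distr_join by (rule assms)
  from AE_distrD[OF measurable_join_id this]
  have ae: "AE x in (IM n \<Otimes>\<^sub>M CM n) \<Otimes>\<^sub>M CM n. P (bjoin n (fst (fst x)) (snd (fst x)) (snd x))" .
  interpret pair_sigma_finite "IM n \<Otimes>\<^sub>M CM n" "CM n"
    by (intro pair_sigma_finite.intro sigma_finite_pair sigma_finite_IM sigma_finite_CM)
  show ?thesis using AE_pair[OF ae] by simp
qed

lemma IM_coords:
  assumes "Y \<in> M \<rightarrow>\<^sub>M IM n"
  shows "(\<lambda>x. fst (Y x)) \<in> M \<rightarrow>\<^sub>M Lb (IX n)" "(\<lambda>x. fst (snd (Y x))) \<in> M \<rightarrow>\<^sub>M Lb {..<n}"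
    "(\<lambda>x. snd (snd (Y x))) \<in> M \<rightarrow>\<^sub>M Lb {..<n}"
    "i < n ==> j < n ==> (\<lambda>x. fst (Y x) (b, i, j)) \<in> borel_measurable M"
    "j < n ==> (\<lambda>x. fst (snd (Y x)) j) \<in> borel_measurable M"
    "j < n ==> (\<lambda>x. snd (snd (Y x)) j) \<in> borel_measurable M"
proof -
  note [measurable] = assms[unfolded IM_def]
  show 1: "(\<lambda>x. fst (Y x)) \<in> M \<rightarrow>\<^sub>M Lb (IX n)" "(\<lambda>x. fst (snd (Y x))) \<in> M \<rightarrow>\<^sub>M Lb {..<n}"
    "(\<lambda>x. snd (snd (Y x))) \<in> M \<rightarrow>\<^sub>M Lb {..<n}"
    by measurable
  show "i < n ==> j < n ==> (\<lambda>x. fst (Y x) (b, i, j)) \<in> borel_measurable M"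
    "j < n ==> (\<lambda>x. fst (snd (Y x)) j) \<in> borel_measurable M"
    "j < n ==> (\<lambda>x. snd (snd (Y x)) j) \<in> borel_measurable M"
    using 1[THEN borel_measurable_component] by auto
qed

lemma CM_coords:
  assumes "P \<in> M \<rightarrow>\<^sub>M CM n"
  shows "(\<lambda>x. fst (P x)) \<in> borel_measurable M" "(\<lambda>x. snd (P x)) \<in> M \<rightarrow>\<^sub>M Lb {..<n}"
    "j < n ==> (\<lambda>x. snd (P x) j) \<in> borel_measurable M"
proof -
  show "(\<lambda>x. fst (P x)) \<in> borel_measurable M"
    using measurable_compose[OF assms[unfolded CM_def] measurable_fst] by simp
  show 1: "(\<lambda>x. snd (P x)) \<in> M \<rightarrow>\<^sub>M Lb {..<n}"
    using measurable_compose[OF assms[unfolded CM_def] measurable_snd] by simp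
  show "j < n ==> (\<lambda>x. snd (P x) j) \<in> borel_measurable M"
    using borel_measurable_component[OF 1] by auto
qed

lemma measurable_into_CM:
  assumes "f \<in> borel_measurable M" "\<And>i. i < n ==> (\<lambda>x. g x i) \<in> borel_measurable M"
  shows "(\<lambda>x. (f x, \<lambda>i\<in>{..<n}. g x i)) \<in> M \<rightarrow>\<^sub>M CM n"
  unfolding CM_def using assms by (intro measurable_Pair measurable_into_Lb) auto

section \<open>Counting the eigenvalues of a pencil through its last column\<close>

definition pencil_deriv :: "nat => (nat => nat => complex) => (nat => nat => complex) => complex => complex" where
  "pencil_deriv n a b z = (\<Sum>p | p permutes {0..<n}. signof p *
      (\<Sum>i = 0..<n. a i (p i) * (\<Prod>j\<in>{0..<n} - {i}. (z * a j (p j) - b j (p j)))))"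

lemma DERIV_pencil:
  "((\<lambda>z. dt n (\<lambda>i j. z * a i j - b i j)) has_field_derivative pencil_deriv n a b z) (at z)"
  unfolding pencil_deriv_def by (rule has_field_derivative_pencil)

text \<open>The derivative is written out as a Leibniz sum so that it is measurable in the entries
  and in the point at the same time.\<close>

lemma borel_measurable_pencil_deriv:
  assumes "\<And>i j. i < n ==> j < n ==> (\<lambda>x. a x i j) \<in> borel_measurable M"
    and "\<And>i j. i < n ==> j < n ==> (\<lambda>x. b x i j) \<in> borel_measurable M"
    and "z \<in> borel_measurable M"
  shows "(\<lambda>x. pencil_deriv n (a x) (b x) (z x)) \<in> borel_measurable M"
  unfolding pencil_deriv_def
proof (intro borel_measurable_sum borel_measurable_times borel_measurable_const borel_measurable_prod
    borel_measurable_diff assms)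
qed (auto dest: permutes_in_image)

lemma bmat_pencil:
  "bmat n (\<lambda>i j. z * A i j - B i j) (\<lambda>i. z * c i - c' i) (\<lambda>j. z * r j - r' j) (z * s - s') =
    (\<lambda>i j. z * bmat n A c r s i j - (bmat n B c' r' s' i j :: complex))"
  by (auto simp: bmat_def fun_eq_iff)

text \<open>The complex Jacobian determinant of \<open>kr\<close> in the variables (z, v) =
  \<open>l\<close>: the first \<open>n\<close> columns are the derivatives in v, the last column is
  the derivative in z.\<close>

definition kq :: "nat => (bool \<times> nat \<times> nat => complex) \<times> (nat => complex) \<times> (nat => complex) =>
    complex \<times> (nat => complex) => complex \<times> (nat => complex) => complex" where
  "kq n y p l = dt (Suc n) (bmat n (\<lambda>i j. fst l * fst y (True, i, j) - fst y (False, i, j))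
     (\<lambda>i. (\<Sum>j<n. fst y (True, i, j) * snd l j) + snd p i)
     (\<lambda>j. fst l * fst (snd y) j - snd (snd y) j)
     ((\<Sum>j<n. fst (snd y) j * snd l j) + fst p))"

text \<open>The last column of B, corner first, for which z = \<open>fst l\<close> is an eigenvalue
  of the pencil with eigenvector (v, 1), v = \<open>snd l\<close>: the equation (z A - B)(v, 1) = 0
  solved for that column.\<close>

definition kr :: "nat => (bool \<times> nat \<times> nat => complex) \<times> (nat => complex) \<times> (nat => complex) =>
    complex \<times> (nat => complex) => complex \<times> (nat => complex) => complex \<times> (nat => complex)" where
  "kr n y p l = ((\<Sum>j<n. (fst l * fst (snd y) j - snd (snd y) j) * snd l j) + fst l * fst p,
     \<lambda>i\<in>{..<n}. (\<Sum>j<n. (fst l * fst y (True, i, j) - fst y (False, i, j)) * snd l j) + fst l * snd p i)"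

lemma measurable_kr:
  assumes Y: "Y \<in> M \<rightarrow>\<^sub>M IM n" and P: "P \<in> M \<rightarrow>\<^sub>M CM n" and L: "L \<in> M \<rightarrow>\<^sub>M CM n"
  shows "(\<lambda>x. kr n (Y x) (P x) (L x)) \<in> M \<rightarrow>\<^sub>M CM n"
  unfolding kr_def
  by (intro measurable_into_CM borel_measurable_add borel_measurable_sum borel_measurable_times borel_measurable_diff
     IM_coords[OF Y] CM_coords[OF P] CM_coords[OF L]) auto

lemma borel_measurable_kq:
  assumes Y: "Y \<in> M \<rightarrow>\<^sub>M IM n" and P: "P \<in> M \<rightarrow>\<^sub>M CM n" and L: "L \<in> M \<rightarrow>\<^sub>M CM n"
  shows "(\<lambda>x. kq n (Y x) (P x) (L x)) \<in> borel_measurable M"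
  unfolding kq_def
proof (rule borel_measurable_dt)
  fix i j
  show "(\<lambda>x. bmat n (\<lambda>i j. fst (L x) * fst (Y x) (True, i, j) - fst (Y x) (False, i, j))
     (\<lambda>i. (\<Sum>j<n. fst (Y x) (True, i, j) * snd (L x) j) + snd (P x) i)
     (\<lambda>j. fst (L x) * fst (snd (Y x)) j - snd (snd (Y x)) j)
     ((\<Sum>j<n. fst (snd (Y x)) j * snd (L x) j) + fst (P x)) i j) \<in> borel_measurable M"
    unfolding bmat_def
    by (cases "i < n"; cases "j < n"; simp only: if_True if_False)
       (intro borel_measurable_add borel_measurable_sum borel_measurable_times borel_measurable_diff
     IM_coords[OF Y] CM_coords[OF P] CM_coords[OF L]; auto)+
qed

text \<open>Almost every last column of B has \<open>Suc n\<close> eigenvalues, hence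
  \<open>Suc n\<close> preimages under \<open>kr\<close>. The count is reduced to one complex
  variable: for a fixed column \<open>cb\<close> the characteristic equation reads s = E(z, cb) /
  D(z) for the corner s, a rational function of degree \<open>Suc n\<close> whose fibres are counted
  by \<open>nn_integral_rational_fibres\<close>. For a fixed z the column is then replaced by the
  eigenvector, a linear substitution with determinant D(z).\<close>

lemma kac_rice:
  fixes X :: "bool \<times> nat \<times> nat => complex" and ra rb ca :: "nat => complex" and sa :: complex
  defines "A \<equiv> \<lambda>i j. X (True, i, j)" and "B \<equiv> \<lambda>i j. X (False, i, j)"
  assumes dA: "dt n A \<noteq> 0" and dA1: "dt (Suc n) (bmat n A ca ra sa) \<noteq> 0"
    and gen: "AE cb in Lb {..<n}. \<forall>z. dt n (\<lambda>i j. z * A i j - B i j) = 0 \<longrightarrow>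
       dt (Suc n) (\<lambda>i j. z * bmat n A ca ra sa i j - bmat n B cb rb 0 i j) \<noteq> 0"
    and g: "g \<in> borel_measurable (CM n)"
  shows "of_nat (Suc n) * (\<integral>\<^sup>+q. g q \<partial>CM n) =
    (\<integral>\<^sup>+l. ennreal ((cmod (kq n (X, (ra, rb)) (sa, ca) l))\<^sup>2) * g (kr n (X, (ra, rb)) (sa, ca) l) \<partial>CM n)"
proof -
  define a where "a = bmat n A ca ra sa"
  define b where "b = (\<lambda>cb. bmat n B cb rb 0)"
  define E where "E = (\<lambda>z cb. dt (Suc n) (\<lambda>i j. z * a i j - b cb i j))"
  define D where "D = (\<lambda>z. dt n (\<lambda>i j. z * A i j - B i j))"
  define E' where "E' = (\<lambda>z cb. pencil_deriv (Suc n) a (b cb) z)"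
  define D' where "D' = (\<lambda>z. pencil_deriv n A B z)"
  define R' where "R' = (\<lambda>z cb. (E' z cb * D z - E z cb * D' z) / (D z * D z))"
  let ?V = "Lb {..<n}"
  have V: "sigma_finite_measure ?V" by (rule sigma_finite_Lb) simp
  have bm: "(\<lambda>x. b (C x) i j) \<in> borel_measurable M" if C: "C \<in> M \<rightarrow>\<^sub>M ?V" for C M i j
    unfolding b_def bmat_def using borel_measurable_component[OF C] by (cases "i < n"; cases "j < n") auto
  have Em: "(\<lambda>x. E (Z x) (C x)) \<in> borel_measurable M" and E'm: "(\<lambda>x. E' (Z x) (C x)) \<in> borel_measurable M"
    if "C \<in> M \<rightarrow>\<^sub>M ?V" "Z \<in> borel_measurable M" for C M Z
    unfolding E_def E'_def
    by (intro borel_measurable_dt borel_measurable_pencil_deriv borel_measurable_diff borel_measurable_times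
         borel_measurable_const bm that)+
  have Dm: "(\<lambda>x. D (Z x)) \<in> borel_measurable M" and D'm: "(\<lambda>x. D' (Z x)) \<in> borel_measurable M"
    if "Z \<in> borel_measurable M" for M and Z :: "'c => complex"
    unfolding D_def D'_def
    by (intro borel_measurable_dt borel_measurable_pencil_deriv borel_measurable_diff borel_measurable_times
         borel_measurable_const that)+
  have R'm: "(\<lambda>x. R' (Z x) (C x)) \<in> borel_measurable M"
    if "C \<in> M \<rightarrow>\<^sub>M ?V" "Z \<in> borel_measurable M" for C M and Z :: "'c => complex"
    unfolding R'_def
    by (intro borel_measurable_divide borel_measurable_diff borel_measurable_times Em E'm Dm D'm that)
  have gm: "(\<lambda>x. g (Z x, C x)) \<in> borel_measurable M"
    if "C \<in> M \<rightarrow>\<^sub>M ?V" "Z \<in> borel_measurable M" for C M and Z :: "'c => complex"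
    by (rule measurable_compose[OF _ g]) (use that in \<open>auto simp: CM_def intro!: measurable_Pair\<close>)
  have m1: "(\<lambda>x. g (E (Z x) (C x) / D (Z x), C x) * ennreal ((cmod (R' (Z x) (C x)))\<^sup>2)) \<in> borel_measurable M"
    if "C \<in> M \<rightarrow>\<^sub>M ?V" "Z \<in> borel_measurable M" for C M and Z :: "'c => complex"
    using gm[OF that(1) borel_measurable_divide[OF Em[OF that] Dm[OF that(2)]]] R'm[OF that] by measurable
  have "(\<integral>\<^sup>+q. g q \<partial>CM n) = (\<integral>\<^sup>+s. \<integral>\<^sup>+c. g (s, c) \<partial>?V \<partial>lborel)"
    unfolding CM_def using g[unfolded CM_def]
    by (simp add: sigma_finite_measure.nn_integral_fst[OF V])
  also have "... = (\<integral>\<^sup>+c. \<integral>\<^sup>+s. g (s, c) \<partial>lborel \<partial>?V)"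
    by (rule nn_integral_swap[OF sigma_finite_lborel V]) (use g[unfolded CM_def] in simp)
  also have "of_nat (Suc n) * ... = (\<integral>\<^sup>+c. of_nat (Suc n) * (\<integral>\<^sup>+s. g (s, c) \<partial>lborel) \<partial>?V)"
  proof (rule nn_integral_cmult[symmetric])
    have "(\<lambda>p. g (snd p, fst p)) \<in> borel_measurable (?V \<Otimes>\<^sub>M lborel)" by (rule gm) auto
    from lborel.borel_measurable_nn_integral_fst[OF this]
    show "(\<lambda>c. \<integral>\<^sup>+s. g (s, c) \<partial>lborel) \<in> borel_measurable ?V" by simp
  qed
  also have "... = (\<integral>\<^sup>+c. \<integral>\<^sup>+z. g (E z c / D z, c) * ennreal ((cmod (R' z c))\<^sup>2) \<partial>lborel \<partial>?V)"
  proof (rule nn_integral_cong_AE)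
    show "AE c in ?V. of_nat (Suc n) * (\<integral>\<^sup>+s. g (s, c) \<partial>lborel) = (\<integral>\<^sup>+z. g (E z c / D z, c) * ennreal ((cmod (R' z c))\<^sup>2) \<partial>lborel)"
      using gen AE_space
    proof eventually_elim
      case (elim c)
      define P where "P = pencil_poly (Suc n) a (b c)"
      define Q where "Q = pencil_poly n A B"
      have PE: "poly P z = E z c" and QD: "poly Q z = D z" for z
        by (simp_all add: P_def Q_def E_def D_def poly_pencil_poly)
      have "(\<integral>\<^sup>+z. g (poly P z / poly Q z, c) * ennreal ((cmod (R' z c))\<^sup>2) \<partial>lborel) = of_nat (Suc n) * (\<integral>\<^sup>+s. g (s, c) \<partial>lborel)"
      proof (rule nn_integral_rational_fibres[where g="\<lambda>s. g (s, c)"])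
        show "degree P = Suc n" unfolding P_def using dA1 by (intro degree_pencil_poly) (simp add: a_def)
        show "degree Q < Suc n" unfolding Q_def using degree_pencil_poly[OF dA] by simp
        show "Q \<noteq> 0" unfolding Q_def by (rule pencil_poly_nonzero[OF dA])
        show "poly Q z \<noteq> 0" if "poly P z = 0" for z
          using elim(1) that unfolding PE QD by (auto simp: D_def E_def a_def b_def)
        show "((\<lambda>z. poly P z / poly Q z) has_field_derivative R' z c) (at z)" if "poly Q z \<noteq> 0" for z
          using that unfolding PE QD R'_def E'_def D'_def E_def D_def
          by (intro DERIV_divide DERIV_pencil)
        show "(\<lambda>z. R' z c) \<in> borel_measurable borel" using elim(2) by (intro R'm) auto
        have "(\<lambda>s. g (s, c)) \<in> borel_measurable borel" using elim(2) by (intro gm) auto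
        then show "(\<lambda>s. g (s, c)) \<in> borel_measurable borel" .
      qed
      then show ?case by (simp add: PE QD)
    qed
  qed
  also have "... = (\<integral>\<^sup>+z. \<integral>\<^sup>+c. g (E z c / D z, c) * ennreal ((cmod (R' z c))\<^sup>2) \<partial>?V \<partial>lborel)"
  proof (rule nn_integral_swap[OF V sigma_finite_lborel])
    have "(\<lambda>x. g (E (snd x) (fst x) / D (snd x), fst x) * ennreal ((cmod (R' (snd x) (fst x)))\<^sup>2)) \<in> borel_measurable (?V \<Otimes>\<^sub>M lborel)"
      by (rule m1) auto
    then show "(\<lambda>(c, z). g (E z c / D z, c) * ennreal ((cmod (R' z c))\<^sup>2)) \<in> borel_measurable (?V \<Otimes>\<^sub>M lborel)"
      by (simp add: case_prod_beta)
  qed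
  also have "... = (\<integral>\<^sup>+z. \<integral>\<^sup>+v. ennreal ((cmod (kq n (X, (ra, rb)) (sa, ca) (z, v)))\<^sup>2) * g (kr n (X, (ra, rb)) (sa, ca) (z, v)) \<partial>?V \<partial>lborel)"
  proof (rule nn_integral_cong_AE)
    have "finite {z. poly (pencil_poly n A B) z = 0}"
      by (rule poly_roots_finite) (rule pencil_poly_nonzero[OF dA])
    from AE_lborel_finite[OF this]
    show "AE z in lborel. (\<integral>\<^sup>+c. g (E z c / D z, c) * ennreal ((cmod (R' z c))\<^sup>2) \<partial>?V) =
       (\<integral>\<^sup>+v. ennreal ((cmod (kq n (X, (ra, rb)) (sa, ca) (z, v)))\<^sup>2) * g (kr n (X, (ra, rb)) (sa, ca) (z, v)) \<partial>?V)"
    proof eventually_elim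
      case (elim z)
      then have Dz: "D z \<noteq> 0" by (simp add: D_def poly_pencil_poly)
      define C where "C = (\<lambda>v. \<lambda>i\<in>{..<n}. (\<Sum>j<n. (z * A i j - B i j) * v j) + z * ca i)"
      define \<tau> where "\<tau> = (\<lambda>v. (\<Sum>j<n. (z * ra j - rb j) * v j) + z * sa)"
      have kr: "kr n (X, (ra, rb)) (sa, ca) (z, v) = (\<tau> v, C v)" for v
        by (simp add: kr_def \<tau>_def C_def A_def B_def)
      \<comment> \<open>For the column \<open>C v\<close> the last column of the pencil at
        \<open>z\<close> is a combination of the other columns, except that its corner exceeds that
        combination by \<open>\<tau> v\<close>.\<close>
      have EC: "E z (C v) = D z * \<tau> v" for v
      proof -
        have "E z (C v) = dt (Suc n) (bmat n (\<lambda>i j. z * A i j - B i j) (\<lambda>i. z * ca i - C v i) (\<lambda>j. z * ra j - rb j) (z * sa - 0))"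
          unfolding E_def a_def b_def bmat_pencil ..
        also have "... = dt (Suc n) (bmat n (\<lambda>i j. z * A i j - B i j) (\<lambda>i. (\<Sum>j<n. (z * A i j - B i j) * (- v j)) + 0 * 1)
            (\<lambda>j. z * ra j - rb j) ((\<Sum>j<n. (z * ra j - rb j) * (- v j)) + \<tau> v * 1))"
          by (rule dt_cong) (auto simp: bmat_def C_def \<tau>_def sum_negf)
        also have "... = D z * \<tau> v"
          by (subst dt_bmat_column) (simp add: dt_bmat_lower D_def)
        finally show ?thesis .
      qed
      \<comment> \<open>The function \<open>E u (C v) - \<tau> v * D u\<close> vanishes at
        \<open>u = z\<close> and factors as \<open>Qt u * (u - z)\<close> with \<open>Qt\<close>
        continuous, so its derivative there is \<open>Qt z\<close>, which is \<open>kq\<close>.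
        Since E / D equals \<open>\<tau> v\<close> at \<open>z\<close>, the quotient rule shows that
        this derivative is also \<open>D z * R' z (C v)\<close>.\<close>
      have key: "D z * R' z (C v) = kq n (X, (ra, rb)) (sa, ca) (z, v)" for v
      proof -
        define Qt where "Qt = (\<lambda>u. dt (Suc n) (bmat n (\<lambda>i j. u * A i j - B i j) (\<lambda>i. u * 0 - - ((\<Sum>j<n. A i j * v j) + ca i))
           (\<lambda>j. u * ra j - rb j) (u * 0 - - ((\<Sum>j<n. ra j * v j) + sa))))"
        have contQ: "isCont Qt z" unfolding Qt_def bmat_pencil by (rule isCont_pencil)
        have F: "E u (C v) - \<tau> v * D u = Qt u * (u - z)" for u
        proof -
          have "E u (C v) - \<tau> v * D u = dt (Suc n) (bmat n (\<lambda>i j. u * A i j - B i j) (\<lambda>i. u * ca i - C v i) (\<lambda>j. u * ra j - rb j) (u * sa + - \<tau> v))"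
            unfolding dt_bmat_corner E_def a_def b_def bmat_pencil[symmetric] D_def by simp
          also have "... = dt (Suc n) (bmat n (\<lambda>i j. u * A i j - B i j) (\<lambda>i. (\<Sum>j<n. (u * A i j - B i j) * (- v j)) + ((\<Sum>j<n. A i j * v j) + ca i) * (u - z))
            (\<lambda>j. u * ra j - rb j) ((\<Sum>j<n. (u * ra j - rb j) * (- v j)) + ((\<Sum>j<n. ra j * v j) + sa) * (u - z)))"
          proof (rule dt_cong)
            fix i j assume "i < Suc n" "j < Suc n"
            have 1: "u * ca i - ((\<Sum>j<n. (z * A i j - B i j) * v j) + z * ca i) =
               (\<Sum>j<n. (u * A i j - B i j) * (- v j)) + ((\<Sum>j<n. A i j * v j) + ca i) * (u - z)" for i
              by (simp add: sum_negf sum_subtractf left_diff_distrib sum_distrib_right sum_distrib_left algebra_simps)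
            have 2: "u * sa - \<tau> v =
               (\<Sum>j<n. (u * ra j - rb j) * (- v j)) + ((\<Sum>j<n. ra j * v j) + sa) * (u - z)"
              by (simp add: \<tau>_def sum_negf sum_subtractf left_diff_distrib sum_distrib_right sum_distrib_left algebra_simps)
            show "bmat n (\<lambda>i j. u * A i j - B i j) (\<lambda>i. u * ca i - C v i) (\<lambda>j. u * ra j - rb j) (u * sa + - \<tau> v) i j =
              bmat n (\<lambda>i j. u * A i j - B i j) (\<lambda>i. (\<Sum>j<n. (u * A i j - B i j) * (- v j)) + ((\<Sum>j<n. A i j * v j) + ca i) * (u - z))
            (\<lambda>j. u * ra j - rb j) ((\<Sum>j<n. (u * ra j - rb j) * (- v j)) + ((\<Sum>j<n. ra j * v j) + sa) * (u - z)) i j"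
              unfolding bmat_def using 1[of i] 2 by (simp add: C_def)
          qed
          also have "... = Qt u * (u - z)"
            by (subst dt_bmat_column) (simp add: Qt_def add.commute)
          finally show ?thesis .
        qed
        have "((\<lambda>u. E u (C v) - \<tau> v * D u) has_field_derivative Qt z) (at z)"
          unfolding CARAT_DERIV by (rule exI[of _ Qt]) (use F contQ in auto)
        moreover have "((\<lambda>u. E u (C v) - \<tau> v * D u) has_field_derivative E' z (C v) - \<tau> v * D' z) (at z)"
          unfolding E_def D_def E'_def D'_def by (intro DERIV_diff DERIV_cmult DERIV_pencil)
        ultimately have "E' z (C v) - \<tau> v * D' z = Qt z" by (rule DERIV_unique[symmetric])
        moreover have "D z * R' z (C v) = E' z (C v) - \<tau> v * D' z"
          using Dz unfolding R'_def EC by (simp add: field_simps)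
        ultimately show ?thesis by (simp add: Qt_def kq_def A_def B_def add.commute)
      qed
      have "(\<integral>\<^sup>+c. g (E z c / D z, c) * ennreal ((cmod (R' z c))\<^sup>2) \<partial>?V)
        = ennreal ((cmod (D z))\<^sup>2) * (\<integral>\<^sup>+v. g (E z (C v) / D z, C v) * ennreal ((cmod (R' z (C v)))\<^sup>2) \<partial>?V)"
        unfolding C_def D_def
        by (rule nn_integral_Lb_linear[OF Dz[unfolded D_def] m1[unfolded D_def]]) auto
      also have "... = (\<integral>\<^sup>+v. ennreal ((cmod (D z))\<^sup>2) * (g (E z (C v) / D z, C v) * ennreal ((cmod (R' z (C v)))\<^sup>2)) \<partial>?V)"
        by (rule nn_integral_cmult[symmetric], rule m1) (auto simp: C_def)
      also have "... = (\<integral>\<^sup>+v. ennreal ((cmod (kq n (X, (ra, rb)) (sa, ca) (z, v)))\<^sup>2) * g (kr n (X, (ra, rb)) (sa, ca) (z, v)) \<partial>?V)"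
        using Dz by (intro nn_integral_cong)
           (simp add: key[symmetric] kr EC norm_mult power_mult_distrib ennreal_mult' mult_ac)
      finally show ?case .
    qed
  qed
  also have "... = (\<integral>\<^sup>+l. ennreal ((cmod (kq n (X, (ra, rb)) (sa, ca) l))\<^sup>2) * g (kr n (X, (ra, rb)) (sa, ca) l) \<partial>CM n)"
  proof -
    have c: "(\<lambda>x. c) \<in> M \<rightarrow>\<^sub>M N" if "c \<in> space N" for c and M :: "(complex \<times> (nat => complex)) measure" and N
      using that by simp
    have kqm: "(\<lambda>l. kq n (X, (ra, rb)) (sa, ca) l) \<in> borel_measurable (CM n)"
      unfolding kq_def
    proof (rule borel_measurable_dt)
      fix i j
      show "(\<lambda>l. bmat n (\<lambda>i j. fst l * fst (X, (ra, rb)) (True, i, j) - fst (X, (ra, rb)) (False, i, j))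
          (\<lambda>i. (\<Sum>j<n. fst (X, (ra, rb)) (True, i, j) * snd l j) + snd (sa, ca) i)
          (\<lambda>j. fst l * fst (snd (X, (ra, rb))) j - snd (snd (X, (ra, rb))) j)
          ((\<Sum>j<n. fst (snd (X, (ra, rb))) j * snd l j) + fst (sa, ca)) i j) \<in> borel_measurable (CM n)"
        unfolding bmat_def
        by (cases "i < n"; cases "j < n"; simp only: if_True if_False)
           (intro borel_measurable_add borel_measurable_sum borel_measurable_times borel_measurable_diff
             borel_measurable_const CM_coords[OF measurable_ident_sets[OF refl]]; auto)+
    qed
    have krm: "(\<lambda>l. kr n (X, (ra, rb)) (sa, ca) l) \<in> CM n \<rightarrow>\<^sub>M CM n"
      unfolding kr_def
      by (intro measurable_into_CM borel_measurable_add borel_measurable_sum borel_measurable_times borel_measurable_diff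
         borel_measurable_const CM_coords[OF measurable_ident_sets[OF refl]]) auto
    have "(\<lambda>l. ennreal ((cmod (kq n (X, (ra, rb)) (sa, ca) l))\<^sup>2) * g (kr n (X, (ra, rb)) (sa, ca) l)) \<in> borel_measurable (CM n)"
      using kqm measurable_compose[OF krm g] by measurable
    then show ?thesis
      unfolding CM_def by (simp add: sigma_finite_measure.nn_integral_fst[OF V, symmetric])
  qed
  finally show ?thesis .
qed

abbreviation ea :: "(bool \<times> nat \<times> nat => complex) => nat => nat => complex" where
  "ea X \<equiv> \<lambda>i j. X (True, i, j)"

abbreviation pen :: "(bool \<times> nat \<times> nat => complex) => complex => nat => nat => complex" where
  "pen X z \<equiv> \<lambda>i j. z * X (True, i, j) - X (False, i, j)"

lemma borel_measurable_ea: "X \<in> M \<rightarrow>\<^sub>M Lb (IX n) ==> m \<le> n ==> (\<lambda>x. dt m (ea (X x))) \<in> borel_measurable M"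
  by (intro borel_measurable_dt) (auto intro!: borel_measurable_component[where I="IX n"])

lemma borel_measurable_pen:
  assumes "X \<in> M \<rightarrow>\<^sub>M Lb (IX n)" "z \<in> borel_measurable M" "m \<le> n"
  shows "(\<lambda>x. dt m (pen (X x) (z x))) \<in> borel_measurable M"
  by (intro borel_measurable_dt borel_measurable_diff borel_measurable_times assms)
     (use assms in \<open>auto intro!: borel_measurable_component[where I="IX n"]\<close>)

subsection \<open>Genericity\<close>

lemma AE_Lb_restrict:
  assumes K: "finite K" "I \<subseteq> K" and ae: "AE x in Lb I. P x"
  shows "AE x in Lb K. P (restrict x I)"
proof -
  have fin: "finite I" "finite (K - I)" using K finite_subset by auto
  obtain N where N: "{x\<in>space (Lb I). \<not> P x} \<subseteq> N" "emeasure (Lb I) N = 0" "N \<in> sets (Lb I)"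
    using AE_E[OF ae] .
  have rm: "(\<lambda>x. restrict x I) \<in> Lb K \<rightarrow>\<^sub>M Lb I" using K by (intro measurable_restrict_subset)
  define N' where "N' = (\<lambda>x. restrict x I) -` N \<inter> space (Lb K)"
  have N': "N' \<in> sets (Lb K)" unfolding N'_def using rm N(3) by (rule measurable_sets)
  have KI: "I \<union> (K - I) = K" using K by auto
  have d: "distr (Lb I \<Otimes>\<^sub>M Lb (K - I)) (Lb K) (merge I (K - I)) = Lb K"
    using lborel_product.distr_merge[of I "K - I"] fin KI by auto
  have mm: "merge I (K - I) \<in> Lb I \<Otimes>\<^sub>M Lb (K - I) \<rightarrow>\<^sub>M Lb K"
    using measurable_merge[of I "K - I" "\<lambda>_. lborel :: complex measure"] KI by simp
  have pre: "merge I (K - I) -` N' \<inter> space (Lb I \<Otimes>\<^sub>M Lb (K - I)) = N \<times> space (Lb (K - I))"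
  proof -
    have "restrict (merge I (K - I) (x, y)) I = x" if "x \<in> space (Lb I)" for x y
      using that by (auto simp: space_PiM PiE_iff extensional_restrict)
    moreover have "N \<subseteq> space (Lb I)" using N(3) by (rule sets.sets_into_space)
    ultimately show ?thesis
      using measurable_space[OF mm] by (auto simp: N'_def space_pair_measure)
  qed
  have "emeasure (Lb K) N' = emeasure (Lb I \<Otimes>\<^sub>M Lb (K - I)) (N \<times> space (Lb (K - I)))"
    by (subst d[symmetric], subst emeasure_distr[OF mm N']) (simp add: pre)
  also have "... = 0"
    using N by (subst sigma_finite_measure.emeasure_pair_measure_Times[OF sigma_finite_Lb[OF fin(2)]]) auto
  finally have "emeasure (Lb K) N' = 0" .
  moreover have "{x\<in>space (Lb K). \<not> P (restrict x I)} \<subseteq> N'"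
    using N(1) measurable_space[OF rm] by (auto simp: N'_def)
  ultimately show ?thesis using N' by (intro AE_I)
qed

text \<open>Fubini: with a measurable \<open>P\<close> the exceptional set may be tested in a single
  coordinate.\<close>

lemma AE_Lb_insert:
  assumes J: "finite J" "e \<notin> J" and P: "Measurable.pred (Lb (insert e J)) P"
    and ae: "AE y in Lb J. AE t in lborel. P (y(e := t))"
  shows "AE x in Lb (insert e J). P x"
proof -
  define N where "N = (\<lambda>x. indicator {x \<in> space (Lb (insert e J)). \<not> P x} x :: ennreal)"
  have S: "{x \<in> space (Lb (insert e J)). \<not> P x} \<in> sets (Lb (insert e J))" using P by measurable
  have Nm: "N \<in> borel_measurable (Lb (insert e J))" unfolding N_def using S by measurable
  have "(\<integral>\<^sup>+x. N x \<partial>Lb (insert e J)) = (\<integral>\<^sup>+y. \<integral>\<^sup>+t. N (y(e := t)) \<partial>lborel \<partial>Lb J)"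
    by (rule lborel_product.product_nn_integral_insert[OF J Nm])
  also have "... = (\<integral>\<^sup>+y. 0 \<partial>Lb J)"
    using ae by (intro nn_integral_cong_AE, eventually_elim)
      (subst nn_integral_cong_AE[of _ "\<lambda>_. 0"], auto elim!: eventually_mono simp: N_def)
  finally have "(\<integral>\<^sup>+x. N x \<partial>Lb (insert e J)) = 0" by simp
  then have "emeasure (Lb (insert e J)) {x \<in> space (Lb (insert e J)). \<not> P x} = 0"
    using S by (simp add: N_def)
  then show ?thesis using S by (intro AE_I[OF _ _ S]) auto
qed

lemma AE_Lb_insert2:
  assumes J: "finite J" "e1 \<notin> J" "e2 \<notin> insert e1 J" and P: "Measurable.pred (Lb (insert e2 (insert e1 J))) P"
    and ae: "AE y in Lb J. AE s in lborel. AE t in lborel. P ((y(e1 := s))(e2 := t))"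
  shows "AE x in Lb (insert e2 (insert e1 J)). P x"
proof -
  let ?K = "insert e2 (insert e1 J)"
  define N where "N = (\<lambda>x. indicator {x \<in> space (Lb ?K). \<not> P x} x :: ennreal)"
  have S: "{x \<in> space (Lb ?K). \<not> P x} \<in> sets (Lb ?K)" using P by measurable
  have Nm: "N \<in> borel_measurable (Lb ?K)" unfolding N_def using S by measurable
  have Gm: "(\<lambda>y. \<integral>\<^sup>+t. N (y(e2 := t)) \<partial>lborel) \<in> borel_measurable (Lb (insert e1 J))"
  proof -
    have "(\<lambda>(y, t). y(e2 := t)) \<in> Lb (insert e1 J) \<Otimes>\<^sub>M lborel \<rightarrow>\<^sub>M Lb ?K"
      by (rule measurable_add_dim)
    from measurable_compose[OF this Nm]
    have "(\<lambda>p. N ((fst p)(e2 := snd p))) \<in> borel_measurable (Lb (insert e1 J) \<Otimes>\<^sub>M lborel)"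
      by (simp add: case_prod_beta)
    from lborel.borel_measurable_nn_integral_fst[OF this] show ?thesis by simp
  qed
  have "(\<integral>\<^sup>+x. N x \<partial>Lb ?K) = (\<integral>\<^sup>+y. \<integral>\<^sup>+t. N (y(e2 := t)) \<partial>lborel \<partial>Lb (insert e1 J))"
    using J by (intro lborel_product.product_nn_integral_insert Nm) auto
  also have "... = (\<integral>\<^sup>+y. \<integral>\<^sup>+s. \<integral>\<^sup>+t. N ((y(e1 := s))(e2 := t)) \<partial>lborel \<partial>lborel \<partial>Lb J)"
    using J by (intro lborel_product.product_nn_integral_insert Gm) auto
  also have "... = (\<integral>\<^sup>+y. 0 \<partial>Lb J)"
  proof (rule nn_integral_cong_AE)
    show "AE y in Lb J. (\<integral>\<^sup>+s. \<integral>\<^sup>+t. N ((y(e1 := s))(e2 := t)) \<partial>lborel \<partial>lborel) = 0"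
      using ae
    proof eventually_elim
      case (elim y)
      have "(\<integral>\<^sup>+s. \<integral>\<^sup>+t. N ((y(e1 := s))(e2 := t)) \<partial>lborel \<partial>lborel) = (\<integral>\<^sup>+s. 0 \<partial>(lborel :: complex measure))"
      proof (rule nn_integral_cong_AE)
        show "AE s in lborel. (\<integral>\<^sup>+t. N ((y(e1 := s))(e2 := t)) \<partial>lborel) = 0"
          using elim
        proof eventually_elim
          case (elim s)
          have "(\<integral>\<^sup>+t. N ((y(e1 := s))(e2 := t)) \<partial>lborel) = (\<integral>\<^sup>+t. 0 \<partial>(lborel :: complex measure))"
            using elim by (intro nn_integral_cong_AE) (auto elim!: eventually_mono simp: N_def)
          then show ?case by simp
        qed
      qed
      then show ?case by simp
    qed
  qed
  finally have "(\<integral>\<^sup>+x. N x \<partial>Lb ?K) = 0" by simp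
  then have "emeasure (Lb ?K) {x \<in> space (Lb ?K). \<not> P x} = 0"
    using S by (simp add: N_def)
  then show ?thesis using S by (intro AE_I[OF _ _ S]) auto
qed

text \<open>Existence of a zero of a continuous function is a countable condition.\<close>

lemma ex_zero_iff_countable:
  fixes h :: "complex => real"
  assumes cont: "continuous_on UNIV h" and h: "\<And>z. h z \<ge> 0"
    and Q: "\<And>S. open S ==> S \<noteq> {} ==> \<exists>q\<in>Q. q \<in> S"
  shows "(\<exists>z. h z = 0) \<longleftrightarrow> (\<exists>m::nat. \<forall>k::nat. \<exists>q\<in>Q. norm q \<le> real m \<and> h q < 1 / real (Suc k))"
proof
  assume "\<exists>z. h z = 0"
  then obtain z where z: "h z = 0" by auto
  obtain m where m: "norm z < real m" using reals_Archimedean2 by blast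
  have "\<exists>q\<in>Q. norm q \<le> real m \<and> h q < 1 / real (Suc k)" for k
  proof -
    have "open {q. norm q < real m \<and> h q < 1 / real (Suc k)}"
      using cont by (intro open_Collect_conj open_Collect_less continuous_intros)
    moreover have "z \<in> {q. norm q < real m \<and> h q < 1 / real (Suc k)}" using z m by simp
    ultimately obtain q where "q \<in> Q" "q \<in> {q. norm q < real m \<and> h q < 1 / real (Suc k)}" using Q by blast
    then show ?thesis by (intro bexI[of _ q]) auto
  qed
  then show "\<exists>m::nat. \<forall>k::nat. \<exists>q\<in>Q. norm q \<le> real m \<and> h q < 1 / real (Suc k)" by blast
next
  assume "\<exists>m::nat. \<forall>k::nat. \<exists>q\<in>Q. norm q \<le> real m \<and> h q < 1 / real (Suc k)"
  then obtain m :: nat where m: "\<And>k::nat. \<exists>q\<in>Q. norm q \<le> real m \<and> h q < 1 / real (Suc k)" by blast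
  have "cball (0::complex) (real m) \<noteq> {}" by simp
  from continuous_attains_inf[OF compact_cball this continuous_on_subset[OF cont]]
  obtain z where "\<forall>q\<in>cball 0 (real m). h z \<le> h q" by blast
  then have z: "\<And>q. norm q \<le> real m ==> h z \<le> h q" by simp
  have "h z = 0"
  proof (rule ccontr)
    assume "h z \<noteq> 0"
    then have "h z > 0" using h[of z] by simp
    then obtain k where k: "1 / real (Suc k) < h z" using reals_Archimedean by (metis inverse_eq_divide)
    obtain q where "norm q \<le> real m" "h q < 1 / real (Suc k)" using m[of k] by blast
    with z[of q] k show False by simp
  qed
  then show "\<exists>z. h z = 0" by blast
qed

text \<open>Fubini asks for a measurable exceptional set, but the quantifier over \<open>z\<close>
  is uncountable; \<open>ex_zero_iff_countable\<close>, applied to the sum of the two moduli,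
  replaces it by a countable one.\<close>

lemma measurable_no_common_zero:
  "Measurable.pred (Lb (IX (Suc n))) (\<lambda>X. \<forall>z. \<not> (dt (Suc n) (pen X z) = 0 \<and> dt n (pen X z) = 0))"
proof -
  obtain Q :: "complex set" where Q: "countable Q" "\<And>S. open S ==> S \<noteq> {} ==> \<exists>q\<in>Q. q \<in> S"
    using countable_dense_exists by blast
  define h where "h = (\<lambda>X z. cmod (dt (Suc n) (pen X z)) + cmod (dt n (pen X z)))"
  have cont: "continuous_on UNIV (h X)" for X
    unfolding h_def by (intro continuous_at_imp_continuous_on ballI isCont_add isCont_norm isCont_pencil)
  have hm: "(\<lambda>X. h X z) \<in> borel_measurable (Lb (IX (Suc n)))" for z
    unfolding h_def
    by (intro borel_measurable_add borel_measurable_norm[THEN measurable_compose[rotated]]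
        borel_measurable_pen[where n="Suc n"]) auto
  have "(\<forall>z. \<not> (dt (Suc n) (pen X z) = 0 \<and> dt n (pen X z) = 0)) \<longleftrightarrow>
     \<not> (\<exists>m::nat. \<forall>k::nat. \<exists>q\<in>Q. norm q \<le> real m \<and> h X q < 1 / real (Suc k))" for X
    unfolding ex_zero_iff_countable[OF cont[of X] _ Q(2), symmetric, simplified h_def, simplified]
    by (subst ex_zero_iff_countable[OF cont[of X] _ Q(2), symmetric]) (auto simp: h_def add_nonneg_eq_0_iff)
  moreover have "Measurable.pred (Lb (IX (Suc n)))
     (\<lambda>X. \<not> (\<exists>m::nat. \<forall>k::nat. \<exists>q\<in>Q. norm q \<le> real m \<and> h X q < 1 / real (Suc k)))"
    using Q(1) hm by measurable
  ultimately show ?thesis by simp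
qed

text \<open>Laplace expansion along the last row. The entry just left of the corner has sign -1, and
  its minor consists of the first \<open>m\<close> columns of \<open>N\<close> followed by the
  border column \<open>c\<close>.\<close>

lemma dt_bmat_row_entry:
  fixes N :: "nat => nat => 'a :: comm_ring_1"
  shows "dt (Suc (Suc m)) (bmat (Suc m) N c (\<lambda>j. if j = m then r j + t else r j) s) =
    dt (Suc (Suc m)) (bmat (Suc m) N c r s) - t * dt (Suc m) (\<lambda>i j. if j < m then N i j else c i)"
proof -
  define r' where "r' = (\<lambda>j. if j = m then r j + t else r j)"
  define Mt where "Mt r = Matrix.mat (Suc (Suc m)) (Suc (Suc m)) (\<lambda>(i, j). bmat (Suc m) N c r s i j)" for r
  have M: "Mt r \<in> carrier_mat (Suc (Suc m)) (Suc (Suc m))" for r by (simp add: Mt_def)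
  have cof: "cofactor (Mt r') (Suc m) j = cofactor (Mt r) (Suc m) j" if "j < Suc (Suc m)" for j
    using that unfolding cofactor_def mat_delete_def Mt_def
    by (intro arg_cong2[where f="(*)"] refl arg_cong[where f=Determinant.det] eq_matI) (auto simp: bmat_def)
  have cm: "cofactor (Mt r) (Suc m) m = - dt (Suc m) (\<lambda>i j. if j < m then N i j else c i)"
  proof -
    have "mat_delete (Mt r) (Suc m) m = Matrix.mat (Suc m) (Suc m) (\<lambda>(i, j). if j < m then N i j else c i)"
      unfolding mat_delete_def Mt_def by (rule eq_matI) (auto simp: bmat_def)
    moreover have "(- 1 :: 'a) ^ (Suc m + m) = - 1" by (simp add: power_add[symmetric] mult_2[symmetric])
    ultimately show ?thesis by (simp add: cofactor_def dt_def)
  qed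
  have lap: "dt (Suc (Suc m)) (bmat (Suc m) N c r s) = (\<Sum>j<Suc (Suc m). Mt r $$ (Suc m, j) * cofactor (Mt r) (Suc m) j)" for r
    unfolding dt_def Mt_def[symmetric] by (rule laplace_expansion_row[OF M]) simp
  have "dt (Suc (Suc m)) (bmat (Suc m) N c r' s) = (\<Sum>j<Suc (Suc m). Mt r' $$ (Suc m, j) * cofactor (Mt r) (Suc m) j)"
    unfolding lap by (intro sum.cong refl) (simp add: cof)
  also have "... = (\<Sum>j<Suc (Suc m). Mt r $$ (Suc m, j) * cofactor (Mt r) (Suc m) j + (if j = m then t * cofactor (Mt r) (Suc m) j else 0))"
    by (intro sum.cong refl) (auto simp: Mt_def bmat_def r'_def ring_distribs)
  also have "... = dt (Suc (Suc m)) (bmat (Suc m) N c r s) + t * cofactor (Mt r) (Suc m) m"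
    unfolding sum.distrib lap[symmetric] by (simp add: sum.delta)
  finally show ?thesis by (simp add: cm r'_def)
qed

text \<open>Two entries of B suffice. At the finitely many zeros z of the old determinant the new
  one is affine in the entry \<open>t\<close> with slope \<open>T z s\<close>, and this slope is
  itself affine in the entry \<open>s\<close> with slope \<open>- dt m (pen X z)\<close>, nonzero by
  coprimality one size below. So finitely many values of \<open>s\<close>, and then finitely many of
  \<open>t\<close>, are excluded.\<close>

lemma generic_coprime_step:
  assumes n: "n = Suc m"
    and d: "dt n (ea X) \<noteq> 0" and cop: "\<forall>z. \<not> (dt n (pen X z) = 0 \<and> dt m (pen X z) = 0)"
  shows "AE s in lborel. AE t in lborel. \<forall>z. \<not> (dt (Suc n) (pen ((X((False, m, n) := s))((False, n, m) := t)) z) = 0 \<and>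
    dt n (pen ((X((False, m, n) := s))((False, n, m) := t)) z) = 0)"
proof -
  define Z where "Z = {z. dt n (pen X z) = 0}"
  have fin: "finite Z"
    using poly_roots_finite[OF pencil_poly_nonzero[OF d, of "\<lambda>i j. X (False, i, j)"]]
    unfolding Z_def poly_pencil_poly .
  define c where "c = (\<lambda>z s i. if i = m then z * X (True, i, n) + - s else z * X (True, i, n) - X (False, i, n))"
  define r where "r = (\<lambda>z j. if j = m then z * X (True, n, j) else z * X (True, n, j) - X (False, n, j))"
  define T where "T = (\<lambda>z s. dt n (\<lambda>i j. if j < m then pen X z i j else c z s i))"
  define K where "K = (\<lambda>z s. dt (Suc n) (bmat n (pen X z) (c z s) (r z) (z * X (True, n, n) - X (False, n, n))))"
  have T: "T z s = T z 0 - s * dt m (pen X z)" for z s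
  proof -
    have eq: "T z s = dt (Suc m) (bmat m (pen X z) (c z 0) (\<lambda>j. pen X z m j) (z * X (True, m, n) + - s))" for s
      unfolding T_def n by (rule dt_cong) (auto simp: bmat_def c_def less_Suc_eq n)
    show ?thesis unfolding eq dt_bmat_corner by simp
  qed
  let ?X = "\<lambda>s t. (X((False, m, n) := s))((False, n, m) := t)"
  have D1: "dt (Suc n) (pen (?X s t) z) = K z s + t * T z s" for s t z
  proof -
    have "dt (Suc n) (pen (?X s t) z) = dt (Suc n) (bmat n (pen X z) (c z s) (\<lambda>j. if j = m then r z j + - t else r z j)
       (z * X (True, n, n) - X (False, n, n)))"
      by (rule dt_cong) (use n in \<open>auto simp: bmat_def c_def r_def less_Suc_eq\<close>)
    then show ?thesis unfolding K_def T_def n by (simp only: dt_bmat_row_entry) simp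
  qed
  have D: "dt n (pen (?X s t) z) = dt n (pen X z)" for s t z
    by (rule dt_cong) (use n in auto)
  have "AE s in lborel. s \<notin> (\<lambda>z. T z 0 / dt m (pen X z)) ` Z"
    by (rule AE_lborel_finite) (use fin in simp)
  then show ?thesis
  proof eventually_elim
    case (elim s)
    have Ts: "T z s \<noteq> 0" if "z \<in> Z" for z
    proof
      assume "T z s = 0"
      moreover have "dt m (pen X z) \<noteq> 0" using that cop by (auto simp: Z_def)
      ultimately have "s = T z 0 / dt m (pen X z)" using T[of z s] by (simp add: field_simps)
      then show False using elim that by auto
    qed
    have "AE t in lborel. t \<notin> (\<lambda>z. - K z s / T z s) ` Z"
      by (rule AE_lborel_finite) (use fin in simp)
    then show ?case
    proof eventually_elim
      case (elim t)
      show ?case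
      proof (intro allI notI, elim conjE)
        fix z assume z: "dt (Suc n) (pen (?X s t) z) = 0" "dt n (pen (?X s t) z) = 0"
        have "z \<in> Z" using z(2) unfolding D Z_def by simp
        moreover have "t = - K z s / T z s"
          using z(1) Ts[OF \<open>z \<in> Z\<close>] unfolding D1 by (simp add: field_simps eq_neg_iff_add_eq_0)
        ultimately show False using elim by auto
      qed
    qed
  qed
qed

text \<open>Coprimality of the determinants of consecutive leading blocks is carried along with
  invertibility because \<open>generic_coprime_step\<close> passes it up by one size. For
  \<open>n = 0\<close> the determinants are 1, so nothing can vanish.\<close>

lemma generic_pencil:
  "AE X in Lb (IX n). dt n (ea X) \<noteq> 0 \<and> (\<forall>z. \<not> (dt n (pen X z) = 0 \<and> dt (n - 1) (pen X z) = 0))"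
proof (induction n)
  case 0
  show ?case by simp
next
  case (Suc n)
  have r: "dt n (ea (restrict X (IX n))) = dt n (ea X)" "dt n (pen (restrict X (IX n)) z) = dt n (pen X z)"
    "dt (n - 1) (pen (restrict X (IX n)) z) = dt (n - 1) (pen X z)" for X z
    by (rule dt_cong; auto)+
  have IH: "AE X in Lb J. dt n (ea X) \<noteq> 0 \<and> (\<forall>z. \<not> (dt n (pen X z) = 0 \<and> dt (n - 1) (pen X z) = 0))"
    if "finite J" "IX n \<subseteq> J" for J
    using AE_Lb_restrict[OF that Suc.IH] by (simp only: r)
  have sub: "IX n \<subseteq> IX (Suc n)" by (auto simp: IX_def)
  have 1: "AE X in Lb (IX (Suc n)). dt (Suc n) (ea X) \<noteq> 0"
  proof -
    define J where "J = IX (Suc n) - {(True, n, n)}"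
    have I: "IX (Suc n) = insert (True, n, n) J" "(True, n, n) \<notin> J" "finite J" "IX n \<subseteq> J"
      using sub by (auto simp: J_def)
    show ?thesis unfolding I(1)
    proof (rule AE_Lb_insert[OF I(3,2)])
      show "Measurable.pred (Lb (insert (True, n, n) J)) (\<lambda>X. dt (Suc n) (ea X) \<noteq> 0)"
        unfolding I(1)[symmetric] using borel_measurable_ea[of "\<lambda>x. x" "Lb (IX (Suc n))" "Suc n" "Suc n"] by measurable
      show "AE X in Lb J. AE t in lborel. dt (Suc n) (ea (X((True, n, n) := t))) \<noteq> 0"
        using IH[OF I(3,4)]
      proof eventually_elim
        case (elim X)
        then have nz: "dt n (ea X) \<noteq> 0" by blast
        define K where "K = dt (Suc n) (bmat n (ea X) (\<lambda>i. X (True, i, n)) (\<lambda>j. X (True, n, j)) 0)"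
        have "dt (Suc n) (ea (X((True, n, n) := t))) = dt (Suc n) (bmat n (ea X) (\<lambda>i. X (True, i, n)) (\<lambda>j. X (True, n, j)) (0 + t))" for t
          by (rule dt_cong) (auto simp: bmat_def less_Suc_eq)
        then have eq: "dt (Suc n) (ea (X((True, n, n) := t))) = K + t * dt n (ea X)" for t
          unfolding dt_bmat_corner K_def .
        have "AE t in lborel. t \<notin> {- K / dt n (ea X)}" by (rule AE_lborel_finite) simp
        then show ?case
          unfolding eq
        proof eventually_elim
          case (elim t)
          then show ?case using nz by (auto simp: field_simps eq_neg_iff_add_eq_0)
        qed
      qed
    qed
  qed
  have 2: "AE X in Lb (IX (Suc n)). \<forall>z. \<not> (dt (Suc n) (pen X z) = 0 \<and> dt n (pen X z) = 0)"
  proof (cases n)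
    case 0
    then show ?thesis by simp
  next
    case (Suc m)
    define J where "J = IX (Suc n) - {(False, m, n), (False, n, m)}"
    have I: "IX (Suc n) = insert (False, n, m) (insert (False, m, n) J)" "(False, m, n) \<notin> J"
      "(False, n, m) \<notin> insert (False, m, n) J" "finite J" "IX n \<subseteq> J"
      using sub Suc by (auto simp: J_def)
    show ?thesis unfolding I(1)
    proof (rule AE_Lb_insert2[OF I(4,2,3)])
      show "Measurable.pred (Lb (insert (False, n, m) (insert (False, m, n) J)))
        (\<lambda>X. \<forall>z. \<not> (dt (Suc n) (pen X z) = 0 \<and> dt n (pen X z) = 0))"
        unfolding I(1)[symmetric] by (rule measurable_no_common_zero)
      show "AE X in Lb J. AE s in lborel. AE t in lborel. \<forall>z. \<not> (dt (Suc n) (pen ((X((False, m, n) := s))((False, n, m) := t)) z) = 0 \<and>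
          dt n (pen ((X((False, m, n) := s))((False, n, m) := t)) z) = 0)"
        using IH[OF I(4,5)] by eventually_elim (rule generic_coprime_step[OF Suc], auto simp: Suc)
    qed
  qed
  from 1 2 show ?case by eventually_elim simp
qed

section \<open>Coordinates that split off an eigenvalue\<close>

lemma dt_scalar: "dt n (\<lambda>i j. if i = j then c else 0 :: 'a :: idom) = c ^ n"
proof -
  have "Matrix.mat n n (\<lambda>(i, j). if i = j then c else 0) = c \<cdot>\<^sub>m 1\<^sub>m n" by (rule eq_matI) auto
  then show ?thesis by (simp add: dt_def)
qed

lemma nn_integral_CM:
  assumes "f \<in> borel_measurable (CM n)"
  shows "(\<integral>\<^sup>+q. f q \<partial>CM n) = (\<integral>\<^sup>+s. \<integral>\<^sup>+c. f (s, c) \<partial>Lb {..<n} \<partial>lborel)"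
  using assms unfolding CM_def
  by (simp add: sigma_finite_measure.nn_integral_fst[OF sigma_finite_Lb])

text \<open>A translation of the corner, then for each corner value \<open>\<sigma>\<close> a
  scaling of the \<open>n\<close> column entries by \<open>\<sigma>\<close>, which costs
  |\<open>\<sigma>\<close>|^(2n); the value 0 is a null set.\<close>

lemma nn_integral_CM_change:
  assumes \<phi>: "\<phi> \<in> borel_measurable (CM n)"
  shows "(\<integral>\<^sup>+q. \<phi> q \<partial>CM n) =
    (\<integral>\<^sup>+l. ennreal (cmod (fst l) ^ (2 * n)) * \<phi> (fst l + t, \<lambda>i\<in>{..<n}. fst l * snd l i + h i) \<partial>CM n)"
proof -
  have V: "sigma_finite_measure (Lb {..<n})" by (rule sigma_finite_Lb) simp
  have m: "(\<lambda>x. \<phi> (f x, g x)) \<in> borel_measurable M" if "f \<in> borel_measurable M" "g \<in> M \<rightarrow>\<^sub>M Lb {..<n}"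
    for f g and M :: "'x measure"
    by (rule measurable_compose[OF _ \<phi>]) (use that in \<open>auto simp: CM_def intro!: measurable_Pair\<close>)
  have cm: "(\<lambda>l. \<phi> (fst l + t, \<lambda>i\<in>{..<n}. fst l * snd l i + h i)) \<in> borel_measurable (CM n)"
    by (rule measurable_compose[OF measurable_into_CM \<phi>])
       (intro borel_measurable_add borel_measurable_times borel_measurable_const
         CM_coords[OF measurable_ident_sets[OF refl]]; simp)+
  have cm2: "(\<lambda>l. ennreal (cmod (fst l) ^ (2 * n)) * \<phi> (fst l + t, \<lambda>i\<in>{..<n}. fst l * snd l i + h i)) \<in> borel_measurable (CM n)"
    using cm CM_coords(1)[OF measurable_ident_sets[OF refl], of n] by measurable
  have "(\<integral>\<^sup>+q. \<phi> q \<partial>CM n) = (\<integral>\<^sup>+s. \<integral>\<^sup>+c. \<phi> (s, c) \<partial>Lb {..<n} \<partial>lborel)"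
    by (rule nn_integral_CM[OF \<phi>])
  also have "... = (\<integral>\<^sup>+s. \<integral>\<^sup>+c. \<phi> (t + s, c) \<partial>Lb {..<n} \<partial>lborel)"
  proof (rule nn_integral_lborel_translation)
    have "(\<lambda>p. \<phi> (fst p, snd p)) \<in> borel_measurable (lborel \<Otimes>\<^sub>M Lb {..<n})" by (rule m) auto
    from sigma_finite_measure.borel_measurable_nn_integral_fst[OF V this]
    show "(\<lambda>s. \<integral>\<^sup>+c. \<phi> (s, c) \<partial>Lb {..<n}) \<in> borel_measurable borel" by simp
  qed
  also have "... = (\<integral>\<^sup>+s. \<integral>\<^sup>+w. ennreal (cmod s ^ (2 * n)) * \<phi> (s + t, \<lambda>i\<in>{..<n}. s * w i + h i) \<partial>Lb {..<n} \<partial>lborel)"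
  proof (rule nn_integral_cong_AE)
    have "AE s in lborel. s \<notin> {0 :: complex}" by (rule AE_lborel_finite) simp
    then show "AE s in lborel. (\<integral>\<^sup>+c. \<phi> (t + s, c) \<partial>Lb {..<n}) =
      (\<integral>\<^sup>+w. ennreal (cmod s ^ (2 * n)) * \<phi> (s + t, \<lambda>i\<in>{..<n}. s * w i + h i) \<partial>Lb {..<n})"
    proof eventually_elim
      case (elim s)
      have eq: "(\<lambda>i\<in>{..<n}. (\<Sum>j<n. (if i = j then s else 0) * x j) + h i) = (\<lambda>i\<in>{..<n}. s * x i + h i)" for x
      proof (rule restrict_ext)
        fix i assume "i \<in> {..<n}"
        have "(\<Sum>j<n. (if i = j then s else 0) * x j) = (\<Sum>j<n. if i = j then s * x j else 0)"
          by (intro sum.cong) auto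
        with \<open>i \<in> {..<n}\<close> show "(\<Sum>j<n. (if i = j then s else 0) * x j) + h i = s * x i + h i" by simp
      qed
      have "(\<integral>\<^sup>+c. \<phi> (t + s, c) \<partial>Lb {..<n}) = ennreal ((cmod (dt n (\<lambda>i j. if i = j then s else 0)))\<^sup>2) *
         (\<integral>\<^sup>+x. \<phi> (t + s, \<lambda>i\<in>{..<n}. (\<Sum>j<n. (if i = j then s else 0) * x j) + h i) \<partial>Lb {..<n})"
        using elim by (intro nn_integral_Lb_linear m) (auto simp: dt_scalar)
      also have "... = ennreal (cmod s ^ (2 * n)) * (\<integral>\<^sup>+x. \<phi> (s + t, \<lambda>i\<in>{..<n}. s * x i + h i) \<partial>Lb {..<n})"
        unfolding eq by (simp add: dt_scalar norm_power power_mult[symmetric] mult.commute add.commute)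
      also have "... = (\<integral>\<^sup>+w. ennreal (cmod s ^ (2 * n)) * \<phi> (s + t, \<lambda>i\<in>{..<n}. s * w i + h i) \<partial>Lb {..<n})"
        by (rule nn_integral_cmult[symmetric])
           (intro m borel_measurable_const measurable_into_Lb borel_measurable_add borel_measurable_times
             borel_measurable_component[OF measurable_ident_sets[OF refl]], auto)
      finally show ?case .
    qed
  qed
  also have "... = (\<integral>\<^sup>+l. ennreal (cmod (fst l) ^ (2 * n)) * \<phi> (fst l + t, \<lambda>i\<in>{..<n}. fst l * snd l i + h i) \<partial>CM n)"
    by (subst nn_integral_CM[OF cm2]) simp
  finally show ?thesis .
qed

text \<open>For fixed last rows r this is a translation of the leading blocks by the rank one
  matrices with entries w_i r_j.\<close>

lemma nn_integral_IM_change: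
  assumes \<psi>: "\<psi> \<in> borel_measurable (IM n)"
  shows "(\<integral>\<^sup>+y. \<psi> y \<partial>IM n) = (\<integral>\<^sup>+y. \<psi> (\<lambda>(b, i, j)\<in>IX n. fst y (b, i, j) + w i * (if b then fst (snd y) j else snd (snd y) j), snd y) \<partial>IM n)"
proof -
  let ?R = "Lb {..<n} \<Otimes>\<^sub>M Lb {..<n} :: ((nat => complex) \<times> (nat => complex)) measure"
  let ?s = "\<lambda>X r. \<lambda>e\<in>IX n. X e + (case e of (b, i, j) => w i * (if b then fst r j else snd r j))"
  have X: "sigma_finite_measure (Lb (IX n))" by (rule sigma_finite_Lb) simp
  have R: "sigma_finite_measure ?R" by (intro sigma_finite_pair sigma_finite_Lb) simp_all
  have m: "(\<lambda>x. \<psi> (f x, g x)) \<in> borel_measurable M" if "f \<in> M \<rightarrow>\<^sub>M Lb (IX n)" "g \<in> M \<rightarrow>\<^sub>M ?R"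
    for f g and M :: "'x measure"
    by (rule measurable_compose[OF _ \<psi>]) (use that in \<open>auto simp: IM_def intro!: measurable_Pair\<close>)
  have sm: "(\<lambda>x. ?s (f x) (g x)) \<in> M \<rightarrow>\<^sub>M Lb (IX n)" if f: "f \<in> M \<rightarrow>\<^sub>M Lb (IX n)" and g: "g \<in> M \<rightarrow>\<^sub>M ?R"
    for f g and M :: "'x measure"
  proof (rule measurable_into_Lb)
    fix e assume "e \<in> IX n"
    then obtain b i j where e: "e = (b, i, j)" "i < n" "j < n" by (cases e) auto
    have "(\<lambda>x. fst (g x) j) \<in> borel_measurable M" "(\<lambda>x. snd (g x) j) \<in> borel_measurable M"
      using borel_measurable_component[OF measurable_compose[OF g measurable_fst]]
        borel_measurable_component[OF measurable_compose[OF g measurable_snd]] e by auto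
    moreover have "(\<lambda>x. f x e) \<in> borel_measurable M" using f \<open>e \<in> IX n\<close> by (rule borel_measurable_component)
    ultimately show "(\<lambda>x. f x e + (case e of (b, i, j) => w i * (if b then fst (g x) j else snd (g x) j))) \<in> borel_measurable M"
      unfolding e by (cases b) auto
  qed
  have "(\<integral>\<^sup>+y. \<psi> y \<partial>IM n) = (\<integral>\<^sup>+X. \<integral>\<^sup>+r. \<psi> (X, r) \<partial>?R \<partial>Lb (IX n))"
    using \<psi> unfolding IM_def by (simp add: sigma_finite_measure.nn_integral_fst[OF R])
  also have "... = (\<integral>\<^sup>+r. \<integral>\<^sup>+X. \<psi> (X, r) \<partial>Lb (IX n) \<partial>?R)"
    by (rule nn_integral_swap[OF X R]) (use \<psi> in \<open>simp add: IM_def\<close>)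
  also have "... = (\<integral>\<^sup>+r. \<integral>\<^sup>+X. \<psi> (?s X r, r) \<partial>Lb (IX n) \<partial>?R)"
    by (intro nn_integral_cong nn_integral_Lb_translation m) auto
  also have "... = (\<integral>\<^sup>+X. \<integral>\<^sup>+r. \<psi> (?s X r, r) \<partial>?R \<partial>Lb (IX n))"
  proof (rule nn_integral_swap[OF R X])
    have "(\<lambda>p. \<psi> (?s (snd p) (fst p), fst p)) \<in> borel_measurable (?R \<Otimes>\<^sub>M Lb (IX n))"
      by (intro m sm measurable_fst measurable_snd)
    then show "(\<lambda>(r, X). \<psi> (?s X r, r)) \<in> borel_measurable (?R \<Otimes>\<^sub>M Lb (IX n))" by (simp add: case_prod_beta)
  qed
  also have "... = (\<integral>\<^sup>+y. \<psi> (?s (fst y) (snd y), snd y) \<partial>IM n)"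
  proof -
    have "(\<lambda>p. \<psi> (?s (fst p) (snd p), snd p)) \<in> borel_measurable (Lb (IX n) \<Otimes>\<^sub>M ?R)"
      by (intro m sm measurable_fst measurable_snd)
    from sigma_finite_measure.nn_integral_fst[OF R this, unfolded fst_conv snd_conv] show ?thesis
      unfolding IM_def .
  qed
  also have "... = (\<integral>\<^sup>+y. \<psi> (\<lambda>(b, i, j)\<in>IX n. fst y (b, i, j) + w i * (if b then fst (snd y) j else snd (snd y) j), snd y) \<partial>IM n)"
    by (intro nn_integral_cong arg_cong[where f=\<psi>]) (auto intro!: restrict_ext)
  finally show ?thesis .
qed

text \<open>The new variables: an eigenvalue \<open>\<lambda>\<close> with eigenvector \<open>(v, 1)\<close>, a corner \<open>\<sigma>\<close> and a row elimination \<open>w\<close>, so that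
  \<open>(A, B) = (M S L, M T L)\<close> with \<open>L\<close> unipotent with last column \<open>(-v, 1)\<close>, \<open>M\<close> unipotent with last column \<open>(w, 1)\<close>, and
  \<open>S\<close>, \<open>T\<close> block triangular with corners \<open>\<sigma>\<close>, \<open>\<lambda> \<sigma>\<close>.\<close>

definition shX :: "nat => (nat => complex) => (bool \<times> nat \<times> nat => complex) \<times> (nat => complex) \<times> (nat => complex) =>
    (bool \<times> nat \<times> nat => complex)" where
  "shX n w y = (\<lambda>(b, i, j)\<in>IX n. fst y (b, i, j) + w i * (if b then fst (snd y) j else snd (snd y) j))"

definition Jn :: "nat => complex \<times> (nat => complex) => complex \<times> (nat => complex) =>
    (bool \<times> nat \<times> nat => complex) \<times> (nat => complex) \<times> (nat => complex) => bool \<times> nat \<times> nat => complex" where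
  "Jn n l q y = bjoin n (shX n (snd q) y, snd y)
     (fst q + - (\<Sum>j<n. fst (snd y) j * snd l j),
      \<lambda>i\<in>{..<n}. fst q * snd q i + - (\<Sum>j<n. shX n (snd q) y (True, i, j) * snd l j))
     (fst l * fst q - (\<Sum>j<n. snd (snd y) j * snd l j),
      \<lambda>i\<in>{..<n}. fst l * (fst q * snd q i) - (\<Sum>j<n. shX n (snd q) y (False, i, j) * snd l j))"

lemma measurable_shX:
  assumes W: "W \<in> M \<rightarrow>\<^sub>M Lb {..<n}" and Y: "Y \<in> M \<rightarrow>\<^sub>M IM n"
  shows "(\<lambda>x. shX n (W x) (Y x)) \<in> M \<rightarrow>\<^sub>M Lb (IX n)"
  unfolding shX_def
proof (rule measurable_into_Lb)
  fix e assume "e \<in> IX n"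
  then obtain b i j where e: "e = (b, i, j)" "i < n" "j < n" by (cases e) auto
  show "(\<lambda>x. case e of (b, i, j) => fst (Y x) (b, i, j) + W x i * (if b then fst (snd (Y x)) j else snd (snd (Y x)) j))
     \<in> borel_measurable M"
    unfolding e prod.case
    by (cases b; simp only: if_True if_False; intro borel_measurable_add borel_measurable_times IM_coords[OF Y]
        borel_measurable_component[OF W]) (use e in auto)
qed

lemma measurable_Jn:
  assumes L: "L \<in> M \<rightarrow>\<^sub>M CM n" and Q: "Q \<in> M \<rightarrow>\<^sub>M CM n" and Y: "Y \<in> M \<rightarrow>\<^sub>M IM n"
  shows "(\<lambda>x. Jn n (L x) (Q x) (Y x)) \<in> M \<rightarrow>\<^sub>M Lb (IX (Suc n))"
  unfolding Jn_def
proof (rule measurable_join)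
  note sh = measurable_shX[OF CM_coords(2)[OF Q] Y]
  have r: "(\<lambda>x. snd (Y x)) \<in> M \<rightarrow>\<^sub>M Lb {..<n} \<Otimes>\<^sub>M Lb {..<n}"
    using measurable_compose[OF Y[unfolded IM_def] measurable_snd] .
  show "(\<lambda>x. (shX n (snd (Q x)) (Y x), snd (Y x))) \<in> M \<rightarrow>\<^sub>M IM n"
    unfolding IM_def by (intro measurable_Pair sh r)
  show "(\<lambda>x. (fst (Q x) + - (\<Sum>j<n. fst (snd (Y x)) j * snd (L x) j),
      \<lambda>i\<in>{..<n}. fst (Q x) * snd (Q x) i + - (\<Sum>j<n. shX n (snd (Q x)) (Y x) (True, i, j) * snd (L x) j))) \<in> M \<rightarrow>\<^sub>M CM n"
    by (intro measurable_into_CM borel_measurable_add borel_measurable_uminus borel_measurable_sum borel_measurable_times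
        IM_coords[OF Y] CM_coords[OF Q] CM_coords[OF L] borel_measurable_component[OF sh]) auto
  show "(\<lambda>x. (fst (L x) * fst (Q x) - (\<Sum>j<n. snd (snd (Y x)) j * snd (L x) j),
      \<lambda>i\<in>{..<n}. fst (L x) * (fst (Q x) * snd (Q x) i) - (\<Sum>j<n. shX n (snd (Q x)) (Y x) (False, i, j) * snd (L x) j))) \<in> M \<rightarrow>\<^sub>M CM n"
    by (intro measurable_into_CM borel_measurable_diff borel_measurable_sum borel_measurable_times
        IM_coords[OF Y] CM_coords[OF Q] CM_coords[OF L] borel_measurable_component[OF sh]) auto
qed

text \<open>The composition of \<open>kac_rice\<close> with the two substitutions. Of the power
  |\<open>\<sigma>\<close>|^(2n+2), the part 2n is the Jacobian of the column scaling; the part 2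
  comes from \<open>kq\<close>, which turns into \<open>\<sigma>\<close> times the pencil
  determinant of the reduced block.\<close>

lemma pencil_change_of_variables:
  assumes f: "f \<in> borel_measurable (Lb (IX (Suc n)))"
  shows "of_nat (Suc n) * (\<integral>\<^sup>+X. f X \<partial>Lb (IX (Suc n))) =
    (\<integral>\<^sup>+l. \<integral>\<^sup>+q. \<integral>\<^sup>+y. ennreal (cmod (fst q) ^ (2 * Suc n) * (cmod (dt n (pen (fst y) (fst l))))\<^sup>2) * f (Jn n l q y)
      \<partial>IM n \<partial>CM n \<partial>CM n)"
proof -
  let ?W = "IM n \<Otimes>\<^sub>M CM n"
  have SW: "sigma_finite_measure ?W" by (intro sigma_finite_pair sigma_finite_IM sigma_finite_CM)
  define \<Phi> where "\<Phi> = (\<lambda>y p l. ennreal ((cmod (kq n y p l))\<^sup>2) * f (bjoin n y p (kr n y p l)))"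
  have \<Phi>m: "(\<lambda>x. \<Phi> (Y x) (P x) (L x)) \<in> borel_measurable M"
    if Y: "Y \<in> M \<rightarrow>\<^sub>M IM n" and P: "P \<in> M \<rightarrow>\<^sub>M CM n" and L: "L \<in> M \<rightarrow>\<^sub>M CM n" for Y P L and M :: "'x measure"
    unfolding \<Phi>_def
    using borel_measurable_kq[OF Y P L] measurable_compose[OF measurable_join[OF Y P measurable_kr[OF Y P L]] f] by measurable
  have "of_nat (Suc n) * (\<integral>\<^sup>+X. f X \<partial>Lb (IX (Suc n))) = of_nat (Suc n) * (\<integral>\<^sup>+w. \<integral>\<^sup>+q. f (bjoin n (fst w) (snd w) q) \<partial>CM n \<partial>?W)"
    by (simp only: nn_integral_join[OF f])
  also have "... = (\<integral>\<^sup>+w. of_nat (Suc n) * (\<integral>\<^sup>+q. f (bjoin n (fst w) (snd w) q) \<partial>CM n) \<partial>?W)"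
  proof (rule nn_integral_cmult[symmetric])
    from sigma_finite_measure.borel_measurable_nn_integral_fst[OF sigma_finite_CM measurable_compose[OF measurable_join_id f]]
    show "(\<lambda>w. \<integral>\<^sup>+q. f (bjoin n (fst w) (snd w) q) \<partial>CM n) \<in> borel_measurable ?W" by simp
  qed
  also have "... = (\<integral>\<^sup>+w. \<integral>\<^sup>+l. \<Phi> (fst w) (snd w) l \<partial>CM n \<partial>?W)"
  proof (rule nn_integral_cong_AE)
    have "AE X in Lb (IX (Suc n)). dt (Suc n) (ea X) \<noteq> 0 \<and> dt n (ea X) \<noteq> 0 \<and>
       (\<forall>z. \<not> (dt (Suc n) (pen X z) = 0 \<and> dt n (pen X z) = 0))"
    proof -
      have r: "dt n (ea (restrict X (IX n))) = dt n (ea X)" for X by (rule dt_cong) simp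
      have "AE X in Lb (IX (Suc n)). dt n (ea X) \<noteq> 0"
      proof -
        have "IX n \<subseteq> IX (Suc n)" by (auto simp: IX_def)
        from AE_Lb_restrict[OF finite_IX this generic_pencil]
        have "AE X in Lb (IX (Suc n)). dt n (ea (restrict X (IX n))) \<noteq> 0" by eventually_elim blast
        then show ?thesis unfolding r .
      qed
      with generic_pencil[of "Suc n"] show ?thesis by eventually_elim simp
    qed
    from AE_join[OF this] AE_space
    show "AE w in ?W. of_nat (Suc n) * (\<integral>\<^sup>+q. f (bjoin n (fst w) (snd w) q) \<partial>CM n) = (\<integral>\<^sup>+l. \<Phi> (fst w) (snd w) l \<partial>CM n)"
    proof eventually_elim
      case (elim w)
      obtain X ra rb sa ca where w: "w = ((X, (ra, rb)), (sa, ca))" by (metis prod.exhaust)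
      let ?b = "\<lambda>q. bjoin n (fst w) (snd w) q"
      have e1: "dt (Suc n) (ea (?b q)) = dt (Suc n) (bmat n (ea X) ca ra sa)" for q
        by (rule dt_cong) (auto simp: bjoin_def w)
      have e2: "dt n (ea (?b q)) = dt n (ea X)" for q
        by (rule dt_cong) (auto simp: bjoin_def w bmat_def)
      have e3: "dt n (pen (?b q) z) = dt n (pen X z)" for q z
        by (rule dt_cong) (auto simp: bjoin_def w bmat_def)
      have e4: "dt (Suc n) (pen (?b (sb, cb)) z) =
        dt (Suc n) (\<lambda>i j. z * bmat n (ea X) ca ra sa i j - bmat n (\<lambda>i j. X (False, i, j)) cb rb sb i j)" for sb cb z
        by (rule dt_cong) (auto simp: bjoin_def w)
      have e5: "dt (Suc n) (\<lambda>i j. z * bmat n (ea X) ca ra sa i j - bmat n (\<lambda>i j. X (False, i, j)) cb rb sb i j) =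
        dt (Suc n) (\<lambda>i j. z * bmat n (ea X) ca ra sa i j - bmat n (\<lambda>i j. X (False, i, j)) cb rb 0 i j) - sb * dt n (pen X z)" for sb cb z
        unfolding bmat_pencil[symmetric]
        using dt_bmat_corner[of n "pen X z" "\<lambda>i. z * ca i - cb i" "\<lambda>j. z * ra j - rb j" "z * sa" "- sb"] by simp
      define G where "G = (\<lambda>cb. \<forall>z. dt n (pen X z) = 0 \<longrightarrow>
         dt (Suc n) (\<lambda>i j. z * bmat n (ea X) ca ra sa i j - bmat n (\<lambda>i j. X (False, i, j)) cb rb 0 i j) \<noteq> 0)"
      have aeq: "AE q in CM n. dt (Suc n) (bmat n (ea X) ca ra sa) \<noteq> 0 \<and> dt n (ea X) \<noteq> 0 \<and> G (snd q)"
        using elim(1)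
      proof eventually_elim
        case (elim q)
        obtain sb cb where q: "q = (sb, cb)" by (cases q)
        have h: "dt (Suc n) (ea (?b q)) \<noteq> 0" "dt n (ea (?b q)) \<noteq> 0"
          "\<And>z. \<not> (dt (Suc n) (pen (?b q) z) = 0 \<and> dt n (pen (?b q) z) = 0)"
          using elim by blast+
        have "G cb"
          unfolding G_def
        proof (intro allI impI notI)
          fix z assume z0: "dt n (pen X z) = 0"
            and E: "dt (Suc n) (\<lambda>i j. z * bmat n (ea X) ca ra sa i j - bmat n (\<lambda>i j. X (False, i, j)) cb rb 0 i j) = 0"
          have "dt (Suc n) (pen (?b q) z) = 0" unfolding q e4 e5[of z cb sb] E z0 by simp
          moreover have "dt n (pen (?b q) z) = 0" unfolding e3 by (rule z0)
          ultimately show False using h(3) by blast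
        qed
        then show ?case using h(1,2) unfolding e1 e2 q by simp
      qed
      interpret pair_sigma_finite "lborel :: complex measure" "Lb {..<n}"
        by (intro pair_sigma_finite.intro sigma_finite_lborel sigma_finite_Lb) simp
      have ae: "AE s in (lborel :: complex measure). AE c in Lb {..<n}. dt (Suc n) (bmat n (ea X) ca ra sa) \<noteq> 0 \<and> dt n (ea X) \<noteq> 0 \<and> G c"
        using AE_pair[OF aeq[unfolded CM_def]] by simp
      \<comment> \<open>The statement inside does not involve the corner \<open>s\<close>, so
        holding for almost every \<open>s\<close> it simply holds.\<close>
      have nl: "ae_filter (lborel :: complex measure) \<noteq> bot" by (simp add: ae_filter_eq_bot_iff)
      have ae: "AE c in Lb {..<n}. dt (Suc n) (bmat n (ea X) ca ra sa) \<noteq> 0 \<and> dt n (ea X) \<noteq> 0 \<and> G c"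
        by (rule iffD1[OF eventually_const[OF nl] ae])
      have nb: "ae_filter (Lb {..<n}) \<noteq> bot"
      proof -
        have "emeasure (Lb {..<n}) (space (Lb {..<n})) = (\<Prod>i<n. emeasure (lborel :: complex measure) (space lborel))"
          unfolding space_PiM by (rule lborel_product.emeasure_PiM) auto
        then show ?thesis by (simp add: ae_filter_eq_bot_iff)
      qed
      then have d: "dt (Suc n) (bmat n (ea X) ca ra sa) \<noteq> 0" "dt n (ea X) \<noteq> 0"
        using eventually_happens[OF ae] nb by blast+
      have wsp: "(X, (ra, rb)) \<in> space (IM n)" "(sa, ca) \<in> space (CM n)"
        using elim(2) by (auto simp: w space_pair_measure)
      have "of_nat (Suc n) * (\<integral>\<^sup>+q. f (?b q) \<partial>CM n) = (\<integral>\<^sup>+l. ennreal ((cmod (kq n (X, (ra, rb)) (sa, ca) l))\<^sup>2) *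
          f (?b (kr n (X, (ra, rb)) (sa, ca) l)) \<partial>CM n)"
      proof (rule kac_rice[OF d(2,1)])
        show "AE cb in Lb {..<n}. \<forall>z. dt n (pen X z) = 0 \<longrightarrow>
         dt (Suc n) (\<lambda>i j. z * bmat n (ea X) ca ra sa i j - bmat n (\<lambda>i j. X (False, i, j)) cb rb 0 i j) \<noteq> 0"
          using ae by eventually_elim (simp add: G_def)
        show "(\<lambda>q. f (?b q)) \<in> borel_measurable (CM n)"
          unfolding w fst_conv snd_conv
          by (intro measurable_compose[OF measurable_join f] measurable_const measurable_ident_sets[OF refl] wsp)
      qed
      then show ?case by (simp add: \<Phi>_def w)
    qed
  qed
  also have "... = (\<integral>\<^sup>+l. \<integral>\<^sup>+w. \<Phi> (fst w) (snd w) l \<partial>?W \<partial>CM n)"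
  proof (rule nn_integral_swap[OF SW sigma_finite_CM])
    have "(\<lambda>x. \<Phi> (fst (fst x)) (snd (fst x)) (snd x)) \<in> borel_measurable (?W \<Otimes>\<^sub>M CM n)"
      by (rule \<Phi>m) auto
    then show "(\<lambda>(w, l). \<Phi> (fst w) (snd w) l) \<in> borel_measurable (?W \<Otimes>\<^sub>M CM n)" by (simp add: case_prod_beta)
  qed
  also have "... = (\<integral>\<^sup>+l. \<integral>\<^sup>+q. \<integral>\<^sup>+y. ennreal (cmod (fst q) ^ (2 * Suc n) * (cmod (dt n (pen (fst y) (fst l))))\<^sup>2) * f (Jn n l q y)
      \<partial>IM n \<partial>CM n \<partial>CM n)"
  proof (rule nn_integral_cong)
    fix l assume l: "l \<in> space (CM n)"
    define T where "T = (\<lambda>(y :: (bool \<times> nat \<times> nat => complex) \<times> (nat => complex) \<times> (nat => complex)) q. (fst q + - (\<Sum>j<n. fst (snd y) j * snd l j),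
       \<lambda>i\<in>{..<n}. fst q * snd q i + - (\<Sum>j<n. fst y (True, i, j) * snd l j)))"
    define \<Psi> where "\<Psi> = (\<lambda>y q. ennreal (cmod (fst q) ^ (2 * n)) * \<Phi> y (T y q) l)"
    have Tm: "(\<lambda>x. T (Y x) (Q x)) \<in> M \<rightarrow>\<^sub>M CM n" if Y: "Y \<in> M \<rightarrow>\<^sub>M IM n" and Q: "Q \<in> M \<rightarrow>\<^sub>M CM n" for Y Q and M :: "'x measure"
      unfolding T_def
      by (intro measurable_into_CM borel_measurable_add borel_measurable_uminus borel_measurable_sum borel_measurable_times
         borel_measurable_const IM_coords[OF Y] CM_coords[OF Q]) auto
    have \<Psi>m: "(\<lambda>x. \<Psi> (Y x) (Q x)) \<in> borel_measurable M" if Y: "Y \<in> M \<rightarrow>\<^sub>M IM n" and Q: "Q \<in> M \<rightarrow>\<^sub>M CM n" for Y Q and M :: "'x measure"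
      unfolding \<Psi>_def using \<Phi>m[OF Y Tm[OF Y Q] measurable_const[OF l]] CM_coords(1)[OF Q] by measurable
    have "(\<integral>\<^sup>+w. \<Phi> (fst w) (snd w) l \<partial>?W) = (\<integral>\<^sup>+y. \<integral>\<^sup>+p. \<Phi> y p l \<partial>CM n \<partial>IM n)"
      using \<Phi>m[of fst ?W snd "\<lambda>_. l"] l by (subst sigma_finite_measure.nn_integral_fst[OF sigma_finite_CM, symmetric]) auto
    also have "... = (\<integral>\<^sup>+y. \<integral>\<^sup>+q. \<Psi> y q \<partial>CM n \<partial>IM n)"
    proof (rule nn_integral_cong)
      fix y assume y: "y \<in> space (IM n)"
      show "(\<integral>\<^sup>+p. \<Phi> y p l \<partial>CM n) = (\<integral>\<^sup>+q. \<Psi> y q \<partial>CM n)"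
        unfolding \<Psi>_def T_def using y l by (intro nn_integral_CM_change \<Phi>m) auto
    qed
    also have "... = (\<integral>\<^sup>+q. \<integral>\<^sup>+y. \<Psi> y q \<partial>IM n \<partial>CM n)"
    proof (rule nn_integral_swap[OF sigma_finite_IM sigma_finite_CM])
      have "(\<lambda>x. \<Psi> (fst x) (snd x)) \<in> borel_measurable (IM n \<Otimes>\<^sub>M CM n)" by (rule \<Psi>m) auto
      then show "(\<lambda>(y, q). \<Psi> y q) \<in> borel_measurable (IM n \<Otimes>\<^sub>M CM n)" by (simp add: case_prod_beta)
    qed
    also have "... = (\<integral>\<^sup>+q. \<integral>\<^sup>+y. ennreal (cmod (fst q) ^ (2 * Suc n) * (cmod (dt n (pen (fst y) (fst l))))\<^sup>2) * f (Jn n l q y) \<partial>IM n \<partial>CM n)"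
    proof (rule nn_integral_cong)
      fix q assume q: "q \<in> space (CM n)"
      have "(\<integral>\<^sup>+y. \<Psi> y q \<partial>IM n) = (\<integral>\<^sup>+y. \<Psi> (shX n (snd q) y, snd y) q \<partial>IM n)"
        unfolding shX_def using q by (intro nn_integral_IM_change \<Psi>m) auto
      also have "... = (\<integral>\<^sup>+y. ennreal (cmod (fst q) ^ (2 * Suc n) * (cmod (dt n (pen (fst y) (fst l))))\<^sup>2) * f (Jn n l q y) \<partial>IM n)"
      proof (rule nn_integral_cong)
        fix y :: "(bool \<times> nat \<times> nat => complex) \<times> (nat => complex) \<times> (nat => complex)"
        obtain X ra rb where y: "y = (X, (ra, rb))" by (metis prod.exhaust)
        obtain \<sigma> w where q: "q = (\<sigma>, w)" by (metis prod.exhaust)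
        obtain z v where l: "l = (z, v)" by (metis prod.exhaust)
        define Y where "Y = (shX n w y, (ra, rb))"
        define P where "P = T Y (\<sigma>, w)"
        \<comment> \<open>Elimination with the corner \<open>\<sigma>\<close> as pivot removes the
          rank one shear by \<open>w\<close>; for \<open>\<sigma> = 0\<close> the whole last column
          is zero.\<close>
        have kq: "kq n Y P l = \<sigma> * dt n (pen X z)"
        proof (cases "\<sigma> = 0")
          case False
          have "kq n Y P l = dt (Suc n) (bmat n (\<lambda>i j. pen X z i j + w i * (z * ra j - rb j)) (\<lambda>i. \<sigma> * w i) (\<lambda>j. z * ra j - rb j) \<sigma>)"
            unfolding kq_def by (rule dt_cong) (auto simp: bmat_def P_def T_def Y_def l shX_def y algebra_simps)
          also have "... = \<sigma> * dt n (pen X z)"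
            by (subst dt_Schur_last) (use False in \<open>auto simp: bmat_def intro!: dt_cong\<close>)
          finally show ?thesis .
        next
          case True
          have "kq n Y P l = dt (Suc n) (bmat n (\<lambda>i j. pen X z i j + w i * (z * ra j - rb j)) (\<lambda>i. 0) (\<lambda>j. z * ra j - rb j) 0)"
            unfolding kq_def by (rule dt_cong) (auto simp: bmat_def P_def T_def Y_def l shX_def y True algebra_simps)
          also have "... = 0" by (simp add: dt_bmat_lower)
          finally show ?thesis using True by simp
        qed
        have kr: "kr n Y P l = (z * \<sigma> - (\<Sum>j<n. rb j * v j), \<lambda>i\<in>{..<n}. z * (\<sigma> * w i) - (\<Sum>j<n. shX n w y (False, i, j) * v j))"
        proof -
          have 1: "(\<Sum>j<n. (z * a j - b j) * v j) + z * (s + - (\<Sum>j<n. a j * v j)) = z * s - (\<Sum>j<n. b j * v j)" for a b s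
            by (simp add: left_diff_distrib sum_subtractf sum_distrib_left algebra_simps)
          show ?thesis
            unfolding kr_def Y_def P_def T_def l fst_conv snd_conv
            by (intro arg_cong2[where f=Pair] restrict_ext) (simp_all only: 1 restrict_apply' mult.assoc)
        qed
        have J: "bjoin n Y P (kr n Y P l) = Jn n l q y"
          unfolding kr Jn_def by (simp add: Y_def P_def T_def l q y)
        have "\<Psi> (shX n (snd q) y, snd y) q = ennreal (cmod \<sigma> ^ (2 * n)) * \<Phi> Y P l"
          by (simp add: \<Psi>_def Y_def P_def q y)
        also have "... = ennreal (cmod \<sigma> ^ (2 * n)) * (ennreal ((cmod (\<sigma> * dt n (pen X z)))\<^sup>2) * f (Jn n l q y))"
          by (simp add: \<Phi>_def kq J)
        also have "... = ennreal (cmod \<sigma> ^ (2 * Suc n) * (cmod (dt n (pen X z)))\<^sup>2) * f (Jn n l q y)"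
        proof -
          have r: "cmod \<sigma> ^ (2 * n) * (cmod (\<sigma> * dt n (pen X z)))\<^sup>2 = cmod \<sigma> ^ (2 * Suc n) * (cmod (dt n (pen X z)))\<^sup>2"
            by (simp add: norm_mult power_mult_distrib power2_eq_square mult_ac)
          show ?thesis
            unfolding mult.assoc[symmetric] r[symmetric] by (subst ennreal_mult) simp_all
        qed
        finally show "\<Psi> (shX n (snd q) y, snd y) q = ennreal (cmod (fst q) ^ (2 * Suc n) * (cmod (dt n (pen (fst y) (fst l))))\<^sup>2) * f (Jn n l q y)"
          by (simp add: q l y)
      qed
      finally show "(\<integral>\<^sup>+y. \<Psi> y q \<partial>IM n) = (\<integral>\<^sup>+y. ennreal (cmod (fst q) ^ (2 * Suc n) * (cmod (dt n (pen (fst y) (fst l))))\<^sup>2) * f (Jn n l q y) \<partial>IM n)" .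
    qed
    finally show "(\<integral>\<^sup>+w. \<Phi> (fst w) (snd w) l \<partial>?W) = (\<integral>\<^sup>+q. \<integral>\<^sup>+y. ennreal (cmod (fst q) ^ (2 * Suc n) * (cmod (dt n (pen (fst y) (fst l))))\<^sup>2) * f (Jn n l q y) \<partial>IM n \<partial>CM n)" .
  qed
  finally show ?thesis .
qed

subsection \<open>The law of the eigenvalues\<close>

text \<open>The squared Frobenius norm of the product \<open>\<pi>\<close>^T a
  \<open>\<rho>\<close>. Unit vectors give the sum of the |a_ij|^2 in the Gaussian density; general
  vectors are forced by the induction, since splitting off a row and a column replaces them by the
  systems \<open>p2\<close> and \<open>rt\<close> of \<open>qf_decompose\<close>.\<close>

definition qf :: "nat => (nat => nat => complex) => (nat => nat => complex) => nat => (nat => nat => complex) => real" where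
  "qf N \<pi> \<rho> n a = (\<Sum>t<N. \<Sum>s<N. (cmod (\<Sum>i<n. \<Sum>j<n. a i j * \<pi> i s * \<rho> j t))\<^sup>2)"

abbreviation eb :: "(bool \<times> nat \<times> nat => complex) => nat => nat => complex" where
  "eb X \<equiv> \<lambda>i j. X (False, i, j)"

text \<open>For invertible A the monic polynomial with the eigenvalues of A^-1 B as roots, kept as a
  function: the law of the unordered eigenvalues is tested on it.\<close>

definition chi :: "nat => (bool \<times> nat \<times> nat => complex) => complex => complex" where
  "chi n X z = dt n (pen X z) / dt n (ea X)"

abbreviation FM :: "(complex => complex) measure" where
  "FM \<equiv> PiM UNIV (\<lambda>_. borel)"

text \<open>The exponent \<open>k\<close> counts the eigenvalues already split off: each step
  rewrites |det(l A - B)|^2 as |det A|^2 |chi(l)|^2.\<close>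

definition gw :: "nat => nat => nat => (nat => nat => complex) => (nat => nat => complex) => (bool \<times> nat \<times> nat => complex) => real" where
  "gw N n k \<pi> \<rho> X = cmod (dt n (ea X)) ^ (2 * k) * exp (- qf N \<pi> \<rho> n (ea X) - qf N \<pi> \<rho> n (eb X))"

definition GI :: "nat => nat => nat => (nat => nat => complex) => (nat => nat => complex) => ((complex => complex) => ennreal) => ennreal" where
  "GI N n k \<pi> \<rho> F = (\<integral>\<^sup>+X. ennreal (gw N n k \<pi> \<rho> X) * F (chi n X) \<partial>Lb (IX n))"

text \<open>The candidate density of the roots. The parameter \<open>M\<close> stands for n + k,
  which is constant along the induction; \<open>M = n\<close> gives the exponent n + 1 of the
  spherical ensemble.\<close>

definition JJ :: "nat => nat => ((complex => complex) => ennreal) => ennreal" where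
  "JJ M n F = (\<integral>\<^sup>+x. ennreal ((\<Prod>i<n. 1 / (1 + (cmod (x i))\<^sup>2) ^ Suc M) * (\<Prod>i<n. \<Prod>k<i. (cmod (x i - x k))\<^sup>2)) *
     F (\<lambda>z. \<Prod>i<n. (z - x i)) \<partial>Lb {..<n})"

text \<open>The factor |p(l)|^2 is the part of the squared Vandermonde product that involves the
  root \<open>l\<close>.\<close>

definition add_root :: "((complex => complex) => ennreal) => complex => (complex => complex) => ennreal" where
  "add_root F l p = ennreal ((cmod (p l))\<^sup>2) * F (\<lambda>z. (z - l) * p z)"

lemma measurable_into_FM: "(\<And>z. (\<lambda>x. f x z) \<in> borel_measurable M) ==> f \<in> M \<rightarrow>\<^sub>M FM"
  by (rule measurable_PiM_single') (auto simp: space_PiM)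

lemma measurable_FM_apply: "(\<lambda>p. p z) \<in> borel_measurable FM"
  by (rule measurable_component_singleton) simp

lemma measurable_add_root [measurable]:
  assumes "F \<in> borel_measurable FM"
  shows "add_root F l \<in> borel_measurable FM"
proof -
  note [measurable] = measurable_FM_apply
  have "(\<lambda>p z. (z - l) * p z) \<in> FM \<rightarrow>\<^sub>M FM"
    by (rule measurable_into_FM) measurable
  from measurable_compose[OF this assms] show ?thesis
    unfolding add_root_def by measurable
qed

lemma JJ_measurable:
  fixes f :: "'b => nat => complex"
  assumes F: "F \<in> borel_measurable FM" and x: "\<And>i. i < n ==> (\<lambda>y. f y i) \<in> borel_measurable M"
  shows "(\<lambda>y. ennreal ((\<Prod>i<n. 1 / (1 + (cmod (f y i))\<^sup>2) ^ Suc m) * (\<Prod>i<n. \<Prod>k<i. (cmod (f y i - f y k))\<^sup>2)) *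
     F (\<lambda>z. \<Prod>i<n. (z - f y i))) \<in> borel_measurable M"
proof -
  have "(\<lambda>y z. \<Prod>i<n. (z - f y i)) \<in> M \<rightarrow>\<^sub>M FM"
    by (intro measurable_into_FM borel_measurable_prod borel_measurable_diff borel_measurable_const x) simp
  from measurable_compose[OF this F] have "(\<lambda>y. F (\<lambda>z. \<Prod>i<n. (z - f y i))) \<in> borel_measurable M" .
  moreover have "(\<lambda>y. cmod (f y i)) \<in> borel_measurable M" if "i < n" for i
    using x[OF that] by measurable
  then have "(\<lambda>y. \<Prod>i<n. 1 / (1 + (cmod (f y i))\<^sup>2) ^ Suc m) \<in> borel_measurable M"
    by (intro borel_measurable_prod borel_measurable_divide borel_measurable_power borel_measurable_add borel_measurable_const) simp
  moreover have "(\<lambda>y. cmod (f y i - f y k)) \<in> borel_measurable M" if "i < n" "k < i" for i k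
  proof -
    have "k < n" using that by linarith
    from x[OF this] x[OF that(1)] show ?thesis by measurable
  qed
  then have "(\<lambda>y. (cmod (f y i - f y k))\<^sup>2) \<in> borel_measurable M" if "i < n" "k < i" for i k
    using that by (intro borel_measurable_power)
  then have "(\<lambda>y. \<Prod>i<n. \<Prod>k<i. (cmod (f y i - f y k))\<^sup>2) \<in> borel_measurable M"
    by (intro borel_measurable_prod) simp
  ultimately show ?thesis by measurable
qed

lemma JJ_0: "JJ M 0 F = F (\<lambda>z. 1)"
  by (simp add: JJ_def PiM_empty nn_integral_count_space_finite)

lemma JJ_Suc:
  assumes F: "F \<in> borel_measurable FM"
  shows "JJ M (Suc n) F = (\<integral>\<^sup>+l. ennreal (1 / (1 + (cmod l)\<^sup>2) ^ Suc M) * JJ M n (add_root F l) \<partial>lborel)"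
    and "(\<lambda>l. ennreal (1 / (1 + (cmod l)\<^sup>2) ^ Suc M) * JJ M n (add_root F l)) \<in> borel_measurable borel"
proof -
  let ?f = "\<lambda>x. ennreal ((\<Prod>i<Suc n. 1 / (1 + (cmod (x i))\<^sup>2) ^ Suc M) * (\<Prod>i<Suc n. \<Prod>k<i. (cmod (x i - x k))\<^sup>2)) *
     F (\<lambda>z. \<Prod>i<Suc n. (z - x i))"
  let ?g = "\<lambda>x. ennreal ((\<Prod>i<n. 1 / (1 + (cmod (x i))\<^sup>2) ^ Suc M) * (\<Prod>i<n. \<Prod>k<i. (cmod (x i - x k))\<^sup>2))"
  have I: "{..<Suc n} = insert n {..<n}" "finite {..<n}" "n \<notin> {..<n}" by auto
  have fm: "?f \<in> borel_measurable (Lb (insert n {..<n}))"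
    by (rule JJ_measurable[OF F]) (rule borel_measurable_component[where I="insert n {..<n}"], auto)
  have split: "?f (x(n := l)) = ennreal (1 / (1 + (cmod l)\<^sup>2) ^ Suc M) * (?g x * add_root F l (\<lambda>z. \<Prod>i<n. (z - x i)))" for x l
  proof -
    have e1: "(\<Prod>i<Suc n. 1 / (1 + (cmod ((x(n := l)) i))\<^sup>2) ^ Suc M) = (\<Prod>i<n. 1 / (1 + (cmod (x i))\<^sup>2) ^ Suc M) * (1 / (1 + (cmod l)\<^sup>2) ^ Suc M)"
      by simp
    have e2: "(\<Prod>i<Suc n. \<Prod>k<i. (cmod ((x(n := l)) i - (x(n := l)) k))\<^sup>2) = (\<Prod>i<n. \<Prod>k<i. (cmod (x i - x k))\<^sup>2) * (cmod (\<Prod>k<n. (l - x k)))\<^sup>2"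
      by (simp add: prod_norm[symmetric] prod_power_distrib)
    have e3: "(\<lambda>z. \<Prod>i<Suc n. (z - (x(n := l)) i)) = (\<lambda>z. (z - l) * (\<Prod>i<n. (z - x i)))"
      by (simp add: mult.commute)
    have n1: "0 \<le> (\<Prod>i<n. 1 / (1 + (cmod (x i))\<^sup>2) ^ Suc M)" and n2: "0 \<le> (\<Prod>i<n. \<Prod>k<i. (cmod (x i - x k))\<^sup>2)"
      by (auto intro!: prod_nonneg)
    show ?thesis
      unfolding e1 e2 e3 add_root_def
      using n1 n2 by (simp only: ennreal_mult mult_nonneg_nonneg zero_le_power2 divide_nonneg_nonneg zero_le_one
          zero_le_power add_nonneg_nonneg mult_ac)
  qed
  have gm: "(\<lambda>x. ?g x * add_root F l (\<lambda>z. \<Prod>i<n. (z - x i))) \<in> borel_measurable (Lb {..<n})" for l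
    by (rule JJ_measurable[OF measurable_add_root[OF F]]) (rule borel_measurable_component[where I="{..<n}"], auto)
  have eq: "(\<integral>\<^sup>+x. ?f (x(n := l)) \<partial>Lb {..<n}) = ennreal (1 / (1 + (cmod l)\<^sup>2) ^ Suc M) * JJ M n (add_root F l)" for l
    unfolding split JJ_def by (rule nn_integral_cmult[OF gm])
  show "JJ M (Suc n) F = (\<integral>\<^sup>+l. ennreal (1 / (1 + (cmod l)\<^sup>2) ^ Suc M) * JJ M n (add_root F l) \<partial>lborel)"
    unfolding eq[symmetric] unfolding JJ_def
    by (rule lborel_product.product_nn_integral_insert_rev[OF I(2,3) fm, folded I(1)])
  show "(\<lambda>l. ennreal (1 / (1 + (cmod l)\<^sup>2) ^ Suc M) * JJ M n (add_root F l)) \<in> borel_measurable borel"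
  proof -
    have "(\<lambda>(l, x). x(n := l)) \<in> lborel \<Otimes>\<^sub>M Lb {..<n} \<rightarrow>\<^sub>M Lb (insert n {..<n})" by measurable
    from measurable_compose[OF this fm]
    have "(\<lambda>p. ?f ((snd p)(n := fst p))) \<in> borel_measurable (lborel \<Otimes>\<^sub>M Lb {..<n})" by (simp only: case_prod_beta)
    from sigma_finite_measure.borel_measurable_nn_integral_fst[OF sigma_finite_Lb this]
    show ?thesis unfolding eq[symmetric] by simp
  qed
qed

section \<open>Orthogonal splitting of the Gaussian exponent\<close>

lemma sum_norm_square: "complex_of_real (\<Sum>s\<in>S. (cmod (a s))\<^sup>2) = (\<Sum>s\<in>S. a s * cnj (a s))"
  by (simp only: of_real_sum complex_norm_square)

lemma complex_pythagoras:
  fixes a b :: "nat => complex"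
  assumes "(\<Sum>s\<in>S. a s * cnj (b s)) = 0"
  shows "(\<Sum>s\<in>S. (cmod (a s + c * b s))\<^sup>2) = (\<Sum>s\<in>S. (cmod (a s))\<^sup>2) + (cmod c)\<^sup>2 * (\<Sum>s\<in>S. (cmod (b s))\<^sup>2)"
proof -
  have "complex_of_real (\<Sum>s\<in>S. (cmod (a s + c * b s))\<^sup>2) = (\<Sum>s\<in>S. (a s + c * b s) * cnj (a s + c * b s))"
    by (rule sum_norm_square)
  also have "... = (\<Sum>s\<in>S. a s * cnj (a s)) + cnj c * (\<Sum>s\<in>S. a s * cnj (b s)) + c * cnj (\<Sum>s\<in>S. a s * cnj (b s)) + c * cnj c * (\<Sum>s\<in>S. b s * cnj (b s))"
    by (simp add: algebra_simps sum.distrib sum_distrib_left)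
  also have "... = complex_of_real ((\<Sum>s\<in>S. (cmod (a s))\<^sup>2) + (cmod c)\<^sup>2 * (\<Sum>s\<in>S. (cmod (b s))\<^sup>2))"
    unfolding assms of_real_add of_real_mult sum_norm_square complex_norm_square by simp
  finally show ?thesis unfolding of_real_eq_iff .
qed

text \<open>Orthogonal projection onto a span, one Gram-Schmidt step per vector. The vectors may be
  dependent: if the residual \<open>h\<close> of \<open>\<rho> n\<close> vanishes, any coefficient
  serves, and division by zero supplies 0.\<close>

lemma exists_projection:
  fixes \<rho> :: "nat => nat => complex"
  shows "\<exists>u. \<forall>j<n. (\<Sum>t<N. \<rho> j t * cnj (\<xi> t - (\<Sum>l<n. u l * \<rho> l t))) = 0"
proof (induction n arbitrary: \<xi>)
  case (Suc n)
  obtain a where a: "\<And>j. j < n ==> (\<Sum>t<N. \<rho> j t * cnj (\<xi> t - (\<Sum>l<n. a l * \<rho> l t))) = 0" using Suc[of \<xi>] by blast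
  obtain b where b: "\<And>j. j < n ==> (\<Sum>t<N. \<rho> j t * cnj (\<rho> n t - (\<Sum>l<n. b l * \<rho> l t))) = 0" using Suc[of "\<rho> n"] by blast
  define x where "x = (\<lambda>t. \<xi> t - (\<Sum>l<n. a l * \<rho> l t))"
  define h where "h = (\<lambda>t. \<rho> n t - (\<Sum>l<n. b l * \<rho> l t))"
  define \<tau> where "\<tau> = (\<Sum>t<N. x t * cnj (h t)) / (\<Sum>t<N. h t * cnj (h t))"
  define u where "u = (\<lambda>l. if l = n then \<tau> else a l - \<tau> * b l)"
  have res: "\<xi> t - (\<Sum>l<Suc n. u l * \<rho> l t) = x t - \<tau> * h t" for t
    by (simp add: u_def x_def h_def left_diff_distrib right_diff_distrib sum_subtractf sum_distrib_left mult.assoc)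
  have hx: "(\<Sum>t<N. h t * cnj (x t - \<tau> * h t)) = 0"
  proof (cases "(\<Sum>t<N. h t * cnj (h t)) = 0")
    case True
    have "complex_of_real (\<Sum>t<N. (cmod (h t))\<^sup>2) = 0" using True by (simp only: sum_norm_square)
    then have "(\<Sum>t<N. (cmod (h t))\<^sup>2) = 0" unfolding of_real_eq_0_iff .
    then have "h t = 0" if "t < N" for t using that by (simp add: sum_nonneg_eq_0_iff)
    then show ?thesis by simp
  next
    case False
    have "(\<Sum>t<N. (x t - \<tau> * h t) * cnj (h t)) = (\<Sum>t<N. x t * cnj (h t)) - \<tau> * (\<Sum>t<N. h t * cnj (h t))"
      by (simp add: left_diff_distrib sum_subtractf sum_distrib_left mult.assoc)
    also have "... = 0" using False by (simp add: \<tau>_def)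
    finally have "cnj (\<Sum>t<N. (x t - \<tau> * h t) * cnj (h t)) = 0" by simp
    then show ?thesis by (simp add: mult.commute)
  qed
  have low: "(\<Sum>t<N. \<rho> j t * cnj (x t - \<tau> * h t)) = 0" if "j < n" for j
  proof -
    have "(\<Sum>t<N. \<rho> j t * cnj (x t - \<tau> * h t)) = (\<Sum>t<N. \<rho> j t * cnj (x t)) - cnj \<tau> * (\<Sum>t<N. \<rho> j t * cnj (h t))"
      by (simp add: right_diff_distrib sum_subtractf sum_distrib_left mult_ac)
    then show ?thesis using a[OF that] b[OF that] unfolding x_def h_def by simp
  qed
  have "(\<Sum>t<N. \<rho> j t * cnj (x t - \<tau> * h t)) = 0" if "j < Suc n" for j
  proof (cases "j = n")
    case True
    have "(\<Sum>t<N. \<rho> n t * cnj (x t - \<tau> * h t)) =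
       (\<Sum>t<N. h t * cnj (x t - \<tau> * h t)) + (\<Sum>l<n. b l * (\<Sum>t<N. \<rho> l t * cnj (x t - \<tau> * h t)))"
    proof -
      have "\<rho> n t * cnj (x t - \<tau> * h t) = h t * cnj (x t - \<tau> * h t) + (\<Sum>l<n. b l * (\<rho> l t * cnj (x t - \<tau> * h t)))" for t
        by (simp add: h_def[of] left_diff_distrib sum_distrib_right mult.assoc)
      then show ?thesis
        by (simp only: sum.distrib sum_distrib_left) (subst sum.swap, rule refl)
    qed
    then show ?thesis using True hx low by simp
  qed (use low that in auto)
  then show ?case unfolding res[symmetric] by blast
qed simp

lemma borel_measurable_qf:
  assumes "\<And>i j. i < n ==> j < n ==> (\<lambda>x. a x i j) \<in> borel_measurable M"
  shows "(\<lambda>x. qf N \<pi> \<rho> n (a x)) \<in> borel_measurable M"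
proof -
  have "(\<lambda>x. \<Sum>i<n. \<Sum>j<n. a x i j * \<pi> i s * \<rho> j t) \<in> borel_measurable M" for s t
    by (intro borel_measurable_sum borel_measurable_times borel_measurable_const assms) auto
  then show ?thesis unfolding qf_def by measurable
qed

lemma measurable_chi:
  assumes "X \<in> M \<rightarrow>\<^sub>M Lb (IX n)"
  shows "(\<lambda>x. chi n (X x)) \<in> M \<rightarrow>\<^sub>M FM"
  unfolding chi_def
  by (intro measurable_into_FM borel_measurable_divide borel_measurable_pen[OF assms] borel_measurable_ea[OF assms]) auto

lemma borel_measurable_gw:
  assumes X: "X \<in> M \<rightarrow>\<^sub>M Lb (IX n)"
  shows "(\<lambda>x. gw N n k \<pi> \<rho> (X x)) \<in> borel_measurable M"
proof -
  have [measurable]: "(\<lambda>x. dt n (ea (X x))) \<in> borel_measurable M" by (rule borel_measurable_ea[OF X]) simp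
  have [measurable]: "(\<lambda>x. qf N \<pi> \<rho> n (ea (X x))) \<in> borel_measurable M" "(\<lambda>x. qf N \<pi> \<rho> n (eb (X x))) \<in> borel_measurable M"
    by (intro borel_measurable_qf borel_measurable_component[OF X]; simp)+
  show ?thesis unfolding gw_def by measurable
qed

text \<open>Pythagoras twice. In the index \<open>s\<close> every entry splits into a part
  orthogonal to \<open>pt\<close> and a multiple of \<open>pt\<close>; in the index \<open>t\<close>
  that multiple splits into a part in the span of the \<open>rt j\<close> and a part along the
  orthogonal residual \<open>r2\<close>. Thus the reduced block, the last row up to a translation,
  and the corner \<open>\<tau>\<close> contribute separate summands.\<close>

lemma qf_decompose:
  assumes J: "\<And>i j. i < n ==> j < n ==> a i j = x i j + w i * r j"
    and J2: "\<And>i. i < n ==> a i n = \<tau> * w i - (\<Sum>j<n. (x i j + w i * r j) * v j)"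
    and J3: "\<And>j. j < n ==> a n j = r j"
    and J4: "a n n = \<tau> - (\<Sum>j<n. r j * v j)"
    and pt: "pt = (\<lambda>s. \<pi> n s + (\<Sum>i<n. w i * \<pi> i s))"
    and rt: "rt = (\<lambda>j t. \<rho> j t - v j * \<rho> n t)"
    and p2: "p2 = (\<lambda>i s. \<pi> i s - g i * pt s)"
    and r2: "r2 = (\<lambda>t. \<rho> n t - (\<Sum>l<n. u l * rt l t))"
    and orth1: "\<And>i. i < n ==> (\<Sum>s<N. p2 i s * cnj (pt s)) = 0"
    and orth2: "\<And>j. j < n ==> (\<Sum>t<N. rt j t * cnj (r2 t)) = 0"
  shows "qf N \<pi> \<rho> (Suc n) a = qf N p2 rt n x
     + (\<Sum>s<N. (cmod (pt s))\<^sup>2) * (\<Sum>t<N. (cmod (\<Sum>j<n. (r j + ((\<Sum>i<n. g i * x i j) + \<tau> * u j)) * rt j t))\<^sup>2)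
     + (\<Sum>s<N. (cmod (pt s))\<^sup>2) * (\<Sum>t<N. (cmod (r2 t))\<^sup>2) * (cmod \<tau>)\<^sup>2"
proof -
  define al where "al = (\<lambda>t. \<Sum>j<n. (r j + ((\<Sum>i<n. g i * x i j) + \<tau> * u j)) * rt j t)"
  define T where "T = (\<lambda>s t. \<Sum>i<n. \<Sum>j<n. x i j * p2 i s * rt j t)"
  have entry: "(\<Sum>i<Suc n. \<Sum>j<Suc n. a i j * \<pi> i s * \<rho> j t) = T s t + (al t + \<tau> * r2 t) * pt s" for s t
  proof -
    have "(\<Sum>i<Suc n. \<Sum>j<Suc n. a i j * \<pi> i s * \<rho> j t) =
      (\<Sum>i<n. (\<Sum>j<n. a i j * \<pi> i s * \<rho> j t) + a i n * \<pi> i s * \<rho> n t) + ((\<Sum>j<n. a n j * \<pi> n s * \<rho> j t) + a n n * \<pi> n s * \<rho> n t)"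
      by simp
    also have "(\<Sum>i<n. (\<Sum>j<n. a i j * \<pi> i s * \<rho> j t) + a i n * \<pi> i s * \<rho> n t) =
       (\<Sum>i<n. (\<Sum>j<n. (x i j + w i * r j) * \<pi> i s * rt j t) + \<tau> * w i * \<pi> i s * \<rho> n t)"
    proof (intro sum.cong refl)
      fix i assume "i \<in> {..<n}"
      then show "(\<Sum>j<n. a i j * \<pi> i s * \<rho> j t) + a i n * \<pi> i s * \<rho> n t =
        (\<Sum>j<n. (x i j + w i * r j) * \<pi> i s * rt j t) + \<tau> * w i * \<pi> i s * \<rho> n t"
        by (simp add: J J2 rt right_diff_distrib left_diff_distrib sum_subtractf sum_distrib_right sum_distrib_left mult_ac)
    qed
    also have "(\<Sum>j<n. a n j * \<pi> n s * \<rho> j t) + a n n * \<pi> n s * \<rho> n t = (\<Sum>j<n. r j * \<pi> n s * rt j t) + \<tau> * \<pi> n s * \<rho> n t"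
      by (simp add: J3 J4 rt right_diff_distrib left_diff_distrib sum_subtractf sum_distrib_right sum_distrib_left mult_ac)
    also have "(\<Sum>i<n. (\<Sum>j<n. (x i j + w i * r j) * \<pi> i s * rt j t) + \<tau> * w i * \<pi> i s * \<rho> n t) =
       (\<Sum>i<n. \<Sum>j<n. x i j * \<pi> i s * rt j t) + (\<Sum>i<n. w i * \<pi> i s) * (\<Sum>j<n. r j * rt j t) + \<tau> * (\<Sum>i<n. w i * \<pi> i s) * \<rho> n t"
      by (simp add: ring_distribs sum.distrib sum_product sum_distrib_left sum_distrib_right mult_ac)
    also have "(\<Sum>i<n. \<Sum>j<n. x i j * \<pi> i s * rt j t) = T s t + pt s * (\<Sum>j<n. (\<Sum>i<n. g i * x i j) * rt j t)"
    proof -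
      have "(\<Sum>i<n. \<Sum>j<n. x i j * \<pi> i s * rt j t) = (\<Sum>i<n. \<Sum>j<n. x i j * p2 i s * rt j t) + (\<Sum>i<n. \<Sum>j<n. pt s * (g i * x i j * rt j t))"
        unfolding sum.distrib[symmetric] by (intro sum.cong refl) (simp add: p2 algebra_simps)
      also have "(\<Sum>i<n. \<Sum>j<n. pt s * (g i * x i j * rt j t)) = pt s * (\<Sum>j<n. (\<Sum>i<n. g i * x i j) * rt j t)"
        by (subst sum.swap) (simp add: sum_distrib_left sum_distrib_right)
      finally show ?thesis by (simp add: T_def)
    qed
    also have "\<rho> n t = r2 t + (\<Sum>l<n. u l * rt l t)" by (simp add: r2)
    also have "T s t + pt s * (\<Sum>j<n. (\<Sum>i<n. g i * x i j) * rt j t) + (\<Sum>i<n. w i * \<pi> i s) * (\<Sum>j<n. r j * rt j t) +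
        \<tau> * (\<Sum>i<n. w i * \<pi> i s) * (r2 t + (\<Sum>l<n. u l * rt l t)) +
       ((\<Sum>j<n. r j * \<pi> n s * rt j t) + \<tau> * \<pi> n s * (r2 t + (\<Sum>l<n. u l * rt l t)))
       = T s t + (al t + \<tau> * r2 t) * pt s"
    proof -
      have 1: "(\<Sum>j<n. r j * \<pi> n s * rt j t) = \<pi> n s * (\<Sum>j<n. r j * rt j t)" by (simp add: sum_distrib_left mult_ac)
      have 2: "al t = (\<Sum>j<n. r j * rt j t) + (\<Sum>j<n. (\<Sum>i<n. g i * x i j) * rt j t) + \<tau> * (\<Sum>l<n. u l * rt l t)"
        by (simp add: al_def ring_distribs sum.distrib sum_distrib_left mult.assoc)
      show ?thesis unfolding 1 2 by (simp add: pt ring_distribs)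
    qed
    finally show ?thesis .
  qed
  have o1: "(\<Sum>s<N. T s t * cnj (pt s)) = 0" for t
  proof -
    have "(\<Sum>s<N. T s t * cnj (pt s)) = (\<Sum>i<n. \<Sum>j<n. x i j * rt j t * (\<Sum>s<N. p2 i s * cnj (pt s)))"
      unfolding T_def sum_distrib_right sum_distrib_left
      by (subst sum.swap, rule sum.cong[OF refl], subst sum.swap) (simp add: mult_ac)
    then show ?thesis using orth1 by simp
  qed
  have o2: "(\<Sum>t<N. al t * cnj (r2 t)) = 0"
  proof -
    have "(\<Sum>t<N. al t * cnj (r2 t)) = (\<Sum>j<n. (r j + ((\<Sum>i<n. g i * x i j) + \<tau> * u j)) * (\<Sum>t<N. rt j t * cnj (r2 t)))"
      unfolding al_def sum_distrib_right[of _ "{..<n}"] sum_distrib_left[of _ _ "{..<N}"]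
      by (subst sum.swap) (simp add: mult.assoc)
    then show ?thesis using orth2 by simp
  qed
  have "qf N \<pi> \<rho> (Suc n) a = (\<Sum>t<N. \<Sum>s<N. (cmod (T s t + (al t + \<tau> * r2 t) * pt s))\<^sup>2)"
    unfolding qf_def entry ..
  also have "... = (\<Sum>t<N. (\<Sum>s<N. (cmod (T s t))\<^sup>2) + (cmod (al t + \<tau> * r2 t))\<^sup>2 * (\<Sum>s<N. (cmod (pt s))\<^sup>2))"
    by (intro sum.cong refl complex_pythagoras o1)
  also have "... = qf N p2 rt n x + (\<Sum>t<N. (cmod (al t + \<tau> * r2 t))\<^sup>2) * (\<Sum>s<N. (cmod (pt s))\<^sup>2)"
    by (simp add: sum.distrib sum_distrib_right qf_def T_def)
  also have "(\<Sum>t<N. (cmod (al t + \<tau> * r2 t))\<^sup>2) = (\<Sum>t<N. (cmod (al t))\<^sup>2) + (cmod \<tau>)\<^sup>2 * (\<Sum>t<N. (cmod (r2 t))\<^sup>2)"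
    by (rule complex_pythagoras[OF o2])
  finally show ?thesis by (simp add: al_def algebra_simps)
qed

definition ew :: "nat => nat => real => (nat => nat => complex) => (nat => complex) => real" where
  "ew N n \<kappa> \<rho> r = exp (- (\<kappa> * (\<Sum>t<N. (cmod (\<Sum>j<n. r j * \<rho> j t))\<^sup>2)))"

lemma borel_measurable_ew: "(\<lambda>r. ennreal (ew N n \<kappa> \<rho> r)) \<in> borel_measurable (Lb {..<n})"
proof -
  have [measurable]: "(\<lambda>r. \<Sum>j<n. r j * \<rho> j t) \<in> borel_measurable (Lb {..<n})" for t
    by (intro borel_measurable_sum borel_measurable_times borel_measurable_const
        borel_measurable_component[where I="{..<n}"]) auto
  show ?thesis unfolding ew_def by measurable
qed

lemma ennreal_regroup:
  fixes X :: ennreal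
  assumes "0 \<le> p1" "0 \<le> p2" "0 \<le> q1" "0 \<le> q2" "0 \<le> e1" "0 \<le> e2" "p1 * p2 = q1 * q2 * (e1 * e2)"
  shows "ennreal p1 * (ennreal p2 * X) = ennreal q1 * ((ennreal q2 * X) * (ennreal e1 * ennreal e2))"
proof -
  have "ennreal p1 * ennreal p2 = ennreal q1 * ennreal q2 * (ennreal e1 * ennreal e2)"
    using assms by (simp add: ennreal_mult[symmetric])
  then have "(ennreal p1 * ennreal p2) * X = (ennreal q1 * ennreal q2 * (ennreal e1 * ennreal e2)) * X" by simp
  then show ?thesis by (simp only: mult_ac)
qed

text \<open>For fixed \<open>v\<close> and \<open>w\<close> the exponent decouples: the two last
  rows integrate to constants by translation invariance, and the corners s of A and l s of B
  contribute k1 (1 + |l|^2) |s|^2, so rescaling s yields the explicit power of 1 + |l|^2. The data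
  \<open>c\<close>, \<open>p2\<close>, \<open>rt\<close> are obtained before \<open>F\<close> and
  \<open>l\<close>, which is what makes different functionals comparable; \<open>c\<close> may be
  infinite for degenerate \<open>v\<close>, \<open>w\<close>.\<close>

lemma GI_fibre:
  fixes v w :: "nat => complex"
  obtains c p2 rt where "\<And>F l. F \<in> borel_measurable FM ==>
    (\<integral>\<^sup>+s. \<integral>\<^sup>+y. ennreal (cmod s ^ (2 * Suc n) * (cmod (dt n (pen (fst y) l)))\<^sup>2) *
       (ennreal (gw N (Suc n) k \<pi> \<rho> (Jn n (l, v) (s, w) y)) * F (chi (Suc n) (Jn n (l, v) (s, w) y))) \<partial>IM n \<partial>lborel)
    = ennreal (1 / (1 + (cmod l)\<^sup>2) ^ Suc (n + Suc k)) * (c * GI N n (Suc k) p2 rt (add_root F l))"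
proof -
  define pt where "pt = (\<lambda>s. \<pi> n s + (\<Sum>i<n. w i * \<pi> i s))"
  define rt where "rt = (\<lambda>j t. \<rho> j t - v j * \<rho> n t)"
  \<comment> \<open>The coefficient of the projection of \<open>\<pi> i\<close> onto
    \<open>pt\<close>; when \<open>pt\<close> vanishes, division by zero makes it 0.\<close>
  define g where "g = (\<lambda>i. (\<Sum>s<N. \<pi> i s * cnj (pt s)) / (\<Sum>s<N. pt s * cnj (pt s)))"
  define p2 where "p2 = (\<lambda>i s. \<pi> i s - g i * pt s)"
  obtain u where u: "\<And>j. j < n ==> (\<Sum>t<N. rt j t * cnj (\<rho> n t - (\<Sum>l<n. u l * rt l t))) = 0"
    using exists_projection[where n=n and N=N and \<rho>=rt and \<xi>="\<rho> n"] by blast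
  define r2 where "r2 = (\<lambda>t. \<rho> n t - (\<Sum>l<n. u l * rt l t))"
  have orth2: "(\<Sum>t<N. rt j t * cnj (r2 t)) = 0" if "j < n" for j unfolding r2_def by (rule u[OF that])
  have orth1: "(\<Sum>s<N. p2 i s * cnj (pt s)) = 0" for i
  proof (cases "(\<Sum>s<N. pt s * cnj (pt s)) = 0")
    case True
    then have "complex_of_real (\<Sum>s<N. (cmod (pt s))\<^sup>2) = 0" by (simp only: sum_norm_square)
    then have "(\<Sum>s<N. (cmod (pt s))\<^sup>2) = 0" unfolding of_real_eq_0_iff .
    then have "pt s = 0" if "s < N" for s using that by (simp add: sum_nonneg_eq_0_iff)
    then show ?thesis by simp
  next
    case False
    have "(\<Sum>s<N. p2 i s * cnj (pt s)) = (\<Sum>s<N. \<pi> i s * cnj (pt s)) - g i * (\<Sum>s<N. pt s * cnj (pt s))"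
      by (simp add: p2_def left_diff_distrib sum_subtractf sum_distrib_left mult.assoc)
    then show ?thesis using False by (simp add: g_def)
  qed
  define k0 where "k0 = (\<Sum>s<N. (cmod (pt s))\<^sup>2)"
  define k1 where "k1 = k0 * (\<Sum>t<N. (cmod (r2 t))\<^sup>2)"
  let ?V = "Lb {..<n}"
  define C0 where "C0 = (\<integral>\<^sup>+r. ennreal (ew N n k0 rt r) \<partial>?V)"
  define S0 where "S0 = (\<integral>\<^sup>+s. ennreal (cmod s ^ (2 * (Suc n + k)) * exp (- (k1 * (cmod s)\<^sup>2))) \<partial>lborel)"
  define c where "c = S0 * (C0 * C0)"
  have V: "sigma_finite_measure ?V" by (rule sigma_finite_Lb) simp
  have "(\<integral>\<^sup>+s. \<integral>\<^sup>+y. ennreal (cmod s ^ (2 * Suc n) * (cmod (dt n (pen (fst y) l)))\<^sup>2) *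
       (ennreal (gw N (Suc n) k \<pi> \<rho> (Jn n (l, v) (s, w) y)) * F (chi (Suc n) (Jn n (l, v) (s, w) y))) \<partial>IM n \<partial>lborel)
    = ennreal (1 / (1 + (cmod l)\<^sup>2) ^ Suc (n + Suc k)) * (c * GI N n (Suc k) p2 rt (add_root F l))"
    (is "?L = ?R")
    if F: "F \<in> borel_measurable FM" for F l
  proof -
    define sw where "sw = (\<lambda>s. ennreal (cmod s ^ (2 * (Suc n + k)) * exp (- (k1 * (1 + (cmod l)\<^sup>2) * (cmod s)\<^sup>2))))"
    define h where "h = (\<lambda>X \<tau> j. (\<Sum>i<n. g i * (X :: nat => nat => complex) i j) + (\<tau> :: complex) * u j)"
    define Z where "Z = (\<lambda>X. ennreal (cmod (dt n (ea X)) ^ (2 * k) * (cmod (dt n (pen X l)))\<^sup>2 *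
        exp (- qf N p2 rt n (ea X) - qf N p2 rt n (eb X))) * F (\<lambda>z. (z - l) * chi n X z))"
    have point: "ennreal (cmod s ^ (2 * Suc n) * (cmod (dt n (pen (fst y) l)))\<^sup>2) *
       (ennreal (gw N (Suc n) k \<pi> \<rho> (Jn n (l, v) (s, w) y)) * F (chi (Suc n) (Jn n (l, v) (s, w) y)))
      = sw s * (Z (fst y) * (ennreal (ew N n k0 rt (\<lambda>j\<in>{..<n}. fst (snd y) j + h (ea (fst y)) s j)) *
         ennreal (ew N n k0 rt (\<lambda>j\<in>{..<n}. snd (snd y) j + h (eb (fst y)) (l * s) j))))" if s: "s \<noteq> 0" for s y
    proof -
      obtain X ra rb where y: "y = (X, (ra, rb))" by (metis prod.exhaust)
      define J where "J = Jn n (l, v) (s, w) y"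
      have Jb: "J (b, i, j) = bmat n (\<lambda>i j. X (b, i, j) + w i * (if b then ra j else rb j))
          (\<lambda>i. (if b then s else l * s) * w i - (\<Sum>j<n. (X (b, i, j) + w i * (if b then ra j else rb j)) * v j))
          (if b then ra else rb) ((if b then s else l * s) - (\<Sum>j<n. (if b then ra else rb) j * v j)) i j"
        if "i < Suc n" "j < Suc n" for b i j
        using that unfolding J_def Jn_def bjoin_def y by (cases b) (auto simp: bmat_def shX_def)
      have qfJ: "qf N \<pi> \<rho> (Suc n) (\<lambda>i j. J (b, i, j)) = qf N p2 rt n (\<lambda>i j. X (b, i, j))
        + k0 * (\<Sum>t<N. (cmod (\<Sum>j<n. ((if b then ra else rb) j + h (\<lambda>i j. X (b, i, j)) (if b then s else l * s) j) * rt j t))\<^sup>2)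
        + k1 * (cmod (if b then s else l * s))\<^sup>2" for b
        unfolding k0_def k1_def h_def
        by (rule qf_decompose[where a="\<lambda>i j. J (b, i, j)" and x="\<lambda>i j. X (b, i, j)" and w=w and v=v
              and r="if b then ra else rb" and \<tau>="if b then s else l * s", OF _ _ _ _ pt_def rt_def p2_def r2_def orth1 orth2])
           (auto simp: Jb bmat_def)
      have dJ: "dt (Suc n) (ea J) = s * dt n (ea X)"
      proof -
        have "dt (Suc n) (ea J) = dt (Suc n) (bmat n (\<lambda>i j. X (True, i, j) + w i * ra j)
            (\<lambda>i. (\<Sum>j<n. (X (True, i, j) + w i * ra j) * (- v j)) + (s * w i) * 1) ra ((\<Sum>j<n. ra j * (- v j)) + s * 1))"
          by (rule dt_cong) (simp add: Jb bmat_def sum_negf)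
        also have "... = dt (Suc n) (bmat n (\<lambda>i j. X (True, i, j) + w i * ra j) (\<lambda>i. s * w i) ra s)"
          by (subst dt_bmat_column) simp
        also have "... = s * dt n (ea X)"
          by (subst dt_Schur_last) (use s in \<open>auto simp: bmat_def intro!: dt_cong\<close>)
        finally show ?thesis .
      qed
      have pJ: "dt (Suc n) (pen J z) = (z - l) * (s * dt n (pen X z))" for z
      proof -
        have "dt (Suc n) (pen J z) = dt (Suc n) (bmat n (\<lambda>i j. pen X z i j + w i * (z * ra j - rb j))
            (\<lambda>i. (\<Sum>j<n. (pen X z i j + w i * (z * ra j - rb j)) * (- v j)) + (s * w i) * (z - l)) (\<lambda>j. z * ra j - rb j)
            ((\<Sum>j<n. (z * ra j - rb j) * (- v j)) + s * (z - l)))"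
        proof (rule dt_cong)
          fix i j assume ij: "i < Suc n" "j < Suc n"
          have 1: "z * (s * w i - (\<Sum>j<n. (X (True, i, j) + w i * ra j) * v j)) - (l * s * w i - (\<Sum>j<n. (X (False, i, j) + w i * rb j) * v j))
            = (\<Sum>j<n. (pen X z i j + w i * (z * ra j - rb j)) * (- v j)) + (s * w i) * (z - l)"
            by (simp add: algebra_simps sum.distrib sum_subtractf sum_negf sum_distrib_left)
          have 2: "z * (s - (\<Sum>j<n. ra j * v j)) - (l * s - (\<Sum>j<n. rb j * v j)) = (\<Sum>j<n. (z * ra j - rb j) * (- v j)) + s * (z - l)"
            by (simp add: algebra_simps sum.distrib sum_subtractf sum_negf sum_distrib_left)
          show "pen J z i j = bmat n (\<lambda>i j. pen X z i j + w i * (z * ra j - rb j))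
            (\<lambda>i. (\<Sum>j<n. (pen X z i j + w i * (z * ra j - rb j)) * (- v j)) + (s * w i) * (z - l)) (\<lambda>j. z * ra j - rb j)
            ((\<Sum>j<n. (z * ra j - rb j) * (- v j)) + s * (z - l)) i j"
            unfolding Jb[OF ij] bmat_def if_True if_False
            by (cases "i < n"; cases "j < n"; simp only: if_True if_False 1 2) (simp_all add: algebra_simps)
        qed
        also have "... = dt (Suc n) (bmat n (\<lambda>i j. pen X z i j + w i * (z * ra j - rb j)) (\<lambda>i. s * w i) (\<lambda>j. z * ra j - rb j) s) * (z - l)"
          by (rule dt_bmat_column)
        also have "dt (Suc n) (bmat n (\<lambda>i j. pen X z i j + w i * (z * ra j - rb j)) (\<lambda>i. s * w i) (\<lambda>j. z * ra j - rb j) s) = s * dt n (pen X z)"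
          by (subst dt_Schur_last) (use s in \<open>auto simp: bmat_def intro!: dt_cong\<close>)
        finally show ?thesis by (simp add: mult.commute)
      qed
      have chiJ: "chi (Suc n) J = (\<lambda>z. (z - l) * chi n X z)"
        unfolding chi_def pJ dJ using s by (auto simp: fun_eq_iff)
      have ew: "ew N n k0 rt (\<lambda>j\<in>{..<n}. f j) = exp (- (k0 * (\<Sum>t<N. (cmod (\<Sum>j<n. f j * rt j t))\<^sup>2)))" for f
        unfolding ew_def by simp
      have gwJ: "gw N (Suc n) k \<pi> \<rho> J = cmod s ^ (2 * k) * cmod (dt n (ea X)) ^ (2 * k) *
         (exp (- qf N p2 rt n (ea X) - qf N p2 rt n (eb X)) *
         (ew N n k0 rt (\<lambda>j\<in>{..<n}. ra j + h (ea X) s j) * ew N n k0 rt (\<lambda>j\<in>{..<n}. rb j + h (eb X) (l * s) j)) *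
         exp (- (k1 * (1 + (cmod l)\<^sup>2) * (cmod s)\<^sup>2)))"
        unfolding gw_def dJ ew qfJ[of True, simplified] qfJ[of False, simplified] mult_exp_exp
        by (simp add: norm_mult power_mult_distrib algebra_simps)
      show ?thesis
        unfolding J_def[symmetric]
        unfolding chiJ Z_def sw_def y fst_conv snd_conv
        by (rule ennreal_regroup)
           (simp_all add: gwJ ew_def power_add power_mult_distrib mult_ac)
    qed
    have Xm: "(\<lambda>X. X) \<in> Lb (IX n) \<rightarrow>\<^sub>M Lb (IX n)" by simp
    have Zm: "Z \<in> borel_measurable (Lb (IX n))"
    proof -
      have "(\<lambda>X z. (z - l) * chi n X z) \<in> Lb (IX n) \<rightarrow>\<^sub>M FM"
      proof (rule measurable_into_FM)
        fix z
        have "(\<lambda>X. chi n X z) \<in> borel_measurable (Lb (IX n))"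
          by (rule measurable_compose[OF measurable_chi[OF Xm] measurable_FM_apply])
        then show "(\<lambda>X. (z - l) * chi n X z) \<in> borel_measurable (Lb (IX n))" by measurable
      qed
      from measurable_compose[OF this F] have [measurable]: "(\<lambda>X. F (\<lambda>z. (z - l) * chi n X z)) \<in> borel_measurable (Lb (IX n))" .
      have [measurable]: "(\<lambda>x. dt n (ea x)) \<in> borel_measurable (Lb (IX n))" by (rule borel_measurable_ea[OF Xm]) simp
      have [measurable]: "(\<lambda>x. dt n (pen x l)) \<in> borel_measurable (Lb (IX n))" by (rule borel_measurable_pen[OF Xm]) auto
      have [measurable]: "(\<lambda>x. qf N p2 rt n (ea x)) \<in> borel_measurable (Lb (IX n))" "(\<lambda>x. qf N p2 rt n (eb x)) \<in> borel_measurable (Lb (IX n))"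
        by (intro borel_measurable_qf borel_measurable_component[OF Xm]; simp)+
      show ?thesis unfolding Z_def by measurable
    qed
    have swm: "sw \<in> borel_measurable borel" unfolding sw_def by measurable
    let ?Rm = "?V \<Otimes>\<^sub>M ?V"
    have Rs: "sigma_finite_measure ?Rm" by (intro sigma_finite_pair V)
    define e where "e = (\<lambda>X s r. ennreal (ew N n k0 rt (\<lambda>j\<in>{..<n}. fst r j + h (ea X) s j)) *
         ennreal (ew N n k0 rt (\<lambda>j\<in>{..<n}. snd r j + h (eb X) (l * s) j)))"
    have eint: "(\<integral>\<^sup>+r. e X s r \<partial>?Rm) = C0 * C0" for X s
    proof -
      have m: "(\<lambda>x. ennreal (ew N n k0 rt (\<lambda>j\<in>{..<n}. f x j + hh j))) \<in> borel_measurable M" if "f \<in> M \<rightarrow>\<^sub>M ?V" for f hh and M :: "'x measure"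
        by (rule measurable_compose[OF measurable_into_Lb borel_measurable_ew])
           (intro borel_measurable_add borel_measurable_const borel_measurable_component[OF that])
      have "(\<integral>\<^sup>+r. e X s r \<partial>?Rm) = (\<integral>\<^sup>+ra. \<integral>\<^sup>+rb. e X s (ra, rb) \<partial>?V \<partial>?V)"
        by (rule sigma_finite_measure.nn_integral_fst[OF V, symmetric]) (unfold e_def, intro borel_measurable_times_ennreal m; simp)
      also have "... = (\<integral>\<^sup>+ra. ennreal (ew N n k0 rt (\<lambda>j\<in>{..<n}. ra j + h (ea X) s j)) *
         (\<integral>\<^sup>+rb. ennreal (ew N n k0 rt (\<lambda>j\<in>{..<n}. rb j + h (eb X) (l * s) j)) \<partial>?V) \<partial>?V)"
        unfolding e_def fst_conv snd_conv by (intro nn_integral_cong nn_integral_cmult m) simp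
      also have "(\<integral>\<^sup>+rb. ennreal (ew N n k0 rt (\<lambda>j\<in>{..<n}. rb j + h (eb X) (l * s) j)) \<partial>?V) = C0"
        unfolding C0_def by (rule nn_integral_Lb_translation[symmetric]) (simp_all add: borel_measurable_ew)
      also have "(\<integral>\<^sup>+ra. ennreal (ew N n k0 rt (\<lambda>j\<in>{..<n}. ra j + h (ea X) s j)) * C0 \<partial>?V) =
         (\<integral>\<^sup>+ra. ennreal (ew N n k0 rt (\<lambda>j\<in>{..<n}. ra j + h (ea X) s j)) \<partial>?V) * C0"
        by (rule nn_integral_multc) (intro m, simp)
      also have "(\<integral>\<^sup>+ra. ennreal (ew N n k0 rt (\<lambda>j\<in>{..<n}. ra j + h (ea X) s j)) \<partial>?V) = C0"
        unfolding C0_def by (rule nn_integral_Lb_translation[symmetric]) (simp_all add: borel_measurable_ew)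
      finally show ?thesis .
    qed
    have emeas: "(\<lambda>p. sw s * (Z (fst p) * e (fst p) s (snd p))) \<in> borel_measurable (IM n)" for s
    proof -
      have idm: "(\<lambda>y. y) \<in> IM n \<rightarrow>\<^sub>M IM n" by simp
      have hm: "(\<lambda>y. h (ea (fst y)) \<tau> j) \<in> borel_measurable (IM n)" "(\<lambda>y. h (eb (fst y)) \<tau> j) \<in> borel_measurable (IM n)"
        if "j < n" for \<tau> j
        unfolding h_def using that
        by (intro borel_measurable_add borel_measurable_sum borel_measurable_times borel_measurable_const IM_coords[OF idm]; simp)+
      have "(\<lambda>y. ennreal (ew N n k0 rt (\<lambda>j\<in>{..<n}. fst (snd y) j + h (ea (fst y)) s j))) \<in> borel_measurable (IM n)"
        "(\<lambda>y. ennreal (ew N n k0 rt (\<lambda>j\<in>{..<n}. snd (snd y) j + h (eb (fst y)) (l * s) j))) \<in> borel_measurable (IM n)"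
        by (rule measurable_compose[OF measurable_into_Lb borel_measurable_ew];
            intro borel_measurable_add IM_coords[OF idm] hm; simp)+
      moreover have "(\<lambda>y. Z (fst y)) \<in> borel_measurable (IM n)"
        by (rule measurable_compose[OF IM_coords(1)[OF idm] Zm])
      ultimately show ?thesis unfolding e_def by measurable
    qed
    have "?L = (\<integral>\<^sup>+s. sw s * ((\<integral>\<^sup>+X. Z X \<partial>Lb (IX n)) * (C0 * C0)) \<partial>lborel)"
    proof (rule nn_integral_cong_AE)
      have "AE s in lborel. s \<notin> {0 :: complex}" by (rule AE_lborel_finite) simp
      then show "AE s in lborel. (\<integral>\<^sup>+y. ennreal (cmod s ^ (2 * Suc n) * (cmod (dt n (pen (fst y) l)))\<^sup>2) *
       (ennreal (gw N (Suc n) k \<pi> \<rho> (Jn n (l, v) (s, w) y)) * F (chi (Suc n) (Jn n (l, v) (s, w) y))) \<partial>IM n) = sw s * ((\<integral>\<^sup>+X. Z X \<partial>Lb (IX n)) * (C0 * C0))"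
      proof eventually_elim
        case (elim s)
        then have s: "s \<noteq> 0" by simp
        have "(\<integral>\<^sup>+y. ennreal (cmod s ^ (2 * Suc n) * (cmod (dt n (pen (fst y) l)))\<^sup>2) *
       (ennreal (gw N (Suc n) k \<pi> \<rho> (Jn n (l, v) (s, w) y)) * F (chi (Suc n) (Jn n (l, v) (s, w) y))) \<partial>IM n)
          = (\<integral>\<^sup>+y. sw s * (Z (fst y) * e (fst y) s (snd y)) \<partial>IM n)"
          unfolding point[OF s] e_def ..
        also have "... = (\<integral>\<^sup>+X. \<integral>\<^sup>+r. sw s * (Z X * e X s r) \<partial>?Rm \<partial>Lb (IX n))"
          using sigma_finite_measure.nn_integral_fst[OF Rs emeas[of s, unfolded IM_def], symmetric] unfolding IM_def by simp
        also have "... = (\<integral>\<^sup>+X. sw s * (Z X * (C0 * C0)) \<partial>Lb (IX n))"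
        proof (rule nn_integral_cong)
          fix X assume X: "X \<in> space (Lb (IX n))"
          have em: "e X s \<in> borel_measurable ?Rm"
            unfolding e_def
            by (intro borel_measurable_times_ennreal; rule measurable_compose[OF measurable_into_Lb borel_measurable_ew];
                intro borel_measurable_add borel_measurable_const borel_measurable_component[OF measurable_fst]
                borel_measurable_component[OF measurable_snd]; simp)
          show "(\<integral>\<^sup>+r. sw s * (Z X * e X s r) \<partial>?Rm) = sw s * (Z X * (C0 * C0))"
            using em by (simp add: nn_integral_cmult eint)
        qed
        also have "... = sw s * ((\<integral>\<^sup>+X. Z X \<partial>Lb (IX n)) * (C0 * C0))"
          using Zm by (simp add: nn_integral_cmult nn_integral_multc)
        finally show ?case .
      qed
    qed
    also have "... = (\<integral>\<^sup>+s. sw s \<partial>lborel) * ((\<integral>\<^sup>+X. Z X \<partial>Lb (IX n)) * (C0 * C0))"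
      by (rule nn_integral_multc) (use swm in simp)
    also have "(\<integral>\<^sup>+X. Z X \<partial>Lb (IX n)) = GI N n (Suc k) p2 rt (add_root F l)"
      unfolding GI_def
    proof (rule nn_integral_cong_AE)
      show "AE X in Lb (IX n). Z X = ennreal (gw N n (Suc k) p2 rt X) * add_root F l (chi n X)"
        using generic_pencil[of n]
      proof eventually_elim
        case (elim X)
        then have "dt n (ea X) \<noteq> 0" by blast
        then have "(cmod (dt n (pen X l)))\<^sup>2 = (cmod (dt n (ea X)))\<^sup>2 * (cmod (chi n X l))\<^sup>2"
          by (simp add: chi_def norm_divide power_divide)
        then have r: "cmod (dt n (ea X)) ^ (2 * k) * (cmod (dt n (pen X l)))\<^sup>2 * exp (- qf N p2 rt n (ea X) - qf N p2 rt n (eb X)) =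
           gw N n (Suc k) p2 rt X * (cmod (chi n X l))\<^sup>2"
          by (simp add: gw_def power2_eq_square mult_ac)
        have "0 \<le> gw N n (Suc k) p2 rt X" by (simp add: gw_def)
        then show ?case
          unfolding Z_def r add_root_def by (simp add: ennreal_mult mult.assoc)
      qed
    qed
    also have "(\<integral>\<^sup>+s. sw s \<partial>lborel) = ennreal (1 / (1 + (cmod l)\<^sup>2) ^ Suc (n + Suc k)) * S0"
    proof -
      \<comment> \<open>The scaling that turns k1 (1 + |l|^2) into k1. It appears to the power 2(n +
        k + 2), two of which come from the area element.\<close>
      define a where "a = 1 / sqrt (1 + (cmod l)\<^sup>2)"
      have a: "a > 0" "a\<^sup>2 = 1 / (1 + (cmod l)\<^sup>2)" "(1 + (cmod l)\<^sup>2) \<noteq> 0"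
        by (auto simp: a_def add_pos_nonneg power_divide real_sqrt_pow2 add_nonneg_eq_0_iff)
      have "(\<integral>\<^sup>+s. sw s \<partial>lborel) = ennreal ((cmod (complex_of_real a))\<^sup>2) * (\<integral>\<^sup>+s. sw (complex_of_real a * s) \<partial>lborel)"
        using swm a by (intro nn_integral_lborel_complex_scale) auto
      also have "(\<lambda>s. sw (complex_of_real a * s)) = (\<lambda>s. ennreal (a ^ (2 * (Suc n + k))) * ennreal (cmod s ^ (2 * (Suc n + k)) * exp (- (k1 * (cmod s)\<^sup>2))))"
      proof
        fix s
        have "k1 * (1 + (cmod l)\<^sup>2) * (a * cmod s)\<^sup>2 = k1 * (cmod s)\<^sup>2"
          using a by (simp add: power_mult_distrib)
        then show "sw (complex_of_real a * s) = ennreal (a ^ (2 * (Suc n + k))) * ennreal (cmod s ^ (2 * (Suc n + k)) * exp (- (k1 * (cmod s)\<^sup>2)))"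
          using a(1) unfolding sw_def by (simp only: norm_mult norm_of_real abs_of_pos power_mult_distrib)
             (simp add: ennreal_mult[symmetric] mult.assoc)
      qed
      also have "(\<integral>\<^sup>+s. ennreal (a ^ (2 * (Suc n + k))) * ennreal (cmod s ^ (2 * (Suc n + k)) * exp (- (k1 * (cmod s)\<^sup>2))) \<partial>lborel) = ennreal (a ^ (2 * (Suc n + k))) * S0"
        unfolding S0_def by (rule nn_integral_cmult) measurable
      also have "ennreal ((cmod (complex_of_real a))\<^sup>2) * (ennreal (a ^ (2 * (Suc n + k))) * S0) = ennreal (a\<^sup>2 * a ^ (2 * (Suc n + k))) * S0"
        using a(1) by (simp add: mult.assoc[symmetric] ennreal_mult[symmetric])
      also have "a\<^sup>2 * a ^ (2 * (Suc n + k)) = (a\<^sup>2) ^ Suc (n + Suc k)"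
        by (simp add: power_mult[symmetric] power_add[symmetric] algebra_simps del: power_Suc)
      also have "... = 1 / (1 + (cmod l)\<^sup>2) ^ Suc (n + Suc k)"
        unfolding a(2) by (rule power_one_over)
      finally show ?thesis .
    qed
    finally show ?thesis by (simp add: c_def mult_ac)
  qed
  then show thesis by (rule that)
qed

lemma nn_integral_CM_rev:
  assumes "f \<in> borel_measurable (CM n)"
  shows "(\<integral>\<^sup>+q. f q \<partial>CM n) = (\<integral>\<^sup>+c. \<integral>\<^sup>+s. f (s, c) \<partial>lborel \<partial>Lb {..<n})"
  unfolding nn_integral_CM[OF assms]
  by (rule nn_integral_swap[OF sigma_finite_lborel sigma_finite_Lb]) (use assms in \<open>simp_all add: CM_def\<close>)

text \<open>Cross-multiplication avoids every normalising constant, finite or not. Since the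
  eigenvector \<open>v\<close> and the row elimination \<open>w\<close> change the quadratic form,
  the statement is proved for all \<open>\<pi>\<close> and \<open>\<rho>\<close> at once.\<close>

lemma GI_JJ_proportional:
  assumes "F \<in> borel_measurable FM" "G \<in> borel_measurable FM"
  shows "GI N n k \<pi> \<rho> F * JJ (n + k) n G = GI N n k \<pi> \<rho> G * JJ (n + k) n F"
  using assms
proof (induction n arbitrary: k \<pi> \<rho> F G)
  case 0
  have "GI N 0 k \<pi> \<rho> F = F (\<lambda>z. 1)" for F
  proof -
    have e: "IX 0 = {}" by (auto simp: IX_def)
    have "chi 0 X = (\<lambda>z. 1)" for X by (auto simp: chi_def)
    then show ?thesis
      unfolding GI_def e by (simp add: PiM_empty nn_integral_count_space_finite gw_def qf_def)
  qed
  then show ?case by (simp add: JJ_0 mult.commute)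
next
  case (Suc n)
  let ?V = "Lb {..<n}" and ?m = "Suc (n + Suc k)"
  have V: "sigma_finite_measure ?V" by (rule sigma_finite_Lb) simp
  define \<Psi> where "\<Psi> F l q y = ennreal (cmod (fst q) ^ (2 * Suc n) * (cmod (dt n (pen (fst y) (fst l))))\<^sup>2) *
       (ennreal (gw N (Suc n) k \<pi> \<rho> (Jn n l q y)) * F (chi (Suc n) (Jn n l q y)))" for F l q y
  have \<Psi>m: "(\<lambda>x. \<Psi> F (L x) (Q x) (Y x)) \<in> borel_measurable M"
    if F: "F \<in> borel_measurable FM" and L: "L \<in> M \<rightarrow>\<^sub>M CM n" and Q: "Q \<in> M \<rightarrow>\<^sub>M CM n" and Y: "Y \<in> M \<rightarrow>\<^sub>M IM n"
    for F L Q Y and M :: "'x measure"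
  proof -
    note J = measurable_Jn[OF L Q Y]
    have [measurable]: "(\<lambda>x. F (chi (Suc n) (Jn n (L x) (Q x) (Y x)))) \<in> borel_measurable M"
      by (rule measurable_compose[OF measurable_chi[OF J] F])
    have [measurable]: "(\<lambda>x. gw N (Suc n) k \<pi> \<rho> (Jn n (L x) (Q x) (Y x))) \<in> borel_measurable M"
      by (rule borel_measurable_gw[OF J])
    have [measurable]: "(\<lambda>x. fst (Q x)) \<in> borel_measurable M" by (rule CM_coords[OF Q])
    have [measurable]: "(\<lambda>x. dt n (pen (fst (Y x)) (fst (L x)))) \<in> borel_measurable M"
      by (rule borel_measurable_pen[OF IM_coords(1)[OF Y] CM_coords(1)[OF L]]) simp
    show ?thesis unfolding \<Psi>_def by measurable
  qed
  define H where "H F l v w = (\<integral>\<^sup>+s. \<integral>\<^sup>+y. \<Psi> F (l, v) (s, w) y \<partial>IM n \<partial>lborel)" for F l v w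
  have Hm: "(\<lambda>x. H F (l x) (v x) (w x)) \<in> borel_measurable M"
    if F: "F \<in> borel_measurable FM" and l: "l \<in> borel_measurable M" and v: "v \<in> M \<rightarrow>\<^sub>M ?V" and w: "w \<in> M \<rightarrow>\<^sub>M ?V"
    for F l v w and M :: "'x measure"
  proof -
    have "(\<lambda>p. \<Psi> F (l (fst (fst p)), v (fst (fst p))) (snd (fst p), w (fst (fst p))) (snd p)) \<in> borel_measurable ((M \<Otimes>\<^sub>M lborel) \<Otimes>\<^sub>M IM n)"
      using l v w by (intro \<Psi>m F) (auto simp: CM_def intro!: measurable_Pair intro: measurable_compose[of fst])
    from sigma_finite_measure.borel_measurable_nn_integral_fst[OF sigma_finite_IM this]
    have "(\<lambda>p. \<integral>\<^sup>+y. \<Psi> F (l (fst p), v (fst p)) (snd p, w (fst p)) y \<partial>IM n) \<in> borel_measurable (M \<Otimes>\<^sub>M lborel)" by simp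
    from lborel.borel_measurable_nn_integral_fst[OF this] show ?thesis unfolding H_def by simp
  qed
  define S where "S F l = (\<integral>\<^sup>+v. \<integral>\<^sup>+w. H F l v w \<partial>?V \<partial>?V)" for F l
  have Sin: "(\<lambda>p. \<integral>\<^sup>+w. H F (fst p) (snd p) w \<partial>?V) \<in> borel_measurable (lborel \<Otimes>\<^sub>M ?V)" if F: "F \<in> borel_measurable FM" for F
  proof -
    have "(\<lambda>x. H F (fst (fst x)) (snd (fst x)) (snd x)) \<in> borel_measurable ((lborel \<Otimes>\<^sub>M ?V) \<Otimes>\<^sub>M ?V)"
      by (intro Hm F) (auto intro!: measurable_compose[OF measurable_fst])
    from sigma_finite_measure.borel_measurable_nn_integral_fst[OF V this] show ?thesis by simp
  qed
  have Sm: "S F \<in> borel_measurable borel" if F: "F \<in> borel_measurable FM" for F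
    using sigma_finite_measure.borel_measurable_nn_integral_fst[OF V Sin[OF F]] by (simp add: S_def[abs_def])
  have GIS: "of_nat (Suc n) * GI N (Suc n) k \<pi> \<rho> F = (\<integral>\<^sup>+l. S F l \<partial>lborel)" if F: "F \<in> borel_measurable FM" for F
  proof -
    have fm: "(\<lambda>X. ennreal (gw N (Suc n) k \<pi> \<rho> X) * F (chi (Suc n) X)) \<in> borel_measurable (Lb (IX (Suc n)))"
      using borel_measurable_gw[of "\<lambda>x. x" "Lb (IX (Suc n))" "Suc n" N k \<pi> \<rho>]
        measurable_compose[OF measurable_chi[of "\<lambda>x. x" "Lb (IX (Suc n))"] F] by measurable
    have "of_nat (Suc n) * GI N (Suc n) k \<pi> \<rho> F = (\<integral>\<^sup>+l. \<integral>\<^sup>+q. \<integral>\<^sup>+y. \<Psi> F l q y \<partial>IM n \<partial>CM n \<partial>CM n)"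
      unfolding GI_def \<Psi>_def by (rule pencil_change_of_variables[OF fm])
    also have "... = (\<integral>\<^sup>+l. \<integral>\<^sup>+w. H F (fst l) (snd l) w \<partial>?V \<partial>CM n)"
    proof (rule nn_integral_cong)
      fix l assume l: "l \<in> space (CM n)"
      have "(\<lambda>p. \<Psi> F l (fst p) (snd p)) \<in> borel_measurable (CM n \<Otimes>\<^sub>M IM n)" using l by (intro \<Psi>m F) auto
      from sigma_finite_measure.borel_measurable_nn_integral_fst[OF sigma_finite_IM this]
      have "(\<lambda>q. \<integral>\<^sup>+y. \<Psi> F l q y \<partial>IM n) \<in> borel_measurable (CM n)" by simp
      from nn_integral_CM_rev[OF this]
      show "(\<integral>\<^sup>+q. \<integral>\<^sup>+y. \<Psi> F l q y \<partial>IM n \<partial>CM n) = (\<integral>\<^sup>+w. H F (fst l) (snd l) w \<partial>?V)"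
        by (simp add: H_def)
    qed
    also have "... = (\<integral>\<^sup>+l. S F l \<partial>lborel)"
      unfolding S_def by (subst nn_integral_CM) (use Sin[OF F] in \<open>simp_all add: CM_def\<close>)
    finally show ?thesis .
  qed
  define K where "K F l = ennreal (1 / (1 + (cmod l)\<^sup>2) ^ ?m) * JJ (n + Suc k) n (add_root F l)" for F l
  have JK: "JJ (Suc n + k) (Suc n) F = (\<integral>\<^sup>+l. K F l \<partial>lborel)" "K F \<in> borel_measurable borel" if "F \<in> borel_measurable FM" for F
    using JJ_Suc[OF that, of "n + Suc k" n] by (simp_all add: K_def[abs_def])
  \<comment> \<open>The identity is first proved on fibres, for two independent roots
    \<open>l\<close> and \<open>l'\<close>: the unknown factor of the fibre occurs on both sides.
    Integration over \<open>v\<close> and \<open>w\<close>, and later over both roots, preserves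
    it.\<close>
  have cross: "S F l * K G l' = S G l' * K F l" if F: "F \<in> borel_measurable FM" and G: "G \<in> borel_measurable FM" for F G l l'
  proof -
    have HH: "H F l v w * K G l' = H G l' v w * K F l" for v w
    proof -
      obtain c p2 rt where c: "\<And>F l. F \<in> borel_measurable FM ==>
        H F l v w = ennreal (1 / (1 + (cmod l)\<^sup>2) ^ ?m) * (c * GI N n (Suc k) p2 rt (add_root F l))"
        unfolding H_def \<Psi>_def fst_conv using GI_fibre[where n=n and N=N and k=k and \<pi>=\<pi> and \<rho>=\<rho> and v=v and w=w] by blast
      have IH: "GI N n (Suc k) p2 rt (add_root F l) * JJ (n + Suc k) n (add_root G l') =
         GI N n (Suc k) p2 rt (add_root G l') * JJ (n + Suc k) n (add_root F l)"
        by (rule Suc.IH) (intro measurable_add_root F G)+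
      have "H F l v w * K G l' = ennreal (1 / (1 + (cmod l)\<^sup>2) ^ ?m) * ennreal (1 / (1 + (cmod l')\<^sup>2) ^ ?m) * c *
          (GI N n (Suc k) p2 rt (add_root F l) * JJ (n + Suc k) n (add_root G l'))"
        unfolding c[OF F] K_def by (simp only: mult_ac)
      also have "... = H G l' v w * K F l" unfolding IH c[OF G] K_def by (simp only: mult_ac)
      finally show ?thesis .
    qed
    have m1: "(\<lambda>w. H F l v w) \<in> borel_measurable ?V" if "F \<in> borel_measurable FM" "v \<in> space ?V" for F l v
      using that by (intro Hm) auto
    have m2: "(\<lambda>v. \<integral>\<^sup>+w. H F l v w \<partial>?V) \<in> borel_measurable ?V" if "F \<in> borel_measurable FM" for F l
      using measurable_compose[OF measurable_Pair1'[of l lborel ?V] Sin[OF that]] by simp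
    have pull: "S F l * k = (\<integral>\<^sup>+v. \<integral>\<^sup>+w. H F l v w * k \<partial>?V \<partial>?V)" if "F \<in> borel_measurable FM" for F l k
    proof -
      have "S F l * k = (\<integral>\<^sup>+v. (\<integral>\<^sup>+w. H F l v w \<partial>?V) * k \<partial>?V)"
        unfolding S_def by (rule nn_integral_multc[OF m2[OF that], symmetric])
      also have "... = (\<integral>\<^sup>+v. \<integral>\<^sup>+w. H F l v w * k \<partial>?V \<partial>?V)"
        by (intro nn_integral_cong nn_integral_multc[symmetric] m1 that)
      finally show ?thesis .
    qed
    show ?thesis unfolding pull[OF F] pull[OF G] HH ..
  qed
  have "(of_nat (Suc n) * GI N (Suc n) k \<pi> \<rho> F) * JJ (Suc n + k) (Suc n) G =
      (of_nat (Suc n) * GI N (Suc n) k \<pi> \<rho> G) * JJ (Suc n + k) (Suc n) F"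
  proof -
    have "(\<integral>\<^sup>+l. S F l \<partial>lborel) * (\<integral>\<^sup>+l. K G l \<partial>lborel) = (\<integral>\<^sup>+l. S F l * (\<integral>\<^sup>+l'. K G l' \<partial>lborel) \<partial>lborel)"
      by (rule nn_integral_multc[symmetric]) (use Sm Suc.prems in simp)
    also have "... = (\<integral>\<^sup>+l. K F l * (\<integral>\<^sup>+l'. S G l' \<partial>lborel) \<partial>lborel)"
    proof (rule nn_integral_cong)
      fix l
      have "S F l * (\<integral>\<^sup>+l'. K G l' \<partial>lborel) = (\<integral>\<^sup>+l'. S F l * K G l' \<partial>lborel)"
        by (rule nn_integral_cmult[symmetric]) (use JK(2) Suc.prems in simp)
      also have "... = (\<integral>\<^sup>+l'. K F l * S G l' \<partial>lborel)"
        by (intro nn_integral_cong) (metis cross[OF Suc.prems] mult.commute)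
      also have "... = K F l * (\<integral>\<^sup>+l'. S G l' \<partial>lborel)"
        by (rule nn_integral_cmult) (use Sm Suc.prems in simp)
      finally show "S F l * (\<integral>\<^sup>+l'. K G l' \<partial>lborel) = K F l * (\<integral>\<^sup>+l'. S G l' \<partial>lborel)" .
    qed
    also have "... = (\<integral>\<^sup>+l. K F l \<partial>lborel) * (\<integral>\<^sup>+l'. S G l' \<partial>lborel)"
      by (rule nn_integral_multc) (use JK(2) Suc.prems in simp)
    finally show ?thesis
      unfolding GIS[OF Suc.prems(1)] GIS[OF Suc.prems(2)] JK(1)[OF Suc.prems(1)] JK(1)[OF Suc.prems(2)]
      by (simp add: mult.commute)
  qed
  then show ?case
    unfolding mult.assoc by (subst (asm) ennreal_mult_cancel_left) (auto simp: of_nat_eq_0_iff)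
qed

section \<open>The Gaussian pair as a density on the entries\<close>

lemma (in product_sigma_finite) PiM_density:
  assumes I: "finite I" and f [measurable]: "\<And>i. i \<in> I ==> f i \<in> borel_measurable (M i)"
    and sf: "\<And>i. sigma_finite_measure (density (M i) (f i))"
  shows "PiM I (\<lambda>i. density (M i) (f i)) = density (PiM I M) (\<lambda>x. \<Prod>i\<in>I. f i (x i))"
proof -
  interpret D: product_sigma_finite "\<lambda>i. density (M i) (f i)"
    using sf by (rule product_sigma_finite.intro)
  have m: "(\<lambda>x. \<Prod>i\<in>I. f i (x i)) \<in> borel_measurable (PiM I M)"
  proof (intro borel_measurable_prod_ennreal)
    fix i assume i: "i \<in> I"
    show "(\<lambda>x. f i (x i)) \<in> borel_measurable (PiM I M)"
      by (rule measurable_compose[OF measurable_component_singleton[where M=M, OF i] f[OF i]])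
  qed
  show ?thesis
  proof (rule D.PiM_eqI[symmetric, OF I])
    show "sets (density (PiM I M) (\<lambda>x. \<Prod>i\<in>I. f i (x i))) = sets (PiM I (\<lambda>i. density (M i) (f i)))"
      by (simp add: sets_PiM_cong[of I I M "\<lambda>i. density (M i) (f i)"])
    fix A assume A: "\<And>i. i \<in> I ==> A i \<in> sets (density (M i) (f i))"
    then have A': "\<And>i. i \<in> I ==> A i \<in> sets (M i)" by simp
    have P: "Pi\<^sub>E I A \<in> sets (PiM I M)" using I A' by (intro sets_PiM_I_finite)
    have "emeasure (density (PiM I M) (\<lambda>x. \<Prod>i\<in>I. f i (x i))) (Pi\<^sub>E I A) =
        (\<integral>\<^sup>+x. (\<Prod>i\<in>I. f i (x i)) * indicator (Pi\<^sub>E I A) x \<partial>PiM I M)"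
      by (rule emeasure_density[OF m P])
    also have "... = (\<integral>\<^sup>+x. (\<Prod>i\<in>I. f i (x i) * indicator (A i) (x i)) \<partial>PiM I M)"
    proof (rule nn_integral_cong)
      fix x assume "x \<in> space (PiM I M)"
      then have "indicator (Pi\<^sub>E I A) x = (\<Prod>i\<in>I. indicator (A i) (x i) :: ennreal)"
        using I by (auto simp: indicator_def space_PiM PiE_iff prod_eq_1_iff intro!: prod_zero[symmetric])
      then show "(\<Prod>i\<in>I. f i (x i)) * indicator (Pi\<^sub>E I A) x = (\<Prod>i\<in>I. f i (x i) * indicator (A i) (x i))"
        by (simp add: prod.distrib)
    qed
    also have "... = (\<Prod>i\<in>I. \<integral>\<^sup>+x. f i x * indicator (A i) x \<partial>M i)"
      using A' by (intro product_nn_integral_prod I) auto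
    also have "... = (\<Prod>i\<in>I. emeasure (density (M i) (f i)) (A i))"
      using A' by (intro prod.cong refl) (simp add: emeasure_density)
    finally show "emeasure (density (PiM I M) (\<lambda>x. \<Prod>i\<in>I. f i (x i))) (Pi\<^sub>E I A) = (\<Prod>i\<in>I. emeasure (density (M i) (f i)) (A i))" .
  qed
qed

definition entries :: "nat => complex mat => complex mat => bool \<times> nat \<times> nat => complex" where
  "entries n A B = (\<lambda>(b, i, j)\<in>IX n. (if b then A else B) $$ (i, j))"

lemma gaussian_matrix_pair_distr:
  assumes g: "gaussian_matrix_pair n M A B" and n: "n \<ge> 1"
  shows "(\<lambda>\<omega>. entries n (A \<omega>) (B \<omega>)) \<in> M \<rightarrow>\<^sub>M Lb (IX n)"
    and "distr M (Lb (IX n)) (\<lambda>\<omega>. entries n (A \<omega>) (B \<omega>)) =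
      density (Lb (IX n)) (\<lambda>X. \<Prod>e\<in>IX n. ennreal (std_complex_gaussian_density (X e)))"
proof -
  interpret prob_space M using g by (simp add: gaussian_matrix_pair_def)
  define X where "X = (\<lambda>(isA, i, j) \<omega>. (if isA then A \<omega> else B \<omega>) $$ (i, j))"
  define gd where "gd = (\<lambda>z. ennreal (std_complex_gaussian_density z))"
  have dist: "distributed M lborel (X e) gd" if "e \<in> IX n" for e
  proof -
    obtain b i j where e: "e = (b, i, j)" by (cases e)
    then show ?thesis using g that by (cases b) (simp_all add: gaussian_matrix_pair_def X_def gd_def)
  qed
  have rv: "X e \<in> borel_measurable M" if "e \<in> IX n" for e
    using distributed_measurable[OF dist[OF that]] by simp
  have ind: "indep_vars (\<lambda>_. borel) X (IX n)"
    using g by (simp add: gaussian_matrix_pair_def X_def IX_def)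
  have entries: "entries n (A \<omega>) (B \<omega>) = (\<lambda>e\<in>IX n. X e \<omega>)" for \<omega>
    by (auto simp: entries_def X_def fun_eq_iff restrict_def)
  show m: "(\<lambda>\<omega>. entries n (A \<omega>) (B \<omega>)) \<in> M \<rightarrow>\<^sub>M Lb (IX n)"
    unfolding entries by (rule measurable_into_Lb) (rule rv)
  have "(True, 0, 0) \<in> IX n" using n by simp
  then have ne: "IX n \<noteq> {}" by blast
  have "distr M (PiM (IX n) (\<lambda>_. borel)) (\<lambda>\<omega>. \<lambda>e\<in>IX n. X e \<omega>) = PiM (IX n) (\<lambda>e. distr M borel (X e))"
    using indep_vars_iff_distr_eq_PiM'[of "IX n" X "\<lambda>_. borel"] ne rv ind by simp
  also have "... = PiM (IX n) (\<lambda>e. density lborel gd)"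
  proof (rule PiM_cong[OF refl])
    fix e assume "e \<in> IX n"
    have "distr M borel (X e) = distr M lborel (X e)" by (rule distr_cong) auto
    then show "distr M borel (X e) = density lborel gd"
      using distributed_distr_eq_density[OF dist[OF \<open>e \<in> IX n\<close>]] by simp
  qed
  also have "... = density (Lb (IX n)) (\<lambda>X. \<Prod>e\<in>IX n. gd (X e))"
  proof (rule lborel_product.PiM_density)
    show "gd \<in> borel_measurable lborel" for e :: "bool \<times> nat \<times> nat"
      unfolding gd_def std_complex_gaussian_density_def by measurable
    obtain e where "e \<in> IX n" using ne by blast
    have "prob_space (distr M lborel (X e))" using rv[OF \<open>e \<in> IX n\<close>] by (intro prob_space_distr) simp
    then have "prob_space (density lborel gd)" using distributed_distr_eq_density[OF dist[OF \<open>e \<in> IX n\<close>]] by simp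
    then show "sigma_finite_measure (density lborel gd)" for i :: "bool \<times> nat \<times> nat"
      by (rule prob_space_imp_sigma_finite)
  qed simp
  finally have "distr M (PiM (IX n) (\<lambda>_. borel)) (\<lambda>\<omega>. entries n (A \<omega>) (B \<omega>)) = density (Lb (IX n)) (\<lambda>X. \<Prod>e\<in>IX n. gd (X e))"
    unfolding entries .
  moreover have "distr M (PiM (IX n) (\<lambda>_. borel)) (\<lambda>\<omega>. entries n (A \<omega>) (B \<omega>)) = distr M (Lb (IX n)) (\<lambda>\<omega>. entries n (A \<omega>) (B \<omega>))"
    by (rule distr_cong) (auto intro!: sets_PiM_cong)
  ultimately show "distr M (Lb (IX n)) (\<lambda>\<omega>. entries n (A \<omega>) (B \<omega>)) =
      density (Lb (IX n)) (\<lambda>X. \<Prod>e\<in>IX n. ennreal (std_complex_gaussian_density (X e)))"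
    by (simp add: gd_def)
qed

lemma gaussian_weight:
  "(\<Prod>e\<in>IX n. ennreal (std_complex_gaussian_density (X e))) =
    ennreal ((1 / pi) ^ card (IX n)) * ennreal (gw n n 0 (\<lambda>i s. if i = s then 1 else 0) (\<lambda>i s. if i = s then 1 else 0) X)"
proof -
  have q: "qf n (\<lambda>i s. if i = s then 1 else 0) (\<lambda>i s. if i = s then 1 else 0) n a = (\<Sum>i<n. \<Sum>j<n. (cmod (a i j))\<^sup>2)" for a
  proof -
    have "(\<Sum>i<n. \<Sum>j<n. a i j * (if i = s then 1 else 0) * (if j = t then 1 else 0)) = a s t" if "s < n" "t < n" for s t
    proof -
      have "(\<Sum>j<n. a i j * (if i = s then 1 else 0) * (if j = t then 1 else 0)) = (if i = s then a i t else 0)" for i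
        using that by (subst sum_mult_delta) auto
      then show ?thesis using that by simp
    qed
    then have "qf n (\<lambda>i s. if i = s then 1 else 0) (\<lambda>i s. if i = s then 1 else 0) n a = (\<Sum>t<n. \<Sum>s<n. (cmod (a s t))\<^sup>2)"
      unfolding qf_def by simp
    then show ?thesis by (subst (asm) sum.swap)
  qed
  have "(\<Prod>e\<in>IX n. std_complex_gaussian_density (X e)) = (1 / pi) ^ card (IX n) * (\<Prod>e\<in>IX n. exp (- (cmod (X e))\<^sup>2))"
    unfolding std_complex_gaussian_density_def by (simp add: prod.distrib power_one_over divide_inverse power_inverse mult.commute)
  also have "(\<Prod>e\<in>IX n. exp (- (cmod (X e))\<^sup>2)) = gw n n 0 (\<lambda>i s. if i = s then 1 else 0) (\<lambda>i s. if i = s then 1 else 0) X"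
    unfolding prod_IX gw_def q by (simp add: exp_sum[symmetric] mult_exp_exp sum_negf)
  finally have e: "(\<Prod>e\<in>IX n. std_complex_gaussian_density (X e)) =
     (1 / pi) ^ card (IX n) * gw n n 0 (\<lambda>i s. if i = s then 1 else 0) (\<lambda>i s. if i = s then 1 else 0) X" .
  have "(\<Prod>e\<in>IX n. ennreal (std_complex_gaussian_density (X e))) = ennreal (\<Prod>e\<in>IX n. std_complex_gaussian_density (X e))"
    by (rule prod_ennreal) (simp add: std_complex_gaussian_density_def)
  then show ?thesis unfolding e by (simp add: ennreal_mult' gw_def)
qed

text \<open>\<open>GI_JJ_proportional\<close> with one functional equal to 1: on the Gaussian side
  its integral is the total probability, which removes the unknown constant.\<close>

lemma eigenvalue_law:
  assumes g: "gaussian_matrix_pair n M A B" and n: "n \<ge> 1" and F: "F \<in> borel_measurable FM"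
  shows "(\<integral>\<^sup>+\<omega>. F (chi n (entries n (A \<omega>) (B \<omega>))) \<partial>M) * JJ n n (\<lambda>_. 1) = JJ n n F"
    and "AE \<omega> in M. dt n (ea (entries n (A \<omega>) (B \<omega>))) \<noteq> 0"
    and "(\<lambda>\<omega>. chi n (entries n (A \<omega>) (B \<omega>))) \<in> M \<rightarrow>\<^sub>M FM"
proof -
  let ?d = "\<lambda>i s :: nat. if i = s then 1 else 0 :: complex"
  let ?c = "ennreal ((1 / pi) ^ card (IX n))"
  interpret prob_space M using g by (simp add: gaussian_matrix_pair_def)
  note D = gaussian_matrix_pair_distr[OF g n]
  have Xm: "(\<lambda>X. X) \<in> Lb (IX n) \<rightarrow>\<^sub>M Lb (IX n)" by simp
  have gm: "(\<lambda>X. \<Prod>e\<in>IX n. ennreal (std_complex_gaussian_density (X e))) \<in> borel_measurable (Lb (IX n))"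
    unfolding gaussian_weight using borel_measurable_gw[OF Xm] by measurable
  have law: "(\<integral>\<^sup>+\<omega>. F (chi n (entries n (A \<omega>) (B \<omega>))) \<partial>M) = ?c * GI n n 0 ?d ?d F" if F: "F \<in> borel_measurable FM" for F
  proof -
    have Fm: "(\<lambda>X. F (chi n X)) \<in> borel_measurable (Lb (IX n))"
      by (rule measurable_compose[OF measurable_chi[OF Xm] F])
    have "(\<integral>\<^sup>+\<omega>. F (chi n (entries n (A \<omega>) (B \<omega>))) \<partial>M) = (\<integral>\<^sup>+X. F (chi n X) \<partial>distr M (Lb (IX n)) (\<lambda>\<omega>. entries n (A \<omega>) (B \<omega>)))"
      by (rule nn_integral_distr[symmetric, OF D(1)]) (use Fm in simp)
    also have "... = (\<integral>\<^sup>+X. ?c * (ennreal (gw n n 0 ?d ?d X) * F (chi n X)) \<partial>Lb (IX n))"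
      unfolding D(2) by (subst nn_integral_density[OF gm Fm]) (simp add: gaussian_weight mult.assoc)
    also have "... = ?c * GI n n 0 ?d ?d F"
      unfolding GI_def by (rule nn_integral_cmult) (use borel_measurable_gw[OF Xm] Fm in measurable)
    finally show ?thesis .
  qed
  have one: "?c * GI n n 0 ?d ?d (\<lambda>_. 1) = 1"
    using law[of "\<lambda>_. 1"] by (simp add: emeasure_space_1)
  have "(\<integral>\<^sup>+\<omega>. F (chi n (entries n (A \<omega>) (B \<omega>))) \<partial>M) * JJ n n (\<lambda>_. 1) = ?c * (GI n n 0 ?d ?d F * JJ (n + 0) n (\<lambda>_. 1))"
    by (simp add: law[OF F] mult.assoc)
  also have "... = ?c * (GI n n 0 ?d ?d (\<lambda>_. 1) * JJ (n + 0) n F)"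
    by (subst GI_JJ_proportional[OF F]) auto
  also have "... = JJ n n F" by (simp only: mult.assoc[symmetric] one) simp
  finally show "(\<integral>\<^sup>+\<omega>. F (chi n (entries n (A \<omega>) (B \<omega>))) \<partial>M) * JJ n n (\<lambda>_. 1) = JJ n n F" .
  have "AE X in density (Lb (IX n)) (\<lambda>X. \<Prod>e\<in>IX n. ennreal (std_complex_gaussian_density (X e))). dt n (ea X) \<noteq> 0"
    unfolding AE_density[OF gm] using generic_pencil[of n] by eventually_elim simp
  then have "AE X in distr M (Lb (IX n)) (\<lambda>\<omega>. entries n (A \<omega>) (B \<omega>)). dt n (ea X) \<noteq> 0" unfolding D(2) .
  from AE_distrD[OF D(1) this] show "AE \<omega> in M. dt n (ea (entries n (A \<omega>) (B \<omega>))) \<noteq> 0" .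
  show "(\<lambda>\<omega>. chi n (entries n (A \<omega>) (B \<omega>))) \<in> M \<rightarrow>\<^sub>M FM"
    by (rule measurable_chi[OF D(1)])
qed

subsection \<open>The event that all points are separated\<close>

definition cd :: "complex => complex => real" where
  "cd z w = norm (inv_stereographic z - inv_stereographic w)"

lemma continuous_on_inv_stereographic: "continuous_on UNIV inv_stereographic"
proof -
  have "continuous_on UNIV (\<lambda>z. inv_stereographic z $ i)" for i :: 3
  proof -
    have nz: "(cmod z)\<^sup>2 + 1 \<noteq> 0" for z using zero_le_power2[of "cmod z"] by linarith
    have eq: "(\<lambda>z. inv_stereographic z $ i) = (if i = 1 then (\<lambda>z. 2 * Re z / ((cmod z)\<^sup>2 + 1)) else
       if i = 2 then (\<lambda>z. 2 * Im z / ((cmod z)\<^sup>2 + 1)) else (\<lambda>z. ((cmod z)\<^sup>2 - 1) / ((cmod z)\<^sup>2 + 1)))"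
      using exhaust_3[of i] by (auto simp: inv_stereographic_eq)
    show ?thesis unfolding eq by (auto intro!: continuous_intros simp: nz)
  qed
  then have "continuous_on UNIV (\<lambda>z. \<chi> i. inv_stereographic z $ i)" by (rule continuous_on_vec_lambda)
  then show ?thesis by simp
qed

lemma continuous_on_cd:
  "continuous_on S f ==> continuous_on S g ==> continuous_on S (\<lambda>x. cd (f x) (g x))"
  unfolding cd_def
  by (intro continuous_intros continuous_on_compose2[OF continuous_on_inv_stereographic]) auto

text \<open>The values at 0, ..., n - 1 determine a monic polynomial of degree \<open>n\<close>, so
  finitely many evaluations describe the event; separation is asked of some enumeration of the
  roots, which makes the set independent of their order.\<close>

definition sepF :: "nat => real => (complex => complex) set" where
  "sepF n \<delta> = {f. \<exists>y. (\<forall>i<n. \<forall>j<n. i \<noteq> j \<longrightarrow> \<delta> < cd (y i) (y j)) \<and> (\<forall>m<n. f (of_nat m) = (\<Prod>i<n. of_nat m - y i))}"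

text \<open>The set is the preimage of a sigma-compact set. Roots bounded by \<open>k\<close> with
  separation margin 1/(k+1) form a compact set, and evaluation at 0, ..., n - 1 is continuous in the
  roots; the coordinates from \<open>n\<close> on are frozen at 0 to keep the product
  compact.\<close>

lemma sepF_measurable: "sepF n \<delta> \<in> sets FM"
proof -
  define \<Phi> :: "(nat => complex) => nat => complex" where
    "\<Phi> = (\<lambda>y m. if m < n then \<Prod>i<n. of_nat m - y i else 0)"
  define U where "U k = (\<Pi>\<^sub>E i\<in>UNIV. if i < n then cball 0 (real k) else {0}) \<inter>
    (\<Inter>i\<in>{..<n}. \<Inter>j\<in>{..<n} - {i}. {y :: nat => complex. \<delta> + 1 / real (Suc k) \<le> cd (y i) (y j)})" for k :: nat
  have proj: "continuous_on UNIV (\<lambda>y :: nat => complex. y i)" for i by (rule continuous_on_product_coordinates)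
  have cU: "compact (U k)" for k
    unfolding U_def
  proof (intro compact_Int_closed closed_INT ballI)
    have "compactin (product_topology (\<lambda>_. euclidean) UNIV) (\<Pi>\<^sub>E i\<in>UNIV. if i < n then cball (0 :: complex) (real k) else {0})"
      by (simp add: compactin_PiE)
    then show "compact (\<Pi>\<^sub>E i\<in>UNIV. if i < n then cball (0 :: complex) (real k) else {0})"
      by (simp add: euclidean_product_topology)
    show "closed {y :: nat => complex. \<delta> + 1 / real (Suc k) \<le> cd (y i) (y j)}" for i j
      by (intro closed_Collect_le continuous_on_cd proj continuous_intros)
  qed
  have c\<Phi>: "continuous_on UNIV \<Phi>"
    unfolding \<Phi>_def
  proof (intro continuous_on_coordinatewise_then_product)
    fix m show "continuous_on UNIV (\<lambda>y. if m < n then \<Prod>i<n. of_nat m - y i else 0 :: complex)"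
      by (cases "m < n") (auto intro!: continuous_intros proj)
  qed
  have cl: "closed (\<Phi> ` U k)" for k
    by (rule compact_imp_closed[OF compact_continuous_image[OF continuous_on_subset[OF c\<Phi> subset_UNIV] cU]])
  have T: "(\<Union>k. \<Phi> ` U k) \<in> sets borel"
    by (rule borel_closed[OF cl, THEN sets.countable_UN[OF image_subsetI]])
  have eq: "sepF n \<delta> = (\<lambda>f m. if m < n then f (of_nat m) else 0) -` (\<Union>k. \<Phi> ` U k) \<inter> space FM"
  proof (rule Set.set_eqI, rule iffI)
    fix f assume "f \<in> sepF n \<delta>"
    then obtain y where y: "\<And>i j. i < n ==> j < n ==> i \<noteq> j ==> \<delta> < cd (y i) (y j)"
      "\<And>m. m < n ==> f (of_nat m) = (\<Prod>i<n. of_nat m - y i)" by (auto simp: sepF_def)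
    define y' where "y' = (\<lambda>i. if i < n then y i else 0)"
    define \<epsilon> where "\<epsilon> = Min (insert 1 ((\<lambda>(i, j). cd (y i) (y j) - \<delta>) ` {(i, j). i < n \<and> j < n \<and> i \<noteq> j}))"
    have fin: "finite {(i, j). i < n \<and> j < n \<and> i \<noteq> j}"
      by (rule finite_subset[of _ "{..<n} \<times> {..<n}"]) auto
    have "\<epsilon> > 0" unfolding \<epsilon>_def using fin y(1) by (subst Min_gr_iff) auto
    then obtain k0 :: nat where k0: "1 / real (Suc k0) < \<epsilon>" using reals_Archimedean by (metis inverse_eq_divide)
    have eps: "\<delta> + \<epsilon> \<le> cd (y i) (y j)" if "i < n" "j < n" "i \<noteq> j" for i j
    proof -
      have "\<epsilon> \<le> cd (y i) (y j) - \<delta>" unfolding \<epsilon>_def using fin that by (intro Min_le) auto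
      then show ?thesis by simp
    qed
    obtain k1 :: nat where k1: "(\<Sum>i<n. cmod (y i)) \<le> real k1" using real_arch_simple by blast
    define k where "k = max k0 k1"
    have "1 / real (Suc k) \<le> 1 / real (Suc k0)" by (rule divide_left_mono) (auto simp: k_def)
    then have "\<delta> + 1 / real (Suc k) \<le> cd (y i) (y j)" if "i < n" "j < n" "i \<noteq> j" for i j
      using eps[OF that] k0 by linarith
    moreover have "cmod (y i) \<le> real k" if "i < n" for i
    proof -
      have "cmod (y i) \<le> (\<Sum>i<n. cmod (y i))" using that by (intro member_le_sum) auto
      then show ?thesis using k1 by (simp add: k_def)
    qed
    ultimately have "y' \<in> U k" by (auto simp: U_def y'_def PiE_iff)
    moreover have "(\<lambda>m. if m < n then f (of_nat m) else 0) = \<Phi> y'"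
      using y(2) by (auto simp: \<Phi>_def y'_def fun_eq_iff)
    ultimately show "f \<in> (\<lambda>f m. if m < n then f (of_nat m) else 0) -` (\<Union>k. \<Phi> ` U k) \<inter> space FM"
      by (auto simp: space_PiM)
  next
    fix f assume "f \<in> (\<lambda>f m. if m < n then f (of_nat m) else 0) -` (\<Union>k. \<Phi> ` U k) \<inter> space FM"
    then obtain k y where y: "y \<in> U k" "(\<lambda>m. if m < n then f (of_nat m) else 0) = \<Phi> y" by auto
    have "\<delta> < cd (y i) (y j)" if "i < n" "j < n" "i \<noteq> j" for i j
    proof -
      have "\<delta> + 1 / real (Suc k) \<le> cd (y i) (y j)" using y(1) that by (auto simp: U_def)
      moreover have "1 / real (Suc k) > 0" by simp
      ultimately show ?thesis by linarith
    qed
    moreover have "f (of_nat m) = (\<Prod>i<n. of_nat m - y i)" if "m < n" for m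
      using fun_cong[OF y(2), of m] that by (simp add: \<Phi>_def)
    ultimately show "f \<in> sepF n \<delta>" by (auto simp: sepF_def)
  qed
  have "(\<lambda>f m. if m < n then f (of_nat m) else 0) \<in> FM \<rightarrow>\<^sub>M (borel :: (nat => complex) measure)"
  proof (rule measurable_coordinatewise_then_product)
    fix m
    show "(\<lambda>f. if m < n then f (of_nat m) else 0) \<in> borel_measurable FM"
      by (cases "m < n") (auto intro: measurable_FM_apply)
  qed
  from measurable_sets[OF this T] show ?thesis unfolding eq .
qed

lemma poly_eq_of_agreement:
  fixes p q :: "complex poly"
  assumes "degree p = n" "degree q = n" "lead_coeff p = lead_coeff q" and eq: "\<And>m. m < n ==> poly p (of_nat m) = poly q (of_nat m)"
  shows "p = q"
proof (rule ccontr)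
  assume "p \<noteq> q"
  then have nz: "p - q \<noteq> 0" by simp
  have "coeff (p - q) i = 0" if "i \<ge> n" for i
    using that assms(1-3) by (cases "i = n") (auto simp: coeff_eq_0)
  then have "n > 0 \<and> degree (p - q) < n"
    using nz by (metis leading_coeff_0_iff not_less le0 gr0I)
  then have deg: "degree (p - q) < n" by simp
  have "of_nat ` {..<n} \<subseteq> {z. poly (p - q) z = 0}" using eq by auto
  then have "card (of_nat ` {..<n} :: complex set) \<le> card {z. poly (p - q) z = 0}"
    by (intro card_mono poly_roots_finite nz)
  also have "... \<le> degree (p - q)" by (rule card_poly_roots_bound[OF nz])
  finally show False using deg by (simp add: card_image inj_on_def)
qed

text \<open>Equal values at \<open>length es\<close> points force equal monic polynomials, so an
  enumeration witnessing membership is a permutation of \<open>es\<close>.\<close>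

lemma sepF_iff:
  "(\<lambda>z. \<Prod>e\<leftarrow>es. z - e) \<in> sepF (length es) \<delta> \<longleftrightarrow> (\<forall>i<length es. \<forall>j<length es. i \<noteq> j \<longrightarrow> \<delta> < cd (es ! i) (es ! j))"
proof
  define n where "n = length es"
  assume "(\<lambda>z. \<Prod>e\<leftarrow>es. z - e) \<in> sepF (length es) \<delta>"
  then obtain y where y: "\<And>i j. i < n ==> j < n ==> i \<noteq> j ==> \<delta> < cd (y i) (y j)"
    "\<And>m. m < n ==> (\<Prod>e\<leftarrow>es. of_nat m - e) = (\<Prod>i<n. of_nat m - y i)"
    by (auto simp: sepF_def n_def)
  define ys where "ys = map y [0..<n]"
  define L where "L = (\<lambda>xs :: complex list. \<Prod>x\<leftarrow>xs. [:- x, 1:])"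
  have deg: "degree (L xs) = length xs" "lead_coeff (L xs) = 1" for xs
    unfolding L_def by (rule degree_linear_factors, rule monic_prod_list) auto
  have ev: "poly (L xs) z = (\<Prod>x\<leftarrow>xs. z - x)" for xs z
    unfolding L_def by (induction xs) (auto simp: algebra_simps)
  have "(\<Prod>x\<leftarrow>ys. z - x) = (\<Prod>i<n. z - y i)" for z
    by (simp add: ys_def prod.list_conv_set_nth lessThan_atLeast0)
  then have "poly (L ys) (of_nat m) = poly (L es) (of_nat m)" if "m < n" for m
    using y(2)[OF that] by (simp only: ev)
  moreover have "degree (L ys) = n" "degree (L es) = n"
    unfolding deg(1) by (simp_all add: ys_def n_def)
  moreover have "lead_coeff (L ys) = lead_coeff (L es)" by (simp only: deg(2))
  ultimately have "L ys = L es" by (intro poly_eq_of_agreement[of _ n])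
  moreover have "proots (L xs) = mset xs" for xs
  proof (induction xs)
    case (Cons x xs)
    have "L xs \<noteq> 0" using deg(2)[of xs] by auto
    then have "proots ([:- x, 1:] * L xs) = {#x#} + proots (L xs)"
      by (subst proots_mult) auto
    then show ?case using Cons by (simp add: L_def)
  qed (simp add: L_def)
  ultimately have "mset es = mset ys" by metis
  then obtain p where p: "p permutes {..<length ys}" "permute_list p ys = es"
    by (rule mset_eq_permutation)
  have len: "length ys = n" by (simp add: ys_def)
  show "\<forall>i<length es. \<forall>j<length es. i \<noteq> j \<longrightarrow> \<delta> < cd (es ! i) (es ! j)"
  proof (intro allI impI)
    fix i j assume ij: "i < length es" "j < length es" "i \<noteq> j"
    then have ij': "i < n" "j < n" by (auto simp: n_def)
    have pp: "p k < n" if "k < n" for k using p(1) that len by (metis lessThan_iff permutes_in_image)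
    have es: "es ! k = y (p k)" if "k < n" for k
      using p(2)[symmetric] permute_list_nth[OF p(1), of k] that pp[OF that] len by (simp add: ys_def)
    have "p i \<noteq> p j" using p(1) ij(3) by (metis permutes_inj injD)
    then show "\<delta> < cd (es ! i) (es ! j)" using y(1) es ij' pp by simp
  qed
next
  assume *: "\<forall>i<length es. \<forall>j<length es. i \<noteq> j \<longrightarrow> \<delta> < cd (es ! i) (es ! j)"
  show "(\<lambda>z. \<Prod>e\<leftarrow>es. z - e) \<in> sepF (length es) \<delta>"
    unfolding sepF_def using *
    by (intro CollectI exI[of _ "\<lambda>i. es ! i"]) (auto simp: prod.list_conv_set_nth lessThan_atLeast0)
qed

lemma min_distance_gt_iff:
  assumes "length es \<ge> 2"
  shows "\<delta> < min_distance (map inv_stereographic es) \<longleftrightarrow> (\<forall>i<length es. \<forall>j<length es. i \<noteq> j \<longrightarrow> \<delta> < cd (es ! i) (es ! j))"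
proof -
  let ?n = "length es"
  let ?S = "{norm (map inv_stereographic es ! i - map inv_stereographic es ! j) | i j.
    i < length (map inv_stereographic es) \<and> j < length (map inv_stereographic es) \<and> i \<noteq> j}"
  have S: "?S = (\<lambda>(i, j). cd (es ! i) (es ! j)) ` {(i, j). i < ?n \<and> j < ?n \<and> i \<noteq> j}"
    unfolding cd_def
  proof (intro subset_antisym subsetI)
    fix d assume "d \<in> ?S"
    then obtain i j where "d = norm (map inv_stereographic es ! i - map inv_stereographic es ! j)"
      "i < ?n" "j < ?n" "i \<noteq> j" by auto
    then show "d \<in> (\<lambda>(i, j). norm (inv_stereographic (es ! i) - inv_stereographic (es ! j))) ` {(i, j). i < ?n \<and> j < ?n \<and> i \<noteq> j}"
      by (intro image_eqI[of _ _ "(i, j)"]) auto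
  next
    fix d assume "d \<in> (\<lambda>(i, j). norm (inv_stereographic (es ! i) - inv_stereographic (es ! j))) ` {(i, j). i < ?n \<and> j < ?n \<and> i \<noteq> j}"
    then obtain i j where "d = norm (inv_stereographic (es ! i) - inv_stereographic (es ! j))"
      "i < ?n" "j < ?n" "i \<noteq> j" by auto
    then show "d \<in> ?S" by (intro CollectI exI[of _ i] exI[of _ j]) auto
  qed
  have "finite {(i, j). i < ?n \<and> j < ?n \<and> i \<noteq> j}"
    by (rule finite_subset[of _ "{..<?n} \<times> {..<?n}"]) auto
  moreover have "(0, 1) \<in> {(i, j). i < ?n \<and> j < ?n \<and> i \<noteq> j}" using assms by auto
  ultimately show ?thesis
    unfolding min_distance_def S by (subst Min_gr_iff) auto
qed

lemma spherical_points_separated: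
  assumes A: "A \<in> carrier_mat n n" and B: "B \<in> carrier_mat n n" and n: "n \<ge> 2" and \<delta>: "\<delta> \<ge> 0"
  shows "\<delta> < min_distance (spherical_points A B) \<longleftrightarrow>
    dt n (ea (entries n A B)) \<noteq> 0 \<and> chi n (entries n A B) \<in> sepF n \<delta>"
proof -
  have matA: "Matrix.mat n n (\<lambda>(i, j). A $$ (i, j)) = A" using A by (intro eq_matI) auto
  then have matA': "Matrix.mat n n (($$) A) = A" by simp
  have dA: "dt n (ea (entries n A B)) = Determinant.det A"
  proof -
    have "dt n (ea (entries n A B)) = dt n (\<lambda>i j. A $$ (i, j))" by (rule dt_cong) (simp add: entries_def)
    then show ?thesis by (simp add: dt_def matA')
  qed
  define C where "C = inverse_mat A * B"
  define es where "es = eigenvalue_list C"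
  have main: "(\<delta> < min_distance (spherical_points A B)) = (\<forall>i<n. \<forall>j<n. i \<noteq> j \<longrightarrow> \<delta> < cd (es ! i) (es ! j))"
    if "C \<in> carrier_mat n n"
    using min_distance_gt_iff[of es \<delta>] eigenvalue_list(2)[OF that] n
    by (simp add: spherical_points_def es_def C_def)
  show ?thesis
  proof (cases "Determinant.det A = 0")
    case True
    \<comment> \<open>For a singular A the matrix \<open>inverse_mat A\<close> is 0, so all
      eigenvalues are 0; as \<open>n\<close> is at least 2, two points coincide, and the left side
      fails for \<open>\<delta> \<ge> 0\<close> just as the right side does.\<close>
    have "mat_inverse A = None"
    proof (rule ccontr)
      assume "mat_inverse A \<noteq> None"
      then obtain D where "mat_inverse A = Some D" by auto
      from mat_inverse(2)[OF A this] have "A * D = 1\<^sub>m n" "D \<in> carrier_mat n n" by auto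
      then have "Determinant.det A * Determinant.det D = 1" using det_mult[OF A] by (metis det_one)
      then show False using True by simp
    qed
    then have C0: "C = 0\<^sub>m n n" using A B by (simp add: C_def inverse_mat_def)
    then have Cc: "C \<in> carrier_mat n n" by simp
    have "char_poly C = [:0, 1:] ^ n"
    proof -
      have "char_poly C = (\<Prod>a\<leftarrow>diag_mat C. [:- a, 1:])"
        by (rule char_poly_upper_triangular[OF Cc]) (simp add: C0 upper_triangular_def)
      also have "diag_mat C = replicate n 0"
        unfolding C0 diag_mat_def by (auto intro!: nth_equalityI)
      finally show ?thesis by simp
    qed
    then have "(\<Prod>e\<leftarrow>es. [:- e, 1:]) = [:0, 1:] ^ n" using eigenvalue_list(1)[OF Cc] by (simp add: es_def)
    then have ev: "poly (\<Prod>e\<leftarrow>es. [:- e, 1:]) z = z ^ n" for z by simp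
    have zero: "e = 0" if "e \<in> set es" for e
    proof -
      have "poly (\<Prod>e\<leftarrow>es. [:- e, 1:]) e = 0" using that by (auto simp: poly_prod_list prod_list_zero_iff)
      then show ?thesis unfolding ev by simp
    qed
    have len: "length es = n" using eigenvalue_list(2)[OF Cc] by (simp add: es_def)
    have "es ! 0 = 0" "es ! 1 = 0" using n len by (auto intro!: zero nth_mem)
    then have "cd (es ! 0) (es ! 1) = 0" by (simp add: cd_def)
    then have "\<not> (\<forall>i<n. \<forall>j<n. i \<noteq> j \<longrightarrow> \<delta> < cd (es ! i) (es ! j))"
    proof (intro notI)
      assume H: "\<forall>i<n. \<forall>j<n. i \<noteq> j \<longrightarrow> \<delta> < cd (es ! i) (es ! j)"
      have "\<delta> < cd (es ! 0) (es ! 1)" using H[rule_format, of 0 1] n by simp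
      then show False using \<open>cd (es ! 0) (es ! 1) = 0\<close> \<delta> by simp
    qed
    then show ?thesis using main[OF Cc] dA True by simp
  next
    case False
    from det_non_zero_imp_unit[OF A False, where b = "()"]
    obtain D where D: "D \<in> carrier_mat n n" "D * A = 1\<^sub>m n" "A * D = 1\<^sub>m n"
      by (auto simp: Units_def ring_mat_def)
    then have "invertible_mat A"
      using A unfolding invertible_mat_def inverts_mat_def by auto
    note inv = inverse_mat_inverts[OF A this]
    have Cc: "C \<in> carrier_mat n n" unfolding C_def using inv(1) B by simp
    have AC: "A * C = B" unfolding C_def using A B inv by (metis assoc_mult_mat left_mult_one_mat)
    have len: "length es = n" using eigenvalue_list(2)[OF Cc] by (simp add: es_def)
    have chi: "chi n (entries n A B) = (\<lambda>z. \<Prod>e\<leftarrow>es. z - e)"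
    proof
      fix z
      have "dt n (pen (entries n A B) z) = Determinant.det (z \<cdot>\<^sub>m A - B)"
        unfolding dt_def using A B by (intro arg_cong[where f=Determinant.det] eq_matI) (auto simp: entries_def)
      \<comment> \<open>The factorisation z A - B = A (z - A^-1 B) identifies \<open>chi\<close>
        with the characteristic polynomial.\<close>
      also have "z \<cdot>\<^sub>m A - B = A * (z \<cdot>\<^sub>m 1\<^sub>m n - C)"
      proof -
        have "A * (z \<cdot>\<^sub>m 1\<^sub>m n - C) = A * (z \<cdot>\<^sub>m 1\<^sub>m n) - A * C"
          using Cc by (intro mult_minus_distrib_mat[OF A]) auto
        also have "A * (z \<cdot>\<^sub>m 1\<^sub>m n) = z \<cdot>\<^sub>m (A * 1\<^sub>m n)"
          by (rule mult_smult_distrib[OF A one_carrier_mat])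
        finally show ?thesis using A AC by simp
      qed
      also have "Determinant.det ... = Determinant.det A * Determinant.det (z \<cdot>\<^sub>m 1\<^sub>m n - C)"
        using A Cc by (intro det_mult) auto
      also have "Determinant.det (z \<cdot>\<^sub>m 1\<^sub>m n - C) = poly (char_poly C) z"
      proof -
        show ?thesis unfolding char_poly_def
          by (rule poly_det_cong[symmetric, of _ n]) (use Cc in \<open>auto simp: char_poly_matrix_def\<close>)
      qed
      also have "poly (char_poly C) z = (\<Prod>e\<leftarrow>es. z - e)"
        unfolding eigenvalue_list(1)[OF Cc] es_def[symmetric] by (induction es) (auto simp: algebra_simps)
      finally show "chi n (entries n A B) z = (\<Prod>e\<leftarrow>es. z - e)"
        using False by (simp add: chi_def dA)
    qed
    show ?thesis using main[OF Cc] sepF_iff[of es \<delta>] dA False by (simp add: chi len)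
  qed
qed

subsection \<open>The uniform measure of the sphere in the stereographic chart\<close>

lemma measure_eqI_atMost:
  fixes M N :: "real measure"
  assumes sets: "sets M = sets borel" "sets N = sets borel"
    and em: "\<And>a. emeasure M {..a} = emeasure N {..a}" and fin: "\<And>a. emeasure M {..a} \<noteq> \<infinity>"
  shows "M = N"
proof (rule measure_eqI_generator_eq[where E="range (\<lambda>a::real. {..a})" and \<Omega>=UNIV and A="\<lambda>i. {..real i}"])
  show "Int_stable (range (\<lambda>a::real. {..a}))" by (auto simp: Int_stable_def)
  show "sets M = sigma_sets UNIV (range (\<lambda>a::real. {..a}))" "sets N = sigma_sets UNIV (range (\<lambda>a::real. {..a}))"
    using sets by (simp_all add: borel_eq_atMost)
  show "(\<Union>i. {..real i}) = UNIV" by (auto intro: real_arch_simple)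
qed (use em fin in auto)

text \<open>A disc of squared radius a has area pi a, and half lines determine the image measure of
  |z|^2.\<close>

lemma nn_integral_norm_square:
  fixes g :: "real => ennreal"
  assumes [measurable]: "g \<in> borel_measurable borel"
  shows "(\<integral>\<^sup>+z. g ((cmod z)\<^sup>2) \<partial>lborel) = ennreal pi * (\<integral>\<^sup>+s\<in>{0..}. g s \<partial>lborel)"
proof -
  let ?M = "distr lborel borel (\<lambda>z::complex. (cmod z)\<^sup>2)"
  let ?N = "density lborel (\<lambda>s::real. ennreal pi * indicator {0..} s)"
  have em: "emeasure ?M {..a} = ennreal (pi * max 0 a) \<and> emeasure ?N {..a} = ennreal (pi * max 0 a)" for a
  proof -
    have N: "emeasure ?N {..a} = ennreal pi * emeasure lborel ({0..} \<inter> {..a})"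
      by (subst emeasure_density) (simp_all add: mult.assoc nn_integral_cmult indicator_inter_arith[symmetric])
    have Int: "{0..} \<inter> {..a} = {0..a}" by auto
    have M: "emeasure ?M {..a} = emeasure lborel {z::complex. (cmod z)\<^sup>2 \<le> a}"
      by (subst emeasure_distr) (auto simp: vimage_def)
    show ?thesis
    proof (cases "a \<ge> 0")
      case True
      have "{z::complex. (cmod z)\<^sup>2 \<le> a} = cball 0 (sqrt a)"
        by (auto simp: dist_norm intro: real_le_rsqrt) (metis True norm_ge_zero power_mono real_sqrt_pow2)
      then show ?thesis using True unfolding N M Int
        by (simp add: emeasure_cball unit_ball_vol_2 ennreal_mult'')
    next
      case False
      then have "{z::complex. (cmod z)\<^sup>2 \<le> a} = {}" by (auto simp: not_le intro: less_le_trans[OF _ zero_le_power2])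
      then show ?thesis using False unfolding N M Int by simp
    qed
  qed
  have "?M = ?N"
    by (rule measure_eqI_atMost) (simp_all add: em)
  then have "(\<integral>\<^sup>+s. g s \<partial>?M) = (\<integral>\<^sup>+s. g s \<partial>?N)" by simp
  then show ?thesis
    by (simp add: nn_integral_distr nn_integral_density mult.assoc nn_integral_cmult mult.commute[of "g _"])
qed

definition sph :: "complex measure" where
  "sph = density lborel (\<lambda>z. ennreal (1 / (pi * (1 + (cmod z)\<^sup>2)\<^sup>2)))"

lemma sets_sph [simp, measurable_cong]: "sets sph = sets borel" and space_sph [simp]: "space sph = UNIV"
  by (simp_all add: sph_def)

lemma nn_integral_sph:
  assumes "g \<in> borel_measurable borel"
  shows "(\<integral>\<^sup>+z. g z \<partial>sph) = (\<integral>\<^sup>+z. ennreal (1 / (pi * (1 + (cmod z)\<^sup>2)\<^sup>2)) * g z \<partial>lborel)"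
  unfolding sph_def using assms by (intro nn_integral_density) auto

lemma one_plus_norm_pos: "1 + (cmod z)\<^sup>2 > 0"
  using zero_le_power2[of "cmod z"] by linarith

text \<open>Archimedes: the height on the sphere is uniformly distributed. The quantity |z|^2 / (1 +
  |z|^2) is the height of the point, rescaled to [0, 1].\<close>

lemma emeasure_sph_disc:
  "emeasure sph {z. (cmod z)\<^sup>2 / (1 + (cmod z)\<^sup>2) \<le> a} = ennreal (max 0 (min 1 a))"
proof -
  let ?h = "\<lambda>s::real. ennreal (1 / (pi * (1 + s)\<^sup>2)) * indicator {s. s / (1 + s) \<le> a} s"
  have "emeasure sph {z. (cmod z)\<^sup>2 / (1 + (cmod z)\<^sup>2) \<le> a} = (\<integral>\<^sup>+z. ?h ((cmod z)\<^sup>2) \<partial>lborel)"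
    unfolding sph_def by (subst emeasure_density) (auto intro!: nn_integral_cong simp: indicator_def)
  also have "... = ennreal pi * (\<integral>\<^sup>+s\<in>{0..}. ?h s \<partial>lborel)"
    by (rule nn_integral_norm_square) measurable
  also have "... = ennreal (max 0 (min 1 a))"
  proof -
    have der: "((\<lambda>s. - 1 / (pi * (1 + s))) has_real_derivative 1 / (pi * (1 + s)\<^sup>2)) (at s)" if "0 \<le> s" for s
      using that by (auto intro!: derivative_eq_intros simp: power2_eq_square divide_simps)
    consider "a < 0" | "0 \<le> a" "a < 1" | "a \<ge> 1" by linarith
    then show ?thesis
    proof cases
      case 1
      have "\<not> s / (1 + s) \<le> a" if "0 \<le> s" for s
      proof -
        have "0 \<le> s / (1 + s)" using that by simp
        then show ?thesis using 1 by linarith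
      qed
      then have "(\<integral>\<^sup>+s\<in>{0..}. ?h s \<partial>lborel) = (\<integral>\<^sup>+(s::real). 0 \<partial>lborel)"
        by (intro nn_integral_cong) (auto simp: indicator_def)
      then show ?thesis using 1 by simp
    next
      case 2
      have iff: "s / (1 + s) \<le> a \<longleftrightarrow> s \<le> a / (1 - a)" if "0 \<le> s" for s
        using that 2 by (simp add: divide_simps) (auto simp: algebra_simps)
      have "(\<integral>\<^sup>+s\<in>{0..}. ?h s \<partial>lborel) = (\<integral>\<^sup>+s\<in>{0..a / (1 - a)}. ennreal (1 / (pi * (1 + s)\<^sup>2)) \<partial>lborel)"
        by (rule nn_integral_cong) (auto simp: indicator_def iff)
      also have "... = ennreal (- 1 / (pi * (1 + a / (1 - a))) - (- 1 / (pi * (1 + 0))))"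
      proof (rule nn_integral_FTC_Icc)
        show "((\<lambda>s. - 1 / (pi * (1 + s))) has_real_derivative 1 / (pi * (1 + s)\<^sup>2)) (at s)"
          if "s \<in> {0..a / (1 - a)}" for s
          using that by (intro der) simp
      qed (use 2 in auto)
      also have "- 1 / (pi * (1 + a / (1 - a))) - (- 1 / (pi * (1 + 0))) = a / pi"
        using 2 by (simp add: field_simps)
      finally show ?thesis using 2 by (simp add: ennreal_mult''[symmetric])
    next
      case 3
      have "s / (1 + s) \<le> a" if "0 \<le> s" for s
      proof -
        have "s / (1 + s) \<le> 1" using that by simp
        then show ?thesis using 3 by linarith
      qed
      then have "(\<integral>\<^sup>+s\<in>{0..}. ?h s \<partial>lborel) = (\<integral>\<^sup>+s\<in>{0..}. ennreal (1 / (pi * (1 + s)\<^sup>2)) \<partial>lborel)"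
        by (intro nn_integral_cong) (auto simp: indicator_def)
      also have "... = ennreal (0 - (- 1 / (pi * (1 + 0))))"
      proof (rule nn_integral_FTC_atLeast)
        show "((\<lambda>s. - 1 / (pi * (1 + s))) \<longlongrightarrow> 0) at_top" using pi_gt_zero by real_asymp
        show "((\<lambda>s. - 1 / (pi * (1 + s))) has_real_derivative 1 / (pi * (1 + s)\<^sup>2)) (at s)" if "0 \<le> s" for s
          by (rule der[OF that])
      qed auto
      finally show ?thesis using 3 by (simp add: ennreal_mult''[symmetric])
    qed
  qed
  finally show ?thesis .
qed

interpretation sph: prob_space sph
proof
  have "{z. (cmod z)\<^sup>2 / (1 + (cmod z)\<^sup>2) \<le> 1} = UNIV" using one_plus_norm_pos by (auto simp: divide_simps)
  then show "emeasure sph (space sph) = 1" using emeasure_sph_disc[of 1] by simp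
qed

lemma nn_integral_sph_radial:
  fixes g :: "real => ennreal"
  assumes [measurable]: "g \<in> borel_measurable borel"
  shows "(\<integral>\<^sup>+z. g ((cmod z)\<^sup>2 / (1 + (cmod z)\<^sup>2)) \<partial>sph) = (\<integral>\<^sup>+u\<in>{0..1}. g u \<partial>lborel)"
proof -
  let ?M = "distr sph borel (\<lambda>z::complex. (cmod z)\<^sup>2 / (1 + (cmod z)\<^sup>2))"
  let ?N = "density lborel (indicator {0..1::real})"
  have em: "emeasure ?M {..a} = ennreal (max 0 (min 1 a)) \<and> emeasure ?N {..a} = ennreal (max 0 (min 1 a))" for a
  proof -
    have "emeasure ?N {..a} = emeasure lborel ({0..1} \<inter> {..a})"
      by (subst emeasure_density) (simp_all add: indicator_inter_arith[symmetric])
    also have "{0..1} \<inter> {..a} = {0..min 1 a}" by auto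
    also have "emeasure lborel {0..min 1 a} = ennreal (max 0 (min 1 a))"
      by (cases "0 \<le> a") auto
    finally show ?thesis
      using emeasure_sph_disc[of a] by (subst emeasure_distr) (auto simp: vimage_def)
  qed
  have "?M = ?N"
    by (rule measure_eqI_atMost) (simp_all add: em)
  then have "(\<integral>\<^sup>+s. g s \<partial>?M) = (\<integral>\<^sup>+s. g s \<partial>?N)" by simp
  then show ?thesis
    by (simp add: nn_integral_distr nn_integral_density mult.commute[of "g _"])
qed

text \<open>A quarter of the squared chordal distance (\<open>cd_square\<close>). It is the
  convenient parameter because for a fixed first point it is uniform on [0, 1], and because the
  modulus of \<open>ker\<close> is a function of it.\<close>

definition qd :: "complex => complex => real" where
  "qd p z = (cmod (z - p))\<^sup>2 / ((1 + (cmod p)\<^sup>2) * (1 + (cmod z)\<^sup>2))"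

lemma qd_nonneg: "0 \<le> qd p z"
  unfolding qd_def using one_plus_norm_pos[of p] one_plus_norm_pos[of z] by simp

lemma qd_commute: "qd p z = qd z p"
  by (simp add: qd_def norm_minus_commute mult.commute)

lemma norm_one_plus_mult_cnj:
  "(cmod (1 + z * cnj w))\<^sup>2 + (cmod (z - w))\<^sup>2 = (1 + (cmod z)\<^sup>2) * (1 + (cmod w)\<^sup>2)"
  unfolding cmod_power2 by (simp add: power2_eq_square algebra_simps)

lemma one_minus_qd: "1 - qd p z = (cmod (1 + z * cnj p))\<^sup>2 / ((1 + (cmod p)\<^sup>2) * (1 + (cmod z)\<^sup>2))"
proof -
  have "(1 + (cmod p)\<^sup>2) * (1 + (cmod z)\<^sup>2) > 0" using one_plus_norm_pos by (intro mult_pos_pos)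
  then show ?thesis using norm_one_plus_mult_cnj[of z p] unfolding qd_def
    by (simp add: field_simps)
qed

lemma qd_le_1: "qd p z \<le> 1"
proof -
  have "0 \<le> 1 - qd p z" unfolding one_minus_qd using one_plus_norm_pos[of p] one_plus_norm_pos[of z] by simp
  then show ?thesis by simp
qed

lemma cd_square: "(cd z w)\<^sup>2 = 4 * qd z w"
proof -
  define a b where "a = (cmod z)\<^sup>2 + 1" and "b = (cmod w)\<^sup>2 + 1"
  define x y x' y' where "x = Re z" and "y = Im z" and "x' = Re w" and "y' = Im w"
  have pos: "a > 0" "b > 0" using one_plus_norm_pos[of z] one_plus_norm_pos[of w] by (auto simp: a_def b_def)
  have a: "x\<^sup>2 + y\<^sup>2 = a - 1" "x'\<^sup>2 + y'\<^sup>2 = b - 1" by (simp_all add: a_def b_def x_def y_def x'_def y'_def cmod_power2)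
  have "(cd z w)\<^sup>2 = (2 * x / a - 2 * x' / b)\<^sup>2 + (2 * y / a - 2 * y' / b)\<^sup>2 + ((a - 2) / a - (b - 2) / b)\<^sup>2"
    unfolding cd_def inv_stereographic_eq
    by (simp add: norm_vec_def L2_set_def sum_3 a_def b_def x_def y_def x'_def y'_def algebra_simps)
  also have "... = 4 * ((x * b - x' * a)\<^sup>2 + (y * b - y' * a)\<^sup>2 + (a - b)\<^sup>2) / (a * b)\<^sup>2"
    using pos by (simp add: field_simps power2_eq_square)
  also have "(x * b - x' * a)\<^sup>2 + (y * b - y' * a)\<^sup>2 + (a - b)\<^sup>2 =
      (x\<^sup>2 + y\<^sup>2) * b\<^sup>2 + (x'\<^sup>2 + y'\<^sup>2) * a\<^sup>2 - 2 * (a * b) * (x * x' + y * y') + (a - b)\<^sup>2"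
    by (simp add: power2_eq_square algebra_simps)
  also have "... = (a * b) * ((x\<^sup>2 + y\<^sup>2) + (x'\<^sup>2 + y'\<^sup>2) - 2 * (x * x' + y * y'))"
    unfolding a by (simp add: power2_eq_square algebra_simps)
  also have "(x\<^sup>2 + y\<^sup>2) + (x'\<^sup>2 + y'\<^sup>2) - 2 * (x * x' + y * y') = (cmod (w - z))\<^sup>2"
    unfolding cmod_power2 x_def y_def x'_def y'_def by (simp add: power2_eq_square algebra_simps)
  also have "4 * (a * b * (cmod (w - z))\<^sup>2) / (a * b)\<^sup>2 = 4 * qd z w"
  proof -
    have "(1 + (cmod z)\<^sup>2) * (1 + (cmod w)\<^sup>2) = a * b" by (simp only: a_def b_def add.commute)
    then show ?thesis using pos unfolding qd_def by (simp add: power2_eq_square)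
  qed
  finally show ?thesis .
qed

lemma borel_measurable_qd [measurable]:
  assumes [measurable]: "f \<in> borel_measurable M" "g \<in> borel_measurable M"
  shows "(\<lambda>x. qd (f x) (g x)) \<in> borel_measurable M"
  unfolding qd_def by measurable

text \<open>The rotation of the sphere that moves the south pole to \<open>p\<close> is the Moebius map \<open>(\<zeta> + p) / (1 - cnj p * \<zeta>)\<close>.\<close>

lemma nn_integral_sph_qd:
  fixes g :: "real => ennreal"
  assumes [measurable]: "g \<in> borel_measurable borel"
  shows "(\<integral>\<^sup>+z. g (qd p z) \<partial>sph) = (\<integral>\<^sup>+u\<in>{0..1}. g u \<partial>lborel)"
proof -
  define U where "U = {\<zeta>. 1 - cnj p * \<zeta> \<noteq> 0}"
  define f where "f = (\<lambda>\<zeta>. (\<zeta> + p) / (1 - cnj p * \<zeta>))"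
  define f' where "f' = (\<lambda>\<zeta>. (1 + of_real ((cmod p)\<^sup>2)) / (1 - cnj p * \<zeta>)\<^sup>2)"
  let ?d = "\<lambda>z. 1 / (pi * (1 + (cmod z)\<^sup>2)\<^sup>2)"
  have pp: "p * cnj p = of_real ((cmod p)\<^sup>2)" by (simp only: complex_norm_square)
  have np: "(1 + of_real ((cmod p)\<^sup>2) :: complex) \<noteq> 0"
    using one_plus_norm_pos[of p] by (metis less_irrefl of_real_1 of_real_add of_real_eq_0_iff)
  have npr: "cmod (1 + of_real ((cmod p)\<^sup>2)) = 1 + (cmod p)\<^sup>2"
    using one_plus_norm_pos[of p] by (metis abs_of_pos norm_of_real of_real_1 of_real_add)
  have Uo: "open U" unfolding U_def by (intro open_Collect_neq continuous_intros)
  have der: "(f has_field_derivative f' z) (at z)" if "z \<in> U" for z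
  proof -
    have nz: "1 - cnj p * z \<noteq> 0" using that by (simp add: U_def)
    have "(f has_field_derivative (1 * (1 - cnj p * z) - (z + p) * (- cnj p)) / ((1 - cnj p * z) * (1 - cnj p * z))) (at z)"
      unfolding f_def using nz by (auto intro!: derivative_eq_intros)
    also have "1 * (1 - cnj p * z) - (z + p) * (- cnj p) = 1 + p * cnj p" by (simp add: algebra_simps)
    finally show ?thesis unfolding f'_def pp by (simp add: power2_eq_square)
  qed
  have nz: "f' z \<noteq> 0" if "z \<in> U" for z using that np by (simp add: U_def f'_def)
  have mf: "f \<in> borel_measurable borel" "f' \<in> borel_measurable borel"
    unfolding f_def f'_def by measurable
  \<comment> \<open>The excluded value, if any, is the image of infinity; every other value has
    exactly one preimage, given by the inverse Moebius map.\<close>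
  have "AE w in lborel. w \<notin> {w. 1 + cnj p * w = 0}"
  proof (rule AE_lborel_finite, rule finite_subset)
    show "{w. 1 + cnj p * w = 0} \<subseteq> {- 1 / cnj p}"
    proof
      fix w assume "w \<in> {w. 1 + cnj p * w = 0}"
      then have e: "cnj p * w = - 1" by (simp add: eq_neg_iff_add_eq_0 add.commute)
      then have "cnj p \<noteq> 0" by auto
      then have "w = (cnj p * w) / cnj p" by simp
      then show "w \<in> {- 1 / cnj p}" unfolding e by simp
    qed
  qed simp
  then have count: "AE w in lborel. card {z\<in>U. f z = w} = 1 \<and> finite {z\<in>U. f z = w}"
  proof eventually_elim
    fix w assume w: "w \<notin> {w. 1 + cnj p * w = 0}"
    then have w0: "1 + cnj p * w \<noteq> 0" by simp
    define \<zeta> where "\<zeta> = (w - p) / (1 + cnj p * w)"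
    have "1 - cnj p * \<zeta> = (1 + p * cnj p) / (1 + cnj p * w)" unfolding \<zeta>_def using w0 by (simp add: field_simps)
    then have z1: "1 - cnj p * \<zeta> = (1 + of_real ((cmod p)\<^sup>2)) / (1 + cnj p * w)" unfolding pp .
    have "\<zeta> + p = w * (1 + p * cnj p) / (1 + cnj p * w)" unfolding \<zeta>_def using w0 by (simp add: field_simps)
    then have z2: "\<zeta> + p = w * (1 + of_real ((cmod p)\<^sup>2)) / (1 + cnj p * w)" unfolding pp .
    have "{z\<in>U. f z = w} = {\<zeta>}"
    proof (intro subset_antisym subsetI)
      fix z assume "z \<in> {z\<in>U. f z = w}"
      then have "z + p = w * (1 - cnj p * z)" by (auto simp: U_def f_def divide_eq_eq)
      then have "z * (1 + cnj p * w) = w - p" by (simp add: algebra_simps eq_diff_eq)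
      then show "z \<in> {\<zeta>}" using w0 by (simp add: \<zeta>_def eq_divide_eq)
    next
      fix z assume "z \<in> {\<zeta>}"
      moreover have "1 - cnj p * \<zeta> \<noteq> 0" unfolding z1 using w0 np by simp
      moreover have "f \<zeta> = w" unfolding f_def z1 z2 using w0 np by simp
      ultimately show "z \<in> {z\<in>U. f z = w}" by (simp add: U_def)
    qed
    then show "card {z\<in>U. f z = w} = 1 \<and> finite {z\<in>U. f z = w}" by simp
  qed
  \<comment> \<open>Rotation invariance in coordinates: the density of \<open>sph\<close> is
    preserved, and the distance to \<open>p\<close> becomes the distance to 0.\<close>
  have dens: "?d (f z) * (cmod (f' z))\<^sup>2 = ?d z \<and> qd p (f z) = (cmod z)\<^sup>2 / (1 + (cmod z)\<^sup>2)" if "z \<in> U" for z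
  proof -
    define D where "D = (cmod (1 - cnj p * z))\<^sup>2"
    define P Z where "P = 1 + (cmod p)\<^sup>2" and "Z = 1 + (cmod z)\<^sup>2"
    have pos: "D > 0" "P > 0" "Z > 0" using that one_plus_norm_pos by (auto simp: D_def P_def Z_def U_def)
    have "D + (cmod (z + p))\<^sup>2 = P * Z"
      using norm_one_plus_mult_cnj[of "-z" p] by (simp add: D_def P_def Z_def mult.commute norm_minus_commute add.commute norm_minus_cancel[of "z + p", simplified])
    then have E1: "1 + (cmod (f z))\<^sup>2 = P * Z / D"
      unfolding f_def norm_divide power_divide D_def[symmetric] using pos(1) by (simp add: field_simps)
    have E2: "(cmod (f' z))\<^sup>2 = P\<^sup>2 / D\<^sup>2"
      unfolding f'_def norm_divide npr norm_power by (simp add: P_def D_def power_divide)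
    have E3: "(cmod (f z - p))\<^sup>2 = (cmod z)\<^sup>2 * P\<^sup>2 / D"
    proof -
      have "f z - p = z * (1 + p * cnj p) / (1 - cnj p * z)"
        using that by (simp add: f_def U_def field_simps)
      then have "cmod (f z - p) = cmod z * P / cmod (1 - cnj p * z)"
        unfolding pp by (simp only: norm_mult norm_divide npr P_def)
      then show ?thesis by (simp add: power_divide power_mult_distrib D_def)
    qed
    show ?thesis
      unfolding qd_def E1 E2 E3 Z_def[symmetric] P_def[symmetric] using pos
      by (simp add: field_simps power2_eq_square)
  qed
  have ae: "AE z in lborel. z \<in> U"
  proof -
    have "AE w in lborel. w \<notin> {w. 1 - cnj p * w = 0}"
    proof (rule AE_lborel_finite, rule finite_subset)
      show "{w. 1 - cnj p * w = 0} \<subseteq> {1 / cnj p}"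
      proof
        fix w assume "w \<in> {w. 1 - cnj p * w = 0}"
        then have e: "cnj p * w = 1" by simp
        then have "cnj p \<noteq> 0" by auto
        then show "w \<in> {1 / cnj p}" using e by (simp add: eq_divide_eq mult.commute)
      qed
    qed simp
    then show ?thesis by eventually_elim (simp add: U_def)
  qed
  have "(\<integral>\<^sup>+w. g (qd p w) \<partial>sph) = of_nat 1 * (\<integral>\<^sup>+w. ennreal (?d w) * g (qd p w) \<partial>lborel)"
    by (simp add: nn_integral_sph)
  also have "... = (\<integral>\<^sup>+z\<in>U. (ennreal (?d (f z)) * g (qd p (f z))) * ennreal ((cmod (f' z))\<^sup>2) \<partial>lborel)"
    by (rule nn_integral_count_preimages[OF Uo der nz mf _ count, symmetric]) auto
  also have "... = (\<integral>\<^sup>+z. ennreal (?d z) * g ((cmod z)\<^sup>2 / (1 + (cmod z)\<^sup>2)) \<partial>lborel)"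
  proof (rule nn_integral_cong_AE)
    show "AE z in lborel. (ennreal (?d (f z)) * g (qd p (f z))) * ennreal ((cmod (f' z))\<^sup>2) * indicator U z =
        ennreal (?d z) * g ((cmod z)\<^sup>2 / (1 + (cmod z)\<^sup>2))"
      using ae
    proof eventually_elim
      fix z assume z: "z \<in> U"
      have "ennreal (?d (f z)) * ennreal ((cmod (f' z))\<^sup>2) = ennreal (?d z)"
        using dens[OF z] by (subst ennreal_mult''[symmetric]) simp_all
      moreover have "(ennreal (?d (f z)) * g (qd p (f z))) * ennreal ((cmod (f' z))\<^sup>2) * indicator U z =
          (ennreal (?d (f z)) * ennreal ((cmod (f' z))\<^sup>2)) * g (qd p (f z))"
        using z by (simp add: ac_simps)
      ultimately show "(ennreal (?d (f z)) * g (qd p (f z))) * ennreal ((cmod (f' z))\<^sup>2) * indicator U z =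
        ennreal (?d z) * g ((cmod z)\<^sup>2 / (1 + (cmod z)\<^sup>2))"
        using dens[OF z] by simp
    qed
  qed
  also have "... = (\<integral>\<^sup>+z. g ((cmod z)\<^sup>2 / (1 + (cmod z)\<^sup>2)) \<partial>sph)"
    by (simp add: nn_integral_sph)
  also have "... = (\<integral>\<^sup>+u\<in>{0..1}. g u \<partial>lborel)" by (rule nn_integral_sph_radial) fact
  finally show ?thesis .
qed

subsection \<open>The kernel\<close>

definition wt :: "nat => complex => real" where
  "wt n z = 1 / sqrt (1 + (cmod z)\<^sup>2) ^ (n - 1)"

text \<open>An orthonormal basis of the polynomials of degree below \<open>n\<close> weighted by
  \<open>wt n\<close>; the squared norming constant is the reciprocal of a Beta integral.\<close>

definition onb :: "nat => nat => complex => complex" where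
  "onb n j z = of_real (sqrt (real n * real (n - 1 choose j)) * wt n z) * z ^ j"

definition ker :: "nat => complex => complex => complex" where
  "ker n z w = of_nat n * (1 + z * cnj w) ^ (n - 1) * of_real (wt n z) * of_real (wt n w)"

lemma borel_measurable_wt [measurable]: "wt n \<in> borel_measurable borel"
  unfolding wt_def by measurable

lemma borel_measurable_onb [measurable]: "onb n j \<in> borel_measurable borel"
  unfolding onb_def by measurable

lemma borel_measurable_ker:
  assumes [measurable]: "f \<in> borel_measurable M" "g \<in> borel_measurable M"
  shows "(\<lambda>x. ker n (f x) (g x)) \<in> borel_measurable M"
proof -
  have [measurable]: "(\<lambda>x. cnj (g x)) \<in> borel_measurable M"
    by (rule measurable_compose[OF assms(2)]) (intro borel_measurable_continuous_onI continuous_intros)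
  show ?thesis unfolding ker_def by measurable
qed

text \<open>The binomial theorem. Together with \<open>integral_onb\<close> it exhibits
  \<open>ker n\<close> as the kernel of an orthogonal projection of rank \<open>n\<close>.\<close>

lemma ker_onb:
  assumes "n \<ge> 1"
  shows "ker n z w = (\<Sum>j<n. onb n j z * cnj (onb n j w))"
proof -
  have lt: "{..n - 1} = {..<n}" using assms by auto
  have "(1 + z * cnj w) ^ (n - 1) = (\<Sum>j<n. of_nat (n - 1 choose j) * (z * cnj w) ^ j)"
    using binomial_ring[of "z * cnj w" 1 "n - 1"] unfolding lt power_one mult_1_right by (simp only: add.commute)
  then have "ker n z w = (\<Sum>j<n. of_nat n * of_nat (n - 1 choose j) * (z * cnj w) ^ j * of_real (wt n z) * of_real (wt n w))"
    by (simp add: ker_def sum_distrib_left sum_distrib_right mult_ac)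
  also have "... = (\<Sum>j<n. onb n j z * cnj (onb n j w))"
  proof (rule sum.cong[OF refl])
    fix j
    have s: "sqrt (real n * real (n - 1 choose j)) * sqrt (real n * real (n - 1 choose j)) = real n * real (n - 1 choose j)"
      by simp
    have "onb n j z * cnj (onb n j w) = of_real (sqrt (real n * real (n - 1 choose j)) * sqrt (real n * real (n - 1 choose j))) *
        of_real (wt n z) * of_real (wt n w) * (z * cnj w) ^ j"
      by (simp add: onb_def power_mult_distrib del: real_sqrt_mult_self)
    then show "of_nat n * of_nat (n - 1 choose j) * (z * cnj w) ^ j * of_real (wt n z) * of_real (wt n w) = onb n j z * cnj (onb n j w)"
      unfolding s by simp
  qed
  finally show ?thesis .
qed

lemma wt_square: "wt n z ^ 2 = 1 / (1 + (cmod z)\<^sup>2) ^ (n - 1)"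
  using one_plus_norm_pos[of z] unfolding wt_def power_divide
  by (simp add: power_mult[symmetric] mult.commute[of _ 2] del: real_sqrt_power) (simp add: power_mult)

text \<open>That the modulus depends on the distance alone is what later makes pair integrals
  independent of the first point.\<close>

lemma norm_ker: "(cmod (ker n z w))\<^sup>2 = (real n)\<^sup>2 * (1 - qd z w) ^ (n - 1)"
proof -
  have "(cmod (ker n z w))\<^sup>2 = (real n)\<^sup>2 * ((cmod (1 + z * cnj w))\<^sup>2) ^ (n - 1) * (wt n z ^ 2 * wt n w ^ 2)"
    by (simp add: ker_def norm_mult norm_power power_mult_distrib power_mult[symmetric] mult.commute[of _ 2] mult.assoc)
  also have "... = (real n)\<^sup>2 * (1 - qd w z) ^ (n - 1)"
    unfolding wt_square one_minus_qd by (simp add: power_divide power_mult_distrib mult.commute)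
  finally show ?thesis by (simp add: qd_commute)
qed

lemma ker_diag: "ker n z z = of_nat n"
proof -
  have "(1 + z * cnj z) ^ (n - 1) * of_real (wt n z) * of_real (wt n z) = (of_real ((1 + (cmod z)\<^sup>2) ^ (n - 1) * wt n z ^ 2) :: complex)"
    by (simp add: complex_norm_square[symmetric] power2_eq_square mult.assoc)
  also have "... = 1" unfolding wt_square using one_plus_norm_pos[of z] by simp
  finally show ?thesis by (simp add: ker_def mult.assoc)
qed

lemma ker_hermitian: "ker n w z = cnj (ker n z w)"
  by (simp add: ker_def mult_ac)

lemma norm_ker_le: "cmod (ker n z w) \<le> real n"
proof -
  have "(1 - qd z w) ^ (n - 1) \<le> 1" using qd_nonneg[of z w] qd_le_1[of z w] by (intro power_le_one) auto
  then have "(cmod (ker n z w))\<^sup>2 \<le> (real n)\<^sup>2" unfolding norm_ker by (simp add: mult_left_le)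
  then show ?thesis by (rule power2_le_imp_le) simp
qed

lemma norm_onb_le:
  assumes "n \<ge> 1" "j < n"
  shows "cmod (onb n j z) \<le> sqrt (real n)"
proof -
  have "of_real (\<Sum>j<n. (cmod (onb n j z))\<^sup>2) = ker n z z"
    unfolding ker_onb[OF assms(1)] of_real_sum by (simp add: complex_norm_square[symmetric])
  then have "(\<Sum>j<n. (cmod (onb n j z))\<^sup>2) = real n"
    unfolding ker_diag using of_real_eq_iff by fastforce
  moreover have "(cmod (onb n j z))\<^sup>2 \<le> (\<Sum>j<n. (cmod (onb n j z))\<^sup>2)"
    using assms(2) by (intro member_le_sum) auto
  ultimately show ?thesis by (intro real_le_rsqrt) simp
qed

lemma integral_sph_rotation:
  fixes h :: "complex => complex"
  assumes [measurable]: "h \<in> borel_measurable borel" and c: "cmod c = 1"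
  shows "(LINT z|sph. h (c * z)) = (LINT z|sph. h z)"
proof -
  have c0: "c \<noteq> 0" using c by auto
  have "distr sph borel ((*) c) = sph"
  proof (rule measure_eqI)
    fix A assume "A \<in> sets (distr sph borel ((*) c))"
    then have [measurable]: "A \<in> sets borel" by simp
    have "emeasure (distr sph borel ((*) c)) A = (\<integral>\<^sup>+z. indicator A z \<partial>distr sph borel ((*) c))" by simp
    also have "... = (\<integral>\<^sup>+z. indicator A (c * z) \<partial>sph)"
      by (rule nn_integral_distr) measurable
    also have "... = (\<integral>\<^sup>+z. ennreal (1 / (pi * (1 + (cmod z)\<^sup>2)\<^sup>2)) * indicator A (c * z) \<partial>lborel)"
      by (subst nn_integral_sph) simp_all
    also have "... = (\<integral>\<^sup>+z. ennreal (1 / (pi * (1 + (cmod z)\<^sup>2)\<^sup>2)) * indicator A z \<partial>lborel)"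
      by (subst (2) nn_integral_lborel_complex_scale[of _ c]) (simp_all add: c c0 norm_mult)
    also have "... = (\<integral>\<^sup>+z. indicator A z \<partial>sph)" by (rule nn_integral_sph[symmetric]) measurable
    finally show "emeasure (distr sph borel ((*) c)) A = emeasure sph A" by simp
  qed simp
  moreover have "(LINT z|distr sph borel ((*) c). h z) = (LINT z|sph. h (c * z))"
    by (rule integral_distr) measurable
  ultimately show ?thesis by simp
qed

lemma nn_integral_power_Beta:
  assumes "j < n"
  shows "(\<integral>\<^sup>+u\<in>{0..1}. ennreal (u ^ j * (1 - u) ^ (n - 1 - j)) \<partial>lborel) = ennreal (1 / (real n * real (n - 1 choose j)))"
proof -
  have "((\<lambda>t. t powr (real j + 1 - 1) * (1 - t) powr (real (n - 1 - j) + 1 - 1)) has_integral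
      Beta (real j + 1) (real (n - 1 - j) + 1)) {0..1}"
    by (rule has_integral_Beta_real) auto
  then have "((\<lambda>t. t ^ j * (1 - t) ^ (n - 1 - j)) has_integral Beta (real j + 1) (real (n - 1 - j) + 1)) {0..1}"
    by (rule has_integral_spike_finite[of "{0, 1}", rotated 2]) (auto simp: powr_realpow)
  then have "((\<lambda>t. t ^ j * (1 - t) ^ (n - 1 - j) * indicator {0..1} t) has_integral Beta (real j + 1) (real (n - 1 - j) + 1)) UNIV"
  proof -
    have "(\<lambda>t. t ^ j * (1 - t) ^ (n - 1 - j) * indicator {0..1} t) = (\<lambda>t::real. if t \<in> {0..1} then t ^ j * (1 - t) ^ (n - 1 - j) else 0)"
      by (auto simp: indicator_def fun_eq_iff)
    then show ?thesis
      using \<open>((\<lambda>t. t ^ j * (1 - t) ^ (n - 1 - j)) has_integral Beta (real j + 1) (real (n - 1 - j) + 1)) {0..1}\<close>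
      by (simp only: has_integral_restrict_UNIV)
  qed
  then have "(\<integral>\<^sup>+t. ennreal (t ^ j * (1 - t) ^ (n - 1 - j) * indicator {0..1} t) \<partial>lborel) = ennreal (Beta (real j + 1) (real (n - 1 - j) + 1))"
    by (intro nn_integral_has_integral_lborel) (auto simp: indicator_def)
  moreover have "Beta (real j + 1) (real (n - 1 - j) + 1) = 1 / (real n * real (n - 1 choose j))"
  proof -
    have f: "real (n - 1 choose j) = fact (n - 1) / (fact j * fact (n - 1 - j))"
      using assms by (intro binomial_fact) auto
    have "real j + 1 + (real (n - 1 - j) + 1) = real n + 1" using assms by (simp add: of_nat_diff)
    moreover have "fact n = real n * fact (n - 1)" using assms by (metis fact_reduce gr_implies_not0 neq0_conv of_nat_fact of_nat_mult fact_reduce)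
    ultimately show ?thesis unfolding Beta_def f
      using Gamma_fact[of j, where ?'a=real] Gamma_fact[of "n - 1 - j", where ?'a=real] Gamma_fact[of n, where ?'a=real] assms
      by (simp add: add.commute)
  qed
  moreover have "(\<integral>\<^sup>+u\<in>{0..1}. ennreal (u ^ j * (1 - u) ^ (n - 1 - j)) \<partial>lborel) = (\<integral>\<^sup>+t. ennreal (t ^ j * (1 - t) ^ (n - 1 - j) * indicator {0..1} t) \<partial>lborel)"
    by (intro nn_integral_cong) (auto simp: indicator_def)
  ultimately show ?thesis by simp
qed

lemma integrable_sph_bounded:
  fixes h :: "complex => 'a :: {banach, second_countable_topology}"
  assumes "h \<in> borel_measurable borel" "\<And>z. norm (h z) \<le> C"
  shows "integrable sph h"
  using assms by (intro sph.integrable_const_bound[of _ C]) auto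

text \<open>On the diagonal this is a Beta integral, through the uniform law of |z|^2 / (1 + |z|^2).
  Off the diagonal a suitable rotation changes the sign of the integral.\<close>

lemma integral_onb:
  assumes n: "n \<ge> 1" and jk: "j < n" "k < n"
  shows "(LINT z|sph. onb n j z * cnj (onb n k z)) = (if j = k then 1 else 0)"
proof (cases "j = k")
  case True
  have sq: "(cmod (onb n j z))\<^sup>2 = (real n * real (n - 1 choose j)) *
      (((cmod z)\<^sup>2 / (1 + (cmod z)\<^sup>2)) ^ j * (1 - (cmod z)\<^sup>2 / (1 + (cmod z)\<^sup>2)) ^ (n - 1 - j))" for z
  proof -
    have p: "1 + (cmod z)\<^sup>2 \<noteq> 0" using one_plus_norm_pos[of z] by simp
    have u: "1 - (cmod z)\<^sup>2 / (1 + (cmod z)\<^sup>2) = 1 / (1 + (cmod z)\<^sup>2)" using p by (simp add: field_simps)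
    have "(cmod (onb n j z))\<^sup>2 = (real n * real (n - 1 choose j)) * wt n z ^ 2 * ((cmod z)\<^sup>2) ^ j"
      by (simp add: onb_def norm_mult norm_power power_mult_distrib power_mult[symmetric] mult.commute[of _ 2])
    also have "... = (real n * real (n - 1 choose j)) * (((cmod z)\<^sup>2) ^ j / ((1 + (cmod z)\<^sup>2) ^ j * (1 + (cmod z)\<^sup>2) ^ (n - 1 - j)))"
      unfolding wt_square power_add[symmetric] using jk by simp
    finally show ?thesis unfolding u by (simp add: power_divide)
  qed
  have "(\<integral>\<^sup>+z. ennreal ((cmod (onb n j z))\<^sup>2) \<partial>sph) =
      ennreal (real n * real (n - 1 choose j)) * (\<integral>\<^sup>+z. ennreal (((cmod z)\<^sup>2 / (1 + (cmod z)\<^sup>2)) ^ j * (1 - (cmod z)\<^sup>2 / (1 + (cmod z)\<^sup>2)) ^ (n - 1 - j)) \<partial>sph)"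
    unfolding sq by (subst ennreal_mult') (auto simp: nn_integral_cmult)
  also have "(\<integral>\<^sup>+z. ennreal (((cmod z)\<^sup>2 / (1 + (cmod z)\<^sup>2)) ^ j * (1 - (cmod z)\<^sup>2 / (1 + (cmod z)\<^sup>2)) ^ (n - 1 - j)) \<partial>sph) =
      ennreal (1 / (real n * real (n - 1 choose j)))"
    using nn_integral_sph_radial[of "\<lambda>u. ennreal (u ^ j * (1 - u) ^ (n - 1 - j))"] nn_integral_power_Beta[OF jk(1)] by simp
  also have "ennreal (real n * real (n - 1 choose j)) * ... = 1"
    using n jk by (subst ennreal_mult''[symmetric]) (auto simp: not_less)
  finally have "(LINT z|sph. (cmod (onb n j z))\<^sup>2) = 1"
    by (subst integral_eq_nn_integral) auto
  then have "(LINT z|sph. of_real ((cmod (onb n j z))\<^sup>2)) = (1 :: complex)"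
    by (subst integral_complex_of_real) simp
  then show ?thesis using True by (simp add: complex_norm_square[symmetric])
next
  case False
  define I where "I = (LINT z|sph. onb n j z * cnj (onb n k z))"
  \<comment> \<open>Chosen so that the rotation multiplies the integrand by exp(i (j - k)
    \<open>\<theta>\<close>) = -1.\<close>
  define \<theta> where "\<theta> = pi / (real j - real k)"
  let ?c = "cis \<theta>"
  have cc: "?c ^ j * cnj ?c ^ k = -1"
  proof -
    have "?c ^ j * cnj ?c ^ k = cis (real j * \<theta> - real k * \<theta>)"
      by (simp add: Complex.DeMoivre cis_cnj cis_mult)
    also have "real j * \<theta> - real k * \<theta> = (real j - real k) * \<theta>" by (simp add: left_diff_distrib)
    also have "... = pi" using False by (simp add: \<theta>_def)
    finally show ?thesis by simp
  qed
  have w: "wt n (?c * z) = wt n z" for z by (simp add: wt_def norm_mult)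
  have m: "(\<lambda>z. onb n j z * cnj (onb n k z)) \<in> borel_measurable borel"
    by (intro borel_measurable_times borel_measurable_onb measurable_compose[OF borel_measurable_onb])
       (intro borel_measurable_continuous_onI continuous_intros)
  have "I = (LINT z|sph. onb n j (?c * z) * cnj (onb n k (?c * z)))"
    unfolding I_def by (rule integral_sph_rotation[OF m, symmetric]) simp
  also have "... = (LINT z|sph. (?c ^ j * cnj ?c ^ k) * (onb n j z * cnj (onb n k z)))"
    unfolding onb_def w by (intro Bochner_Integration.integral_cong refl) (simp add: power_mult_distrib mult_ac)
  also have "... = - I" unfolding cc I_def by simp
  finally have "I = 0" by simp
  then show ?thesis using False by (simp add: I_def)
qed

lemma ker_reproducing:
  assumes n: "n \<ge> 1"
  shows "(LINT c|sph. ker n a c * ker n c b) = ker n a b"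
proof -
  have cm: "(\<lambda>z. cnj (onb n k z)) \<in> borel_measurable borel" for k
    by (rule measurable_compose[OF borel_measurable_onb]) (intro borel_measurable_continuous_onI continuous_intros)
  have int: "integrable sph (\<lambda>z. onb n j z * cnj (onb n k z))" if "j < n" "k < n" for j k
  proof (rule integrable_sph_bounded)
    show "norm (onb n j z * cnj (onb n k z)) \<le> sqrt n * sqrt n" for z
      unfolding norm_mult using norm_onb_le[OF n that(1), of z] norm_onb_le[OF n that(2), of z] by (intro mult_mono) auto
  qed (use cm in measurable)
  have "(LINT c|sph. ker n a c * ker n c b) = (LINT c|sph. (\<Sum>k<n. \<Sum>j<n. (onb n k a * cnj (onb n j b)) * (onb n j c * cnj (onb n k c))))"
    unfolding ker_onb[OF n] sum_product by (intro Bochner_Integration.integral_cong refl sum.cong) (simp add: mult_ac)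
  also have "... = (\<Sum>k<n. \<Sum>j<n. (onb n k a * cnj (onb n j b)) * (LINT c|sph. onb n j c * cnj (onb n k c)))"
  proof -
    have i: "integrable sph (\<lambda>c. (onb n k a * cnj (onb n j b)) * (onb n j c * cnj (onb n k c)))" if "j < n" "k < n" for j k
      by (intro integrable_mult_right int that)
    have "(LINT c|sph. (\<Sum>k<n. \<Sum>j<n. (onb n k a * cnj (onb n j b)) * (onb n j c * cnj (onb n k c)))) =
        (\<Sum>k<n. LINT c|sph. (\<Sum>j<n. (onb n k a * cnj (onb n j b)) * (onb n j c * cnj (onb n k c))))"
      by (rule Bochner_Integration.integral_sum, rule Bochner_Integration.integrable_sum, rule i) simp_all
    also have "... = (\<Sum>k<n. \<Sum>j<n. LINT c|sph. (onb n k a * cnj (onb n j b)) * (onb n j c * cnj (onb n k c)))"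
      by (intro sum.cong refl Bochner_Integration.integral_sum i) simp_all
    finally show ?thesis by simp
  qed
  also have "... = (\<Sum>k<n. \<Sum>j<n. if j = k then onb n k a * cnj (onb n j b) else 0)"
    by (intro sum.cong refl) (simp add: integral_onb[OF n])
  also have "... = ker n a b" unfolding ker_onb[OF n] by simp
  finally show ?thesis .
qed

subsection \<open>Schur complements of reproducing kernels\<close>

text \<open>Bounded Hermitian kernels that are idempotent as integral operators, that is, kernels of
  orthogonal projections of L^2(\<open>sph\<close>). Values at single points matter below, so the
  identities are required everywhere and not just almost everywhere.\<close>

definition rep :: "(complex => complex => complex) => bool" where
  "rep L \<longleftrightarrow> (\<forall>a b. L b a = cnj (L a b)) \<and> (\<forall>a. L a \<in> borel_measurable borel) \<and>
     (\<lambda>a. L a a) \<in> borel_measurable borel \<and> (\<exists>C. \<forall>a b. cmod (L a b) \<le> C) \<and>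
     (\<forall>a b. (LINT c|sph. L a c * L c b) = L a b)"

lemma repD:
  assumes "rep L"
  shows "L b a = cnj (L a b)" "L a \<in> borel_measurable borel" "(\<lambda>a. L a b) \<in> borel_measurable borel"
    "(\<lambda>a. L a a) \<in> borel_measurable borel" "(LINT c|sph. L a c * L c b) = L a b"
    "integrable sph (\<lambda>c. L a c * L c b)" "integrable sph (\<lambda>c. L c c)"
    "\<exists>C. \<forall>a b. cmod (L a b) \<le> C"
proof -
  show h: "L b a = cnj (L a b)" for a b using assms unfolding rep_def by blast
  show m: "L a \<in> borel_measurable borel" for a using assms unfolding rep_def by blast
  have "(\<lambda>a. L a b) = (\<lambda>a. cnj (L b a))" by (rule ext) (rule h)
  then show m2: "(\<lambda>a. L a b) \<in> borel_measurable borel"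
  proof -
    have "cnj \<in> borel_measurable borel" by (intro borel_measurable_continuous_onI continuous_intros)
    then show ?thesis unfolding \<open>(\<lambda>a. L a b) = (\<lambda>a. cnj (L b a))\<close> by (rule measurable_compose[OF m])
  qed
  show d: "(\<lambda>a. L a a) \<in> borel_measurable borel" "(LINT c|sph. L a c * L c b) = L a b"
    using assms unfolding rep_def by blast+
  show bd: "\<exists>C. \<forall>a b. cmod (L a b) \<le> C" using assms unfolding rep_def by (elim conjE)
  then obtain C where C: "\<And>a b. cmod (L a b) \<le> C" by blast
  show "integrable sph (\<lambda>c. L a c * L c b)"
  proof (rule integrable_sph_bounded)
    show "(\<lambda>c. L a c * L c b) \<in> borel_measurable borel" using m[of a] m2 by measurable
    show "norm (L a c * L c b) \<le> C * C" for c
      unfolding norm_mult using C[of a a] by (intro mult_mono C order_trans[OF norm_ge_zero C]) auto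
  qed
  show "integrable sph (\<lambda>c. L c c)" by (rule integrable_sph_bounded[OF d(1) C])
qed

text \<open>Reproduction at equal arguments and Hermitian symmetry turn the diagonal into a squared
  norm; all positivity below rests on this.\<close>

lemma rep_diag_integral:
  assumes "rep L"
  shows "L a a = of_real (LINT c|sph. (cmod (L a c))\<^sup>2)" "integrable sph (\<lambda>c. (cmod (L a c))\<^sup>2)"
proof -
  have e: "L a c * L c a = of_real ((cmod (L a c))\<^sup>2)" for c
    by (subst repD(1)[OF assms, of c a]) (simp add: complex_norm_square[symmetric])
  have "L a a = (LINT c|sph. of_real ((cmod (L a c))\<^sup>2))"
    using repD(5)[OF assms, of a a] unfolding e by simp
  then show "L a a = of_real (LINT c|sph. (cmod (L a c))\<^sup>2)" by (simp only: integral_complex_of_real)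
  have "integrable sph (\<lambda>c. complex_of_real ((cmod (L a c))\<^sup>2))"
    using repD(6)[OF assms, of a a] unfolding e .
  then show "integrable sph (\<lambda>c. (cmod (L a c))\<^sup>2)" by (simp only: complex_of_real_integrable_eq)
qed

lemma rep_diag:
  assumes "rep L"
  shows "L a a = of_real (Re (L a a))" "Re (L a a) \<ge> 0"
  using rep_diag_integral(1)[OF assms, of a] by (simp_all add: integral_nonneg_AE)

text \<open>A row of squared norm 0 vanishes almost everywhere, and the reproducing identity
  upgrades this to everywhere. It settles the cases with a zero pivot.\<close>

lemma rep_diag_zero:
  assumes "rep L" "L a a = 0"
  shows "L a b = 0" "L b a = 0"
proof -
  have "(LINT c|sph. (cmod (L a c))\<^sup>2) = 0" using rep_diag_integral(1)[OF assms(1), of a] assms(2) by simp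
  then have "AE c in sph. (cmod (L a c))\<^sup>2 = 0"
    using integral_nonneg_eq_0_iff_AE[OF rep_diag_integral(2)[OF assms(1), of a]] by simp
  then have "AE c in sph. L a c * L c b = 0" by eventually_elim simp
  then have "(LINT c|sph. L a c * L c b) = 0" by (rule integral_eq_zero_AE)
  then show "L a b = 0" using repD(5)[OF assms(1)] by simp
  then show "L b a = 0" using repD(1)[OF assms(1), of b a] by simp
qed

text \<open>The kernel of the process conditioned on a point at \<open>y\<close>. For
  \<open>L y y = 0\<close> division by zero leaves \<open>L\<close> unchanged, the right convention
  because the row and column at \<open>y\<close> are then 0.\<close>

definition red :: "(complex => complex => complex) => complex => complex => complex => complex" where
  "red L y a b = L a b - L a y * L y b / L y y"

lemma rep_red:
  assumes L: "rep L"
  shows "rep (red L y)"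
proof (cases "L y y = 0")
  case True
  then have "red L y = L" by (simp add: red_def fun_eq_iff)
  then show ?thesis using L by simp
next
  case False
  note m = repD(2,3,4)[OF L]
  obtain C where C: "\<And>a b. cmod (L a b) \<le> C" using repD(8)[OF L] by blast
  show ?thesis unfolding rep_def
  proof (intro conjI allI)
    show "red L y b a = cnj (red L y a b)" for a b
    proof -
      have "cnj (red L y a b) = cnj (L a b) - cnj (L a y) * cnj (L y b) / cnj (L y y)"
        by (simp only: red_def complex_cnj_diff complex_cnj_mult complex_cnj_divide)
      also have "... = L b a - L y a * L b y / L y y"
        by (simp only: repD(1)[OF L, symmetric])
      finally show ?thesis by (simp add: red_def mult.commute)
    qed
    show "red L y a \<in> borel_measurable borel" for a
      unfolding red_def[abs_def] using m(1)[of a] m(1)[of y] by measurable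
    show "(\<lambda>a. red L y a a) \<in> borel_measurable borel"
      unfolding red_def[abs_def] using m(1)[of y] m(2)[of y] m(3) by measurable
    have "cmod (red L y a b) \<le> C + C * C / cmod (L y y)" for a b
    proof -
      have "cmod (red L y a b) \<le> cmod (L a b) + cmod (L a y) * cmod (L y b) / cmod (L y y)"
        unfolding red_def norm_mult[symmetric] norm_divide[symmetric] by (rule norm_triangle_ineq4)
      also have "... \<le> cmod (L a b) + C * C / cmod (L y y)"
        by (intro add_left_mono divide_right_mono mult_mono C order_trans[OF norm_ge_zero C]) auto
      finally have "cmod (red L y a b) \<le> cmod (L a b) + C * C / cmod (L y y)" .
      then show ?thesis using C[of a b] by linarith
    qed
    then show "\<exists>C. \<forall>a b. cmod (red L y a b) \<le> C" by blast
    fix a b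
    note i = repD(6)[OF L]
    have "(LINT c|sph. red L y a c * red L y c b) =
        (LINT c|sph. (L a c * L c b - (L a c * L c y) * (L y b / L y y)) - ((L y c * L c b) * (L a y / L y y) - (L y c * L c y) * ((L a y / L y y) * (L y b / L y y))))"
      unfolding red_def by (intro Bochner_Integration.integral_cong refl) (simp add: algebra_simps)
    also have "... = (L a b - L a y * (L y b / L y y)) - (L y b * (L a y / L y y) - L y y * ((L a y / L y y) * (L y b / L y y)))"
      using i by (simp only: Bochner_Integration.integral_diff integrable_mult_left Bochner_Integration.integrable_diff integral_mult_left_zero repD(5)[OF L])
    also have "... = red L y a b" using False by (simp add: red_def)
    finally show "(LINT c|sph. red L y a c * red L y c b) = red L y a b" .
  qed
qed

lemma red_diag:
  assumes L: "rep L"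
  shows "red L y a a = of_real (Re (L a a) - (cmod (L a y))\<^sup>2 / Re (L y y))"
    "Re (red L y a a) \<le> Re (L a a)"
proof -
  have e: "L a y * L y a = of_real ((cmod (L a y))\<^sup>2)"
    by (subst repD(1)[OF L, of y a]) (simp add: complex_norm_square[symmetric])
  have "red L y a a = of_real (Re (L a a)) - of_real ((cmod (L a y))\<^sup>2) / of_real (Re (L y y))"
    unfolding red_def e by (subst (1 2) rep_diag(1)[OF L]) simp
  then show *: "red L y a a = of_real (Re (L a a) - (cmod (L a y))\<^sup>2 / Re (L y y))" by simp
  show "Re (red L y a a) \<le> Re (L a a)" unfolding * using rep_diag(2)[OF L, of y] by simp
qed

text \<open>The Schur complement at \<open>b\<close> is again reproducing, so its diagonal is
  nonnegative.\<close>

lemma rep_Cauchy_Schwarz: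
  assumes L: "rep L"
  shows "(cmod (L a b))\<^sup>2 \<le> Re (L a a) * Re (L b b)"
proof (cases "L b b = 0")
  case True
  then show ?thesis using rep_diag_zero(2)[OF L True] by simp
next
  case False
  have "0 \<le> Re (red L b a a)" using rep_diag(2)[OF rep_red[OF L]] .
  then have "0 \<le> Re (L a a) - (cmod (L a b))\<^sup>2 / Re (L b b)" unfolding red_diag(1)[OF L] by simp
  moreover have "Re (L b b) > 0" using rep_diag[OF L, of b] False by (cases "Re (L b b) = 0") auto
  ultimately show ?thesis by (simp add: field_simps)
qed

definition det2 :: "(complex => complex => complex) => complex => complex => real" where
  "det2 L p q = Re (L p p) * Re (L q q) - (cmod (L p q))\<^sup>2"

lemma det2_nonneg: "rep L ==> det2 L p q \<ge> 0"
  using rep_Cauchy_Schwarz[of L p q] by (simp add: det2_def)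

text \<open>Fischer's inequality for a \<open>1 + 2\<close> block decomposition.\<close>

lemma det2_red_le:
  assumes L: "rep L"
  shows "det2 (red L y) p q \<le> det2 L p q"
proof (cases "L y y = 0")
  case True
  then have "red L y = L" by (simp add: red_def fun_eq_iff)
  then show ?thesis by simp
next
  case False
  define a b c u v s where "a = Re (L p p)" and "b = Re (L q q)" and "c = L p q" and "u = L p y" and "v = L q y" and "s = Re (L y y)"
  have s: "s > 0" using rep_diag[OF L, of y] False unfolding s_def by (cases "Re (L y y) = 0") auto
  have Ly: "L y y = of_real s" unfolding s_def by (rule rep_diag(1)[OF L])
  have Lyq: "L y q = cnj v" unfolding v_def by (rule repD(1)[OF L])
  have ab: "a \<ge> 0" "b \<ge> 0" using rep_diag(2)[OF L] by (auto simp: a_def b_def)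
  have cs: "cmod c \<le> sqrt a * sqrt b"
    using rep_Cauchy_Schwarz[OF L, of p q] unfolding real_sqrt_mult[symmetric] by (intro real_le_rsqrt) (simp add: a_def b_def c_def)
  define r where "r = Re (cnj c * (u * cnj v))"
  have rd: "red L y p q = c - of_real (1 / s) * (u * cnj v)" unfolding red_def Ly Lyq c_def u_def by simp
  have nsq: "(cmod (c - of_real t * w))\<^sup>2 = (cmod c)\<^sup>2 - 2 * t * Re (cnj c * w) + t\<^sup>2 * (cmod w)\<^sup>2" for t w
    unfolding cmod_power2 by (simp add: power2_eq_square algebra_simps)
  have n: "(cmod (red L y p q))\<^sup>2 = (cmod c)\<^sup>2 - 2 * (1 / s) * r + (1 / s)\<^sup>2 * (cmod u * cmod v)\<^sup>2"
    unfolding rd nsq r_def by (simp add: norm_mult)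
  have r: "r \<le> (sqrt a * sqrt b) * (cmod u * cmod v)"
  proof -
    have "r \<le> cmod (cnj c * (u * cnj v))" unfolding r_def by (rule complex_Re_le_cmod)
    also have "... = cmod c * (cmod u * cmod v)" by (simp add: norm_mult)
    also have "... \<le> (sqrt a * sqrt b) * (cmod u * cmod v)" by (rule mult_right_mono[OF cs]) simp
    finally show ?thesis .
  qed
  \<comment> \<open>Conditioning lowers \<open>det2\<close> by (a |v|^2 + b |u|^2 - 2 r) / s.
    Cauchy-Schwarz for the pair bounds \<open>r\<close> by sqrt(a b) |u| |v|, so the numerator is at
    least this square.\<close>
  have "0 \<le> (sqrt a * cmod v - sqrt b * cmod u)\<^sup>2" by simp
  also have "... = a * (cmod v)\<^sup>2 + b * (cmod u)\<^sup>2 - 2 * ((sqrt a * sqrt b) * (cmod u * cmod v))"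
    using ab by (simp add: power2_diff power_mult_distrib)
  finally have key: "0 \<le> a * (cmod v)\<^sup>2 + b * (cmod u)\<^sup>2 - 2 * r" using r by linarith
  have "det2 (red L y) p q = (a - (cmod u)\<^sup>2 / s) * (b - (cmod v)\<^sup>2 / s) - (cmod (red L y p q))\<^sup>2"
    unfolding det2_def red_diag(1)[OF L] by (simp add: a_def b_def u_def v_def s_def)
  also have "... = det2 L p q - (a * (cmod v)\<^sup>2 + b * (cmod u)\<^sup>2 - 2 * r) / s"
    unfolding n det2_def a_def[symmetric] b_def[symmetric] c_def[symmetric] using s
    by (simp add: field_simps power2_eq_square)
  also have "... \<le> det2 L p q" using key s by simp
  finally show ?thesis .
qed

primrec cK :: "(complex => complex => complex) => (nat => complex) => nat => complex => complex => complex" where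
  "cK L x 0 = L"
| "cK L x (Suc m) = red (cK L x m) (x m)"

lemma cK_Suc_shift: "cK L x (Suc m) = cK (red L (x 0)) (\<lambda>i. x (Suc i)) m"
  by (induction m) simp_all

lemma cK_cong: "(\<And>i. i < m ==> x i = y i) ==> cK L x m = cK L y m"
  by (induction m) simp_all

lemma rep_cK: "rep L ==> rep (cK L x m)"
  by (induction m) (simp_all add: rep_red)

text \<open>The product of the successive pivots, equal to the determinant of the kernel matrix by
  \<open>dt_DD\<close>. In this form it is visibly nonnegative, and the last point occurs in the
  last factor only.\<close>

definition DD :: "(complex => complex => complex) => (nat => complex) => nat => real" where
  "DD L x m = (\<Prod>i<m. Re (cK L x i (x i) (x i)))"

lemma DD_0 [simp]: "DD L x 0 = 1"
  and DD_Suc: "DD L x (Suc m) = DD L x m * Re (cK L x m (x m) (x m))"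
  by (simp_all add: DD_def)

lemma DD_Suc_shift: "DD L x (Suc m) = Re (L (x 0) (x 0)) * DD (red L (x 0)) (\<lambda>i. x (Suc i)) m"
  unfolding DD_def by (subst prod.lessThan_Suc_shift) (simp only: cK_Suc_shift cK.simps(1))

lemma DD_cong: "(\<And>i. i < m ==> x i = y i) ==> DD L x m = DD L y m"
  unfolding DD_def by (intro prod.cong refl) (simp add: cK_cong[of _ x y])

lemma DD_nonneg: "rep L ==> DD L x m \<ge> 0"
  unfolding DD_def by (intro prod_nonneg ballI rep_diag(2) rep_cK)

lemma cK_diag_le: "rep L ==> Re (cK L x m a a) \<le> Re (L a a)"
proof (induction m)
  case (Suc m)
  then show ?case using red_diag(2)[OF rep_cK[OF Suc.prems], of x m "x m" a] by simp
qed simp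

lemma det2_cK_le: "rep L ==> det2 (cK L x m) p q \<le> det2 L p q"
proof (induction m)
  case (Suc m)
  then show ?case using det2_red_le[OF rep_cK[OF Suc.prems], of x m "x m" p q] by simp
qed simp

lemma DD_Suc_le: "rep L ==> DD L x (Suc m) \<le> DD L x m * Re (L (x m) (x m))"
  unfolding DD_Suc by (intro mult_left_mono cK_diag_le DD_nonneg)

lemma DD_Suc_Suc:
  assumes L: "rep L"
  shows "DD L x (Suc (Suc m)) = DD L x m * det2 (cK L x m) (x m) (x (Suc m))"
proof -
  let ?M = "cK L x m" and ?p = "x m" and ?q = "x (Suc m)"
  have M: "rep ?M" by (rule rep_cK[OF L])
  have "Re (?M ?p ?p) * Re (red ?M ?p ?q ?q) = det2 ?M ?p ?q"
  proof (cases "?M ?p ?p = 0")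
    case True
    then show ?thesis using rep_diag_zero(1)[OF M True] by (simp add: det2_def)
  next
    case False
    have "Re (?M ?p ?p) \<noteq> 0" using rep_diag(1)[OF M, of ?p] False by auto
    moreover have "cmod (?M ?q ?p) = cmod (?M ?p ?q)" using repD(1)[OF M, of ?q ?p] by simp
    ultimately show ?thesis unfolding red_diag(1)[OF M] det2_def by (simp add: field_simps)
  qed
  then show ?thesis by (simp add: DD_Suc mult.assoc)
qed

lemma DD_Suc_Suc_le:
  assumes L: "rep L"
  shows "DD L x (Suc (Suc m)) \<le> DD L x m * det2 L (x m) (x (Suc m))"
  unfolding DD_Suc_Suc[OF L] by (intro mult_left_mono det2_cK_le L DD_nonneg)

text \<open>Fischer's inequality, two points at a time: conditioning on the earlier points can only
  lower the two-point determinant of the next pair.\<close>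

lemma DD_pairs_le:
  assumes L: "rep L"
  shows "DD L x (2 * k) \<le> (\<Prod>l<k. det2 L (x (2 * l)) (x (2 * l + 1)))"
proof (induction k)
  case (Suc k)
  have "DD L x (2 * Suc k) \<le> DD L x (2 * k) * det2 L (x (2 * k)) (x (Suc (2 * k)))"
    using DD_Suc_Suc_le[OF L, of x "2 * k"] by simp
  also have "... \<le> (\<Prod>l<k. det2 L (x (2 * l)) (x (2 * l + 1))) * det2 L (x (2 * k)) (x (Suc (2 * k)))"
    by (intro mult_right_mono Suc.IH det2_nonneg L)
  finally show ?case by simp
qed simp

text \<open>Elimination of the first point matches \<open>DD_Suc_shift\<close>; a zero pivot means a
  zero row, and then both sides vanish.\<close>

lemma dt_DD: "rep L ==> dt m (\<lambda>i j. L (x i) (x j)) = of_real (DD L x m)"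
proof (induction m arbitrary: L x)
  case (Suc m)
  show ?case
  proof (cases "L (x 0) (x 0) = 0")
    case True
    have "dt (Suc m) (\<lambda>i j. L (x i) (x j)) = 0"
      by (rule dt_row_zero[of 0]) (auto simp: rep_diag_zero(1)[OF Suc.prems True])
    then show ?thesis by (simp add: DD_Suc_shift True)
  next
    case False
    have "dt (Suc m) (\<lambda>i j. L (x i) (x j)) = L (x 0) (x 0) * dt m (\<lambda>i j. red L (x 0) (x (Suc i)) (x (Suc j)))"
      unfolding red_def using False by (intro dt_Schur_first[where f="\<lambda>i j. L (x i) (x j)"])
    also have "dt m (\<lambda>i j. red L (x 0) (x (Suc i)) (x (Suc j))) = of_real (DD (red L (x 0)) (\<lambda>i. x (Suc i)) m)"
      by (rule Suc.IH) (rule rep_red[OF Suc.prems])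
    finally show ?thesis unfolding DD_Suc_shift of_real_mult using rep_diag(1)[OF Suc.prems, of "x 0"] by simp
  qed
qed simp

text \<open>The part |L(a, y)|^2 / L(y, y) removed from the diagonal integrates to 1, by
  reproduction at \<open>y\<close>.\<close>

lemma trace_red:
  assumes L: "rep L" and y: "L y y \<noteq> 0"
  shows "(LINT a|sph. Re (red L y a a)) = (LINT a|sph. Re (L a a)) - 1"
proof -
  have i1: "integrable sph (\<lambda>a. Re (L a a))" using repD(7)[OF L] by (rule integrable_Re)
  have sym: "cmod (L a y) = cmod (L y a)" for a using repD(1)[OF L, of a y] by simp
  have "(LINT a|sph. Re (red L y a a)) = (LINT a|sph. Re (L a a) - (cmod (L y a))\<^sup>2 / Re (L y y))"
    unfolding red_diag(1)[OF L] by (simp add: sym)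
  also have "... = (LINT a|sph. Re (L a a)) - (LINT a|sph. (cmod (L y a))\<^sup>2) / Re (L y y)"
    using i1 rep_diag_integral(2)[OF L, of y] by simp
  also have "(LINT a|sph. (cmod (L y a))\<^sup>2) = Re (L y y)"
    using rep_diag_integral(1)[OF L, of y] by simp
  also have "Re (L y y) / Re (L y y) = 1" using rep_diag(1)[OF L, of y] y by auto
  finally show ?thesis .
qed

lemma trace_cK:
  assumes L: "rep L" and "DD L x m \<noteq> 0"
  shows "(LINT a|sph. Re (cK L x m a a)) = (LINT a|sph. Re (L a a)) - real m"
  using assms(2)
proof (induction m)
  case (Suc m)
  then have "DD L x m \<noteq> 0" "cK L x m (x m) (x m) \<noteq> 0" by (auto simp: DD_Suc)
  then show ?case using Suc.IH trace_red[OF rep_cK[OF L], of x m "x m"] by simp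
qed simp

text \<open>Integrating out the last point produces the trace of the conditioned kernel. If an
  earlier pivot is 0 the trace may drop by less than \<open>m\<close>, but then both sides are
  0.\<close>

lemma nn_integral_DD:
  assumes L: "rep L"
  shows "(\<integral>\<^sup>+z. ennreal (DD L (x(m := z)) (Suc m)) \<partial>sph) = ennreal (((LINT a|sph. Re (L a a)) - real m) * DD L x m)"
proof -
  have M: "rep (cK L x m)" by (rule rep_cK[OF L])
  have "DD L (x(m := z)) (Suc m) = DD L x m * Re (cK L x m z z)" for z
    unfolding DD_Suc by (simp add: DD_cong[of m "x(m := z)" x] cK_cong[of m "x(m := z)" x])
  then have "(\<integral>\<^sup>+z. ennreal (DD L (x(m := z)) (Suc m)) \<partial>sph) = (\<integral>\<^sup>+z. ennreal (DD L x m * Re (cK L x m z z)) \<partial>sph)" by simp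
  also have "... = ennreal (LINT z|sph. DD L x m * Re (cK L x m z z))"
    by (intro nn_integral_eq_integral integrable_mult_right integrable_Re repD(7)[OF M] AE_I2 mult_nonneg_nonneg DD_nonneg L rep_diag(2)[OF M])
  also have "(LINT z|sph. DD L x m * Re (cK L x m z z)) = DD L x m * (LINT z|sph. Re (cK L x m z z))" by simp
  also have "... = ((LINT a|sph. Re (L a a)) - real m) * DD L x m"
    using trace_cK[OF L, of x m] by (cases "DD L x m = 0") auto
  finally show ?thesis .
qed

lemma rep_ker: "n \<ge> 1 ==> rep (ker n)"
  unfolding rep_def
  by (intro conjI allI ker_reproducing)
     (auto intro!: ker_hermitian borel_measurable_ker exI[of _ "real n"] norm_ker_le)

lemma trace_ker: "(LINT a|sph. Re (ker n a a)) = real n"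
  by (simp add: ker_diag sph.prob_space[simplified])

lemma det2_ker: "det2 (ker n) p q = (real n)\<^sup>2 * (1 - (1 - qd p q) ^ (n - 1))"
  unfolding det2_def norm_ker ker_diag by (simp add: power2_eq_square algebra_simps)

subsection \<open>The joint density of the roots\<close>

definition newton :: "(nat => 'a :: idom) => nat => 'a poly" where
  "newton x j = (\<Prod>k<j. [:- x k, 1:])"

lemma degree_newton: "degree (newton x j) = j" and lead_coeff_newton: "coeff (newton x j) j = 1"
proof -
  have "degree (newton x j) = j \<and> coeff (newton x j) j = 1"
  proof (induction j)
    case (Suc j)
    have nz: "newton x j \<noteq> 0" using Suc by auto
    have e: "newton x (Suc j) = newton x j * [:- x j, 1:]" by (simp add: newton_def)
    have "degree (newton x (Suc j)) = Suc j" unfolding e using Suc nz by (subst degree_mult_eq) auto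
    moreover have "lead_coeff (newton x (Suc j)) = 1" unfolding e lead_coeff_mult using Suc by simp
    ultimately show ?case by simp
  qed (simp add: newton_def)
  then show "degree (newton x j) = j" "coeff (newton x j) j = 1" by auto
qed

lemma dt_lower:
  fixes f :: "nat => nat => 'a :: idom"
  assumes "\<And>i j. i < j ==> j < n ==> f i j = 0"
  shows "dt n f = (\<Prod>i<n. f i i)"
  using assms
proof (induction n)
  case (Suc n)
  have "dt (Suc n) f = dt (Suc n) (bmat n f (\<lambda>_. 0) (f n) (f n n))"
    by (rule dt_cong) (auto simp: bmat_def less_Suc_eq Suc.prems)
  also have "... = dt n f * f n n" by (rule dt_bmat_lower)
  finally show ?case using Suc by simp
qed simp

lemma dt_upper:
  fixes f :: "nat => nat => 'a :: idom"
  assumes "\<And>i j. j < i ==> i < n ==> f i j = 0"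
  shows "dt n f = (\<Prod>i<n. f i i)"
  using assms
proof (induction n)
  case (Suc n)
  have "dt (Suc n) f = dt (Suc n) (bmat n f (\<lambda>i. f i n) (\<lambda>_. 0) (f n n))"
    by (rule dt_cong) (auto simp: bmat_def less_Suc_eq Suc.prems)
  also have "... = dt n f * f n n" by (rule dt_bmat_upper)
  finally show ?case using Suc by simp
qed simp

text \<open>Passing from monomials to the Newton polynomials of the nodes is a unipotent column
  operation and makes the matrix triangular.\<close>

lemma dt_Vandermonde:
  fixes x :: "nat => 'a :: idom"
  shows "dt n (\<lambda>i j. x i ^ j) = (\<Prod>i<n. \<Prod>k<i. x i - x k)"
proof -
  have ev: "poly (newton x j) t = (\<Prod>k<j. t - x k)" for j t
    by (simp add: newton_def poly_prod)
  have "dt n (\<lambda>i j. x i ^ j) * dt n (\<lambda>k j. coeff (newton x j) k) = dt n (\<lambda>i j. \<Sum>k<n. x i ^ k * coeff (newton x j) k)"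
    by (rule dt_mult)
  also have "... = dt n (\<lambda>i j. \<Prod>k<j. x i - x k)"
  proof (rule dt_cong)
    fix i j assume "i < n" "j < n"
    have "(\<Sum>k<n. x i ^ k * coeff (newton x j) k) = (\<Sum>k\<le>j. coeff (newton x j) k * x i ^ k)"
      using \<open>j < n\<close> by (intro sum.mono_neutral_cong_right) (auto simp: mult.commute coeff_eq_0 degree_newton)
    also have "... = poly (newton x j) (x i)" by (simp add: poly_altdef degree_newton)
    finally show "(\<Sum>k<n. x i ^ k * coeff (newton x j) k) = (\<Prod>k<j. x i - x k)" by (simp add: ev)
  qed
  also have "... = (\<Prod>i<n. \<Prod>k<i. x i - x k)"
    by (rule dt_lower) (auto intro!: prod_zero bexI)
  also have "dt n (\<lambda>k j. coeff (newton x j) k) = 1"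
    by (subst dt_upper) (auto simp: coeff_eq_0 degree_newton lead_coeff_newton)
  finally show ?thesis by simp
qed

lemma dt_scale:
  fixes f :: "nat => nat => 'a :: comm_ring_1"
  shows "dt n (\<lambda>i j. a i * f i j * b j) = (\<Prod>i<n. a i) * (\<Prod>i<n. b i) * dt n f"
  unfolding dt_leibniz sum_distrib_left
proof (rule sum.cong[OF refl])
  fix p assume "p \<in> {p. p permutes {0..<n}}"
  then have p: "p permutes {0..<n}" by simp
  have "(\<Prod>i = 0..<n. b (p i)) = (\<Prod>i = 0..<n. b i)"
    using prod.permute[OF p, of b] by (simp add: o_def)
  then show "signof p * (\<Prod>i = 0..<n. a i * f i (p i) * b (p i)) =
      (\<Prod>i<n. a i) * (\<Prod>i<n. b i) * (signof p * (\<Prod>i = 0..<n. f i (p i)))"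
    by (simp add: prod.distrib lessThan_atLeast0 mult_ac)
qed

lemma dt_transpose:
  fixes f :: "nat => nat => 'a :: comm_ring_1"
  shows "dt n (\<lambda>i j. f j i) = dt n f"
proof -
  have "Matrix.mat n n (\<lambda>(i, j). f j i) = transpose_mat (Matrix.mat n n (\<lambda>(i, j). f i j))"
    by (rule eq_matI) auto
  then show ?thesis unfolding dt_def by (simp add: det_transpose[of _ n])
qed

text \<open>For \<open>n\<close> points the kernel matrix is a square matrix times its adjoint, so
  its determinant is the squared modulus of a weighted Vandermonde determinant.\<close>

lemma DD_ker_full:
  assumes n: "n \<ge> 1"
  shows "DD (ker n) x n = (\<Prod>j<n. real n * real (n - 1 choose j)) *
    ((\<Prod>i<n. 1 / (1 + (cmod (x i))\<^sup>2) ^ (n - 1)) * (\<Prod>i<n. \<Prod>k<i. (cmod (x i - x k))\<^sup>2))"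
proof -
  let ?s = "\<lambda>j. sqrt (real n * real (n - 1 choose j))"
  let ?P = "\<Prod>i<n. complex_of_real (wt n (x i))"
  let ?S = "\<Prod>j<n. complex_of_real (?s j)"
  let ?V = "\<Prod>i<n. \<Prod>k<i. x i - x k"
  have row: "dt n (\<lambda>i j. onb n j (x i)) = ?P * ?S * ?V"
  proof -
    have "dt n (\<lambda>i j. onb n j (x i)) = dt n (\<lambda>i j. of_real (wt n (x i)) * x i ^ j * of_real (?s j))"
      by (rule dt_cong) (simp add: onb_def mult_ac)
    then show ?thesis by (simp only: dt_scale dt_Vandermonde)
  qed
  have col: "dt n (\<lambda>j i. cnj (onb n j (x i))) = ?P * ?S * cnj ?V"
  proof -
    have "dt n (\<lambda>j i. cnj (onb n j (x i))) = dt n (\<lambda>i j. cnj (onb n j (x i)))" by (rule dt_transpose)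
    also have "... = dt n (\<lambda>i j. of_real (wt n (x i)) * cnj (x i) ^ j * of_real (?s j))"
      by (rule dt_cong) (simp add: onb_def mult_ac)
    finally show ?thesis using dt_Vandermonde[of n "\<lambda>i. cnj (x i)"] by (simp only: dt_scale cnj_prod complex_cnj_diff)
  qed
  have "of_real (DD (ker n) x n) = dt n (\<lambda>i j. ker n (x i) (x j))" using dt_DD[OF rep_ker[OF n]] by simp
  also have "... = dt n (\<lambda>i j. onb n j (x i)) * dt n (\<lambda>j i. cnj (onb n j (x i)))"
    unfolding ker_onb[OF n] by (rule dt_mult[symmetric])
  also have "... = (?S * ?S) * ((?P * ?P) * (?V * cnj ?V))"
    unfolding row col by (simp only: mult_ac)
  also have "?S * ?S = of_real (\<Prod>j<n. real n * real (n - 1 choose j))"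
    by (simp add: prod.distrib[symmetric] of_real_mult[symmetric] del: of_real_mult)
  also have "?P * ?P = of_real (\<Prod>i<n. 1 / (1 + (cmod (x i))\<^sup>2) ^ (n - 1))"
  proof -
    have "?P * ?P = (\<Prod>i<n. complex_of_real (wt n (x i) ^ 2))"
      by (simp only: prod.distrib[symmetric] of_real_mult[symmetric] power2_eq_square)
    then show ?thesis by (simp only: wt_square of_real_prod)
  qed
  also have "?V * cnj ?V = of_real (\<Prod>i<n. \<Prod>k<i. (cmod (x i - x k))\<^sup>2)"
    by (simp only: of_real_prod complex_norm_square cnj_prod prod.distrib)
  finally show ?thesis by (simp only: of_real_mult[symmetric] of_real_eq_iff)
qed

text \<open>Each pivot depends on the order of the points, their product does not: permuting rows
  and columns simultaneously conjugates the permutations in the Leibniz sum.\<close>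

lemma DD_ker_permute:
  assumes n: "n \<ge> 1" and p: "p permutes {..<n}"
  shows "DD (ker n) (\<lambda>i. x (p i)) n = DD (ker n) x n"
proof -
  have p0: "p permutes {0..<n}" using p by (simp add: lessThan_atLeast0)
  have "dt n (\<lambda>i j. ker n (x (p i)) (x (p j))) = dt n (\<lambda>i j. ker n (x i) (x j))"
  proof -
    have ip: "inv_into UNIV p permutes {0..<n}" by (rule permutes_inv[OF p0])
    have "dt n (\<lambda>i j. ker n (x (p i)) (x (p j))) = (\<Sum>q | q permutes {0..<n}. signof q * (\<Prod>i = 0..<n. ker n (x i) (x ((p \<circ> q \<circ> (inv_into UNIV p)) i))))"
      unfolding dt_leibniz
    proof (intro sum.cong refl arg_cong2[where f="(*)"])
      fix q
      show "(\<Prod>i = 0..<n. ker n (x (p i)) (x (p (q i)))) = (\<Prod>i = 0..<n. ker n (x i) (x ((p \<circ> q \<circ> (inv_into UNIV p)) i)))"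
        using prod.permute[OF p0, of "\<lambda>i. ker n (x i) (x ((p \<circ> q \<circ> (inv_into UNIV p)) i))"]
        by (simp add: o_def permutes_inverses(2)[OF p0])
    qed
    also have "... = (\<Sum>q | q permutes {0..<n}. signof q * (\<Prod>i = 0..<n. ker n (x i) (x (q i))))"
    proof (rule sum.reindex_bij_witness[where i="\<lambda>q. inv_into UNIV p \<circ> q \<circ> p" and j="\<lambda>q. p \<circ> q \<circ> (inv_into UNIV p)"])
      fix q assume "q \<in> {q. q permutes {0..<n}}"
      then have q: "q permutes {0..<n}" by simp
      show "inv_into UNIV p \<circ> (p \<circ> q \<circ> (inv_into UNIV p)) \<circ> p = q" "p \<circ> (inv_into UNIV p \<circ> q \<circ> p) \<circ> (inv_into UNIV p) = q"
        by (simp_all add: fun_eq_iff permutes_inverses[OF p0])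
      show "p \<circ> q \<circ> (inv_into UNIV p) \<in> {q. q permutes {0..<n}}" "inv_into UNIV p \<circ> q \<circ> p \<in> {q. q permutes {0..<n}}"
        using q p0 ip by (auto intro!: permutes_compose)
      have pp: "permutation p" "permutation q" "permutation (inv_into UNIV p)"
        using p0 q ip by (auto intro: permutes_imp_permutation[of "{0..<n}"])
      have "evenperm (p \<circ> q \<circ> (inv_into UNIV p)) = evenperm q"
        using pp by (auto simp: evenperm_comp permutation_compose evenperm_inv)
      then show "signof (p \<circ> q \<circ> (inv_into UNIV p)) * (\<Prod>i = 0..<n. ker n (x i) (x ((p \<circ> q \<circ> (inv_into UNIV p)) i))) =
         signof q * (\<Prod>i = 0..<n. ker n (x i) (x ((p \<circ> q \<circ> (inv_into UNIV p)) i)))"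
        by (simp add: sign_def)
    qed
    also have "... = dt n (\<lambda>i j. ker n (x i) (x j))" by (simp add: dt_leibniz)
    finally show ?thesis .
  qed
  then show ?thesis unfolding dt_DD[OF rep_ker[OF n]] by simp
qed

subsection \<open>Correlation integrals\<close>

abbreviation SP :: "nat set => (nat => complex) measure" where
  "SP I \<equiv> PiM I (\<lambda>_. sph)"

declare sets_sph [measurable_cong del]

interpretation sph_product: product_sigma_finite "\<lambda>_::nat. sph"
  by (rule product_sigma_finite.intro) (rule sph.sigma_finite_measure_axioms)

lemma prob_space_SP: "prob_space (SP I)"
  by (rule prob_space_PiM) (rule sph.prob_space_axioms)

lemma SP_component [measurable (raw)]: "(\<lambda>x. x i) \<in> borel_measurable (SP I)"
proof (cases "i \<in> I")
  case True
  then have "(\<lambda>x. x i) \<in> SP I \<rightarrow>\<^sub>M sph" by (rule measurable_component_singleton)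
  then show ?thesis by (simp cong: measurable_cong_sets)
next
  case False
  have "(\<lambda>x. x i) \<in> borel_measurable (SP I) \<longleftrightarrow> (\<lambda>x. undefined :: complex) \<in> borel_measurable (SP I)"
    by (rule measurable_cong) (use False in \<open>auto simp: space_PiM PiE_def extensional_def\<close>)
  then show ?thesis by simp
qed

text \<open>Functions of finitely many points are kept as functions of whole sequences and shared
  between the spaces \<open>SP {..<m}\<close> for different \<open>m\<close>; dependence on an
  initial segment makes this consistent.\<close>

definition dep :: "nat => ((nat => complex) => 'b) => bool" where
  "dep m f \<longleftrightarrow> (\<forall>x y. (\<forall>i<m. x i = y i) \<longrightarrow> f x = f y)"

lemma depD: "dep m f ==> (\<And>i. i < m ==> x i = y i) ==> f x = f y"
  unfolding dep_def by blast

lemma depI: "(\<And>x y. (\<And>i. i < m ==> x i = y i) ==> f x = f y) ==> dep m f"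
  unfolding dep_def by blast

lemma dep_mono:
  assumes "dep m f" "m \<le> m'"
  shows "dep m' f"
  by (rule depI, rule depD[OF assms(1)]) (use assms(2) in auto)

lemma dep_mult:
  assumes "dep m f" "dep m g"
  shows "dep m (\<lambda>x. f x * g x :: 'b :: times)"
  by (rule depI, rule arg_cong2[where f="(*)"], rule depD[OF assms(1)], simp, rule depD[OF assms(2)], simp)

lemma dep_const: "dep m (\<lambda>_. c)"
  by (rule depI) (rule refl)

lemma dep_DD: "dep m (\<lambda>x. DD L x m)"
  by (rule depI) (rule DD_cong)

lemma measurable_SP_mono:
  fixes f :: "(nat => complex) => ennreal"
  assumes f: "f \<in> borel_measurable (SP {..<m})" and d: "dep m f" and "m \<le> m'"
  shows "f \<in> borel_measurable (SP {..<m'})"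
proof -
  have "(\<lambda>x. f (restrict x {..<m})) \<in> borel_measurable (SP {..<m'})"
    by (rule measurable_compose[OF measurable_restrict_subset f]) (use assms(3) in auto)
  moreover have "f (restrict x {..<m}) = f x" for x by (rule depD[OF d]) simp
  ultimately show ?thesis by simp
qed

lemma borel_measurable_DD_ker:
  assumes n: "n \<ge> 1" and f: "\<And>i. i < m ==> (\<lambda>\<omega>. f \<omega> i) \<in> borel_measurable M"
  shows "(\<lambda>\<omega>. DD (ker n) (f \<omega>) m) \<in> borel_measurable M"
proof -
  have "(\<lambda>\<omega>. dt m (\<lambda>i j. ker n (f \<omega> i) (f \<omega> j))) \<in> borel_measurable M"
    by (rule borel_measurable_dt) (intro borel_measurable_ker f)
  then have "(\<lambda>\<omega>. Re (dt m (\<lambda>i j. ker n (f \<omega> i) (f \<omega> j)))) \<in> borel_measurable M" by measurable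
  then show ?thesis by (simp add: dt_DD[OF rep_ker[OF n]])
qed

lemma measurable_DD_SP: "n \<ge> 1 ==> (\<lambda>x. DD (ker n) x m) \<in> borel_measurable (SP I)"
  by (rule borel_measurable_DD_ker) simp_all

lemma measurable_ennreal_DD [measurable]: "n \<ge> 1 ==> (\<lambda>x. ennreal (DD (ker n) x m)) \<in> borel_measurable (SP I)"
  by (rule measurable_compose[OF measurable_DD_SP measurable_ennreal])

lemma integrate_last:
  assumes f: "f \<in> borel_measurable (SP {..<m})" and d: "dep m f" and h: "h \<in> borel_measurable (SP {..<Suc m})"
  shows "(\<integral>\<^sup>+x. f x * h x \<partial>SP {..<Suc m}) = (\<integral>\<^sup>+x. f x * (\<integral>\<^sup>+z. h (x(m := z)) \<partial>sph) \<partial>SP {..<m})"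
proof -
  have S: "{..<Suc m} = insert m {..<m}" by auto
  have f': "f \<in> borel_measurable (SP {..<Suc m})" by (rule measurable_SP_mono[OF f d]) simp
  have "(\<integral>\<^sup>+x. f x * h x \<partial>SP {..<Suc m}) = (\<integral>\<^sup>+x. (\<integral>\<^sup>+z. f (x(m := z)) * h (x(m := z)) \<partial>sph) \<partial>SP {..<m})"
    unfolding S using f' h by (intro sph_product.product_nn_integral_insert) (auto simp: S)
  also have "... = (\<integral>\<^sup>+x. f x * (\<integral>\<^sup>+z. h (x(m := z)) \<partial>sph) \<partial>SP {..<m})"
  proof (rule nn_integral_cong)
    fix x assume x: "x \<in> space (SP {..<m})"
    have "f (x(m := z)) = f x" for z by (rule depD[OF d]) simp
    moreover have "(\<lambda>z. h (x(m := z))) \<in> borel_measurable sph"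
    proof (rule measurable_compose[OF _ h])
      show "(\<lambda>z. x(m := z)) \<in> sph \<rightarrow>\<^sub>M SP {..<Suc m}"
        unfolding S by (rule measurable_fun_upd[where J="{..<m}"]) (use x in auto)
    qed
    ultimately show "(\<integral>\<^sup>+z. f (x(m := z)) * h (x(m := z)) \<partial>sph) = f x * (\<integral>\<^sup>+z. h (x(m := z)) \<partial>sph)"
      by (simp add: nn_integral_cmult)
  qed
  finally show ?thesis .
qed

text \<open>The integral against the \<open>m\<close>-point correlation function, which is the
  determinant of the kernel matrix. For \<open>m = n\<close> the total mass is n!
  (\<open>Dn_total\<close>).\<close>

definition Dn :: "nat => nat => ((nat => complex) => ennreal) => ennreal" where
  "Dn n m f = (\<integral>\<^sup>+x. f x * ennreal (DD (ker n) x m) \<partial>SP {..<m})"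

lemma Dn_Suc:
  assumes n: "n \<ge> 1" and f: "f \<in> borel_measurable (SP {..<m})" and d: "dep m f" and m: "m \<le> n"
  shows "Dn n (Suc m) f = of_nat (n - m) * Dn n m f"
proof -
  have "Dn n (Suc m) f = (\<integral>\<^sup>+x. f x * (\<integral>\<^sup>+z. ennreal (DD (ker n) (x(m := z)) (Suc m)) \<partial>sph) \<partial>SP {..<m})"
    unfolding Dn_def by (rule integrate_last[OF f d measurable_ennreal_DD[OF n]])
  also have "... = (\<integral>\<^sup>+x. of_nat (n - m) * (f x * ennreal (DD (ker n) x m)) \<partial>SP {..<m})"
  proof (rule nn_integral_cong)
    fix x
    have "(\<integral>\<^sup>+z. ennreal (DD (ker n) (x(m := z)) (Suc m)) \<partial>sph) = ennreal (real (n - m) * DD (ker n) x m)"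
      unfolding nn_integral_DD[OF rep_ker[OF n]] trace_ker using m by (simp add: of_nat_diff)
    also have "... = of_nat (n - m) * ennreal (DD (ker n) x m)"
      by (subst ennreal_mult') (simp_all add: ennreal_of_nat_eq_real_of_nat)
    finally show "f x * (\<integral>\<^sup>+z. ennreal (DD (ker n) (x(m := z)) (Suc m)) \<partial>sph) = of_nat (n - m) * (f x * ennreal (DD (ker n) x m))"
      by (simp add: ac_simps)
  qed
  also have "... = of_nat (n - m) * Dn n m f"
    unfolding Dn_def by (intro nn_integral_cmult borel_measurable_times_ennreal f measurable_ennreal_DD n)
  finally show ?thesis .
qed

text \<open>Integrating out the points one by one costs the remaining traces n - m, ..., 2,
  1.\<close>

lemma Dn_marginal:
  assumes n: "n \<ge> 1" and f: "f \<in> borel_measurable (SP {..<m})" and d: "dep m f" and m: "m \<le> n"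
  shows "Dn n n f = of_nat (fact (n - m)) * Dn n m f"
proof -
  have "of_nat (fact (n - m - j)) * Dn n (m + j) f = of_nat (fact (n - m)) * Dn n m f" if "m + j \<le> n" for j
    using that
  proof (induction j)
    case (Suc j)
    have "Dn n (Suc (m + j)) f = of_nat (n - (m + j)) * Dn n (m + j) f"
      using Suc.prems by (intro Dn_Suc[OF n] measurable_SP_mono[OF f d] dep_mono[OF d]) auto
    moreover have "fact (n - m - j) = (n - (m + j)) * fact (n - m - Suc j)"
      using Suc.prems fact_reduce[of "n - m - j", where ?'a=nat] by (simp add: Suc_diff_Suc)
    ultimately show ?case using Suc by (simp add: ac_simps)
  qed simp
  from this[of "n - m"] show ?thesis using m by simp
qed

lemma Dn_total: "n \<ge> 1 ==> Dn n n (\<lambda>_. 1) = of_nat (fact n)"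
  by (subst Dn_marginal[of n _ 0]) (auto intro: dep_const simp: Dn_def prob_space.emeasure_space_1[OF prob_space_SP])

lemma Dn_mono: "(\<And>x. f x \<le> g x) ==> Dn n m f \<le> Dn n m g"
  unfolding Dn_def by (intro nn_integral_mono mult_right_mono) auto

lemma Dn_add:
  assumes "n \<ge> 1" "f \<in> borel_measurable (SP {..<m})" "g \<in> borel_measurable (SP {..<m})"
  shows "Dn n m (\<lambda>x. f x + g x) = Dn n m f + Dn n m g"
  unfolding Dn_def distrib_right by (intro nn_integral_add borel_measurable_times_ennreal assms measurable_ennreal_DD)

lemma Dn_sum:
  assumes "n \<ge> 1" "\<And>s. s \<in> S ==> f s \<in> borel_measurable (SP {..<m})"
  shows "Dn n m (\<lambda>x. \<Sum>s\<in>S. f s x) = (\<Sum>s\<in>S. Dn n m (f s))"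
  unfolding Dn_def sum_distrib_right by (intro nn_integral_sum borel_measurable_times_ennreal assms measurable_ennreal_DD)

lemma Dn_permute:
  assumes n: "n \<ge> 1" and p: "p permutes {..<n}" and f: "f \<in> borel_measurable (SP {..<n})" and d: "dep n f"
  shows "Dn n n (\<lambda>x. f (\<lambda>i. x (p i))) = Dn n n f"
proof -
  let ?t = "\<lambda>x. \<lambda>i\<in>{..<n}. x (p i)"
  have distr: "distr (SP {..<n}) (SP {..<n}) ?t = SP {..<n}"
  proof (rule distr_PiM_reindex[where M="\<lambda>_. sph"])
    show "prob_space sph" by (rule sph.prob_space_axioms)
    show "inj_on p {..<n}" by (rule permutes_inj_on[OF p])
    show "p \<in> {..<n} \<rightarrow> {..<n}" using permutes_in_image[OF p] by auto
  qed
  have t: "?t \<in> SP {..<n} \<rightarrow>\<^sub>M SP {..<n}"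
    by (rule measurable_restrict) (simp cong: measurable_cong_sets)
  have "Dn n n f = (\<integral>\<^sup>+x. f x * ennreal (DD (ker n) x n) \<partial>distr (SP {..<n}) (SP {..<n}) ?t)"
    unfolding distr Dn_def ..
  also have "... = (\<integral>\<^sup>+x. f (?t x) * ennreal (DD (ker n) (?t x) n) \<partial>SP {..<n})"
  proof (rule nn_integral_distr[OF t])
    have "(\<lambda>x. f x * ennreal (DD (ker n) x n)) \<in> borel_measurable (SP {..<n})"
      by (intro borel_measurable_times_ennreal f measurable_ennreal_DD n)
    then show "(\<lambda>x. f x * ennreal (DD (ker n) x n)) \<in> borel_measurable (distr (SP {..<n}) (SP {..<n}) ?t)" by simp
  qed
  also have "... = Dn n n (\<lambda>x. f (\<lambda>i. x (p i)))"
    unfolding Dn_def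
  proof (rule nn_integral_cong)
    fix x
    have "f (?t x) = f (\<lambda>i. x (p i))" by (rule depD[OF d]) simp
    moreover have "DD (ker n) (?t x) n = DD (ker n) (\<lambda>i. x (p i)) n" by (rule DD_cong) simp
    ultimately show "f (?t x) * ennreal (DD (ker n) (?t x) n) = f (\<lambda>i. x (p i)) * ennreal (DD (ker n) x n)"
      by (simp add: DD_ker_permute[OF n p])
  qed
  finally show ?thesis ..
qed

text \<open>Moves an arbitrary tuple of labels to the initial labels, so that
  \<open>Dn_permute\<close> reduces all tuples to one.\<close>

lemma distinct_list_extends_to_permutation:
  assumes "distinct xs" "set xs \<subseteq> {..<n}"
  obtains p where "p permutes {..<n}" "\<And>i. i < length xs ==> p i = xs ! i"
proof -
  let ?m = "length xs"
  have m: "?m \<le> n" using card_mono[OF _ assms(2)] distinct_card[OF assms(1)] by simp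
  have "card ({..<n} - {..<?m}) = card ({..<n} - set xs)"
    using assms m by (simp add: card_Diff_subset distinct_card)
  then obtain g where g: "bij_betw g ({..<n} - {..<?m}) ({..<n} - set xs)"
    by (metis finite_Diff finite_lessThan finite_same_card_bij)
  have nth: "bij_betw (\<lambda>i. xs ! i) {..<?m} (set xs)" using assms(1) by (simp add: bij_betw_nth)
  define p where "p = (\<lambda>i. if i < ?m then xs ! i else if i < n then g i else i)"
  have "bij_betw p {..<?m} (set xs)" using nth by (subst bij_betw_cong[of _ _ "\<lambda>i. xs ! i"]) (auto simp: p_def)
  moreover have "bij_betw p ({..<n} - {..<?m}) ({..<n} - set xs)"
    using g by (subst bij_betw_cong[of _ _ g]) (auto simp: p_def)
  ultimately have "bij_betw p ({..<?m} \<union> ({..<n} - {..<?m})) (set xs \<union> ({..<n} - set xs))"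
    by (rule bij_betw_combine) auto
  moreover have "{..<?m} \<union> ({..<n} - {..<?m}) = {..<n}" "set xs \<union> ({..<n} - set xs) = {..<n}"
    using m assms(2) by auto
  ultimately have "bij_betw p {..<n} {..<n}" by simp
  then have "p permutes {..<n}" by (rule bij_imp_permutes) (use m in \<open>auto simp: p_def\<close>)
  then show ?thesis by (rule that) (simp add: p_def)
qed

subsection \<open>Close pairs\<close>

definition ib :: "bool => ennreal" where
  "ib P = (if P then 1 else 0)"

lemma ib_simps [simp]: "ib True = 1" "ib False = 0"
  by (simp_all add: ib_def)

lemma measurable_ib [measurable]: "Measurable.pred M P ==> (\<lambda>x. ib (P x)) \<in> borel_measurable M"
  unfolding ib_def by measurable

lemma ib_mono: "(P ==> Q) ==> ib P \<le> ib Q" and ib_conj: "ib (P \<and> Q) = ib P * ib Q"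
  by (auto simp: ib_def)

text \<open>The integral of the two-point density n^2 (1 - (1 - u)^(n-1)) for u from 0 to
  \<open>t\<close>, that is, the expected number of ordered pairs with \<open>qd\<close> at most
  \<open>t\<close>.\<close>

definition bb :: "nat => real => real" where
  "bb n t = (real n)\<^sup>2 * t - real n * (1 - (1 - t) ^ n)"

lemma nn_integral_close:
  assumes t: "0 \<le> t" "t \<le> 1"
  shows "(\<integral>\<^sup>+z. ib (qd p z \<le> t) \<partial>sph) = ennreal t"
proof -
  have "(\<integral>\<^sup>+z. ib (qd p z \<le> t) \<partial>sph) = (\<integral>\<^sup>+u\<in>{0..1}. ib (u \<le> t) \<partial>lborel)"
    by (rule nn_integral_sph_qd) measurable
  also have "... = (\<integral>\<^sup>+u. indicator {0..t} u \<partial>lborel)"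
    using t by (intro nn_integral_cong) (auto simp: ib_def indicator_def)
  also have "... = ennreal t" using t by simp
  finally show ?thesis .
qed

lemma borel_measurable_det2_ker [measurable]:
  assumes [measurable]: "f \<in> borel_measurable M" "g \<in> borel_measurable M"
  shows "(\<lambda>x. det2 (ker n) (f x) (g x)) \<in> borel_measurable M"
  unfolding det2_ker by measurable

definition rr :: "nat => real => complex => complex => ennreal" where
  "rr n t p z = ennreal (det2 (ker n) p z) * ib (qd p z \<le> t)"

lemma borel_measurable_rr [measurable]:
  assumes [measurable]: "f \<in> borel_measurable M" "g \<in> borel_measurable M"
  shows "(\<lambda>x. rr n t (f x) (g x)) \<in> borel_measurable M"
  unfolding rr_def by measurable

lemma bb_nonneg:
  assumes "n \<ge> 1" "0 \<le> t" "t \<le> 1"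
  shows "bb n t \<ge> 0"
proof -
  have "1 + real n * (- t) \<le> (1 + (- t)) ^ n" by (rule Bernoulli_inequality) (use assms in simp)
  then have "1 - (1 - t) ^ n \<le> real n * t" by simp
  then have "real n * (1 - (1 - t) ^ n) \<le> real n * (real n * t)" by (rule mult_left_mono) simp
  then show ?thesis by (simp add: bb_def power2_eq_square mult.assoc)
qed

lemma nn_integral_rr:
  assumes n: "n \<ge> 1" and t: "0 \<le> t" "t \<le> 1"
  shows "(\<integral>\<^sup>+z. rr n t p z \<partial>sph) = ennreal (bb n t)"
proof -
  have "(\<integral>\<^sup>+z. rr n t p z \<partial>sph) = (\<integral>\<^sup>+z. ennreal ((real n)\<^sup>2 * (1 - (1 - qd p z) ^ (n - 1))) * ib (qd p z \<le> t) \<partial>sph)"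
    by (simp only: rr_def det2_ker)
  also have "... = (\<integral>\<^sup>+u\<in>{0..1}. ennreal ((real n)\<^sup>2 * (1 - (1 - u) ^ (n - 1))) * ib (u \<le> t) \<partial>lborel)"
    by (rule nn_integral_sph_qd[of "\<lambda>u. ennreal ((real n)\<^sup>2 * (1 - (1 - u) ^ (n - 1))) * ib (u \<le> t)"]) measurable
  also have "... = (\<integral>\<^sup>+u. ennreal ((real n)\<^sup>2 * (1 - (1 - u) ^ (n - 1))) * indicator {0..t} u \<partial>lborel)"
    using t by (intro nn_integral_cong) (auto simp: ib_def indicator_def)
  also have "... = ennreal (((real n)\<^sup>2 * t + real n * (1 - t) ^ n) - ((real n)\<^sup>2 * 0 + real n * (1 - 0) ^ n))"
  proof (rule nn_integral_FTC_Icc)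
    fix u assume u: "u \<in> {0..t}"
    have "((\<lambda>u. (real n)\<^sup>2 * u + real n * (1 - u) ^ n) has_real_derivative (real n)\<^sup>2 * 1 + real n * (real n * ((1 - u) ^ (n - 1) * (0 - 1)))) (at u)"
      by (auto intro!: derivative_eq_intros)
    then show "((\<lambda>u. (real n)\<^sup>2 * u + real n * (1 - u) ^ n) has_real_derivative (real n)\<^sup>2 * (1 - (1 - u) ^ (n - 1))) (at u)"
      by (simp add: power2_eq_square algebra_simps)
    have "(1 - u) ^ (n - 1) \<le> 1" using u t by (intro power_le_one) auto
    then show "0 \<le> (real n)\<^sup>2 * (1 - (1 - u) ^ (n - 1))" by simp
  qed (use t in auto)
  also have "((real n)\<^sup>2 * t + real n * (1 - t) ^ n) - ((real n)\<^sup>2 * 0 + real n * (1 - 0) ^ n) = bb n t"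
    by (simp add: bb_def algebra_simps)
  finally show ?thesis .
qed

lemma integrate_last_const:
  assumes f: "f \<in> borel_measurable (SP {..<m})" and d: "dep m f" and h: "h \<in> borel_measurable (SP {..<Suc m})"
    and c: "\<And>x. (\<integral>\<^sup>+z. h (x(m := z)) \<partial>sph) = c"
  shows "(\<integral>\<^sup>+x. f x * h x \<partial>SP {..<Suc m}) = c * (\<integral>\<^sup>+x. f x \<partial>SP {..<m})"
  unfolding integrate_last[OF f d h] c by (subst nn_integral_multc[OF f]) (rule mult.commute)

text \<open>The second point goes first: by homogeneity its integral is \<open>bb n t\<close>
  whatever the first point is. A further condition \<open>h\<close> on the first point then
  contributes its own constant.\<close>

lemma integrate_pair:
  assumes f: "f \<in> borel_measurable (SP {..<m})" and d: "dep m f" and n: "n \<ge> 1" and t: "0 \<le> t" "t \<le> 1"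
    and h: "h \<in> borel_measurable (SP {..<Suc m})" "dep (Suc m) h" and c: "\<And>x. (\<integral>\<^sup>+z. h (x(m := z)) \<partial>sph) = c"
  shows "(\<integral>\<^sup>+x. f x * h x * rr n t (x m) (x (Suc m)) \<partial>SP {..<Suc (Suc m)}) = ennreal (bb n t) * (c * (\<integral>\<^sup>+x. f x \<partial>SP {..<m}))"
proof -
  have f': "f \<in> borel_measurable (SP {..<Suc m})" by (rule measurable_SP_mono[OF f d]) simp
  have "(\<integral>\<^sup>+x. f x * h x * rr n t (x m) (x (Suc m)) \<partial>SP {..<Suc (Suc m)}) = ennreal (bb n t) * (\<integral>\<^sup>+x. f x * h x \<partial>SP {..<Suc m})"
  proof (rule integrate_last_const)
    show "(\<lambda>x. f x * h x) \<in> borel_measurable (SP {..<Suc m})" using f' h(1) by measurable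
    show "dep (Suc m) (\<lambda>x. f x * h x)"
      by (intro dep_mult dep_mono[OF d] h(2)) simp
    show "(\<lambda>x. rr n t (x m) (x (Suc m))) \<in> borel_measurable (SP {..<Suc (Suc m)})" by measurable
    show "(\<integral>\<^sup>+z. rr n t ((x(Suc m := z)) m) ((x(Suc m := z)) (Suc m)) \<partial>sph) = ennreal (bb n t)" for x
      using nn_integral_rr[OF n t, of "x m"] by simp
  qed
  also have "(\<integral>\<^sup>+x. f x * h x \<partial>SP {..<Suc m}) = c * (\<integral>\<^sup>+x. f x \<partial>SP {..<m})"
    by (rule integrate_last_const[OF f d h(1) c])
  finally show ?thesis .
qed

definition PP :: "nat => real => nat => (nat => complex) => ennreal" where
  "PP n t k x = (\<Prod>l<k. rr n t (x (2 * l)) (x (2 * l + 1)))"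

lemma measurable_PP [measurable]: "PP n t k \<in> borel_measurable (SP I)"
  unfolding PP_def[abs_def] by (intro borel_measurable_prod_ennreal borel_measurable_rr SP_component)

lemma dep_PP: "dep (2 * k) (PP n t k)"
  unfolding PP_def[abs_def] by (intro depI prod.cong refl) simp

lemma nn_integral_PP:
  assumes n: "n \<ge> 1" and t: "0 \<le> t" "t \<le> 1"
  shows "(\<integral>\<^sup>+x. PP n t k x \<partial>SP {..<2 * k}) = ennreal (bb n t ^ k)"
proof (induction k)
  case 0
  show ?case by (simp add: PP_def prob_space.emeasure_space_1[OF prob_space_SP])
next
  case (Suc k)
  have "(\<integral>\<^sup>+x. PP n t (Suc k) x \<partial>SP {..<2 * Suc k}) = (\<integral>\<^sup>+x. PP n t k x * 1 * rr n t (x (2 * k)) (x (Suc (2 * k))) \<partial>SP {..<Suc (Suc (2 * k))})"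
    by (simp add: PP_def)
  also have "... = ennreal (bb n t) * (1 * (\<integral>\<^sup>+x. PP n t k x \<partial>SP {..<2 * k}))"
    by (rule integrate_pair[OF _ dep_PP n t]) (auto intro: dep_const simp: sph.emeasure_space_1[simplified])
  also have "... = ennreal (bb n t ^ Suc k)" unfolding Suc using bb_nonneg[OF n t] by (simp add: ennreal_mult)
  finally show ?case .
qed

text \<open>The condition is charged to the first point of the later pair \<open>l'\<close>, which
  is otherwise uniform, so it contributes the area \<open>e\<close> of a cap.\<close>

lemma nn_integral_PP_near:
  assumes n: "n \<ge> 1" and t: "0 \<le> t" "t \<le> 1" and e: "0 \<le> e" "e \<le> 1" and ll: "l < l'" "l' < k"
  shows "(\<integral>\<^sup>+x. PP n t k x * ib (qd (x (2 * l)) (x (2 * l')) \<le> e) \<partial>SP {..<2 * k}) = ennreal (e * bb n t ^ k)"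
  using ll(2)
proof (induction k)
  case (Suc k)
  note b = bb_nonneg[OF n t]
  show ?case
  proof (cases "l' = k")
    case True
    have "(\<integral>\<^sup>+x. PP n t (Suc k) x * ib (qd (x (2 * l)) (x (2 * l')) \<le> e) \<partial>SP {..<2 * Suc k}) =
        (\<integral>\<^sup>+x. PP n t k x * ib (qd (x (2 * l)) (x (2 * k)) \<le> e) * rr n t (x (2 * k)) (x (Suc (2 * k))) \<partial>SP {..<Suc (Suc (2 * k))})"
      by (simp add: PP_def True mult_ac)
    also have "... = ennreal (bb n t) * (ennreal e * (\<integral>\<^sup>+x. PP n t k x \<partial>SP {..<2 * k}))"
    proof (rule integrate_pair[OF _ dep_PP n t])
      show "dep (Suc (2 * k)) (\<lambda>x. ib (qd (x (2 * l)) (x (2 * k)) \<le> e))"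
        using ll True by (intro depI) simp
      show "(\<integral>\<^sup>+z. ib (qd ((x(2 * k := z)) (2 * l)) ((x(2 * k := z)) (2 * k)) \<le> e) \<partial>sph) = ennreal e" for x
        using ll True nn_integral_close[OF e, of "x (2 * l)"] by simp
    qed measurable
    also have "... = ennreal (e * bb n t ^ Suc k)"
      unfolding nn_integral_PP[OF n t] using b e by (simp add: ennreal_mult[symmetric] mult_ac)
    finally show ?thesis .
  next
    case False
    then have l': "l' < k" using Suc.prems by simp
    have "(\<integral>\<^sup>+x. PP n t (Suc k) x * ib (qd (x (2 * l)) (x (2 * l')) \<le> e) \<partial>SP {..<2 * Suc k}) =
        (\<integral>\<^sup>+x. (PP n t k x * ib (qd (x (2 * l)) (x (2 * l')) \<le> e)) * 1 * rr n t (x (2 * k)) (x (Suc (2 * k))) \<partial>SP {..<Suc (Suc (2 * k))})"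
      by (simp add: PP_def mult_ac)
    also have "... = ennreal (bb n t) * (1 * (\<integral>\<^sup>+x. PP n t k x * ib (qd (x (2 * l)) (x (2 * l')) \<le> e) \<partial>SP {..<2 * k}))"
    proof (rule integrate_pair[OF _ _ n t])
      show "dep (2 * k) (\<lambda>x. PP n t k x * ib (qd (x (2 * l)) (x (2 * l')) \<le> e))"
        by (intro dep_mult dep_PP, rule depI) (use l' ll in simp)
    qed (auto intro: dep_const simp: sph.emeasure_space_1[simplified])
    also have "... = ennreal (e * bb n t ^ Suc k)"
      unfolding Suc.IH[OF l'] using b e by (simp add: ennreal_mult[symmetric] mult_ac)
    finally show ?thesis .
  qed
qed simp

lemma cd_triangle: "cd a c \<le> cd a b + cd b c"
  unfolding cd_def dist_norm[symmetric] by (rule dist_triangle)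

lemma cd_sqrt: "cd a b = 2 * sqrt (qd a b)"
proof -
  have "cd a b = sqrt ((cd a b)\<^sup>2)" by (simp add: cd_def)
  then show ?thesis by (simp add: cd_square real_sqrt_mult)
qed

section \<open>Separated pairs and the block structure of the kernel matrix\<close>

definition CL :: "real => nat => (nat => complex) => bool" where
  "CL t k x \<longleftrightarrow> (\<forall>l<k. qd (x (2 * l)) (x (2 * l + 1)) \<le> t)"

definition sepd :: "real => nat => (nat => complex) => bool" where
  "sepd e k x \<longleftrightarrow> (\<forall>l'<k. \<forall>l<l'. \<not> qd (x (2 * l)) (x (2 * l')) \<le> e)"

lemma pred_CL [measurable]: "Measurable.pred (SP I) (CL t k)"
  unfolding CL_def[abs_def] by measurable

lemma pred_sepd [measurable]: "Measurable.pred (SP I) (sepd e k)"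
  unfolding sepd_def[abs_def] by measurable

lemma dep_CL: "dep (2 * k) (CL t k)"
  unfolding CL_def[abs_def] by (rule depI) auto

lemma dep_sepd: "dep (2 * k) (sepd e k)"
  unfolding sepd_def[abs_def] by (rule depI) auto

text \<open>In chordal distance the first points are more than 2 sqrt e apart, and each point is
  within 2 sqrt t of the first point of its pair. The factor 16 gives 4 sqrt t <= sqrt e, so more
  than sqrt e remains, which is \<open>qd > e / 4\<close>.\<close>

lemma separated_pairs_distance:
  assumes te: "0 \<le> t" "16 * t \<le> e" and CL: "CL t k x" and sep: "sepd e k x"
    and ij: "i < 2 * k" "j < 2 * k" "i div 2 \<noteq> j div 2"
  shows "qd (x i) (x j) > e / 4"
proof -
  have close: "cd (x (2 * (i div 2))) (x i) \<le> 2 * sqrt t" if "i < 2 * k" for i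
  proof (cases "even i")
    case True
    then show ?thesis using te by (simp add: cd_def)
  next
    case False
    then have "i = 2 * (i div 2) + 1" by simp
    moreover have "i div 2 < k" using that by simp
    ultimately have "qd (x (2 * (i div 2))) (x i) \<le> t" using CL unfolding CL_def by metis
    then show ?thesis unfolding cd_sqrt by simp
  qed
  have far: "2 * sqrt e < cd (x (2 * (i div 2))) (x (2 * (j div 2)))"
  proof -
    have "i div 2 < k" "j div 2 < k" using ij by auto
    then have "e < qd (x (2 * (i div 2))) (x (2 * (j div 2)))"
      using sep ij(3) qd_commute unfolding sepd_def by (metis linorder_neqE_nat not_le)
    then show ?thesis unfolding cd_sqrt by simp
  qed
  have "sqrt (16 * t) \<le> sqrt e" using te by simp
  then have s: "4 * sqrt t \<le> sqrt e" by (simp add: real_sqrt_mult)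
  have "cd (x (2 * (i div 2))) (x (2 * (j div 2))) \<le> cd (x (2 * (i div 2))) (x i) + (cd (x i) (x j) + cd (x j) (x (2 * (j div 2))))"
    using cd_triangle[of "x (2 * (i div 2))" "x (2 * (j div 2))" "x i"] cd_triangle[of "x i" "x (2 * (j div 2))" "x j"] by linarith
  moreover have "cd (x j) (x (2 * (j div 2))) = cd (x (2 * (j div 2))) (x j)" by (simp add: cd_def norm_minus_commute)
  ultimately have "sqrt e < cd (x i) (x j)" using close[OF ij(1)] close[OF ij(2)] far s by linarith
  then have "sqrt (e / 4) < sqrt (qd (x i) (x j))" unfolding cd_sqrt by (simp add: real_sqrt_divide)
  then show ?thesis by simp
qed

lemma dt_block:
  fixes f :: "nat => nat => 'a :: idom"
  assumes "\<And>i j. a \<le> i ==> i < a + b ==> j < a ==> f i j = 0"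
  shows "dt (a + b) f = dt a f * dt b (\<lambda>i j. f (a + i) (a + j))"
proof -
  have "Matrix.mat (a + b) (a + b) (\<lambda>(i, j). f i j) =
      four_block_mat (Matrix.mat a a (\<lambda>(i, j). f i j)) (Matrix.mat a b (\<lambda>(i, j). f i (a + j)))
        (0\<^sub>m b a) (Matrix.mat b b (\<lambda>(i, j). f (a + i) (a + j)))"
    by (rule eq_matI) (auto simp: assms)
  then show ?thesis unfolding dt_def
    by (simp only:) (rule det_four_block_mat_lower_left_zero[where n=a and m=b], auto)
qed

text \<open>Writes the product of two-point determinants as the determinant of the truncated kernel
  matrix, to be compared with the full one term by term.\<close>

lemma dt_pairs:
  assumes L: "rep L"
  shows "dt (2 * k) (\<lambda>i j. if i div 2 = j div 2 then L (x i) (x j) else 0) = of_real (\<Prod>l<k. det2 L (x (2 * l)) (x (2 * l + 1)))"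
proof (induction k)
  case (Suc k)
  let ?f = "\<lambda>i j. if i div 2 = j div 2 then L (x i) (x j) else 0"
  have "dt (2 * Suc k) ?f = dt (2 * k + 2) ?f" by simp
  also have "... = dt (2 * k) ?f * dt 2 (\<lambda>i j. ?f (2 * k + i) (2 * k + j))"
  proof (rule dt_block)
    fix i j assume "2 * k \<le> i" "i < 2 * k + 2" "j < 2 * k"
    then have "j div 2 < k" "k \<le> i div 2" by auto
    then show "?f i j = 0" by auto
  qed
  also have "dt 2 (\<lambda>i j. ?f (2 * k + i) (2 * k + j)) = dt 2 (\<lambda>i j. L (x (2 * k + i)) (x (2 * k + j)))"
    by (rule dt_cong) auto
  also have "... = of_real (DD L (\<lambda>i. x (2 * k + i)) 2)" by (rule dt_DD[OF L])
  also have "DD L (\<lambda>i. x (2 * k + i)) 2 = det2 L (x (2 * k)) (x (2 * k + 1))"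
    using DD_Suc_Suc[OF L, of "\<lambda>i. x (2 * k + i)" 0] by (simp add: numeral_2_eq_2)
  finally show ?case unfolding Suc by simp
qed simp

text \<open>For separated pairs, all terms of the Leibniz expansion that leave the blocks are small.\<close>

lemma det2_product_le_DD:
  assumes n: "n \<ge> 1" and te: "0 \<le> t" "16 * t \<le> e" "e \<le> 1" and CL: "CL t k x" and sep: "sepd e k x"
  shows "(\<Prod>l<k. det2 (ker n) (x (2 * l)) (x (2 * l + 1))) \<le>
    DD (ker n) x (2 * k) + fact (2 * k) * (real n ^ (2 * k) * sqrt ((1 - e / 4) ^ (n - 1)))"
proof -
  let ?s = "sqrt ((1 - e / 4) ^ (n - 1))"
  let ?K = "\<lambda>i j. ker n (x i) (x j)"
  let ?B = "\<lambda>i j. if i div 2 = j div 2 then ?K i j else 0"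
  let ?I = "{0..<2 * k}"
  have off: "cmod (?K i j) \<le> real n * ?s" if "i < 2 * k" "j < 2 * k" "i div 2 \<noteq> j div 2" for i j
  proof -
    have "(1 - qd (x i) (x j)) ^ (n - 1) \<le> (1 - e / 4) ^ (n - 1)"
      using separated_pairs_distance[OF te(1,2) CL sep that] qd_le_1[of "x i" "x j"] by (intro power_mono) auto
    then have "(cmod (?K i j))\<^sup>2 \<le> (real n)\<^sup>2 * (1 - e / 4) ^ (n - 1)"
      unfolding norm_ker by (rule mult_left_mono) simp
    then have "cmod (?K i j) \<le> sqrt ((real n)\<^sup>2 * (1 - e / 4) ^ (n - 1))" by (rule real_le_rsqrt)
    then show ?thesis by (simp add: real_sqrt_mult)
  qed
  have tm: "cmod (signof p * (\<Prod>i\<in>?I. ?K i (p i)) - signof p * (\<Prod>i\<in>?I. ?B i (p i))) \<le> real n ^ (2 * k) * ?s"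
    if p: "p permutes ?I" for p
  proof (cases "\<forall>i\<in>?I. i div 2 = p i div 2")
    case True
    then have "(\<Prod>i\<in>?I. ?B i (p i)) = (\<Prod>i\<in>?I. ?K i (p i))" by (intro prod.cong) auto
    then show ?thesis using te by simp
  next
    case False
    \<comment> \<open>A permutation that leaves a block kills the truncated product, while the full
      product contains at least one entry between separated pairs, of modulus at most n s; all its
      other entries are at most n.\<close>
    then obtain i0 where i0: "i0 \<in> ?I" "i0 div 2 \<noteq> p i0 div 2" by blast
    then have z: "(\<Prod>i\<in>?I. ?B i (p i)) = 0" by (intro prod_zero) auto
    have pi0: "p i0 < 2 * k" using permutes_in_image[OF p] i0(1) by auto
    have sg: "cmod (signof p) = 1" by (cases p rule: sign_cases) simp_all
    have "cmod (\<Prod>i\<in>?I. ?K i (p i)) = cmod (?K i0 (p i0)) * (\<Prod>i\<in>?I - {i0}. cmod (?K i (p i)))"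
      unfolding prod.remove[OF finite_atLeastLessThan i0(1)] norm_mult prod_norm[symmetric] ..
    also have "... \<le> (real n * ?s) * (\<Prod>i\<in>?I - {i0}. real n)"
      using te i0 pi0 by (intro mult_mono off prod_mono conjI norm_ker_le norm_ge_zero prod_nonneg ballI mult_nonneg_nonneg) auto
    also have "... = real n ^ (2 * k) * ?s"
    proof -
      have "2 * k = Suc (2 * k - 1)" using i0(1) by auto
      then have "real n ^ (2 * k) = real n * real n ^ (2 * k - 1)" by (metis power_Suc)
      then show ?thesis using i0(1) by simp
    qed
    finally show ?thesis unfolding z mult_zero_right diff_zero norm_mult sg mult_1_left .
  qed
  have "of_real (DD (ker n) x (2 * k)) - of_real (\<Prod>l<k. det2 (ker n) (x (2 * l)) (x (2 * l + 1))) =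
      (\<Sum>p | p permutes ?I. signof p * (\<Prod>i\<in>?I. ?K i (p i)) - signof p * (\<Prod>i\<in>?I. ?B i (p i)))"
    unfolding dt_DD[OF rep_ker[OF n], symmetric] dt_pairs[OF rep_ker[OF n], symmetric] dt_leibniz sum_subtractf ..
  then have "cmod (of_real (DD (ker n) x (2 * k) - (\<Prod>l<k. det2 (ker n) (x (2 * l)) (x (2 * l + 1))))) \<le>
      (\<Sum>p | p permutes ?I. real n ^ (2 * k) * ?s)"
    unfolding of_real_diff by (simp only:) (intro order_trans[OF norm_sum] sum_mono tm, simp)
  also have "... = fact (2 * k) * (real n ^ (2 * k) * ?s)"
    by (simp add: card_permutations[of ?I "2 * k"])
  finally have "\<bar>DD (ker n) x (2 * k) - (\<Prod>l<k. det2 (ker n) (x (2 * l)) (x (2 * l + 1)))\<bar> \<le> fact (2 * k) * (real n ^ (2 * k) * ?s)"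
    by (simp only: norm_of_real)
  then show ?thesis by linarith
qed

lemma PP_eq: "rep (ker n) ==> PP n t k x = ennreal (\<Prod>l<k. det2 (ker n) (x (2 * l)) (x (2 * l + 1))) * ib (CL t k x)"
proof (induction k)
  case (Suc k)
  have "ib (CL t (Suc k) x) = ib (CL t k x) * ib (qd (x (2 * k)) (x (2 * k + 1)) \<le> t)"
    unfolding ib_conj[symmetric] CL_def by (simp add: All_less_Suc conj_commute)
  then show ?case using Suc unfolding PP_def
    by (simp add: rr_def ennreal_mult prod_nonneg det2_nonneg mult_ac)
qed (simp add: PP_def CL_def)

text \<open>Fischer's inequality pointwise; after it the pairs decouple.\<close>

lemma Dn_close_le:
  assumes n: "n \<ge> 1" and t: "0 \<le> t" "t \<le> 1"
  shows "Dn n (2 * k) (\<lambda>x. ib (CL t k x)) \<le> ennreal (bb n t ^ k)"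
proof -
  have "Dn n (2 * k) (\<lambda>x. ib (CL t k x)) \<le> (\<integral>\<^sup>+x. PP n t k x \<partial>SP {..<2 * k})"
    unfolding Dn_def PP_eq[OF rep_ker[OF n]] mult.commute[of "ib _"]
    by (intro nn_integral_mono mult_right_mono ennreal_leI DD_pairs_le rep_ker n) simp
  then show ?thesis by (simp add: nn_integral_PP[OF n t])
qed

text \<open>Where the first points are separated, the product of two-point determinants exceeds the
  true determinant by no more than the off-block error. Configurations with two first points within
  \<open>e\<close> have product mass \<open>e * bb n t ^ k\<close> for each of at most k^2 choices
  of two pairs.\<close>

lemma Dn_separated_ge:
  assumes n: "n \<ge> 1" and te: "0 \<le> t" "16 * t \<le> e" "e \<le> 1"
  shows "ennreal (bb n t ^ k) \<le> Dn n (2 * k) (\<lambda>x. ib (CL t k x \<and> sepd e k x)) +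
    ennreal (fact (2 * k) * (real n ^ (2 * k) * sqrt ((1 - e / 4) ^ (n - 1)))) + ennreal (real (k\<^sup>2) * (e * bb n t ^ k))"
proof -
  let ?err = "fact (2 * k) * (real n ^ (2 * k) * sqrt ((1 - e / 4) ^ (n - 1)))"
  define S where "S = Sigma {..<k} (\<lambda>l'. {..<l'})"
  have fin: "finite S" and mem: "s \<in> S \<longleftrightarrow> fst s < k \<and> snd s < fst s" for s
    by (cases s, auto simp: S_def)+
  have t: "t \<le> 1" "0 \<le> e" using te by auto
  note b = bb_nonneg[OF n te(1) t(1)]
  interpret P: prob_space "SP {..<2 * k}" by (rule prob_space_SP)
  have err: "?err \<ge> 0" using te by simp
  have pw: "PP n t k x \<le> (ib (CL t k x \<and> sepd e k x) * ennreal (DD (ker n) x (2 * k)) + ennreal ?err) +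
      (\<Sum>s\<in>S. PP n t k x * ib (qd (x (2 * snd s)) (x (2 * fst s)) \<le> e))" for x
  proof (cases "sepd e k x")
    case True
    have "PP n t k x \<le> ib (CL t k x \<and> sepd e k x) * ennreal (DD (ker n) x (2 * k)) + ennreal ?err"
    proof (cases "CL t k x")
      case True
      have "ennreal (\<Prod>l<k. det2 (ker n) (x (2 * l)) (x (2 * l + 1))) \<le> ennreal (DD (ker n) x (2 * k) + ?err)"
        by (rule ennreal_leI) (rule det2_product_le_DD[OF n te True \<open>sepd e k x\<close>])
      then show ?thesis using True \<open>sepd e k x\<close> err
        by (simp add: PP_eq[OF rep_ker[OF n]] ennreal_plus DD_nonneg[OF rep_ker[OF n]] del: power_mult_distrib)
    qed (simp add: PP_eq[OF rep_ker[OF n]])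
    then show ?thesis by (rule order_trans) simp
  next
    case False
    then obtain l l' where ll: "l < l'" "l' < k" "qd (x (2 * l)) (x (2 * l')) \<le> e" by (auto simp: sepd_def)
    have "PP n t k x = PP n t k x * ib (qd (x (2 * snd (l', l))) (x (2 * fst (l', l))) \<le> e)" using ll by simp
    also have "... \<le> (\<Sum>s\<in>S. PP n t k x * ib (qd (x (2 * snd s)) (x (2 * fst s)) \<le> e))"
      using ll fin by (intro member_le_sum[of "(l', l)" S "\<lambda>s. PP n t k x * ib (qd (x (2 * snd s)) (x (2 * fst s)) \<le> e)"]) (auto simp: mem)
    finally show ?thesis by (rule order_trans) simp
  qed
  have mD: "(\<lambda>x. ennreal (DD (ker n) x (2 * k))) \<in> borel_measurable (SP {..<2 * k})"
    using measurable_DD_SP[OF n] by measurable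
  note [measurable] = mD
  have "ennreal (bb n t ^ k) = (\<integral>\<^sup>+x. PP n t k x \<partial>SP {..<2 * k})" by (simp add: nn_integral_PP[OF n te(1) t(1)])
  also have "... \<le> (\<integral>\<^sup>+x. (ib (CL t k x \<and> sepd e k x) * ennreal (DD (ker n) x (2 * k)) + ennreal ?err) +
      (\<Sum>s\<in>S. PP n t k x * ib (qd (x (2 * snd s)) (x (2 * fst s)) \<le> e)) \<partial>SP {..<2 * k})"
    by (intro nn_integral_mono pw)
  also have "... = (Dn n (2 * k) (\<lambda>x. ib (CL t k x \<and> sepd e k x)) + ennreal ?err) +
      (\<integral>\<^sup>+x. (\<Sum>s\<in>S. PP n t k x * ib (qd (x (2 * snd s)) (x (2 * fst s)) \<le> e)) \<partial>SP {..<2 * k})"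
    unfolding Dn_def
    by (subst nn_integral_add, measurable, subst nn_integral_add, measurable) (simp add: P.emeasure_space_1)
  also have "(\<integral>\<^sup>+x. (\<Sum>s\<in>S. PP n t k x * ib (qd (x (2 * snd s)) (x (2 * fst s)) \<le> e)) \<partial>SP {..<2 * k}) =
      (\<Sum>s\<in>S. ennreal (e * bb n t ^ k))"
  proof -
    have "(\<integral>\<^sup>+x. PP n t k x * ib (qd (x (2 * snd s)) (x (2 * fst s)) \<le> e) \<partial>SP {..<2 * k}) = ennreal (e * bb n t ^ k)" if "s \<in> S" for s
      using that by (intro nn_integral_PP_near n te t) (auto simp: mem)
    moreover have "(\<integral>\<^sup>+x. (\<Sum>s\<in>S. PP n t k x * ib (qd (x (2 * snd s)) (x (2 * fst s)) \<le> e)) \<partial>SP {..<2 * k}) =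
        (\<Sum>s\<in>S. \<integral>\<^sup>+x. PP n t k x * ib (qd (x (2 * snd s)) (x (2 * fst s)) \<le> e) \<partial>SP {..<2 * k})"
    proof (rule nn_integral_sum)
      fix s :: "nat \<times> nat"
      have "(\<lambda>x. qd (x (2 * snd s)) (x (2 * fst s))) \<in> borel_measurable (SP {..<2 * k})"
        by (rule borel_measurable_qd[OF SP_component SP_component])
      then show "(\<lambda>x. PP n t k x * ib (qd (x (2 * snd s)) (x (2 * fst s)) \<le> e)) \<in> borel_measurable (SP {..<2 * k})"
        by (intro borel_measurable_times_ennreal measurable_PP measurable_ib) simp
    qed
    ultimately show ?thesis by simp
  qed
  also have "... \<le> ennreal (real (k\<^sup>2) * (e * bb n t ^ k))"
  proof -
    have "card S \<le> card ({..<k} \<times> {..<k})" unfolding S_def by (rule card_mono) auto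
    then have "card S \<le> k\<^sup>2" by (simp add: power2_eq_square)
    then have "real (card S) * (e * bb n t ^ k) \<le> real (k\<^sup>2) * (e * bb n t ^ k)"
      using b t by (intro mult_right_mono of_nat_mono mult_nonneg_nonneg zero_le_power)
    then have "ennreal (real (card S) * (e * bb n t ^ k)) \<le> ennreal (real (k\<^sup>2) * (e * bb n t ^ k))" by (rule ennreal_leI)
    moreover have "(\<Sum>s\<in>S. ennreal (e * bb n t ^ k)) = ennreal (real (card S) * (e * bb n t ^ k))"
      by (simp only: sum_constant) (subst ennreal_mult', use b t in \<open>simp_all add: ennreal_of_nat_eq_real_of_nat\<close>)
    ultimately show ?thesis by simp
  qed
  finally show ?thesis by (simp add: add_left_mono)
qed

subsection \<open>Isolated pairs and their factorial moments\<close>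

text \<open>In a symmetric irreflexive relation, the pairs that are isolated edges are disjoint, so \<open>k\<close>-tuples
  of distinct ones are given by distinct lists of length \<open>2 * k\<close>.\<close>

definition pairlists :: "(nat \<times> nat) set => nat => nat list set" where
  "pairlists H k = {xs. distinct xs \<and> length xs = 2 * k \<and> (\<forall>l<k. (xs ! (2 * l), xs ! (2 * l + 1)) \<in> H)}"

lemma pairlists_subset:
  assumes "H \<subseteq> {..<n} \<times> {..<n}" "xs \<in> pairlists H k"
  shows "set xs \<subseteq> {..<n}"
proof
  fix a assume "a \<in> set xs"
  then obtain i where i: "i < 2 * k" "a = xs ! i" using assms(2) by (auto simp: pairlists_def in_set_conv_nth)
  then have "i div 2 < k" by auto
  then have "(xs ! (2 * (i div 2)), xs ! (2 * (i div 2) + 1)) \<in> H" using assms(2) by (simp add: pairlists_def)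
  moreover have "i = 2 * (i div 2) \<or> i = 2 * (i div 2) + 1" by presburger
  ultimately show "a \<in> {..<n}" using assms(1) i(2) by (metis SigmaE2 subsetD)
qed

lemma finite_pairlists:
  assumes "H \<subseteq> {..<n} \<times> {..<n}"
  shows "finite (pairlists H k)"
proof (rule finite_subset)
  show "pairlists H k \<subseteq> {xs. set xs \<subseteq> {..<n} \<and> length xs = 2 * k}"
  proof
    fix xs assume "xs \<in> pairlists H k"
    then show "xs \<in> {xs. set xs \<subseteq> {..<n} \<and> length xs = 2 * k}"
      using pairlists_subset[OF assms, of xs k] by (simp add: pairlists_def)
  qed
qed (rule finite_lists_length_eq, simp)

text \<open>Partners are unique, so the labels in a list are matched among themselves, and an edge
  whose first end is new also has a new second end. Each of the \<open>2 * k\<close> listed labels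
  is the first end of exactly one oriented edge; these are the edges excluded as extensions.\<close>

lemma card_pairlists_Suc:
  assumes H: "H \<subseteq> {..<n} \<times> {..<n}" and sym: "\<And>i j. (i, j) \<in> H ==> (j, i) \<in> H" and irr: "\<And>i. (i, i) \<notin> H"
    and uniq: "\<And>i j j'. (i, j) \<in> H ==> (i, j') \<in> H ==> j = j'"
  shows "card (pairlists H (Suc k)) = card (pairlists H k) * (card H - 2 * k)"
proof -
  have finH: "finite H" by (rule finite_subset[OF H]) simp
  have inj: "inj_on fst H" using uniq by (auto simp: inj_on_def)
  let ?E = "\<lambda>xs. {e \<in> H. fst e \<notin> set xs}"
  have memb: "xs ! i \<in> fst ` H" if "xs \<in> pairlists H k" "i < 2 * k" for xs i
  proof -
    have "i div 2 < k" using that(2) by auto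
    then have "(xs ! (2 * (i div 2)), xs ! (2 * (i div 2) + 1)) \<in> H" using that(1) by (simp add: pairlists_def)
    moreover have "i = 2 * (i div 2) \<or> i = 2 * (i div 2) + 1" by presburger
    ultimately show ?thesis using sym by (metis fst_conv image_eqI)
  qed
  have snd_mem: "snd e \<notin> set xs" if xs: "xs \<in> pairlists H k" and e: "e \<in> ?E xs" for xs e
  proof
    assume "snd e \<in> set xs"
    then obtain i where i: "i < 2 * k" "snd e = xs ! i" using xs by (auto simp: pairlists_def in_set_conv_nth)
    have l: "i div 2 < k" using i(1) by auto
    then have p: "(xs ! (2 * (i div 2)), xs ! (2 * (i div 2) + 1)) \<in> H" using xs by (simp add: pairlists_def)
    have e': "(snd e, fst e) \<in> H" using e sym by (cases e) auto
    have len: "2 * (i div 2) < length xs" "2 * (i div 2) + 1 < length xs" using xs l by (auto simp: pairlists_def)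
    have "i = 2 * (i div 2) \<or> i = 2 * (i div 2) + 1" by presburger
    then have "fst e = xs ! (2 * (i div 2) + 1) \<or> fst e = xs ! (2 * (i div 2))"
      using p sym[OF p] e' i(2) uniq by metis
    then show False using e len by (metis (mono_tags, lifting) mem_Collect_eq nth_mem)
  qed
  have cardE: "card (?E xs) = card H - 2 * k" if xs: "xs \<in> pairlists H k" for xs
  proof -
    have "fst ` (H - ?E xs) = set xs"
    proof (intro subset_antisym subsetI)
      fix a assume a: "a \<in> set xs"
      then obtain i where "i < 2 * k" "a = xs ! i" using xs by (auto simp: pairlists_def in_set_conv_nth)
      then have "a \<in> fst ` H" using memb[OF xs] by simp
      then show "a \<in> fst ` (H - ?E xs)" using a by auto
    qed auto
    moreover have "card (fst ` (H - ?E xs)) = card (H - ?E xs)"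
      by (rule card_image) (rule inj_on_subset[OF inj], auto)
    moreover have "card (set xs) = 2 * k" using xs by (auto simp: pairlists_def distinct_card)
    ultimately have "card (H - ?E xs) = 2 * k" by simp
    moreover have "card (H - ?E xs) = card H - card (?E xs)" using finH by (intro card_Diff_subset) auto
    moreover have "card (?E xs) \<le> card H" using finH by (intro card_mono) auto
    ultimately show ?thesis by linarith
  qed
  have "pairlists H (Suc k) = (\<lambda>(xs, e). xs @ [fst e, snd e]) ` Sigma (pairlists H k) ?E"
  proof (intro subset_antisym subsetI)
    fix ys assume ys: "ys \<in> pairlists H (Suc k)"
    then have len: "length ys = 2 * k + 2" and dis: "distinct ys" and m: "\<And>l. l < Suc k ==> (ys ! (2 * l), ys ! (2 * l + 1)) \<in> H"
      by (auto simp: pairlists_def)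
    define xs where "xs = take (2 * k) ys"
    let ?a = "ys ! (2 * k)" and ?b = "ys ! (2 * k + 1)"
    have dec: "ys = xs @ [?a, ?b]"
      by (rule nth_equalityI) (auto simp: xs_def len nth_append nth_Cons' less_Suc_eq min_def)
    have lx: "length xs = 2 * k" by (simp add: xs_def len)
    have "xs \<in> pairlists H k"
      using dis m lx by (auto simp: pairlists_def xs_def)
    moreover have "(?a, ?b) \<in> ?E xs"
    proof -
      have "?a \<notin> set xs" using dis by (subst (asm) dec) auto
      then show ?thesis using m[of k] by simp
    qed
    ultimately show "ys \<in> (\<lambda>(xs, e). xs @ [fst e, snd e]) ` Sigma (pairlists H k) ?E"
      using dec by (intro image_eqI[of _ _ "(xs, (?a, ?b))"]) auto
  next
    fix ys assume "ys \<in> (\<lambda>(xs, e). xs @ [fst e, snd e]) ` Sigma (pairlists H k) ?E"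
    then obtain xs e where xs: "xs \<in> pairlists H k" and e: "e \<in> ?E xs" and ys: "ys = xs @ [fst e, snd e]" by auto
    have lx: "length xs = 2 * k" using xs by (simp add: pairlists_def)
    have "fst e \<noteq> snd e" using e irr by (cases e) auto
    then have "distinct ys" using xs e snd_mem[OF xs e] by (auto simp: ys pairlists_def)
    moreover have "(ys ! (2 * l), ys ! (2 * l + 1)) \<in> H" if "l < Suc k" for l
    proof (cases "l = k")
      case True
      then show ?thesis using e lx by (simp add: ys nth_append)
    next
      case False
      then have "l < k" "2 * l + 1 < length xs" using that lx by auto
      then show ?thesis using xs by (simp add: ys nth_append pairlists_def)
    qed
    ultimately show "ys \<in> pairlists H (Suc k)" using lx by (simp add: pairlists_def ys)
  qed
  moreover have "inj_on (\<lambda>(xs, e). xs @ [fst e, snd e]) (Sigma (pairlists H k) ?E)"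
    by (auto simp: inj_on_def prod_eq_iff)
  ultimately have "card (pairlists H (Suc k)) = card (Sigma (pairlists H k) ?E)" by (simp add: card_image)
  also have "... = (\<Sum>xs\<in>pairlists H k. card (?E xs))"
    using finite_pairlists[OF H] finH by (intro card_SigmaI) auto
  also have "... = (\<Sum>xs\<in>pairlists H k. card H - 2 * k)" by (intro sum.cong refl cardE)
  finally show ?thesis by simp
qed

text \<open>\<open>H\<close> contains every edge in both orientations: a set of \<open>k\<close>
  edges gives k! orders and 2^k orientations.\<close>

lemma card_pairlists:
  assumes H: "H \<subseteq> {..<n} \<times> {..<n}" and sym: "\<And>i j. (i, j) \<in> H ==> (j, i) \<in> H" and irr: "\<And>i. (i, i) \<notin> H"
    and uniq: "\<And>i j j'. (i, j) \<in> H ==> (i, j') \<in> H ==> j = j'"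
  shows "card (pairlists H k) = 2 ^ k * fact k * (card {e \<in> H. fst e < snd e} choose k)"
proof -
  let ?A = "{e \<in> H. fst e < snd e}"
  have finH: "finite H" by (rule finite_subset[OF H]) simp
  have "H = ?A \<union> prod.swap ` ?A"
  proof (intro subset_antisym subsetI)
    fix e assume e: "e \<in> H"
    show "e \<in> ?A \<union> prod.swap ` ?A"
    proof (cases "fst e < snd e")
      case False
      then have "snd e < fst e" using e irr by (cases e) (auto simp: not_less le_less)
      then have "prod.swap e \<in> ?A" using sym e by (cases e) auto
      then have "prod.swap (prod.swap e) \<in> prod.swap ` ?A" by (rule imageI)
      then show ?thesis by simp
    qed (use e in simp)
  qed (use sym in auto)
  then have "card H = card (?A \<union> prod.swap ` ?A)" by (rule arg_cong)
  also have "... = card ?A + card (prod.swap ` ?A)" using finH by (intro card_Un_disjoint) auto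
  also have "card (prod.swap ` ?A) = card ?A" by (rule card_image) (auto simp: inj_on_def)
  finally have cH: "card H = 2 * card ?A" by simp
  show ?thesis
  proof (induction k)
    case 0
    have "pairlists H 0 = {[]}" by (auto simp: pairlists_def)
    then show ?case by simp
  next
    case (Suc k)
    let ?g = "card ?A"
    have "Suc k * (?g choose Suc k) = ?g * ((?g - 1) choose k)" by (rule binomial_absorption)
    also have "... = (?g - k) * (?g choose k)" by (rule binomial_absorb_comp[symmetric])
    also have "... = (?g choose k) * (?g - k)" by (rule mult.commute)
    finally have b: "Suc k * (?g choose Suc k) = (?g choose k) * (?g - k)" .
    have c: "card H - 2 * k = 2 * (?g - k)" unfolding cH by simp
    have "card (pairlists H (Suc k)) = card (pairlists H k) * (card H - 2 * k)"
      by (rule card_pairlists_Suc[OF H sym irr uniq])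
    also have "... = (2 ^ k * fact k * (?g choose k)) * (2 * (?g - k))" unfolding Suc c ..
    also have "... = (2 * 2 ^ k) * fact k * ((?g choose k) * (?g - k))" by (simp only: mult_ac)
    also have "... = (2 * 2 ^ k) * fact k * (Suc k * (?g choose Suc k))" unfolding b ..
    also have "... = (2 * 2 ^ k) * (Suc k * fact k) * (?g choose Suc k)" by (simp only: mult_ac)
    also have "(2 * 2 ^ k) * (Suc k * fact k) = 2 ^ Suc k * (fact (Suc k) :: nat)" by simp
    finally show ?case .
  qed
qed

section \<open>From factorial moments to the probability of zero\<close>

lemma bonferroni_zero:
  "\<bar>(if g = 0 then 1 else 0) - (\<Sum>k\<le>m. (- 1) ^ k * real (g choose k))\<bar> \<le> real (g choose m)"
proof (cases "g = 0")
  case True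
  have "(\<Sum>k\<le>m. (- 1) ^ k * real (0 choose k)) = (\<Sum>k\<in>{0}. (- 1) ^ k * real (0 choose k))"
    by (rule sum.mono_neutral_right) auto
  then show ?thesis using True by simp
next
  case False
  then obtain h where h: "g = Suc h" by (cases g) auto
  \<comment> \<open>Pascal's rule telescopes the alternating sum and leaves a signed binomial
    coefficient of \<open>g - 1\<close>.\<close>
  have "(\<Sum>k\<le>m. (- 1) ^ k * real (Suc h choose k)) = (- 1) ^ m * real (h choose m)"
    by (induction m) (simp_all add: algebra_simps)
  then have "\<bar>0 - (\<Sum>k\<le>m. (- 1) ^ k * real (g choose k))\<bar> = real (h choose m)"
    by (simp add: h abs_mult power_abs)
  moreover have "h choose m \<le> g choose m" unfolding h by (cases m) simp_all
  ultimately show ?thesis using False by simp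
qed

text \<open>The truncation error after \<open>m\<close> terms has the limit
  \<open>\<mu> ^ m / fact m\<close>, so a large \<open>m\<close> is fixed before n tends to
  infinity.\<close>

lemma poisson_zero_limit:
  fixes a :: "nat => real" and s :: "nat => nat => real"
  assumes lim: "\<And>k. (\<lambda>n. s n k) \<longlonglongrightarrow> \<mu> ^ k / fact k"
    and bound: "\<And>m. eventually (\<lambda>n. \<bar>a n - (\<Sum>k\<le>m. (- 1) ^ k * s n k)\<bar> \<le> s n m) sequentially"
  shows "a \<longlonglongrightarrow> exp (- \<mu>)"
proof (rule LIMSEQ_I)
  fix r :: real assume r: "r > 0"
  have "(\<lambda>k. (- \<mu>) ^ k / fact k) sums exp (- \<mu>)"
    using exp_converges[of "- \<mu>"] by (simp add: field_simps)
  then have l1: "(\<lambda>m. \<Sum>k\<le>m. (- \<mu>) ^ k / fact k) \<longlonglongrightarrow> exp (- \<mu>)" by (simp add: sums_def_le)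
  have l2: "(\<lambda>m. \<mu> ^ m / fact m) \<longlonglongrightarrow> 0"
    using summable_LIMSEQ_zero[OF sums_summable[OF exp_converges[of \<mu>]]] by (simp add: field_simps)
  \<comment> \<open>Two quarters bound the truncation error \<open>s n m\<close>, one the
    convergence of the partial sum in n, and one the tail of the exponential series.\<close>
  have r4: "r / 4 > 0" using r by simp
  have "eventually (\<lambda>m. \<bar>(\<Sum>k\<le>m. (- \<mu>) ^ k / fact k) - exp (- \<mu>)\<bar> < r / 4 \<and> \<bar>\<mu> ^ m / fact m\<bar> < r / 4) sequentially"
    using tendstoD[OF l1 r4] tendstoD[OF l2 r4]
    by eventually_elim (simp only: dist_real_def diff_0_right simp_thms)
  then obtain m where m: "\<bar>(\<Sum>k\<le>m. (- \<mu>) ^ k / fact k) - exp (- \<mu>)\<bar> < r / 4" "\<bar>\<mu> ^ m / fact m\<bar> < r / 4"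
    by (auto simp: eventually_sequentially)
  have e: "(- 1) ^ k * (\<mu> ^ k / fact k) = (- \<mu>) ^ k / fact k" for k
    by (simp add: power_minus[of \<mu>])
  have l3: "(\<lambda>n. \<Sum>k\<le>m. (- 1) ^ k * s n k) \<longlonglongrightarrow> (\<Sum>k\<le>m. (- \<mu>) ^ k / fact k)"
    unfolding e[symmetric] by (intro tendsto_intros lim)
  have "eventually (\<lambda>n. \<bar>(\<Sum>k\<le>m. (- 1) ^ k * s n k) - (\<Sum>k\<le>m. (- \<mu>) ^ k / fact k)\<bar> < r / 4) sequentially"
    using tendstoD[OF l3 r4] by (simp only: dist_real_def)
  moreover have "eventually (\<lambda>n. \<bar>s n m - \<mu> ^ m / fact m\<bar> < r / 4) sequentially"
    using tendstoD[OF lim[of m] r4] by (simp only: dist_real_def)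
  moreover note bound[of m]
  ultimately have "eventually (\<lambda>n. norm (a n - exp (- \<mu>)) < r) sequentially"
  proof eventually_elim
    case (elim n)
    then show ?case using m unfolding real_norm_def by linarith
  qed
  then show "\<exists>N. \<forall>n\<ge>N. norm (a n - exp (- \<mu>)) < r" by (simp add: eventually_sequentially)
qed

section \<open>Good pairs and the factorial moments of their number\<close>

definition good :: "nat => real => (nat => complex) => nat => nat => bool" where
  "good n t x i j \<longleftrightarrow> i < n \<and> j < n \<and> i \<noteq> j \<and> qd (x i) (x j) \<le> t \<and>
     (\<forall>m<n. m \<noteq> i \<longrightarrow> m \<noteq> j \<longrightarrow> \<not> qd (x m) (x i) \<le> t \<and> \<not> qd (x m) (x j) \<le> t)"

definition GP :: "nat => real => (nat => complex) => (nat \<times> nat) set" where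
  "GP n t x = {(i, j). good n t x i j}"

definition GL :: "nat => real => nat => (nat => complex) => bool" where
  "GL n t k x \<longleftrightarrow> (\<forall>l<k. good n t x (2 * l) (2 * l + 1))"

lemma pred_good [measurable]: "Measurable.pred (SP I) (\<lambda>x. good n t x i j)"
  unfolding good_def by measurable

lemma pred_GL [measurable]: "Measurable.pred (SP I) (GL n t k)"
  unfolding GL_def[abs_def] by measurable

lemma dep_good: "dep n (\<lambda>x. good n t x i j)"
  unfolding good_def by (intro depI conj_cong refl) auto

lemma dep_GL: "dep n (GL n t k)"
proof (rule depI)
  fix x y :: "nat => complex" assume "\<And>i. i < n ==> x i = y i"
  then have "good n t x i j = good n t y i j" for i j using depD[OF dep_good, of n x y t i j] by simp
  then show "GL n t k x = GL n t k y" by (simp add: GL_def)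
qed

lemma good_permute:
  assumes p: "p permutes {..<n}" and ij: "i < n" "j < n"
  shows "good n t (\<lambda>i. x (p i)) i j \<longleftrightarrow> good n t x (p i) (p j)"
proof -
  have lt: "p m < n \<longleftrightarrow> m < n" for m using permutes_in_image[OF p, of m] by simp
  have eq: "p a = p b \<longleftrightarrow> a = b" for a b using permutes_inj[OF p] by (auto dest: injD)
  have all: "(\<forall>m<n. P m) \<longleftrightarrow> (\<forall>m<n. P (p m))" for P
  proof
    assume *: "\<forall>m<n. P (p m)"
    show "\<forall>m<n. P m"
    proof (intro allI impI)
      fix m assume "m < n"
      moreover obtain m' where "m = p m'" using permutes_surj[OF p] by (metis surjD)
      ultimately show "P m" using * lt by simp
    qed
  qed (simp add: lt)
  show ?thesis unfolding good_def
    by (subst (2) all) (simp add: lt eq)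
qed

lemma GP_properties:
  shows "GP n t x \<subseteq> {..<n} \<times> {..<n}" "(i, j) \<in> GP n t x ==> (j, i) \<in> GP n t x" "(i, i) \<notin> GP n t x"
    "(i, j) \<in> GP n t x ==> (i, j') \<in> GP n t x ==> j = j'"
proof -
  show "GP n t x \<subseteq> {..<n} \<times> {..<n}" "(i, i) \<notin> GP n t x" by (auto simp: GP_def good_def)
  show "(j, i) \<in> GP n t x" if "(i, j) \<in> GP n t x"
    using that qd_commute[of "x i" "x j"] by (simp add: GP_def good_def)
  show "j = j'" if a: "(i, j) \<in> GP n t x" and b: "(i, j') \<in> GP n t x"
  proof (rule ccontr)
    assume "j \<noteq> j'"
    then have "\<not> qd (x j') (x i) \<le> t" using a b by (auto simp: GP_def good_def)
    then show False using b qd_commute[of "x i" "x j'"] by (auto simp: GP_def good_def)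
  qed
qed

definition gc :: "nat => real => (nat => complex) => nat" where
  "gc n t x = card {e \<in> GP n t x. fst e < snd e}"

definition DL :: "nat => nat => nat list set" where
  "DL n m = {xs. length xs = m \<and> distinct xs \<and> set xs \<subseteq> {..<n}}"

lemma finite_DL: "finite (DL n m)"
  by (rule finite_subset[OF _ finite_lists_length_eq[of "{..<n}" m]]) (auto simp: DL_def)

lemma card_DL: "m \<le> n ==> card (DL n m) * fact (n - m) = fact n"
proof -
  assume m: "m \<le> n"
  have "card (DL n m) = \<Prod>{n - m + 1..n}"
    using card_lists_distinct_length_eq[of "{..<n}" m] m by (simp add: DL_def)
  also have "... * fact (n - m) = (fact n :: nat)"
  proof -
    have "{1..n} = {1..n - m} \<union> {n - m + 1..n}" by auto
    then have "fact n = \<Prod>{1..n - m} * \<Prod>{n - m + 1..n}"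
      unfolding fact_prod by (simp add: prod.union_disjoint)
    then show ?thesis by (simp add: fact_prod mult.commute)
  qed
  finally show ?thesis .
qed

text \<open>Partners in good pairs are unique, so \<open>card_pairlists\<close> applies. A sum of
  indicators over lists of labels can be integrated term by term, and symmetry makes the terms
  equal.\<close>

lemma factorial_moment_eq:
  "of_nat (2 ^ k * fact k * (gc n t x choose k)) = (\<Sum>xs\<in>DL n (2 * k). ib (\<forall>l<k. good n t x (xs ! (2 * l)) (xs ! (2 * l + 1))))"
proof -
  let ?P = "\<lambda>xs. \<forall>l<k. good n t x (xs ! (2 * l)) (xs ! (2 * l + 1))"
  have sub: "set xs \<subseteq> {..<n}" if "xs \<in> pairlists (GP n t x) k" for xs
    by (rule pairlists_subset[OF GP_properties(1) that])
  have iff: "xs \<in> pairlists (GP n t x) k \<longleftrightarrow> length xs = 2 * k \<and> distinct xs \<and> ?P xs" for xs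
    by (auto simp: pairlists_def GP_def)
  have "pairlists (GP n t x) k = {xs \<in> DL n (2 * k). ?P xs}"
    using sub iff unfolding DL_def by blast
  then have "of_nat (card (pairlists (GP n t x) k)) = (\<Sum>xs\<in>{xs \<in> DL n (2 * k). ?P xs}. 1 :: ennreal)" by simp
  also have "... = (\<Sum>xs\<in>DL n (2 * k). ib (?P xs))"
    unfolding ib_def by (rule sum.inter_filter) (rule finite_DL)
  also have "card (pairlists (GP n t x) k) = 2 ^ k * fact k * (gc n t x choose k)"
    unfolding gc_def by (rule card_pairlists[OF GP_properties])
  finally show ?thesis .
qed

lemma dep_comp:
  assumes "dep m f"
  shows "dep m (\<lambda>x. h (f x))"
  by (rule depI, rule arg_cong[where f=h], rule depD[OF assms])

text \<open>The extra point is integrated out first: given the pairs its density is at most n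
  (\<open>DD_Suc_le\<close>), and it is confined to a cap of area \<open>t\<close>.\<close>

lemma Dn_attached_le:
  assumes n: "n \<ge> 1" and t: "0 \<le> t" "t \<le> 1" and i: "i < 2 * k" and k: "2 * k < n"
  shows "Dn n n (\<lambda>x. ib (CL t k x) * ib (qd (x (2 * k)) (x i) \<le> t)) \<le>
    of_nat (fact (n - Suc (2 * k))) * ennreal (real n * t * bb n t ^ k)"
proof -
  let ?f = "\<lambda>x. ib (CL t k x) * ib (qd (x (2 * k)) (x i) \<le> t)"
  note b = bb_nonneg[OF n t]
  have dep_ib: "dep (2 * k) (\<lambda>x. ib (CL t k x))"
    by (rule dep_comp[OF dep_CL])
  have dep_q: "dep (Suc (2 * k)) (\<lambda>x. ib (qd (x (2 * k)) (x i) \<le> t))"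
    using i by (intro depI) simp
  have mq: "(\<lambda>x. ib (qd (x (2 * k)) (x i) \<le> t)) \<in> borel_measurable (SP I)" for I
    by measurable
  have mCL: "(\<lambda>x. ib (CL t k x)) \<in> borel_measurable (SP I)" for I by measurable
  have "Dn n (Suc (2 * k)) ?f \<le> (\<integral>\<^sup>+x. (ib (CL t k x) * ennreal (DD (ker n) x (2 * k) * real n)) * ib (qd (x (2 * k)) (x i) \<le> t) \<partial>SP {..<Suc (2 * k)})"
    unfolding Dn_def
  proof (rule nn_integral_mono)
    fix x
    have "DD (ker n) x (Suc (2 * k)) \<le> DD (ker n) x (2 * k) * real n"
      using DD_Suc_le[OF rep_ker[OF n], of x "2 * k"] by (simp add: ker_diag)
    then have "?f x * ennreal (DD (ker n) x (Suc (2 * k))) \<le> ?f x * ennreal (DD (ker n) x (2 * k) * real n)"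
      by (intro mult_left_mono ennreal_leI) simp_all
    then show "?f x * ennreal (DD (ker n) x (Suc (2 * k))) \<le>
        (ib (CL t k x) * ennreal (DD (ker n) x (2 * k) * real n)) * ib (qd (x (2 * k)) (x i) \<le> t)"
      by (simp only: mult_ac)
  qed
  also have "... = ennreal t * (\<integral>\<^sup>+x. ib (CL t k x) * ennreal (DD (ker n) x (2 * k) * real n) \<partial>SP {..<2 * k})"
  proof (rule integrate_last_const)
    have "(\<lambda>x. DD (ker n) x (2 * k) * real n) \<in> borel_measurable (SP {..<2 * k})"
      using measurable_DD_SP[OF n, of "2 * k" "{..<2 * k}"] by simp
    then show "(\<lambda>x. ib (CL t k x) * ennreal (DD (ker n) x (2 * k) * real n)) \<in> borel_measurable (SP {..<2 * k})"
      by (intro borel_measurable_times_ennreal mCL measurable_compose[OF _ measurable_ennreal])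
    show "dep (2 * k) (\<lambda>x. ib (CL t k x) * ennreal (DD (ker n) x (2 * k) * real n))"
      by (intro dep_mult dep_ib dep_comp[OF dep_DD, where h="\<lambda>d. ennreal (d * real n)"])
    show "(\<integral>\<^sup>+z. ib (qd ((x(2 * k := z)) (2 * k)) ((x(2 * k := z)) i) \<le> t) \<partial>sph) = ennreal t" for x
      using i nn_integral_close[OF t, of "x i"] by (simp add: qd_commute[of _ "x i"])
  qed (rule mq)
  also have "(\<integral>\<^sup>+x. ib (CL t k x) * ennreal (DD (ker n) x (2 * k) * real n) \<partial>SP {..<2 * k}) =
      (\<integral>\<^sup>+x. ennreal (real n) * (ib (CL t k x) * ennreal (DD (ker n) x (2 * k))) \<partial>SP {..<2 * k})"
    by (intro nn_integral_cong) (simp add: ennreal_mult' mult_ac)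
  also have "... = ennreal (real n) * Dn n (2 * k) (\<lambda>x. ib (CL t k x))"
    unfolding Dn_def by (intro nn_integral_cmult borel_measurable_times_ennreal mCL measurable_ennreal_DD n)
  also have "... \<le> ennreal (real n) * ennreal (bb n t ^ k)"
    by (intro mult_left_mono Dn_close_le n t) simp
  also have "ennreal t * (ennreal (real n) * ennreal (bb n t ^ k)) = ennreal (real n * t * bb n t ^ k)"
    using t b by (simp add: ennreal_mult[symmetric] mult_ac)
  finally have "Dn n (Suc (2 * k)) ?f \<le> ennreal (real n * t * bb n t ^ k)" by (simp add: mult_left_mono)
  moreover have "Dn n n ?f = of_nat (fact (n - Suc (2 * k))) * Dn n (Suc (2 * k)) ?f"
    by (intro Dn_marginal n borel_measurable_times_ennreal mCL mq dep_mult dep_q dep_mono[OF dep_ib]) (use k in auto)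
  ultimately show ?thesis by (simp add: mult_left_mono)
qed

text \<open>A point of another pair has \<open>qd > e / 4\<close>, which is at least
  \<open>t\<close>, so only labels from \<open>2 * k\<close> on can spoil the isolation.\<close>

lemma isolated_or_attached:
  assumes te: "0 < t" "16 * t \<le> e" and k: "2 * k < n" and CL: "CL t k x" and sep: "sepd e k x"
  shows "GL n t k x \<or> (\<exists>i<2 * k. \<exists>m\<in>{2 * k..<n}. qd (x m) (x i) \<le> t)"
proof (rule ccontr)
  assume not: "\<not> (GL n t k x \<or> (\<exists>i<2 * k. \<exists>m\<in>{2 * k..<n}. qd (x m) (x i) \<le> t))"
  have far: "\<not> qd (x m) (x i) \<le> t" if m: "m < n" "m div 2 \<noteq> i div 2" and i: "i < 2 * k" for m i
  proof (cases "m < 2 * k")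
    case True
    have "qd (x m) (x i) > e / 4"
      by (rule separated_pairs_distance[OF _ te(2) CL sep True i m(2)]) (use te in simp)
    then show ?thesis using te by simp
  next
    case False
    then show ?thesis using not m i by auto
  qed
  have "good n t x (2 * l) (2 * l + 1)" if l: "l < k" for l
    unfolding good_def
  proof (intro conjI allI impI)
    show "qd (x (2 * l)) (x (2 * l + 1)) \<le> t" using CL l by (simp add: CL_def)
    fix m assume m: "m < n" "m \<noteq> 2 * l" "m \<noteq> 2 * l + 1"
    have "m div 2 \<noteq> l" using m by auto
    then have ml: "m div 2 \<noteq> (2 * l) div 2" "m div 2 \<noteq> (2 * l + 1) div 2" by simp_all
    show "\<not> qd (x m) (x (2 * l)) \<le> t" by (rule far[OF m(1) ml(1)]) (use l in simp)
    show "\<not> qd (x m) (x (2 * l + 1)) \<le> t" by (rule far[OF m(1) ml(2)]) (use l in simp)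
  qed (use l k in auto)
  then show False using not by (simp add: GL_def)
qed

text \<open>The upper bound forgets isolation. For the lower one, a close and separated
  configuration either consists of good pairs or has an extra point attached to one of its
  \<open>2 * k\<close> points; the three error terms are attachment, kernel entries between
  different pairs, and first points that are not separated. The factorial is the cost of integrating
  out the other points.\<close>

lemma factorial_moment_bounds:
  assumes n: "n \<ge> 1" and te: "0 < t" "16 * t \<le> e" "e \<le> 1" and k: "2 * k < n"
  shows "Dn n n (\<lambda>x. ib (GL n t k x)) \<le> of_nat (fact (n - 2 * k)) * ennreal (bb n t ^ k)"
    and "of_nat (fact (n - 2 * k)) * ennreal (bb n t ^ k) \<le> Dn n n (\<lambda>x. ib (GL n t k x)) +
      of_nat (fact (n - 2 * k)) * ennreal (real (2 * k) * (real n * t * bb n t ^ k) +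
        fact (2 * k) * (real n ^ (2 * k) * sqrt ((1 - e / 4) ^ (n - 1))) + real (k\<^sup>2) * (e * bb n t ^ k))"
proof -
  let ?F = "of_nat (fact (n - 2 * k)) :: ennreal"
  let ?c1 = "real (2 * k) * (real n * t * bb n t ^ k)"
  let ?c2 = "fact (2 * k) * (real n ^ (2 * k) * sqrt ((1 - e / 4) ^ (n - 1)))"
  let ?c3 = "real (k\<^sup>2) * (e * bb n t ^ k)"
  have t: "0 \<le> t" "t \<le> 1" and e: "0 \<le> e" using te by auto
  note b = bb_nonneg[OF n t]
  have mCL: "(\<lambda>x. ib (CL t k x)) \<in> borel_measurable (SP I)" for I by measurable
  have mGL: "(\<lambda>x. ib (GL n t k x)) \<in> borel_measurable (SP I)" for I by measurable
  have mCS: "(\<lambda>x. ib (CL t k x \<and> sepd e k x)) \<in> borel_measurable (SP I)" for I by measurable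
  have dep_ib: "dep (2 * k) (\<lambda>x. ib (CL t k x))"
    by (rule dep_comp[OF dep_CL])
  have dep_cs: "dep (2 * k) (\<lambda>x. ib (CL t k x \<and> sepd e k x))"
    unfolding ib_conj by (intro dep_mult dep_ib dep_comp[OF dep_sepd])
  have "Dn n n (\<lambda>x. ib (GL n t k x)) \<le> Dn n n (\<lambda>x. ib (CL t k x))"
    by (intro Dn_mono ib_mono) (auto simp: GL_def CL_def good_def)
  also have "... = ?F * Dn n (2 * k) (\<lambda>x. ib (CL t k x))"
    by (intro Dn_marginal n mCL dep_ib) (use k in simp)
  also have "... \<le> ?F * ennreal (bb n t ^ k)" by (intro mult_left_mono Dn_close_le n t) simp
  finally show "Dn n n (\<lambda>x. ib (GL n t k x)) \<le> ?F * ennreal (bb n t ^ k)" .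
  define g where "g = (\<lambda>(i, m) x. ib (CL t k x) * ib (qd (x m) (x i) \<le> t))"
  define S where "S = {..<2 * k} \<times> {2 * k..<n}"
  have fin: "finite S" by (simp add: S_def)
  have mg: "g s \<in> borel_measurable (SP I)" for s I
  proof -
    have "(\<lambda>x. qd (x (snd s)) (x (fst s))) \<in> borel_measurable (SP I)"
      by (rule borel_measurable_qd[OF SP_component SP_component])
    then have "(\<lambda>x. ib (CL t k x) * ib (qd (x (snd s)) (x (fst s)) \<le> t)) \<in> borel_measurable (SP I)"
      by (intro borel_measurable_times_ennreal mCL measurable_ib) simp
    then show ?thesis by (simp add: g_def case_prod_beta)
  qed
  have gs: "Dn n n (g s) \<le> of_nat (fact (n - Suc (2 * k))) * ennreal (real n * t * bb n t ^ k)" if "s \<in> S" for s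
  proof -
    obtain i m where s: "s = (i, m)" by (cases s)
    have i: "i < 2 * k" and m: "2 * k \<le> m" "m < n" using that by (simp_all add: S_def s)
    define f where "f = (\<lambda>x. ib (CL t k x) * ib (qd (x (2 * k)) (x i) \<le> t))"
    \<comment> \<open>Relabelling the attached point \<open>m\<close> as \<open>2 * k\<close> leaves
      the pairs untouched and reduces to \<open>Dn_attached_le\<close>.\<close>
    let ?p = "Transposition.transpose (2 * k) m"
    have fx: "ib (CL t k (\<lambda>j. x (?p j))) * ib (qd (x (?p (2 * k))) (x (?p i)) \<le> t) = g s x" for x
    proof -
      have "CL t k (\<lambda>j. x (?p j)) = CL t k x"
        by (rule depD[OF dep_CL]) (use m in \<open>simp add: Transposition.transpose_def\<close>)
      moreover have "?p i = i" using i m by (simp add: Transposition.transpose_def)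
      ultimately show ?thesis by (simp add: g_def s)
    qed
    have "Dn n n (\<lambda>x. f (\<lambda>j. x (?p j))) = Dn n n f"
    proof (rule Dn_permute[OF n])
      show "?p permutes {..<n}" using m by (intro permutes_swap_id) auto
      show "f \<in> borel_measurable (SP {..<n})" using mg[of "(i, 2 * k)"] by (simp add: g_def f_def)
      have "dep n (\<lambda>x. ib (qd (x (2 * k)) (x i) \<le> t))" using i k by (intro depI) simp
      then show "dep n f" unfolding f_def using k by (intro dep_mult dep_mono[OF dep_ib]) auto
    qed
    moreover have "(\<lambda>x. f (\<lambda>j. x (?p j))) = g s" by (rule ext) (simp only: f_def fx)
    ultimately have "Dn n n (g s) = Dn n n f" by simp
    then show ?thesis using Dn_attached_le[OF n t i k] by (simp add: f_def)
  qed
  have pw: "ib (CL t k x \<and> sepd e k x) \<le> ib (GL n t k x) + (\<Sum>s\<in>S. g s x)" for x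
  proof (cases "CL t k x \<and> sepd e k x \<and> \<not> GL n t k x")
    case True
    then obtain i m where im: "i < 2 * k" "m \<in> {2 * k..<n}" "qd (x m) (x i) \<le> t"
      using isolated_or_attached[OF te(1,2) k, of x] by auto
    have "ib (CL t k x \<and> sepd e k x) \<le> g (i, m) x" using True im by (simp add: g_def)
    also have "... \<le> (\<Sum>s\<in>S. g s x)" using im fin by (intro member_le_sum[of "(i, m)" S "\<lambda>s. g s x"]) (auto simp: S_def)
    finally show ?thesis by (rule order_trans) simp
  next
    case False
    then have "ib (CL t k x \<and> sepd e k x) \<le> ib (GL n t k x)" by (auto intro: ib_mono)
    then show ?thesis by (rule order_trans) simp
  qed
  have A: "?F * Dn n (2 * k) (\<lambda>x. ib (CL t k x \<and> sepd e k x)) \<le> Dn n n (\<lambda>x. ib (GL n t k x)) + ?F * ennreal ?c1"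
  proof -
    have "?F * Dn n (2 * k) (\<lambda>x. ib (CL t k x \<and> sepd e k x)) = Dn n n (\<lambda>x. ib (CL t k x \<and> sepd e k x))"
      by (rule Dn_marginal[OF n mCS dep_cs, symmetric]) (use k in simp)
    also have "... \<le> Dn n n (\<lambda>x. ib (GL n t k x) + (\<Sum>s\<in>S. g s x))" by (rule Dn_mono) (rule pw)
    also have "... = Dn n n (\<lambda>x. ib (GL n t k x)) + (\<Sum>s\<in>S. Dn n n (g s))"
      by (subst Dn_add[OF n mGL borel_measurable_sum[OF mg]], subst Dn_sum[OF n mg], rule refl)
    also have "(\<Sum>s\<in>S. Dn n n (g s)) \<le> (\<Sum>s\<in>S. of_nat (fact (n - Suc (2 * k))) * ennreal (real n * t * bb n t ^ k))"
      by (rule sum_mono) (rule gs)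
    also have "... = of_nat (card S * fact (n - Suc (2 * k))) * ennreal (real n * t * bb n t ^ k)"
      by (simp add: mult.assoc)
    \<comment> \<open>There are (2 k)(n - 2 k) choices of a host and an attached label; the factor n
      - 2 k completes the factorial.\<close>
    also have "card S * fact (n - Suc (2 * k)) = 2 * k * fact (n - 2 * k)"
    proof -
      have "n - 2 * k = Suc (n - Suc (2 * k))" using k by simp
      then have "fact (n - 2 * k) = (n - 2 * k) * fact (n - Suc (2 * k))" by (metis fact_Suc of_nat_id)
      then show ?thesis by (simp add: S_def)
    qed
    also have "of_nat (2 * k * fact (n - 2 * k)) * ennreal (real n * t * bb n t ^ k) = ?F * ennreal ?c1"
    proof -
      have "of_nat (2 * k * fact (n - 2 * k)) = ?F * ennreal (real (2 * k))"
        unfolding ennreal_of_nat_eq_real_of_nat[of "2 * k", symmetric] by (simp only: of_nat_mult mult_ac)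
      moreover have "ennreal (real (2 * k)) * ennreal (real n * t * bb n t ^ k) = ennreal ?c1"
        by (subst ennreal_mult') simp_all
      ultimately show ?thesis by (simp only: mult.assoc)
    qed
    finally show ?thesis by (simp add: add_left_mono)
  qed
  have c: "0 \<le> ?c1" "0 \<le> ?c2" "0 \<le> ?c3" using t b te e by auto
  have "?F * ennreal (bb n t ^ k) \<le> ?F * (Dn n (2 * k) (\<lambda>x. ib (CL t k x \<and> sepd e k x)) + ennreal ?c2 + ennreal ?c3)"
    by (intro mult_left_mono Dn_separated_ge n te t) simp
  also have "... = ?F * Dn n (2 * k) (\<lambda>x. ib (CL t k x \<and> sepd e k x)) + (?F * ennreal ?c2 + ?F * ennreal ?c3)"
    by (simp only: distrib_left add.assoc)
  also have "... \<le> (Dn n n (\<lambda>x. ib (GL n t k x)) + ?F * ennreal ?c1) + (?F * ennreal ?c2 + ?F * ennreal ?c3)"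
    by (rule add_right_mono[OF A])
  also have "... = Dn n n (\<lambda>x. ib (GL n t k x)) + ?F * (ennreal ?c1 + ennreal ?c2 + ennreal ?c3)"
    by (simp only: distrib_left add.assoc)
  also have "ennreal ?c1 + ennreal ?c2 + ennreal ?c3 = ennreal (?c1 + ?c2 + ?c3)"
    using c by (simp only: ennreal_plus add_nonneg_nonneg)
  finally show "?F * ennreal (bb n t ^ k) \<le> Dn n n (\<lambda>x. ib (GL n t k x)) + ?F * ennreal (?c1 + ?c2 + ?c3)" .
qed

subsection \<open>The law of the points\<close>

text \<open>The law of the points in uniformly random order, read in the stereographic chart; n! is
  the total mass found in \<open>Dn_total\<close>.\<close>

definition QQ :: "nat => (nat => complex) measure" where
  "QQ n = density (SP {..<n}) (\<lambda>x. ennreal (DD (ker n) x n / fact n))"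

lemma sets_QQ [simp]: "sets (QQ n) = sets (SP {..<n})" and space_QQ: "space (QQ n) = space (SP {..<n})"
  by (simp_all add: QQ_def)

lemma measurable_QQ: "f \<in> borel_measurable (QQ n) \<longleftrightarrow> f \<in> borel_measurable (SP {..<n})"
  unfolding measurable_cong_sets[OF sets_QQ refl] ..

lemma nn_integral_QQ:
  assumes n: "n \<ge> 1" and f: "f \<in> borel_measurable (SP {..<n})"
  shows "of_nat (fact n) * (\<integral>\<^sup>+x. f x \<partial>QQ n) = Dn n n f"
proof -
  have m: "(\<lambda>x. ennreal (DD (ker n) x n / fact n)) \<in> borel_measurable (SP {..<n})"
    using measurable_DD_SP[OF n, of n "{..<n}"] by (intro measurable_compose[OF _ measurable_ennreal]) simp
  have c: "of_nat (fact n) * ennreal (DD (ker n) x n / fact n) = ennreal (DD (ker n) x n)" for x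
  proof -
    have "of_nat (fact n) * ennreal (DD (ker n) x n / fact n) = ennreal (real (fact n) * (DD (ker n) x n / fact n))"
      by (subst ennreal_mult') (simp_all add: ennreal_of_nat_eq_real_of_nat del: of_nat_fact)
    then show ?thesis by simp
  qed
  have "of_nat (fact n) * (\<integral>\<^sup>+x. f x \<partial>QQ n) = of_nat (fact n) * (\<integral>\<^sup>+x. ennreal (DD (ker n) x n / fact n) * f x \<partial>SP {..<n})"
    unfolding QQ_def using m f by (subst nn_integral_density) auto
  also have "... = (\<integral>\<^sup>+x. of_nat (fact n) * (ennreal (DD (ker n) x n / fact n) * f x) \<partial>SP {..<n})"
    by (intro nn_integral_cmult[symmetric] borel_measurable_times_ennreal m f)
  also have "... = Dn n n f"
    unfolding Dn_def mult.assoc[symmetric] c by (intro nn_integral_cong) (rule mult.commute)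
  finally show ?thesis .
qed

lemma ennreal_of_nat_fact_cancel: "of_nat (fact n) * a = of_nat (fact n) * (b :: ennreal) ==> a = b"
  by (metis ennreal_mult_cancel_left ennreal_of_nat_eq_real_of_nat ennreal_neq_top fact_nonzero of_nat_0_eq_iff)

lemma prob_space_QQ: "n \<ge> 1 ==> prob_space (QQ n)"
proof
  assume n: "n \<ge> 1"
  have "of_nat (fact n) * emeasure (QQ n) (space (QQ n)) = of_nat (fact n) * 1"
    using nn_integral_QQ[OF n, of "\<lambda>_. 1"] Dn_total[OF n] by simp
  then show "emeasure (QQ n) (space (QQ n)) = 1" by (rule ennreal_of_nat_fact_cancel)
qed

lemma pred_QQ:
  assumes "Measurable.pred (SP {..<n}) P"
  shows "{x \<in> space (QQ n). P x} \<in> sets (QQ n)"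
  using assms by (simp add: space_QQ pred_def)

lemma emeasure_QQ:
  assumes n: "n \<ge> 1" and P: "Measurable.pred (SP {..<n}) P"
  shows "of_nat (fact n) * emeasure (QQ n) {x \<in> space (QQ n). P x} = Dn n n (\<lambda>x. ib (P x))"
proof -
  have "emeasure (QQ n) {x \<in> space (QQ n). P x} = (\<integral>\<^sup>+x. indicator {x \<in> space (QQ n). P x} x \<partial>QQ n)"
    using pred_QQ[OF P] by simp
  also have "... = (\<integral>\<^sup>+x. ib (P x) \<partial>QQ n)"
    by (intro nn_integral_cong) (auto simp: ib_def indicator_def)
  finally show ?thesis using nn_integral_QQ[OF n measurable_ib[OF P]] by simp
qed

lemma gc_choose:
  "real (gc n t x choose k) = enn2real (\<Sum>xs\<in>DL n (2 * k). ib (\<forall>l<k. good n t x (xs ! (2 * l)) (xs ! (2 * l + 1)))) / (2 ^ k * fact k)"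
  unfolding factorial_moment_eq[symmetric] ennreal_of_nat_eq_real_of_nat by simp

lemma measurable_good_list:
  "(\<lambda>x. ib (\<forall>l<k. good n t x (xs ! (2 * l)) (xs ! (2 * l + 1)))) \<in> borel_measurable (SP I)"
proof (rule measurable_ib)
  have "Measurable.pred (SP I) (\<lambda>x. l < k \<longrightarrow> good n t x (xs ! (2 * l)) (xs ! (2 * l + 1)))" for l
    by (cases "l < k") (auto intro: pred_good measurable_const)
  then show "Measurable.pred (SP I) (\<lambda>x. \<forall>l<k. good n t x (xs ! (2 * l)) (xs ! (2 * l + 1)))"
    by (rule pred_intros_countable)
qed

lemma borel_measurable_gc: "(\<lambda>x. real (gc n t x choose k)) \<in> borel_measurable (SP I)"
  unfolding gc_choose
  by (intro borel_measurable_divide borel_measurable_const borel_measurable_enn2real borel_measurable_sum measurable_good_list)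

lemma gc_choose_le: "real (gc n t x choose k) \<le> 2 ^ (n * n)"
proof -
  have "gc n t x \<le> card ({..<n} \<times> {..<n})"
    unfolding gc_def using GP_properties(1)[of n t x] by (intro card_mono) auto
  then have "(gc n t x choose k) \<le> 2 ^ (n * n)"
    using binomial_le_pow2[of "gc n t x" k] by (simp add: order_trans[OF _ power_increasing])
  then show ?thesis by (metis of_nat_le_iff of_nat_numeral of_nat_power)
qed

lemma integrable_gc: "n \<ge> 1 ==> integrable (QQ n) (\<lambda>x. real (gc n t x choose k))"
  using gc_choose_le borel_measurable_gc
  by (intro finite_measure.integrable_const_bound[of _ _ "2 ^ (n * n)"])
     (auto simp: measurable_QQ prob_space.finite_measure[OF prob_space_QQ])

text \<open>By symmetry every list of distinct labels contributes as much as the labels 0, ..., 2 k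
  - 1, and there are n! / (n - 2 k)! such lists.\<close>

lemma integral_gc:
  assumes n: "n \<ge> 1" and k: "2 * k \<le> n"
  shows "Dn n n (\<lambda>x. ib (GL n t k x)) = of_nat (fact (n - 2 * k)) * ennreal (2 ^ k * fact k * (LINT x|QQ n. real (gc n t x choose k)))"
proof -
  let ?s = "LINT x|QQ n. real (gc n t x choose k)"
  have each: "Dn n n (\<lambda>x. ib (\<forall>l<k. good n t x (xs ! (2 * l)) (xs ! (2 * l + 1)))) = Dn n n (\<lambda>x. ib (GL n t k x))"
    if xs: "xs \<in> DL n (2 * k)" for xs
  proof -
    obtain p where p: "p permutes {..<n}" "\<And>i. i < length xs ==> p i = xs ! i"
      using distinct_list_extends_to_permutation[of xs n] xs by (auto simp: DL_def)
    have e: "GL n t k (\<lambda>i. x (p i)) = (\<forall>l<k. good n t x (xs ! (2 * l)) (xs ! (2 * l + 1)))" for x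
      unfolding GL_def using p(2) xs k by (auto simp: DL_def good_permute[OF p(1)])
    have "Dn n n (\<lambda>x. ib (GL n t k (\<lambda>i. x (p i)))) = Dn n n (\<lambda>x. ib (GL n t k x))"
    proof (rule Dn_permute[OF n p(1)])
      show "(\<lambda>x. ib (GL n t k x)) \<in> borel_measurable (SP {..<n})" by measurable
      show "dep n (\<lambda>x. ib (GL n t k x))" by (rule dep_comp[OF dep_GL])
    qed
    then show ?thesis unfolding e .
  qed
  have "of_nat (fact n) * ennreal (2 ^ k * fact k * ?s) = of_nat (fact n) * (\<integral>\<^sup>+x. ennreal (2 ^ k * fact k * real (gc n t x choose k)) \<partial>QQ n)"
    using integrable_gc[OF n, of t k] by (subst nn_integral_eq_integral) auto
  also have "... = of_nat (fact n) * (\<integral>\<^sup>+x. (\<Sum>xs\<in>DL n (2 * k). ib (\<forall>l<k. good n t x (xs ! (2 * l)) (xs ! (2 * l + 1)))) \<partial>QQ n)"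
    unfolding factorial_moment_eq[symmetric] ennreal_of_nat_eq_real_of_nat by simp
  also have "... = Dn n n (\<lambda>x. \<Sum>xs\<in>DL n (2 * k). ib (\<forall>l<k. good n t x (xs ! (2 * l)) (xs ! (2 * l + 1))))"
    by (intro nn_integral_QQ n borel_measurable_sum measurable_good_list)
  also have "... = (\<Sum>xs\<in>DL n (2 * k). Dn n n (\<lambda>x. ib (GL n t k x)))"
    unfolding Dn_sum[OF n measurable_good_list] by (intro sum.cong refl each)
  also have "... = of_nat (card (DL n (2 * k))) * Dn n n (\<lambda>x. ib (GL n t k x))" by simp
  finally have *: "of_nat (fact n) * ennreal (2 ^ k * fact k * ?s) = of_nat (card (DL n (2 * k))) * Dn n n (\<lambda>x. ib (GL n t k x))" .
  have "of_nat (fact n) * (of_nat (fact (n - 2 * k)) * ennreal (2 ^ k * fact k * ?s)) =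
      of_nat (fact (n - 2 * k)) * (of_nat (fact n) * ennreal (2 ^ k * fact k * ?s))" by (simp only: mult.left_commute)
  also have "... = of_nat (card (DL n (2 * k)) * fact (n - 2 * k)) * Dn n n (\<lambda>x. ib (GL n t k x))"
    unfolding * of_nat_mult by (simp only: mult_ac)
  also have "... = of_nat (fact n) * Dn n n (\<lambda>x. ib (GL n t k x))" unfolding card_DL[OF k] ..
  finally show ?thesis by (rule ennreal_of_nat_fact_cancel[symmetric])
qed

lemma integral_gc_bounds:
  assumes n: "n \<ge> 1" and te: "0 < t" "16 * t \<le> e" "e \<le> 1" and k: "2 * k < n"
  shows "2 ^ k * fact k * (LINT x|QQ n. real (gc n t x choose k)) \<le> bb n t ^ k"
    and "bb n t ^ k \<le> 2 ^ k * fact k * (LINT x|QQ n. real (gc n t x choose k)) +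
      (real (2 * k) * (real n * t * bb n t ^ k) +
        fact (2 * k) * (real n ^ (2 * k) * sqrt ((1 - e / 4) ^ (n - 1))) + real (k\<^sup>2) * (e * bb n t ^ k))"
proof -
  let ?s = "2 ^ k * fact k * (LINT x|QQ n. real (gc n t x choose k))"
  let ?c = "real (2 * k) * (real n * t * bb n t ^ k) +
        fact (2 * k) * (real n ^ (2 * k) * sqrt ((1 - e / 4) ^ (n - 1))) + real (k\<^sup>2) * (e * bb n t ^ k)"
  have t: "0 \<le> t" "t \<le> 1" and e: "0 \<le> e" using te by auto
  note b = bb_nonneg[OF n t]
  have s: "?s \<ge> 0" by simp
  have c: "?c \<ge> 0" using t b te e by (intro add_nonneg_nonneg mult_nonneg_nonneg) auto
  have F: "of_nat (fact (n - 2 * k)) = ennreal (real (fact (n - 2 * k)))" by (simp add: ennreal_of_nat_eq_real_of_nat del: of_nat_fact)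
  have Fp: "real (fact (n - 2 * k)) > 0" by simp
  have eq: "Dn n n (\<lambda>x. ib (GL n t k x)) = ennreal (real (fact (n - 2 * k)) * ?s)"
    using k by (subst integral_gc[OF n]) (simp_all add: F ennreal_mult del: of_nat_fact)
  have "ennreal (real (fact (n - 2 * k)) * ?s) \<le> ennreal (real (fact (n - 2 * k)) * bb n t ^ k)"
    using factorial_moment_bounds(1)[OF n te k] b unfolding eq F by (simp add: ennreal_mult del: of_nat_fact)
  then have "real (fact (n - 2 * k)) * ?s \<le> real (fact (n - 2 * k)) * bb n t ^ k"
    using b by (subst (asm) ennreal_le_iff) simp_all
  then show "?s \<le> bb n t ^ k" using Fp by (simp only: mult_le_cancel_left_pos)
  have "ennreal (real (fact (n - 2 * k)) * bb n t ^ k) \<le> ennreal (real (fact (n - 2 * k)) * ?s) + ennreal (real (fact (n - 2 * k)) * ?c)"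
    using factorial_moment_bounds(2)[OF n te k] b c unfolding eq F by (simp only: ennreal_mult zero_le_power of_nat_0_le_iff)
  also have "... = ennreal (real (fact (n - 2 * k)) * ?s + real (fact (n - 2 * k)) * ?c)"
    by (rule ennreal_plus[symmetric]) (use s c in \<open>simp_all only: mult_nonneg_nonneg of_nat_0_le_iff\<close>)
  finally have le: "ennreal (real (fact (n - 2 * k)) * bb n t ^ k) \<le> ennreal (real (fact (n - 2 * k)) * ?s + real (fact (n - 2 * k)) * ?c)" .
  have nn: "0 \<le> real (fact (n - 2 * k)) * ?s + real (fact (n - 2 * k)) * ?c"
    by (intro add_nonneg_nonneg[OF mult_nonneg_nonneg[OF _ s] mult_nonneg_nonneg[OF _ c]]) simp_all
  have "real (fact (n - 2 * k)) * bb n t ^ k \<le> real (fact (n - 2 * k)) * (?s + ?c)"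
    by (subst distrib_left) (rule iffD1[OF ennreal_le_iff[OF nn] le])
  then show "bb n t ^ k \<le> ?s + ?c" using Fp by (simp only: mult_le_cancel_left_pos)
qed

lemma bonferroni_QQ:
  assumes n: "n \<ge> 1"
  shows "\<bar>measure (QQ n) {x \<in> space (QQ n). gc n t x = 0} - (\<Sum>k\<le>m. (- 1) ^ k * (LINT x|QQ n. real (gc n t x choose k)))\<bar>
    \<le> (LINT x|QQ n. real (gc n t x choose m))"
proof -
  interpret Q: prob_space "QQ n" by (rule prob_space_QQ[OF n])
  have pr: "Measurable.pred (SP {..<n}) (\<lambda>x. gc n t x = 0)"
  proof -
    have "(\<lambda>x. real (gc n t x)) \<in> borel_measurable (SP {..<n})" using borel_measurable_gc[of n t 1] by simp
    then have "Measurable.pred (SP {..<n}) (\<lambda>x. real (gc n t x) = 0)" by measurable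
    then show ?thesis by simp
  qed
  have i0: "integrable (QQ n) (\<lambda>x. if gc n t x = 0 then 1 else 0 :: real)"
    and e0: "(LINT x|QQ n. (if gc n t x = 0 then 1 else 0 :: real)) = measure (QQ n) {x \<in> space (QQ n). gc n t x = 0}"
  proof -
    have "(LINT x|QQ n. (if gc n t x = 0 then 1 else 0 :: real)) = (LINT x|QQ n. indicator {x \<in> space (QQ n). gc n t x = 0} x)"
      by (rule Bochner_Integration.integral_cong) (auto simp: indicator_def)
    then show "(LINT x|QQ n. (if gc n t x = 0 then 1 else 0 :: real)) = measure (QQ n) {x \<in> space (QQ n). gc n t x = 0}"
      using pred_QQ[OF pr] by simp
    have "integrable (QQ n) (indicator {x \<in> space (QQ n). gc n t x = 0} :: _ => real)"
      by (rule integrable_real_indicator[OF pred_QQ[OF pr]]) (simp add: Q.emeasure_eq_measure)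
    then show "integrable (QQ n) (\<lambda>x. if gc n t x = 0 then 1 else 0 :: real)"
      by (rule Bochner_Integration.integrable_cong[THEN iffD1, rotated 2]) (auto simp: indicator_def)
  qed
  let ?f = "\<lambda>x. (if gc n t x = 0 then 1 else 0 :: real) - (\<Sum>k\<le>m. (- 1) ^ k * real (gc n t x choose k))"
  have isum: "integrable (QQ n) (\<lambda>x. \<Sum>k\<le>m. (- 1) ^ k * real (gc n t x choose k))"
    by (intro Bochner_Integration.integrable_sum integrable_mult_right integrable_gc n)
  have "(LINT x|QQ n. ?f x) = measure (QQ n) {x \<in> space (QQ n). gc n t x = 0} - (\<Sum>k\<le>m. (- 1) ^ k * (LINT x|QQ n. real (gc n t x choose k)))"
    unfolding Bochner_Integration.integral_diff[OF i0 isum] e0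
    by (subst Bochner_Integration.integral_sum) (auto intro!: integrable_mult_right integrable_gc n)
  then have "\<bar>measure (QQ n) {x \<in> space (QQ n). gc n t x = 0} - (\<Sum>k\<le>m. (- 1) ^ k * (LINT x|QQ n. real (gc n t x choose k)))\<bar> =
      \<bar>LINT x|QQ n. ?f x\<bar>" by simp
  also have "... \<le> (LINT x|QQ n. \<bar>?f x\<bar>)" by (rule integral_abs_bound)
  also have "... \<le> (LINT x|QQ n. real (gc n t x choose m))"
    using i0 isum by (intro integral_mono integrable_gc n integrable_abs Bochner_Integration.integrable_diff bonferroni_zero)
  finally show ?thesis .
qed

definition nc :: "nat => real => (nat => complex) => bool" where
  "nc n t x \<longleftrightarrow> (\<forall>i<n. \<forall>j<n. i \<noteq> j \<longrightarrow> \<not> qd (x i) (x j) \<le> t)"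

lemma pred_nc [measurable]: "Measurable.pred (SP I) (nc n t)"
  unfolding nc_def[abs_def] by measurable

text \<open>A close pair that is not good has a third point near one of its ends. That end is listed
  first, so both conditions involve \<open>xs ! 0\<close>, as in
  \<open>Dn_attached_le\<close>.\<close>

lemma close_pair_alternatives:
  assumes "\<not> nc n t x" "gc n t x = 0"
  shows "\<exists>xs\<in>DL n 3. qd (x (xs ! 0)) (x (xs ! 1)) \<le> t \<and> qd (x (xs ! 2)) (x (xs ! 0)) \<le> t"
proof -
  have "finite (GP n t x)" using GP_properties(1) by (rule finite_subset) simp
  then have "finite {e \<in> GP n t x. fst e < snd e}" by simp
  then have empty: "{e \<in> GP n t x. fst e < snd e} = {}" using assms(2) unfolding gc_def by (metis card_0_eq)
  have ngood: "\<not> good n t x i j" for i j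
  proof
    assume "good n t x i j"
    then have "(i, j) \<in> GP n t x" by (simp add: GP_def)
    moreover then have "(j, i) \<in> GP n t x" by (rule GP_properties(2))
    moreover have "i \<noteq> j" using \<open>good n t x i j\<close> by (simp add: good_def)
    ultimately show False using empty by (metis (mono_tags, lifting) empty_iff fst_conv mem_Collect_eq nat_neq_iff snd_conv)
  qed
  obtain i j where ij: "i < n" "j < n" "i \<noteq> j" "qd (x i) (x j) \<le> t" using assms(1) by (auto simp: nc_def)
  then obtain m where m: "m < n" "m \<noteq> i" "m \<noteq> j" "qd (x m) (x i) \<le> t \<or> qd (x m) (x j) \<le> t"
    using ngood[of i j] by (auto simp: good_def)
  show ?thesis
  proof (cases "qd (x m) (x i) \<le> t")
    case True
    then show ?thesis using ij m by (intro bexI[of _ "[i, j, m]"]) (auto simp: DL_def)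
  next
    case False
    then show ?thesis using ij m qd_commute[of "x i" "x j"] by (intro bexI[of _ "[j, i, m]"]) (auto simp: DL_def)
  qed
qed

text \<open>A union bound over ordered triples of labels: by symmetry each obeys the bound of
  \<open>Dn_attached_le\<close> with \<open>k = 1\<close>, and the number of triples cancels the
  factorials.\<close>

lemma nc_vs_gc:
  assumes n: "n \<ge> 3" and t: "0 \<le> t" "t \<le> 1"
  shows "\<bar>measure (QQ n) {x \<in> space (QQ n). nc n t x} - measure (QQ n) {x \<in> space (QQ n). gc n t x = 0}\<bar> \<le> real n * t * bb n t"
proof -
  have n1: "n \<ge> 1" using n by simp
  interpret Q: prob_space "QQ n" by (rule prob_space_QQ[OF n1])
  note b = bb_nonneg[OF n1 t]
  define T where "T = (\<lambda>xs (x :: nat => complex). qd (x (xs ! 0)) (x (xs ! 1)) \<le> t \<and> qd (x (xs ! 2)) (x (xs ! 0)) \<le> t)"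
  have p: "Measurable.pred (SP I) (\<lambda>x. qd (x a) (x b) \<le> t)" for I a b
  proof -
    have [measurable]: "(\<lambda>x. qd (x a) (x b)) \<in> borel_measurable (SP I)"
      by (rule borel_measurable_qd[OF SP_component SP_component])
    show ?thesis by measurable
  qed
  have mT: "Measurable.pred (SP I) (T xs)" for xs I
  proof -
    have [measurable]: "Measurable.pred (SP I) (\<lambda>x. qd (x (xs ! 0)) (x (xs ! 1)) \<le> t)"
      "Measurable.pred (SP I) (\<lambda>x. qd (x (xs ! 2)) (x (xs ! 0)) \<le> t)"
      by (rule p)+
    show ?thesis unfolding T_def by measurable
  qed
  let ?E = "\<lambda>xs. {x \<in> space (QQ n). T xs x}"
  let ?N = "{x \<in> space (QQ n). nc n t x}" and ?G = "{x \<in> space (QQ n). gc n t x = 0}"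
  have mE: "?E xs \<in> sets (QQ n)" for xs by (rule pred_QQ[OF mT])
  have mN: "?N \<in> sets (QQ n)" by (rule pred_QQ) measurable
  have mG: "?G \<in> sets (QQ n)"
  proof (rule pred_QQ)
    have "(\<lambda>x. real (gc n t x)) \<in> borel_measurable (SP {..<n})" using borel_measurable_gc[of n t 1] by simp
    then have "Measurable.pred (SP {..<n}) (\<lambda>x. real (gc n t x) = 0)" by measurable
    then show "Measurable.pred (SP {..<n}) (\<lambda>x. gc n t x = 0)" by simp
  qed
  have sub: "?N \<subseteq> ?G"
  proof
    fix x assume "x \<in> ?N"
    then have "GP n t x = {}" by (auto simp: GP_def good_def nc_def)
    then show "x \<in> ?G" using \<open>x \<in> ?N\<close> by (simp add: gc_def)
  qed
  have each: "of_nat (fact n) * emeasure (QQ n) (?E xs) \<le> of_nat (fact (n - 3)) * ennreal (real n * t * bb n t)"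
    if xs: "xs \<in> DL n 3" for xs
  proof -
    obtain p where p: "p permutes {..<n}" "\<And>i. i < length xs ==> p i = xs ! i"
      using distinct_list_extends_to_permutation[of xs n] xs by (auto simp: DL_def)
    define f where "f = (\<lambda>x. ib (CL t 1 x) * ib (qd (x (2 * 1)) (x 0) \<le> t))"
    have len: "length xs = 3" using xs by (simp add: DL_def)
    have e: "f (\<lambda>i. x (p i)) = ib (T xs x)" for x
      using p(2)[of 0] p(2)[of 1] p(2)[of 2] by (simp add: len f_def T_def CL_def ib_conj)
    have mf: "f \<in> borel_measurable (SP I)" for I unfolding f_def by measurable
    have "of_nat (fact n) * emeasure (QQ n) (?E xs) = Dn n n (\<lambda>x. ib (T xs x))"
      by (rule emeasure_QQ[OF n1 mT])
    also have "... = Dn n n (\<lambda>x. f (\<lambda>i. x (p i)))" unfolding e ..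
    also have "... = Dn n n f"
    proof (rule Dn_permute[OF n1 p(1) mf])
      show "dep n f" unfolding f_def CL_def by (intro depI) (use n in simp)
    qed
    also have "... \<le> of_nat (fact (n - Suc (2 * 1))) * ennreal (real n * t * bb n t ^ 1)"
      unfolding f_def by (rule Dn_attached_le[OF n1 t]) (use n in auto)
    also have "n - Suc (2 * 1) = n - 3" by simp
    finally show ?thesis by simp
  qed
  have "?G - ?N \<subseteq> (\<Union>xs\<in>DL n 3. ?E xs)"
    using close_pair_alternatives[of n t] by (auto simp: T_def)
  then have "emeasure (QQ n) (?G - ?N) \<le> emeasure (QQ n) (\<Union>xs\<in>DL n 3. ?E xs)"
    by (rule emeasure_mono) (intro sets.finite_UN finite_DL mE)
  also have "... \<le> (\<Sum>xs\<in>DL n 3. emeasure (QQ n) (?E xs))"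
    by (rule emeasure_subadditive_finite[OF finite_DL]) (use mE in blast)
  finally have "of_nat (fact n) * emeasure (QQ n) (?G - ?N) \<le> of_nat (fact n) * (\<Sum>xs\<in>DL n 3. emeasure (QQ n) (?E xs))"
    by (rule mult_left_mono) simp
  also have "... = (\<Sum>xs\<in>DL n 3. of_nat (fact n) * emeasure (QQ n) (?E xs))" by (rule sum_distrib_left)
  also have "... \<le> (\<Sum>xs\<in>DL n 3. of_nat (fact (n - 3)) * ennreal (real n * t * bb n t))" by (rule sum_mono) (rule each)
  also have "... = of_nat (card (DL n 3) * fact (n - 3)) * ennreal (real n * t * bb n t)" by (simp add: mult.assoc)
  also have "... = of_nat (fact n) * ennreal (real n * t * bb n t)" unfolding card_DL[OF n] ..
  finally have "ennreal (real (fact n) * measure (QQ n) (?G - ?N)) \<le> ennreal (real (fact n) * (real n * t * bb n t))"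
    using t b by (simp add: Q.emeasure_eq_measure ennreal_mult ennreal_of_nat_eq_real_of_nat del: of_nat_fact)
  then have "real (fact n) * measure (QQ n) (?G - ?N) \<le> real (fact n) * (real n * t * bb n t)"
    using t b by (subst (asm) ennreal_le_iff) simp_all
  then have "measure (QQ n) (?G - ?N) \<le> real n * t * bb n t" by simp
  moreover have "measure (QQ n) (?G - ?N) = measure (QQ n) ?G - measure (QQ n) ?N"
    by (rule Q.finite_measure_Diff[OF mG mN sub])
  moreover have "measure (QQ n) ?N \<le> measure (QQ n) ?G" by (rule Q.finite_measure_mono[OF sub mG])
  ultimately show ?thesis by linarith
qed

text \<open>The exponent n + 1 in the density of the roots is 2 from the density of
  \<open>sph\<close> plus n - 1 from the weights in the kernel.\<close>

lemma Dn_JJ: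
  assumes n: "n \<ge> 1" and F: "F \<in> borel_measurable FM"
  shows "Dn n n (\<lambda>x. F (\<lambda>z. \<Prod>i<n. z - x i)) = ennreal ((1 / pi) ^ n * (\<Prod>j<n. real n * real (n - 1 choose j))) * JJ n n F"
proof -
  let ?w = "\<lambda>z::complex. 1 / (pi * (1 + (cmod z)\<^sup>2)\<^sup>2)"
  let ?C = "(1 / pi) ^ n * (\<Prod>j<n. real n * real (n - 1 choose j))"
  let ?D = "\<lambda>x. (\<Prod>i<n. 1 / (1 + (cmod (x i))\<^sup>2) ^ Suc n) * (\<Prod>i<n. \<Prod>k<i. (cmod (x i - x k))\<^sup>2)"
  have comp: "(\<lambda>x. x i) \<in> borel_measurable (Lb {..<n})" if "i < n" for i
    by (rule borel_measurable_component[OF measurable_ident_sets[OF refl]]) (use that in simp)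
  have SP: "SP {..<n} = density (Lb {..<n}) (\<lambda>x. \<Prod>i<n. ennreal (?w (x i)))"
    unfolding sph_def
    by (rule lborel_product.PiM_density) (use sph.sigma_finite_measure_axioms in \<open>simp_all add: sph_def\<close>)
  have mw: "(\<lambda>x. \<Prod>i<n. ennreal (?w (x i))) \<in> borel_measurable (Lb {..<n})"
  proof (rule borel_measurable_prod_ennreal)
    fix i assume "i \<in> {..<n}"
    then have [measurable]: "(\<lambda>x. x i) \<in> borel_measurable (Lb {..<n})" by (intro comp) simp
    show "(\<lambda>x. ennreal (?w (x i))) \<in> borel_measurable (Lb {..<n})" by measurable
  qed
  have mD: "(\<lambda>x. ennreal (DD (ker n) x n)) \<in> borel_measurable (Lb {..<n})"
    by (rule measurable_compose[OF borel_measurable_DD_ker[OF n comp] measurable_ennreal])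
  have mF: "(\<lambda>x. F (\<lambda>z. \<Prod>i<n. z - x i)) \<in> borel_measurable (Lb {..<n})"
  proof (rule measurable_compose[OF _ F])
    show "(\<lambda>x z. \<Prod>i<n. z - x i) \<in> Lb {..<n} \<rightarrow>\<^sub>M FM"
      by (intro measurable_into_FM borel_measurable_prod borel_measurable_diff borel_measurable_const comp) simp
  qed
  have dens: "(\<Prod>i<n. ?w (x i)) * DD (ker n) x n = ?C * ?D x" for x :: "nat => complex"
  proof -
    have "(\<Prod>i<n. ?w (x i)) = (\<Prod>i<n. (1 / pi) * (1 / (1 + (cmod (x i))\<^sup>2)\<^sup>2))"
      by (rule prod.cong) simp_all
    also have "... = (1 / pi) ^ n * (\<Prod>i<n. 1 / (1 + (cmod (x i))\<^sup>2)\<^sup>2)"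
      unfolding prod.distrib by simp
    finally have W: "(\<Prod>i<n. ?w (x i)) = (1 / pi) ^ n * (\<Prod>i<n. 1 / (1 + (cmod (x i))\<^sup>2)\<^sup>2)" .
    have "(\<Prod>i<n. 1 / (1 + (cmod (x i))\<^sup>2)\<^sup>2) * (\<Prod>i<n. 1 / (1 + (cmod (x i))\<^sup>2) ^ (n - 1)) =
        (\<Prod>i<n. 1 / (1 + (cmod (x i))\<^sup>2) ^ Suc n)"
      unfolding prod.distrib[symmetric]
    proof (rule prod.cong[OF refl])
      fix i
      have "Suc n = 2 + (n - 1)" using n by simp
      then have "(1 + (cmod (x i))\<^sup>2) ^ Suc n = (1 + (cmod (x i))\<^sup>2)\<^sup>2 * (1 + (cmod (x i))\<^sup>2) ^ (n - 1)"
        by (simp only: power_add)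
      then show "1 / (1 + (cmod (x i))\<^sup>2)\<^sup>2 * (1 / (1 + (cmod (x i))\<^sup>2) ^ (n - 1)) = 1 / (1 + (cmod (x i))\<^sup>2) ^ Suc n"
        by (simp only: times_divide_times_eq mult_1_right)
    qed
    then show ?thesis unfolding W DD_ker_full[OF n] by (simp only: mult_ac)
  qed
  have "Dn n n (\<lambda>x. F (\<lambda>z. \<Prod>i<n. z - x i)) =
      (\<integral>\<^sup>+x. (\<Prod>i<n. ennreal (?w (x i))) * (F (\<lambda>z. \<Prod>i<n. z - x i) * ennreal (DD (ker n) x n)) \<partial>Lb {..<n})"
    unfolding Dn_def SP by (rule nn_integral_density[OF mw]) (intro borel_measurable_times_ennreal mF mD)
  also have "... = (\<integral>\<^sup>+x. ennreal ?C * (ennreal (?D x) * F (\<lambda>z. \<Prod>i<n. z - x i)) \<partial>Lb {..<n})"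
  proof (rule nn_integral_cong)
    fix x :: "nat => complex"
    have w0: "0 \<le> (\<Prod>i<n. ?w (x i))" by (intro prod_nonneg) simp
    have C0: "0 \<le> ?C" by (intro mult_nonneg_nonneg prod_nonneg) simp_all
    have "(\<Prod>i<n. ennreal (?w (x i))) = ennreal (\<Prod>i<n. ?w (x i))" by (rule prod_ennreal) simp
    then have "(\<Prod>i<n. ennreal (?w (x i))) * ennreal (DD (ker n) x n) = ennreal ((\<Prod>i<n. ?w (x i)) * DD (ker n) x n)"
      using ennreal_mult'[OF w0] by simp
    also have "... = ennreal ?C * ennreal (?D x)" unfolding dens by (rule ennreal_mult'[OF C0])
    finally have e: "(\<Prod>i<n. ennreal (?w (x i))) * ennreal (DD (ker n) x n) = ennreal ?C * ennreal (?D x)" .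
    have "(\<Prod>i<n. ennreal (?w (x i))) * (F (\<lambda>z. \<Prod>i<n. z - x i) * ennreal (DD (ker n) x n)) =
        ((\<Prod>i<n. ennreal (?w (x i))) * ennreal (DD (ker n) x n)) * F (\<lambda>z. \<Prod>i<n. z - x i)"
      by (simp only: mult_ac)
    then show "(\<Prod>i<n. ennreal (?w (x i))) * (F (\<lambda>z. \<Prod>i<n. z - x i) * ennreal (DD (ker n) x n)) =
        ennreal ?C * (ennreal (?D x) * F (\<lambda>z. \<Prod>i<n. z - x i))"
      unfolding e by (simp only: mult.assoc)
  qed
  also have "... = ennreal ?C * JJ n n F"
    unfolding JJ_def by (rule nn_integral_cmult) (rule JJ_measurable[OF F comp])
  finally show ?thesis .
qed

text \<open>The constant of \<open>Dn_JJ\<close> is identified by the functional 1, for which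
  \<open>Dn_total\<close> gives n!.\<close>

lemma points_law:
  assumes g: "gaussian_matrix_pair n M A B" and n: "n \<ge> 1" and F: "F \<in> borel_measurable FM"
  shows "of_nat (fact n) * (\<integral>\<^sup>+\<omega>. F (chi n (entries n (A \<omega>) (B \<omega>))) \<partial>M) = Dn n n (\<lambda>x. F (\<lambda>z. \<Prod>i<n. z - x i))"
proof -
  let ?C = "ennreal ((1 / pi) ^ n * (\<Prod>j<n. real n * real (n - 1 choose j)))"
  let ?E = "\<integral>\<^sup>+\<omega>. F (chi n (entries n (A \<omega>) (B \<omega>))) \<partial>M"
  have "of_nat (fact n) = ?C * JJ n n (\<lambda>_. 1)"
    using Dn_JJ[OF n, of "\<lambda>_. 1"] Dn_total[OF n] by simp
  then have "of_nat (fact n) * ?E = ?C * (?E * JJ n n (\<lambda>_. 1))" by (simp only: mult_ac)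
  also have "... = ?C * JJ n n F" unfolding eigenvalue_law(1)[OF g n F] ..
  also have "... = Dn n n (\<lambda>x. F (\<lambda>z. \<Prod>i<n. z - x i))" by (rule Dn_JJ[OF n F, symmetric])
  finally show ?thesis .
qed

lemma less_cd_iff:
  assumes "\<delta> \<ge> 0"
  shows "\<delta> < cd a b \<longleftrightarrow> \<not> qd a b \<le> \<delta>\<^sup>2 / 4"
proof -
  have "cd a b \<ge> 0" by (simp add: cd_def)
  then have "\<delta> < cd a b \<longleftrightarrow> \<delta>\<^sup>2 < (cd a b)\<^sup>2"
    using assms by (metis power2_less_imp_less power_strict_mono zero_less_numeral)
  then show ?thesis unfolding cd_square by auto
qed

text \<open>Outside the null event of a singular A, the event is a condition on the polynomial
  \<open>chi\<close> alone, so \<open>points_law\<close> transfers it to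
  \<open>QQ n\<close>.\<close>

lemma separation_probability:
  assumes g: "gaussian_matrix_pair n M A B" and n: "n \<ge> 2" and \<delta>: "\<delta> \<ge> 0"
  shows "measure M {\<omega> \<in> space M. \<delta> < min_distance (spherical_points (A \<omega>) (B \<omega>))} =
    measure (QQ n) {x \<in> space (QQ n). nc n (\<delta>\<^sup>2 / 4) x}"
proof -
  have n1: "n \<ge> 1" using n by simp
  let ?X = "\<lambda>\<omega>. entries n (A \<omega>) (B \<omega>)"
  let ?S = "{\<omega> \<in> space M. dt n (ea (?X \<omega>)) \<noteq> 0 \<and> chi n (?X \<omega>) \<in> sepF n \<delta>}"
  let ?F = "indicator (sepF n \<delta>) :: _ => ennreal"
  have F: "?F \<in> borel_measurable FM" by (rule borel_measurable_indicator[OF sepF_measurable])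
  have carrier: "A \<omega> \<in> carrier_mat n n" "B \<omega> \<in> carrier_mat n n" if "\<omega> \<in> space M" for \<omega>
    using g that unfolding gaussian_matrix_pair_def by blast+
  have S: "{\<omega> \<in> space M. \<delta> < min_distance (spherical_points (A \<omega>) (B \<omega>))} = ?S"
    using spherical_points_separated[OF carrier n \<delta>] by blast
  have mS: "?S \<in> sets M"
  proof -
    have "(\<lambda>\<omega>. dt n (ea (?X \<omega>))) -` (- {0}) \<inter> space M \<in> sets M"
      by (rule measurable_sets[OF borel_measurable_ea[OF gaussian_matrix_pair_distr(1)[OF g n1] order_refl]]) simp
    moreover have "(\<lambda>\<omega>. chi n (?X \<omega>)) -` sepF n \<delta> \<inter> space M \<in> sets M"
      by (rule measurable_sets[OF eigenvalue_law(3)[OF g n1 F] sepF_measurable])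
    ultimately have "((\<lambda>\<omega>. dt n (ea (?X \<omega>))) -` (- {0}) \<inter> space M) \<inter> ((\<lambda>\<omega>. chi n (?X \<omega>)) -` sepF n \<delta> \<inter> space M) \<in> sets M"
      by (rule sets.Int)
    also have "((\<lambda>\<omega>. dt n (ea (?X \<omega>))) -` (- {0}) \<inter> space M) \<inter> ((\<lambda>\<omega>. chi n (?X \<omega>)) -` sepF n \<delta> \<inter> space M) = ?S"
      by blast
    finally show ?thesis .
  qed
  have "emeasure M ?S = (\<integral>\<^sup>+\<omega>. indicator ?S \<omega> \<partial>M)" using mS by simp
  also have "... = (\<integral>\<^sup>+\<omega>. ?F (chi n (?X \<omega>)) \<partial>M)"
  proof (rule nn_integral_cong_AE)
    show "AE \<omega> in M. indicator ?S \<omega> = ?F (chi n (?X \<omega>))"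
      using eigenvalue_law(2)[OF g n1 F] AE_space
    proof eventually_elim
      case (elim \<omega>)
      then show ?case by (simp add: indicator_def)
    qed
  qed
  finally have e: "emeasure M ?S = (\<integral>\<^sup>+\<omega>. ?F (chi n (?X \<omega>)) \<partial>M)" .
  have F': "?F (\<lambda>z. \<Prod>i<n. z - x i) = ib (nc n (\<delta>\<^sup>2 / 4) x)" for x
  proof -
    have "(\<lambda>z. \<Prod>i<n. z - x i) = (\<lambda>z. \<Prod>e\<leftarrow>map x [0..<n]. z - e)"
      by (simp add: prod.list_conv_set_nth lessThan_atLeast0)
    then have "(\<lambda>z. \<Prod>i<n. z - x i) \<in> sepF n \<delta> \<longleftrightarrow> (\<forall>i<n. \<forall>j<n. i \<noteq> j \<longrightarrow> \<delta> < cd (x i) (x j))"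
      using sepF_iff[of "map x [0..<n]" \<delta>] by simp
    then have "(\<lambda>z. \<Prod>i<n. z - x i) \<in> sepF n \<delta> \<longleftrightarrow> nc n (\<delta>\<^sup>2 / 4) x"
      unfolding nc_def less_cd_iff[OF \<delta>] .
    then show ?thesis by (simp add: ib_def indicator_def)
  qed
  have "of_nat (fact n) * emeasure M ?S = Dn n n (\<lambda>x. ib (nc n (\<delta>\<^sup>2 / 4) x))"
    unfolding e points_law[OF g n1 F] F' ..
  also have "... = of_nat (fact n) * emeasure (QQ n) {x \<in> space (QQ n). nc n (\<delta>\<^sup>2 / 4) x}"
    by (rule emeasure_QQ[OF n1 pred_nc, symmetric])
  finally have "emeasure M ?S = emeasure (QQ n) {x \<in> space (QQ n). nc n (\<delta>\<^sup>2 / 4) x}"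
    by (rule ennreal_of_nat_fact_cancel)
  then show ?thesis unfolding S measure_def by simp
qed

subsection \<open>The limit\<close>

text \<open>In the expansion of (1 - t)^n the linear term cancels n^2 t, and n^3 t^2 / 2 remains;
  this fixes the order n^(-3/2) of t.\<close>

lemma bb_limit:
  assumes c: "(c::real) > 0"
  shows "(\<lambda>n. bb n (c * real n powr (- 3 / 2))) \<longlonglongrightarrow> c\<^sup>2 / 2"
proof -
  have "(\<lambda>n. (real n)\<^sup>2 * (c * real n powr (- 3 / 2)) - real n * (1 - (1 - c * real n powr (- 3 / 2)) powr real n)) \<longlonglongrightarrow> c\<^sup>2 / 2"
    using c by (real_asymp simp: power2_eq_square)
  moreover have "eventually (\<lambda>n. c * real n powr (- 3 / 2) < 1) sequentially"
    using c by real_asymp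
  then have "eventually (\<lambda>n. (real n)\<^sup>2 * (c * real n powr (- 3 / 2)) - real n * (1 - (1 - c * real n powr (- 3 / 2)) powr real n) =
      bb n (c * real n powr (- 3 / 2))) sequentially"
    by eventually_elim (simp add: bb_def powr_realpow)
  ultimately show ?thesis by (rule Lim_transform_eventually)
qed

text \<open>With e = n^(-1/2) the bound (1 - e/4)^((n-1)/2) <= exp(-(n-1) e / 8) decays like exp(-
  sqrt n / 8), which beats every power of n.\<close>

lemma offdiagonal_limit:
  "(\<lambda>n. real n ^ m * sqrt ((1 - real n powr (- 1 / 2) / 4) ^ (n - 1))) \<longlonglongrightarrow> 0"
proof -
  let ?y = "\<lambda>n::nat. real n powr (1 / 2) / 8"
  have "filterlim ?y at_top sequentially" by real_asymp
  then have "(\<lambda>n. ?y n ^ (2 * m) / exp (?y n)) \<longlonglongrightarrow> 0"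
    by (rule filterlim_compose[OF tendsto_power_div_exp_0])
  moreover have "(\<lambda>n::nat. exp (real n powr (- 1 / 2) / 8)) \<longlonglongrightarrow> 1" by real_asymp
  ultimately have lim: "(\<lambda>n. 8 ^ (2 * m) * (?y n ^ (2 * m) / exp (?y n)) * exp (real n powr (- 1 / 2) / 8)) \<longlonglongrightarrow> 8 ^ (2 * m) * 0 * 1"
    by (intro tendsto_intros)
  show ?thesis
  proof (rule tendsto_sandwich[where f="\<lambda>_. 0" and
      h="\<lambda>n. 8 ^ (2 * m) * (?y n ^ (2 * m) / exp (?y n)) * exp (real n powr (- 1 / 2) / 8)"])
    show "(\<lambda>n. 8 ^ (2 * m) * (?y n ^ (2 * m) / exp (?y n)) * exp (real n powr (- 1 / 2) / 8)) \<longlonglongrightarrow> 0"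
      using lim by simp
    have ev: "eventually (\<lambda>n::nat. n \<ge> 1) sequentially" by (rule eventually_ge_at_top)
    show "eventually (\<lambda>n. 0 \<le> real n ^ m * sqrt ((1 - real n powr (- 1 / 2) / 4) ^ (n - 1))) sequentially"
      using ev
    proof eventually_elim
      case (elim n)
      have "real n powr (- 1 / 2) \<le> real n powr 0" using elim by (intro powr_mono) auto
      then have "real n powr (- 1 / 2) / 4 \<le> 1" using elim by simp
      then show ?case by simp
    qed
    show "eventually (\<lambda>n. real n ^ m * sqrt ((1 - real n powr (- 1 / 2) / 4) ^ (n - 1)) \<le>
        8 ^ (2 * m) * (?y n ^ (2 * m) / exp (?y n)) * exp (real n powr (- 1 / 2) / 8)) sequentially"
      using ev
    proof eventually_elim
      case (elim n)
      let ?e = "real n powr (- 1 / 2)"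
      have n0: "real n > 0" using elim by simp
      have "?e \<le> real n powr 0" using elim by (intro powr_mono) auto
      then have e1: "?e / 4 \<le> 1" using elim by simp
      have "1 - ?e / 4 \<le> exp (- (?e / 4))" using exp_ge_add_one_self[of "- (?e / 4)"] by simp
      then have "(1 - ?e / 4) ^ (n - 1) \<le> exp (- (?e / 4)) ^ (n - 1)" using e1 by (intro power_mono) auto
      also have "... = exp (real (n - 1) * (- (?e / 4)))" by (rule exp_of_nat_mult[symmetric])
      also have "... = (exp (real (n - 1) * (- (?e / 8))))\<^sup>2" by (simp add: exp_double[symmetric])
      finally have "sqrt ((1 - ?e / 4) ^ (n - 1)) \<le> exp (real (n - 1) * (- (?e / 8)))"
        by (intro real_le_lsqrt) (use e1 in auto)
      also have "real (n - 1) * (- (?e / 8)) = - ?y n + ?e / 8"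
      proof -
        have "real n * ?e = real n powr 1 * ?e" using n0 by simp
        also have "... = real n powr (1 / 2)" unfolding powr_add[symmetric] by simp
        finally have "real n * ?e = real n powr (1 / 2)" .
        moreover have "real (n - 1) * (- (?e / 8)) = - (real n * ?e) / 8 + ?e / 8"
          using elim by (simp add: of_nat_diff field_simps)
        ultimately show ?thesis by simp
      qed
      also have "exp (- ?y n + ?e / 8) = 1 / exp (?y n) * exp (?e / 8)"
        by (simp add: exp_diff)
      finally have s: "sqrt ((1 - ?e / 4) ^ (n - 1)) \<le> 1 / exp (?y n) * exp (?e / 8)" .
      have y: "real n ^ m = 8 ^ (2 * m) * ?y n ^ (2 * m)"
      proof -
        have "(real n powr (1 / 2)) ^ 2 = real n" using n0 by (simp add: powr_half_sqrt)
        then have "(real n powr (1 / 2)) ^ (2 * m) = real n ^ m" by (simp only: power_mult)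
        then show ?thesis by (simp add: power_divide)
      qed
      have "real n ^ m * sqrt ((1 - ?e / 4) ^ (n - 1)) \<le> real n ^ m * (1 / exp (?y n) * exp (?e / 8))"
        by (rule mult_left_mono[OF s]) simp
      also have "... = 8 ^ (2 * m) * (?y n ^ (2 * m) / exp (?y n)) * exp (?e / 8)" unfolding y by simp
      finally show ?case .
    qed
  qed simp
qed

text \<open>The separation scale e = n^(-1/2) is a compromise: it tends to 0, so pairs that are not
  separated are negligible; it eventually exceeds 16 t; and n e tends to infinity, so kernel entries
  between pairs decay faster than any power. Of the two halvings in c^2/4, one comes from
  \<open>bb_limit\<close> and the other from the orientations 2^k.\<close>

lemma moment_limit:
  assumes c: "(c::real) > 0"
  shows "(\<lambda>n. LINT x|QQ n. real (gc n (c * real n powr (- 3 / 2)) x choose k)) \<longlonglongrightarrow> (c\<^sup>2 / 4) ^ k / fact k"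
proof -
  let ?t = "\<lambda>n. c * real n powr (- 3 / 2)" and ?e = "\<lambda>n. real n powr (- 1 / 2)"
  let ?b = "\<lambda>n. bb n (?t n)" and ?s = "\<lambda>n. LINT x|QQ n. real (gc n (?t n) x choose k)"
  let ?err = "\<lambda>n. real (2 * k) * (real n * ?t n * ?b n ^ k) +
        fact (2 * k) * (real n ^ (2 * k) * sqrt ((1 - ?e n / 4) ^ (n - 1))) + real (k\<^sup>2) * (?e n * ?b n ^ k)"
  let ?q = "2 ^ k * fact k :: real"
  note b = bb_limit[OF c]
  have nt: "(\<lambda>n. real n * ?t n) \<longlonglongrightarrow> 0" using c by real_asymp
  have e: "?e \<longlonglongrightarrow> 0" by real_asymp
  have "?err \<longlonglongrightarrow> real (2 * k) * (0 * (c\<^sup>2 / 2) ^ k) + fact (2 * k) * 0 + real (k\<^sup>2) * (0 * (c\<^sup>2 / 2) ^ k)"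
    by (intro tendsto_add tendsto_mult tendsto_const tendsto_power b nt e offdiagonal_limit)
  then have err: "?err \<longlonglongrightarrow> 0" by simp
  have bk: "(\<lambda>n. ?b n ^ k) \<longlonglongrightarrow> (c\<^sup>2 / 2) ^ k" by (intro tendsto_power b)
  have ev: "eventually (\<lambda>n. 16 * ?t n \<le> ?e n) sequentially" "eventually (\<lambda>n. ?e n \<le> 1) sequentially"
    using c by real_asymp+
  have ev2: "eventually (\<lambda>n::nat. n \<ge> 1) sequentially" "eventually (\<lambda>n. 2 * k < n) sequentially"
    by (rule eventually_ge_at_top eventually_gt_at_top)+
  have "(\<lambda>n. ?q * ?s n) \<longlonglongrightarrow> (c\<^sup>2 / 2) ^ k"
  proof (rule tendsto_sandwich[OF _ _ _ bk])
    show "(\<lambda>n. ?b n ^ k - ?err n) \<longlonglongrightarrow> (c\<^sup>2 / 2) ^ k" using tendsto_diff[OF bk err] by simp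
    show "eventually (\<lambda>n. ?b n ^ k - ?err n \<le> ?q * ?s n) sequentially"
      using ev ev2
    proof eventually_elim
      case (elim n)
      have "?t n > 0" using c elim by simp
      from integral_gc_bounds(2)[OF elim(3) this elim(1,2,4)] show ?case by linarith
    qed
    show "eventually (\<lambda>n. ?q * ?s n \<le> ?b n ^ k) sequentially"
      using ev ev2
    proof eventually_elim
      case (elim n)
      have "?t n > 0" using c elim by simp
      from integral_gc_bounds(1)[OF elim(3) this elim(1,2,4)] show ?case .
    qed
  qed
  then have "(\<lambda>n. (?q * ?s n) / ?q) \<longlonglongrightarrow> (c\<^sup>2 / 2) ^ k / ?q" by (intro tendsto_divide tendsto_const) simp_all
  moreover have "(c\<^sup>2 / 2) ^ k / ?q = (c\<^sup>2 / 4) ^ k / fact k"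
  proof -
    have "(c\<^sup>2 / 4) ^ k = (c\<^sup>2 / 2) ^ k / 2 ^ k" by (simp add: power_divide power_mult_distrib[symmetric])
    then show ?thesis by simp
  qed
  ultimately show ?thesis by simp
qed

lemma no_close_pair_limit:
  assumes c: "(c::real) > 0"
  shows "(\<lambda>n. measure (QQ n) {x \<in> space (QQ n). nc n (c * real n powr (- 3 / 2)) x}) \<longlonglongrightarrow> exp (- (c\<^sup>2 / 4))"
proof -
  let ?t = "\<lambda>n. c * real n powr (- 3 / 2)"
  let ?a = "\<lambda>n. measure (QQ n) {x \<in> space (QQ n). gc n (?t n) x = 0}"
  let ?r = "\<lambda>n. measure (QQ n) {x \<in> space (QQ n). nc n (?t n) x}"
  have a: "?a \<longlonglongrightarrow> exp (- (c\<^sup>2 / 4))"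
  proof (rule poisson_zero_limit[OF moment_limit[OF c]])
    fix m
    have "eventually (\<lambda>n::nat. n \<ge> 1) sequentially" by (rule eventually_ge_at_top)
    then show "eventually (\<lambda>n. \<bar>?a n - (\<Sum>k\<le>m. (- 1) ^ k * (LINT x|QQ n. real (gc n (?t n) x choose k)))\<bar> \<le>
        (LINT x|QQ n. real (gc n (?t n) x choose m))) sequentially"
      by eventually_elim (rule bonferroni_QQ)
  qed
  have nt: "(\<lambda>n. real n * ?t n) \<longlonglongrightarrow> 0" using c by real_asymp
  have lim: "(\<lambda>n. real n * ?t n * bb n (?t n)) \<longlonglongrightarrow> 0"
    using tendsto_mult[OF nt bb_limit[OF c]] by simp
  have d: "(\<lambda>n. ?r n - ?a n) \<longlonglongrightarrow> 0"
  proof (rule Lim_null_comparison[OF _ lim])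
    have "eventually (\<lambda>n. ?t n \<le> 1) sequentially" using c by real_asymp
    moreover have "eventually (\<lambda>n::nat. n \<ge> 3) sequentially" by (rule eventually_ge_at_top)
    ultimately show "eventually (\<lambda>n. norm (?r n - ?a n) \<le> real n * ?t n * bb n (?t n)) sequentially"
    proof eventually_elim
      case (elim n)
      then show ?case using nc_vs_gc[of n "?t n"] c by simp
    qed
  qed
  have "(\<lambda>n. (?r n - ?a n) + ?a n) \<longlonglongrightarrow> 0 + exp (- (c\<^sup>2 / 4))" by (rule tendsto_add[OF d a])
  then show ?thesis by simp
qed

theorem corollary1p6:
  fixes M :: "nat \<Rightarrow> 'a measure"
    and A B :: "nat \<Rightarrow> 'a \<Rightarrow> complex mat"
    and x :: real
  assumes "\<And>n. n \<ge> 1 \<Longrightarrow> gaussian_matrix_pair n (M n) (A n) (B n)"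
    and "x > 0"
  shows "(\<lambda>n. measure (M n)
             {\<omega> \<in> space (M n).
                real n powr (3 / 4) * min_distance (spherical_points (A n \<omega>) (B n \<omega>)) > x})
         \<longlonglongrightarrow> exp (- (x ^ 4) / 64)"
proof -
  \<comment> \<open>Distance at most x n^(-3/4) means \<open>qd\<close> at most (x^2/4) n^(-3/2),
    and (x^2/4)^2 / 4 = x^4/64.\<close>
  let ?c = "x\<^sup>2 / 4"
  have c: "?c > 0" using assms(2) by simp
  have e: "- (?c\<^sup>2 / 4) = - (x ^ 4) / 64" by (simp add: power_divide power_mult[symmetric])
  have lim: "(\<lambda>n. measure (QQ n) {y \<in> space (QQ n). nc n (?c * real n powr (- 3 / 2)) y}) \<longlonglongrightarrow> exp (- (x ^ 4) / 64)"
    using no_close_pair_limit[OF c] unfolding e .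
  \<comment> \<open>\<open>min_distance\<close> is meaningful only from two points on.\<close>
  have ev: "eventually (\<lambda>n::nat. n \<ge> 2) sequentially" by (rule eventually_ge_at_top)
  show ?thesis
  proof (rule Lim_transform_eventually[OF lim])
    show "eventually (\<lambda>n. measure (QQ n) {y \<in> space (QQ n). nc n (?c * real n powr (- 3 / 2)) y} =
        measure (M n) {\<omega> \<in> space (M n). real n powr (3 / 4) * min_distance (spherical_points (A n \<omega>) (B n \<omega>)) > x}) sequentially"
      using ev
    proof eventually_elim
      case (elim n)
      define \<delta> where "\<delta> = x * real n powr (- 3 / 4)"
      have n0: "real n > 0" using elim by simp
      have \<delta>: "\<delta> \<ge> 0" using assms(2) by (simp add: \<delta>_def)
      have "(real n powr (- 3 / 4))\<^sup>2 = real n powr (- 3 / 2)"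
        unfolding power2_eq_square powr_add[symmetric] by simp
      then have sq: "\<delta>\<^sup>2 / 4 = ?c * real n powr (- 3 / 2)" by (simp add: \<delta>_def power_mult_distrib)
      have p: "real n powr (- 3 / 4) * real n powr (3 / 4) = 1" using n0 unfolding powr_add[symmetric] by simp
      have pos: "real n powr (3 / 4) > 0" using n0 by simp
      have iff: "real n powr (3 / 4) * m > x \<longleftrightarrow> \<delta> < m" for m
      proof -
        have "\<delta> * real n powr (3 / 4) = x" unfolding \<delta>_def using p by (simp add: mult.assoc)
        then have "x < real n powr (3 / 4) * m \<longleftrightarrow> real n powr (3 / 4) * \<delta> < real n powr (3 / 4) * m" by (simp add: mult.commute)
        then show ?thesis using pos by simp
      qed
      have g: "gaussian_matrix_pair n (M n) (A n) (B n)" using assms(1) elim by simp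
      show ?case unfolding iff using separation_probability[OF g elim \<delta>] by (simp only: sq)
    qed
  qed
qed

end
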